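(* Let $g\in C_\infty(\mathbb{R}^d)$, let $A\in C_0^\infty(\mathbb{R}^d;\mathbb{R}^d)$ and $V\in C_0(\mathbb{R}^d;\mathbb{R})$, and let $u^m$ be defined as in the context. Then for every $0<T<\infty$, $$\sup_{0\le t\le T}\ \sup_{x\in\mathbb{R}^d}|u^m(x,t)-u^0(x,t)|\to 0\quad\text{as } m\downarrow 0.$$
   Context: Let $d\ge1$. $D_0$ is the set of right-continuous paths $X:[0,\infty)\to\mathbb{R}^d$ with left limits and $X(0)=0$, with the $\sigma$-algebra generated by coordinate maps. For $m\ge0$, $\lambda^m$ is the probability measure on $D_0$ under which the coordinate process $X(t)$ is a Lévy process with $E^m[e^{i\xi\cdot X(t)}]=e^{-t(\sqrt{|\xi|^2+m^2}-m)}$ ($E^m$ = expectation under $\lambda^m$). Its Lévy measure is $n^m(dy)=n^m(|y|)dy$ on $\mathbb{R}^d\setminus\{0\}$, where $n^m(r)=2\left(\frac{m}{2\pi}\right)^{(d+1)/2}\frac{K_{(d+1)/2}(mr)}{r^{(d+1)/2}}$ for $m>0$ ($K_\nu$ the modified Bessel function of the third kind) and $n^0(r)=\frac{\Gamma((d+1)/2)}{\pi^{(d+1)/2}}r^{-(d+1)}$. For $X\in D_0$, $N_X$ is the counting measure on $(0,\infty)\times(\mathbb{R}^d\setminus\{0\})$ given by $N_X(E)=\#\{s>0:(s,X(s)-X(s-))\in E\}$, and $\widetilde{N^m_X}(ds\,dy)=N_X(ds\,dy)-ds\,n^m(dy)$ (a compensated Poisson random measure under $\lambda^m$); $\int_0^t$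 means $\int_{(0,t]}$. For $x\in\mathbb{R}^d$, $t\ge0$, define ($\lambda^m$-a.s.) $$Y^m(t,x,X)=\int_0^t\!\int_{|y|\ge1}A(x+X(s-)+\tfrac12 y)\cdot y\,N_X(ds\,dy)+\int_0^t\!\int_{0<|y|<1}A(x+X(s-)+\tfrac12 y)\cdot y\,\widetilde{N^m_X}(ds\,dy)+\int_0^t ds\int_{0<|y|<1}\big[A(x+X(s)+\tfrac12 y)-A(x+X(s))\big]\cdot y\,n^m(dy),$$ $S^m(t,x,X)=iY^m(t,x,X)+\int_0^tV(x+X(s))\,ds$, and $u^m(x,t)=E^m\big[e^{-S^m(t,x,X)}g(x+X(t))\big]$ (the solution of the imaginary-time relativistic Schrödinger equation $\partial_t u=-[H^m_A-m+V]u$ with $u(\cdot,0)=g$). $C_\infty(\mathbb{R}^d)$ is the space of continuous $g:\mathbb{R}^d\to\mathbb{C}$ with $|g(x)|\to0$ as $|x|\to\infty$, with the sup norm. *)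

theory Defs
  imports "HOL-Analysis.Analysis" "HOL-Probability.Probability"
begin

coinductive smooth_fun :: "('a::euclidean_space \<Rightarrow> 'b::real_normed_vector) \<Rightarrow> bool" where
  "(\<forall>x. f differentiable (at x)) \<Longrightarrow>
   (\<forall>v. smooth_fun (\<lambda>x. frechet_derivative f (at x) v)) \<Longrightarrow> smooth_fun f"

definition has_compact_support :: "('a::euclidean_space \<Rightarrow> 'b::real_normed_vector) \<Rightarrow> bool" where
  "has_compact_support f \<longleftrightarrow> compact (closure {x. f x \<noteq> 0})"

definition C0_smooth :: "('a::euclidean_space \<Rightarrow> 'a) \<Rightarrow> bool" where
  "C0_smooth A \<longleftrightarrow> smooth_fun A \<and> has_compact_support A"

definition C0_cont :: "('a::euclidean_space \<Rightarrow> real) \<Rightarrow> bool" where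
  "C0_cont V \<longleftrightarrow> continuous_on UNIV V \<and> has_compact_support V"

definition C_infty :: "('a::euclidean_space \<Rightarrow> complex) \<Rightarrow> bool" where
  "C_infty g \<longleftrightarrow> continuous_on UNIV g \<and> (g \<longlongrightarrow> 0) at_infinity"

text \<open>Paths on [0,oo), extended by 0 to negative times (canonical representative).\<close>
definition D0 :: "(real \<Rightarrow> 'a::euclidean_space) set" where
  "D0 = {X. X 0 = 0 \<and> (\<forall>t<0. X t = 0) \<and> (\<forall>t\<ge>0. continuous (at_right t) X)
           \<and> (\<forall>t>0. \<exists>l. (X \<longlongrightarrow> l) (at_left t))}"

definition cyl_space :: "(real \<Rightarrow> 'a::euclidean_space) measure" where
  "cyl_space = sigma D0 {{X \<in> D0. X t \<in> B} | t B. 0 \<le> t \<and> B \<in> sets borel}"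

definition lft :: "(real \<Rightarrow> 'a::euclidean_space) \<Rightarrow> real \<Rightarrow> 'a" where
  "lft X s = Lim (at_left s) X"

definition jump :: "(real \<Rightarrow> 'a::euclidean_space) \<Rightarrow> real \<Rightarrow> 'a" where
  "jump X s = X s - lft X s"

definition is_rel_levy_law :: "real \<Rightarrow> (real \<Rightarrow> 'a::euclidean_space) measure \<Rightarrow> bool" where
  "is_rel_levy_law m M \<longleftrightarrow>
     prob_space M \<and> sets M = sets cyl_space \<and>
     (\<forall>(ts::nat \<Rightarrow> real) n. 0 \<le> ts 0 \<and> (\<forall>k<n. ts k < ts (Suc k)) \<longrightarrow>
        prob_space.indep_vars M (\<lambda>_. borel) (\<lambda>k X. X (ts (Suc k)) - X (ts k)) {..<n}) \<and>
     (\<forall>s t. 0 \<le> s \<and> s \<le> t \<longrightarrow>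
        distr M borel (\<lambda>X. X t - X s) = distr M borel (\<lambda>X. X (t - s))) \<and>
     (\<forall>t\<ge>0. \<forall>\<xi>::'a. (\<integral>X. cis (\<xi> \<bullet> X t) \<partial>M) =
        exp (- complex_of_real (t * (sqrt (norm \<xi> ^ 2 + m ^ 2) - m))))"

definition lam :: "real \<Rightarrow> (real \<Rightarrow> 'a::euclidean_space) measure" where
  "lam m = (THE M. is_rel_levy_law m M)"

text \<open>Modified Bessel function of the third kind (integral representation, z > 0).\<close>
definition besselK :: "real \<Rightarrow> real \<Rightarrow> real" where
  "besselK \<nu> z = (LBINT s:{0..}. exp (- z * cosh s) * cosh (\<nu> * s))"

definition nden :: "'a::euclidean_space itself \<Rightarrow> real \<Rightarrow> real \<Rightarrow> real" where
  "nden _ m r = (let d = real DIM('a) in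
     if m > 0 then 2 * (m / (2 * pi)) powr ((d + 1) / 2) * besselK ((d + 1) / 2) (m * r)
                   / r powr ((d + 1) / 2)
     else Gamma ((d + 1) / 2) / pi powr ((d + 1) / 2) * r powr (- (d + 1)))"

definition Y_big :: "('a::euclidean_space \<Rightarrow> 'a) \<Rightarrow> real \<Rightarrow> 'a \<Rightarrow> (real \<Rightarrow> 'a) \<Rightarrow> real" where
  "Y_big A t x X = (\<Sum>s \<in> {s \<in> {0<..t}. norm (jump X s) \<ge> 1}.
       A (x + lft X s + (1/2) *\<^sub>R jump X s) \<bullet> jump X s)"

definition Y_trunc :: "real \<Rightarrow> ('a::euclidean_space \<Rightarrow> 'a) \<Rightarrow> real \<Rightarrow> 'a \<Rightarrow> real \<Rightarrow> (real \<Rightarrow> 'a) \<Rightarrow> real" where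
  "Y_trunc m A t x \<epsilon> X =
     (\<Sum>s \<in> {s \<in> {0<..t}. \<epsilon> \<le> norm (jump X s) \<and> norm (jump X s) < 1}.
        A (x + lft X s + (1/2) *\<^sub>R jump X s) \<bullet> jump X s)
     - (LBINT s:{0<..t}. LBINT y:{y. \<epsilon> \<le> norm y \<and> norm y < 1}.
          (A (x + lft X s + (1/2) *\<^sub>R y) \<bullet> y) * nden TYPE('a) m (norm y))"

text \<open>The compensated integral: limit in probability (under lambda^m) as eps -> 0+.\<close>
definition Y_small :: "real \<Rightarrow> ('a::euclidean_space \<Rightarrow> 'a) \<Rightarrow> real \<Rightarrow> 'a \<Rightarrow> (real \<Rightarrow> 'a) \<Rightarrow> real" where
  "Y_small m A t x = (SOME Z. Z \<in> borel_measurable (lam m) \<and>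
     (\<forall>\<delta>>0. ((\<lambda>\<epsilon>. measure (lam m) {X \<in> space (lam m). \<bar>Y_trunc m A t x \<epsilon> X - Z X\<bar> > \<delta>})
              \<longlongrightarrow> 0) (at_right 0)))"

definition Y_drift :: "real \<Rightarrow> ('a::euclidean_space \<Rightarrow> 'a) \<Rightarrow> real \<Rightarrow> 'a \<Rightarrow> (real \<Rightarrow> 'a) \<Rightarrow> real" where
  "Y_drift m A t x X = (LBINT s:{0<..t}. LBINT y:{y. 0 < norm y \<and> norm y < 1}.
       ((A (x + X s + (1/2) *\<^sub>R y) - A (x + X s)) \<bullet> y) * nden TYPE('a) m (norm y))"

definition Ym :: "real \<Rightarrow> ('a::euclidean_space \<Rightarrow> 'a) \<Rightarrow> real \<Rightarrow> 'a \<Rightarrow> (real \<Rightarrow> 'a) \<Rightarrow> real" where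
  "Ym m A t x X = Y_big A t x X + Y_small m A t x X + Y_drift m A t x X"

definition Sm :: "real \<Rightarrow> ('a::euclidean_space \<Rightarrow> 'a) \<Rightarrow> ('a \<Rightarrow> real) \<Rightarrow> real \<Rightarrow> 'a \<Rightarrow> (real \<Rightarrow> 'a) \<Rightarrow> complex" where
  "Sm m A V t x X = \<i> * complex_of_real (Ym m A t x X)
      + complex_of_real (LBINT s:{0<..t}. V (x + X s))"

definition um :: "real \<Rightarrow> ('a::euclidean_space \<Rightarrow> 'a) \<Rightarrow> ('a \<Rightarrow> real) \<Rightarrow> ('a \<Rightarrow> complex)
                  \<Rightarrow> 'a \<Rightarrow> real \<Rightarrow> complex" where
  "um m A V g x t = (\<integral>X. exp (- Sm m A V t x X) * g (x + X t) \<partial>(lam m :: (real \<Rightarrow> 'a) measure))"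

end

(* The phase Y^m does not depend on m. The compensator and the drift cancel up to terms that vanish with the
   truncation, because the Levy density is even, so Y^m is almost surely the sum of
   A(X(s-) + jump/2) . jump over the large jumps plus the limit of the plain sums over jumps of size at
   least eps. The limit exists by a second-moment bound for Riemann sums: the odd part A(X(s-)) . jump
   gives orthogonal increments and the remainder is quadratic in the jump.

   Hence u^m - u^0 is the difference of the integrals of one bounded functional of the path up to time T
   under lambda^m and lambda^0. These laws are compared by subordination: the density of the inverse
   Gaussian subordinator for mass m is exp(h m - m^2 s) times the one for mass 0, so increments over time
   h satisfy p^m_h <= exp(h m) p^0_h. Independence of increments and approximation by grid events give
   lambda^m <= exp(T m) lambda^0 on the paths stopped at T, so the difference is at most
   4 K (exp(T m) - 1), uniformly in x and t. The case of equal masses gives uniqueness of the law. *)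
theory Submission
  imports Defs "HOL-Real_Asymp.Real_Asymp"
begin

section \<open>Fourier uniqueness by Gaussian smoothing\<close>

text \<open>Two choice operators shape the proof. \<open>lam m\<close> is a \<open>THE\<close>, so
  both existence and uniqueness of the law have to be established; existence goes through a
  projective limit on the dyadic rationals followed by a cadlag modification. \<open>Y_small\<close>
  is a \<open>SOME\<close> limit in probability under \<open>lam m\<close>, so it is fixed only up
  to a null set that changes with \<open>m\<close>. The two integrals become comparable once both
  integrands are replaced by one Borel functional defined on every path, which is why the small-jump
  part is taken as a pointwise limit along powers of 1/8. The jump estimates rest on the bound
  \<psi>(\<xi>) \<le> |\<xi>| for the characteristic exponent, which is uniform in the mass. It
  controls tails and truncated second moments of increments over a time h at order h, and Riemann
  sums carry these bounds over to jump sums. The comparison constant exp(T m) grows with the time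
  horizon, hence the functional must be shown to depend on the stopped path alone.\<close>

lemma borel_measurable_cis [measurable]:
  "f \<in> borel_measurable M \<Longrightarrow> (\<lambda>x. cis (f x)) \<in> borel_measurable M"
  by (intro measurable_compose[OF _ borel_measurable_continuous_onI[OF continuous_on_cis[OF continuous_on_id]]])

definition gauss :: "'a::euclidean_space measure" where
  "gauss = distr (\<Pi>\<^sub>M b\<in>Basis. std_normal_distribution) borel (\<lambda>f. \<Sum>b\<in>Basis. f b *\<^sub>R b)"

lemma prob_space_PiM_std_normal: "prob_space (\<Pi>\<^sub>M b\<in>(Basis::'a::euclidean_space set). std_normal_distribution)"
  by (intro prob_space_PiM) (use real_dist_normal_dist real_distribution_def in blast)

lemma sets_gauss [simp, measurable_cong]: "sets gauss = sets borel"
  by (simp add: gauss_def)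

lemma space_gauss [simp]: "space gauss = UNIV"
  by (simp add: gauss_def)

lemma sets_PiM_std_normal [measurable_cong]:
  "sets (\<Pi>\<^sub>M b\<in>I. std_normal_distribution) = sets (\<Pi>\<^sub>M b\<in>I. (borel :: real measure))"
  by (intro sets_PiM_cong) auto

lemma prob_space_gauss [simp]: "prob_space gauss"
  unfolding gauss_def
  by (intro prob_space.prob_space_distr[OF prob_space_PiM_std_normal]) measurable

lemma measurable_basis_sum:
  "(\<lambda>f. \<Sum>b\<in>Basis. f b *\<^sub>R b) \<in> (\<Pi>\<^sub>M b\<in>Basis. std_normal_distribution) \<rightarrow>\<^sub>M (borel :: 'a::euclidean_space measure)"
  by measurable

lemma gauss_cf: "(\<integral>z. cis (\<xi> \<bullet> z) \<partial>gauss) = complex_of_real (exp (- (norm \<xi>)\<^sup>2 / 2))"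
proof -
  interpret product_sigma_finite "\<lambda>_::'a. std_normal_distribution"
    using real_dist_normal_dist
    by (auto simp: product_sigma_finite_def real_distribution_def intro!: prob_space_imp_sigma_finite)
  interpret std: prob_space std_normal_distribution
    using real_dist_normal_dist real_distribution_def by blast
  have "(\<integral>z. cis (\<xi> \<bullet> z) \<partial>gauss) =
      (\<integral>f. cis (\<xi> \<bullet> (\<Sum>b\<in>Basis. f b *\<^sub>R b)) \<partial>(\<Pi>\<^sub>M b\<in>(Basis::'a set). std_normal_distribution))"
    unfolding gauss_def by (subst integral_distr[OF measurable_basis_sum]) simp_all
  also have "\<dots> = (\<integral>f. (\<Prod>b\<in>Basis. iexp ((\<xi> \<bullet> b) * f b)) \<partial>(\<Pi>\<^sub>M b\<in>(Basis::'a set). std_normal_distribution))"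
    by (intro Bochner_Integration.integral_cong refl)
       (simp add: inner_sum_right cis_conv_exp exp_sum[symmetric] sum_distrib_left mult.commute)
  also have "\<dots> = (\<Prod>b\<in>(Basis::'a set). char std_normal_distribution (\<xi> \<bullet> b))"
    unfolding char_def
    by (subst product_integral_prod) (auto intro!: std.integrable_const_bound[where B=1])
  also have "\<dots> = complex_of_real (exp (\<Sum>b\<in>Basis. - (\<xi> \<bullet> b)\<^sup>2 / 2))"
    by (simp add: char_std_normal_distribution exp_sum)
  also have "(\<Sum>b\<in>Basis. - (\<xi> \<bullet> b)\<^sup>2 / 2) = - (norm \<xi>)\<^sup>2 / 2"
    unfolding power2_norm_eq_inner euclidean_inner[of \<xi> \<xi>]
    by (simp add: sum_negf sum_divide_distrib power2_eq_square)
  finally show ?thesis .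
qed

text \<open>The Gaussian is its own Fourier transform, so the kernel is a Gaussian average of
  characters, and Fubini moves that average outside. The complex weight \<open>h\<close> makes this
  a statement about the complex measure h dM, which is what the coordinatewise argument for
  independence needs.\<close>

lemma gauss_smoothing:
  fixes X :: "'b \<Rightarrow> 'a::euclidean_space" and h :: "'b \<Rightarrow> complex"
  assumes "finite_measure M" and X [measurable]: "X \<in> borel_measurable M" and h: "integrable M h"
  shows "(\<integral>\<omega>. of_real (exp (- (c * norm (X \<omega> - x))\<^sup>2 / 2)) * h \<omega> \<partial>M) =
    (\<integral>\<xi>. cis (- (c *\<^sub>R \<xi> \<bullet> x)) * (\<integral>\<omega>. cis ((c *\<^sub>R \<xi>) \<bullet> X \<omega>) * h \<omega> \<partial>M) \<partial>gauss)"
proof -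
  interpret M: finite_measure M by fact
  interpret g: prob_space "gauss :: 'a measure" by simp
  interpret pair_sigma_finite "gauss :: 'a measure" M ..
  have [measurable]: "h \<in> borel_measurable M" using h by auto
  have int: "integrable (gauss \<Otimes>\<^sub>M M) (\<lambda>(\<xi>, \<omega>). cis (\<xi> \<bullet> (c *\<^sub>R (X \<omega> - x))) * h \<omega>)"
  proof (rule Fubini_integrable)
    show "integrable gauss (\<lambda>\<xi>. \<integral>\<omega>. norm (case (\<xi>, \<omega>) of (\<xi>, \<omega>) \<Rightarrow> cis (\<xi> \<bullet> (c *\<^sub>R (X \<omega> - x))) * h \<omega>) \<partial>M)"
      by (simp add: norm_mult)
    show "AE \<xi> in gauss. integrable M (\<lambda>\<omega>. case (\<xi>, \<omega>) of (\<xi>, \<omega>) \<Rightarrow> cis (\<xi> \<bullet> (c *\<^sub>R (X \<omega> - x))) * h \<omega>)"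
      by (intro AE_I2) (auto intro!: Bochner_Integration.integrable_bound[OF h] simp: norm_mult)
  qed measurable
  have "(\<integral>\<xi>. cis (- (c *\<^sub>R \<xi> \<bullet> x)) * (\<integral>\<omega>. cis ((c *\<^sub>R \<xi>) \<bullet> X \<omega>) * h \<omega> \<partial>M) \<partial>gauss) =
     (\<integral>\<xi>. (\<integral>\<omega>. cis (\<xi> \<bullet> (c *\<^sub>R (X \<omega> - x))) * h \<omega> \<partial>M) \<partial>gauss)"
  proof (intro Bochner_Integration.integral_cong refl)
    fix \<xi> :: 'a
    have eq: "cis (- (c *\<^sub>R \<xi> \<bullet> x)) * (cis ((c *\<^sub>R \<xi>) \<bullet> X \<omega>) * h \<omega>) = cis (\<xi> \<bullet> (c *\<^sub>R (X \<omega> - x))) * h \<omega>" for \<omega>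
      unfolding mult.assoc[symmetric] cis_mult by (simp add: inner_diff_right right_diff_distrib)
    show "cis (- (c *\<^sub>R \<xi> \<bullet> x)) * (\<integral>\<omega>. cis ((c *\<^sub>R \<xi>) \<bullet> X \<omega>) * h \<omega> \<partial>M) =
        (\<integral>\<omega>. cis (\<xi> \<bullet> (c *\<^sub>R (X \<omega> - x))) * h \<omega> \<partial>M)"
      by (simp only: integral_mult_right_zero[symmetric] eq)
  qed
  also have "\<dots> = (\<integral>\<omega>. (\<integral>\<xi>. cis (\<xi> \<bullet> (c *\<^sub>R (X \<omega> - x))) * h \<omega> \<partial>gauss) \<partial>M)"
    using Fubini_integral[OF int] by simp
  also have "\<dots> = (\<integral>\<omega>. of_real (exp (- (c * norm (X \<omega> - x))\<^sup>2 / 2)) * h \<omega> \<partial>M)"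
  proof (intro Bochner_Integration.integral_cong refl)
    fix \<omega>
    have "(\<integral>\<xi>. cis (\<xi> \<bullet> (c *\<^sub>R (X \<omega> - x))) \<partial>gauss) = of_real (exp (- (c * norm (X \<omega> - x))\<^sup>2 / 2))"
      using gauss_cf[of "c *\<^sub>R (X \<omega> - x)"] by (simp add: inner_commute power_mult_distrib)
    then show "(\<integral>\<xi>. cis (\<xi> \<bullet> (c *\<^sub>R (X \<omega> - x))) * h \<omega> \<partial>gauss) =
        of_real (exp (- (c * norm (X \<omega> - x))\<^sup>2 / 2)) * h \<omega>"
      by simp
  qed
  finally show ?thesis by simp
qed

lemma integrable_gauss_kernel: "integrable lborel (\<lambda>z::'a::euclidean_space. exp (- (norm z)\<^sup>2 / 2))"
proof (rule integrableI_nonneg)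
  have "(\<integral>\<^sup>+z. ennreal (exp (- (norm z)\<^sup>2 / 2)) \<partial>(lborel::'a measure)) =
     (\<integral>\<^sup>+z. (\<Prod>b\<in>Basis. ennreal (exp (- (z \<bullet> b)\<^sup>2 / 2))) \<partial>(lborel::'a measure))"
  proof (intro nn_integral_cong)
    fix z :: 'a
    have "- (norm z)\<^sup>2 / 2 = (\<Sum>b\<in>Basis. - (z \<bullet> b)\<^sup>2 / 2)"
      unfolding power2_norm_eq_inner euclidean_inner[of z z]
      by (simp add: sum_negf sum_divide_distrib power2_eq_square)
    then show "ennreal (exp (- (norm z)\<^sup>2 / 2)) = (\<Prod>b\<in>Basis. ennreal (exp (- (z \<bullet> b)\<^sup>2 / 2)))"
      by (simp add: exp_sum prod_ennreal)
  qed
  also have "\<dots> = (\<Prod>b\<in>(Basis::'a set). \<integral>\<^sup>+x. ennreal (exp (- x\<^sup>2 / 2)) \<partial>lborel)"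
    by (intro nn_integral_lborel_prod) auto
  also have "\<dots> < \<infinity>"
  proof -
    have "integrable lborel (\<lambda>x. sqrt (2*pi) * std_normal_density x)"
      by (intro integrable_mult_right) simp
    then have "integrable lborel (\<lambda>x::real. exp (- x\<^sup>2 / 2))"
      by (simp add: std_normal_density_def)
    then have "(\<integral>\<^sup>+x. ennreal (exp (- x\<^sup>2 / 2)) \<partial>lborel) < \<infinity>"
      by (subst (asm) integrable_iff_bounded) auto
    then show ?thesis by (simp only: prod_constant less_top[symmetric] power_eq_top_ennreal infinity_ennreal_def) simp
  qed
  finally show "(\<integral>\<^sup>+z. ennreal (exp (- (norm z)\<^sup>2 / 2)) \<partial>(lborel::'a measure)) < \<infinity>" .
qed auto

lemma not_AE_False_lborel: "\<not> (AE x::'a::euclidean_space in lborel. False)"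
  using AE_iff_measurable[of "UNIV::'a set" lborel "\<lambda>_. False"] by simp

lemma integral_gauss_kernel_pos: "0 < (\<integral>z. exp (- (norm z)\<^sup>2 / 2) \<partial>(lborel::'a::euclidean_space measure))"
proof -
  have "0 \<le> (\<integral>z. exp (- (norm z)\<^sup>2 / 2) \<partial>(lborel::'a measure))" by simp
  moreover have "(\<integral>z. exp (- (norm z)\<^sup>2 / 2) \<partial>(lborel::'a measure)) \<noteq> 0"
  proof
    assume "(\<integral>z. exp (- (norm z)\<^sup>2 / 2) \<partial>(lborel::'a measure)) = 0"
    then have "AE z::'a in lborel. exp (- (norm z)\<^sup>2 / 2) = 0"
      by (subst (asm) integral_nonneg_eq_0_iff_AE[OF integrable_gauss_kernel]) auto
    then show False using not_AE_False_lborel[where 'a='a] by (simp only: exp_not_eq_zero)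
  qed
  ultimately show ?thesis by linarith
qed

lemma gauss_kernel_scale:
  fixes y :: "'a::euclidean_space" and f :: "'a \<Rightarrow> real"
  assumes n: "n > 0" and [measurable]: "f \<in> borel_measurable borel" and B: "\<And>x. \<bar>f x\<bar> \<le> B"
  shows "integrable lborel (\<lambda>x. f x * exp (- (n * norm (y - x))\<^sup>2 / 2))" (is ?I)
    and "(\<integral>x. n ^ DIM('a) * (f x * exp (- (n * norm (y - x))\<^sup>2 / 2)) \<partial>lborel) =
      (\<integral>z. f (y + z /\<^sub>R n) * exp (- (norm z)\<^sup>2 / 2) \<partial>lborel)"
proof -
  have int: "integrable lborel (\<lambda>z. f (y + z /\<^sub>R n) * exp (- (norm z)\<^sup>2 / 2))"
    by (rule Bochner_Integration.integrable_bound[OF integrable_mult_right[OF integrable_gauss_kernel, of "B"]])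
       (use B in \<open>auto simp: abs_mult intro!: mult_right_mono order_trans[OF B] abs_ge_self\<close>)
  have eq: "lborel = density (distr lborel borel (\<lambda>z. y + inverse n *\<^sub>R z)) (\<lambda>_. ennreal (\<bar>inverse n\<bar> ^ DIM('a)))"
    using n by (intro lborel_affine) auto
  have simp1: "n * norm (z /\<^sub>R n) = norm z" for z :: 'a using n by simp
  show ?I
    using int n by (subst eq) (simp add: integrable_density integrable_distr_eq simp1 del: norm_scaleR)
  show "(\<integral>x. n ^ DIM('a) * (f x * exp (- (n * norm (y - x))\<^sup>2 / 2)) \<partial>lborel) =
      (\<integral>z. f (y + z /\<^sub>R n) * exp (- (norm z)\<^sup>2 / 2) \<partial>lborel)"
    using n by (subst eq) (simp add: integral_density integral_distr simp1 power_inverse mult.assoc[symmetric] del: norm_scaleR)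
qed

text \<open>Integrating the smoothed quantity against \<open>f\<close> and exchanging the integrals
  turns the kernel around: \<open>f\<close> is averaged at scale 1/n around the value of
  \<open>X\<close>. The power of \<open>n\<close> is the Jacobian of x = X + z/n.\<close>

lemma gauss_conv:
  fixes X :: "'b \<Rightarrow> 'a::euclidean_space" and h :: "'b \<Rightarrow> complex" and f :: "'a \<Rightarrow> real"
  assumes "finite_measure M" and X [measurable]: "X \<in> borel_measurable M" and h: "integrable M h"
    and n: "n > 0" and f [measurable]: "f \<in> borel_measurable borel" and B: "\<And>x. \<bar>f x\<bar> \<le> B"
  shows "(\<integral>x. of_real (n ^ DIM('a) * f x) * (\<integral>\<omega>. of_real (exp (- (n * norm (X \<omega> - x))\<^sup>2 / 2)) * h \<omega> \<partial>M) \<partial>lborel) =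
    (\<integral>\<omega>. of_real (\<integral>z. f (X \<omega> + z /\<^sub>R n) * exp (- (norm z)\<^sup>2 / 2) \<partial>lborel) * h \<omega> \<partial>M)"
proof -
  interpret M: finite_measure M by fact
  interpret pair_sigma_finite M "lborel :: 'a measure" ..
  have [measurable]: "h \<in> borel_measurable M" using h by auto
  have B0: "0 \<le> B" using B[of 0] by linarith
  define F where "F \<omega> x = complex_of_real (n ^ DIM('a) * (f x * exp (- (n * norm (X \<omega> - x))\<^sup>2 / 2))) * h \<omega>" for \<omega> x
  have I1: "integrable lborel (F \<omega>)" for \<omega>
    unfolding F_def using gauss_kernel_scale(1)[OF n f B, of "X \<omega>"] by (intro integrable_mult_left integrable_of_real integrable_mult_right) auto
  have nF: "norm (F \<omega> x) = n ^ DIM('a) * (\<bar>f x\<bar> * exp (- (n * norm (X \<omega> - x))\<^sup>2 / 2)) * norm (h \<omega>)" for \<omega> x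
    using n by (simp add: F_def norm_mult abs_mult norm_power)
  have "(\<integral>x. norm (F \<omega> x) \<partial>lborel) = (\<integral>z. \<bar>f (X \<omega> + z /\<^sub>R n)\<bar> * exp (- (norm z)\<^sup>2 / 2) \<partial>lborel) * norm (h \<omega>)" for \<omega>
    unfolding nF using gauss_kernel_scale(2)[OF n, of "\<lambda>x. \<bar>f x\<bar>" B "X \<omega>"] B by simp
  moreover have "(\<integral>z. \<bar>f (X \<omega> + z /\<^sub>R n)\<bar> * exp (- (norm z)\<^sup>2 / 2) \<partial>lborel) \<le> (\<integral>z. B * exp (- (norm (z::'a))\<^sup>2 / 2) \<partial>lborel)" for \<omega>
  proof (rule integral_mono')
    show "integrable lborel (\<lambda>z. B * exp (- (norm (z::'a))\<^sup>2 / 2))"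
      by (intro integrable_mult_right integrable_gauss_kernel)
  qed (use B B0 in \<open>auto intro: mult_right_mono\<close>)
  ultimately have bound: "(\<integral>x. norm (F \<omega> x) \<partial>lborel) \<le> (\<integral>z. B * exp (- (norm (z::'a))\<^sup>2 / 2) \<partial>lborel) * norm (h \<omega>)" for \<omega>
    by (simp add: mult_right_mono del: integral_mult_right_zero)
  have FM [measurable]: "(\<lambda>(\<omega>, x). F \<omega> x) \<in> borel_measurable (M \<Otimes>\<^sub>M lborel)"
    unfolding F_def by measurable
  have int: "integrable (M \<Otimes>\<^sub>M lborel) (\<lambda>(\<omega>, x). F \<omega> x)"
  proof (rule Fubini_integrable)
    show "integrable M (\<lambda>\<omega>. \<integral>x. norm (case (\<omega>, x) of (\<omega>, x) \<Rightarrow> F \<omega> x) \<partial>lborel)"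
    proof (rule Bochner_Integration.integrable_bound)
      show "integrable M (\<lambda>\<omega>. (\<integral>z. B * exp (- (norm (z::'a))\<^sup>2 / 2) \<partial>lborel) * norm (h \<omega>))"
        using h by (intro integrable_mult_right) auto
    qed (use bound in \<open>auto intro!: AE_I2 order_trans[OF _ abs_ge_self] simp del: integral_mult_right_zero\<close>)
  qed (use I1 in auto)
  have "(\<integral>x. of_real (n ^ DIM('a) * f x) * (\<integral>\<omega>. of_real (exp (- (n * norm (X \<omega> - x))\<^sup>2 / 2)) * h \<omega> \<partial>M) \<partial>lborel) =
      (\<integral>x. (\<integral>\<omega>. F \<omega> x \<partial>M) \<partial>lborel)"
    by (intro Bochner_Integration.integral_cong refl, subst integral_mult_right_zero[symmetric])
       (simp add: F_def mult.assoc)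
  also have "\<dots> = (\<integral>\<omega>. (\<integral>x. F \<omega> x \<partial>lborel) \<partial>M)"
    using Fubini_integral[OF int] by simp
  also have "\<dots> = (\<integral>\<omega>. of_real (\<integral>z. f (X \<omega> + z /\<^sub>R n) * exp (- (norm z)\<^sup>2 / 2) \<partial>lborel) * h \<omega> \<partial>M)"
    unfolding F_def using gauss_kernel_scale(2)[OF n f B]
    by (intro Bochner_Integration.integral_cong refl) (simp only: integral_mult_left_zero integral_complex_of_real)
  finally show ?thesis .
qed

text \<open>The kernel is left unnormalized, so its mass \<open>I\<close> survives in the limit;
  positivity of that mass lets it cancel later.\<close>

lemma gauss_conv_limit:
  fixes X :: "'b \<Rightarrow> 'a::euclidean_space" and h :: "'b \<Rightarrow> complex" and f :: "'a \<Rightarrow> real"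
  assumes "finite_measure M" and X [measurable]: "X \<in> borel_measurable M" and h: "integrable M h"
    and f: "continuous_on UNIV f" and B: "\<And>x. \<bar>f x\<bar> \<le> B"
  defines "I \<equiv> (\<integral>z. exp (- (norm (z::'a))\<^sup>2 / 2) \<partial>lborel)"
  shows "(\<lambda>n. (\<integral>\<omega>. of_real (\<integral>z. f (X \<omega> + z /\<^sub>R real (Suc n)) * exp (- (norm z)\<^sup>2 / 2) \<partial>lborel) * h \<omega> \<partial>M))
    \<longlonglongrightarrow> of_real I * (\<integral>\<omega>. of_real (f (X \<omega>)) * h \<omega> \<partial>M)"
proof -
  have [measurable]: "h \<in> borel_measurable M" using h by auto
  have [measurable]: "f \<in> borel_measurable borel" using f by (rule borel_measurable_continuous_onI)
  have lim: "(\<lambda>n. \<integral>z. f (y + z /\<^sub>R real (Suc n)) * exp (- (norm z)\<^sup>2 / 2) \<partial>lborel) \<longlonglongrightarrow>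
      (\<integral>z. f y * exp (- (norm (z::'a))\<^sup>2 / 2) \<partial>lborel)" for y :: 'a
  proof (rule integral_dominated_convergence)
    show "integrable lborel (\<lambda>z. B * exp (- (norm (z::'a))\<^sup>2 / 2))"
      by (intro integrable_mult_right integrable_gauss_kernel)
    show "AE z in lborel. (\<lambda>n. f (y + z /\<^sub>R real (Suc n)) * exp (- (norm z)\<^sup>2 / 2)) \<longlonglongrightarrow> f y * exp (- (norm z)\<^sup>2 / 2)"
    proof (intro AE_I2 tendsto_mult tendsto_const)
      fix z :: 'a
      have "(\<lambda>n. y + z /\<^sub>R real (Suc n)) \<longlonglongrightarrow> y + 0 *\<^sub>R z"
        by (intro tendsto_add tendsto_scaleR tendsto_const LIMSEQ_inverse_real_of_nat)
      then show "(\<lambda>n. f (y + z /\<^sub>R real (Suc n))) \<longlonglongrightarrow> f y"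
        using f by (auto simp: continuous_on_eq_continuous_at isCont_def
            intro: isCont_tendsto_compose[of y f])
    qed
  qed (use B in \<open>auto simp: abs_mult intro!: AE_I2 mult_right_mono\<close>)
  have bd: "\<bar>\<integral>z. f (y + z /\<^sub>R real (Suc n)) * exp (- (norm z)\<^sup>2 / 2) \<partial>lborel\<bar> \<le> B * I" for y n
  proof -
    have "\<bar>\<integral>z. f (y + z /\<^sub>R real (Suc n)) * exp (- (norm z)\<^sup>2 / 2) \<partial>lborel\<bar> \<le> (\<integral>z. B * exp (- (norm (z::'a))\<^sup>2 / 2) \<partial>lborel)"
      unfolding real_norm_def[symmetric]
    proof (rule Bochner_Integration.integral_norm_bound_integral)
      show "integrable lborel (\<lambda>z. f (y + z /\<^sub>R real (Suc n)) * exp (- (norm z)\<^sup>2 / 2))"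
        by (rule Bochner_Integration.integrable_bound[OF integrable_mult_right[OF integrable_gauss_kernel, of "B"]])
           (use B in \<open>auto simp: abs_mult intro!: mult_right_mono order_trans[OF B] abs_ge_self\<close>)
      show "integrable lborel (\<lambda>z. B * exp (- (norm (z::'a))\<^sup>2 / 2))"
        by (intro integrable_mult_right integrable_gauss_kernel)
    qed (use B in \<open>auto simp: abs_mult intro!: mult_right_mono\<close>)
    then show ?thesis by (simp add: I_def)
  qed
  have "(\<lambda>n. (\<integral>\<omega>. of_real (\<integral>z. f (X \<omega> + z /\<^sub>R real (Suc n)) * exp (- (norm z)\<^sup>2 / 2) \<partial>lborel) * h \<omega> \<partial>M))
    \<longlonglongrightarrow> (\<integral>\<omega>. of_real (\<integral>z. f (X \<omega>) * exp (- (norm (z::'a))\<^sup>2 / 2) \<partial>lborel) * h \<omega> \<partial>M)"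
  proof (rule integral_dominated_convergence)
    show "integrable M (\<lambda>\<omega>. B * I * norm (h \<omega>))" using h by auto
    show "AE \<omega> in M. (\<lambda>n. of_real (\<integral>z. f (X \<omega> + z /\<^sub>R real (Suc n)) * exp (- (norm z)\<^sup>2 / 2) \<partial>lborel) * h \<omega>)
       \<longlonglongrightarrow> of_real (\<integral>z. f (X \<omega>) * exp (- (norm (z::'a))\<^sup>2 / 2) \<partial>lborel) * h \<omega>"
      by (intro AE_I2 tendsto_mult tendsto_of_real tendsto_const lim)
    show "AE \<omega> in M. norm (of_real (\<integral>z. f (X \<omega> + z /\<^sub>R real (Suc n)) * exp (- (norm z)\<^sup>2 / 2) \<partial>lborel) * h \<omega>) \<le> B * I * norm (h \<omega>)" for n
      using bd by (auto simp: norm_mult intro!: AE_I2 mult_right_mono)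
  qed measurable
  also have "(\<integral>\<omega>. of_real (\<integral>z. f (X \<omega>) * exp (- (norm (z::'a))\<^sup>2 / 2) \<partial>lborel) * h \<omega> \<partial>M) =
      of_real I * (\<integral>\<omega>. of_real (f (X \<omega>)) * h \<omega> \<partial>M)"
    by (subst integral_mult_right_zero[symmetric]) (simp add: I_def mult_ac)
  finally show ?thesis .
qed

text \<open>Equal weighted characteristic functions give equal Gaussian averages at every scale,
  then equal integrals of bounded continuous functions, then of indicators of closed sets, which
  form an intersection-stable generator of the Borel sets.\<close>

theorem fourier_determines:
  fixes X :: "'b \<Rightarrow> 'a::euclidean_space" and Y :: "'c \<Rightarrow> 'a" and h :: "'b \<Rightarrow> complex" and k :: "'c \<Rightarrow> complex"
  assumes M: "finite_measure M" and X [measurable]: "X \<in> borel_measurable M" and h: "integrable M h"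
    and N: "finite_measure N" and Y [measurable]: "Y \<in> borel_measurable N" and k: "integrable N k"
    and eq: "\<And>\<xi>. (\<integral>\<omega>. cis (\<xi> \<bullet> X \<omega>) * h \<omega> \<partial>M) = (\<integral>\<omega>. cis (\<xi> \<bullet> Y \<omega>) * k \<omega> \<partial>N)"
    and A: "A \<in> sets borel"
  shows "(\<integral>\<omega>. indicator A (X \<omega>) * h \<omega> \<partial>M) = (\<integral>\<omega>. indicator A (Y \<omega>) * k \<omega> \<partial>N)"
proof -
  have [measurable]: "h \<in> borel_measurable M" using h by auto
  have [measurable]: "k \<in> borel_measurable N" using k by auto
  have cont: "(\<integral>\<omega>. of_real (f (X \<omega>)) * h \<omega> \<partial>M) = (\<integral>\<omega>. of_real (f (Y \<omega>)) * k \<omega> \<partial>N)"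
    if f: "continuous_on UNIV f" and B: "\<And>x. \<bar>f x\<bar> \<le> B" for f and B :: real
  proof -
    have [measurable]: "f \<in> borel_measurable borel" using f by (rule borel_measurable_continuous_onI)
    have "(\<integral>\<omega>. of_real (\<integral>z. f (X \<omega> + z /\<^sub>R real (Suc n)) * exp (- (norm z)\<^sup>2 / 2) \<partial>lborel) * h \<omega> \<partial>M) =
       (\<integral>\<omega>. of_real (\<integral>z. f (Y \<omega> + z /\<^sub>R real (Suc n)) * exp (- (norm z)\<^sup>2 / 2) \<partial>lborel) * k \<omega> \<partial>N)" for n
      by (subst (1 2) gauss_conv[symmetric, where B=B])
         (simp_all only: M N h k X Y B gauss_smoothing eq, simp_all)
    then have "of_real (\<integral>z. exp (- (norm (z::'a))\<^sup>2 / 2) \<partial>lborel) * (\<integral>\<omega>. of_real (f (X \<omega>)) * h \<omega> \<partial>M) =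
       of_real (\<integral>z. exp (- (norm (z::'a))\<^sup>2 / 2) \<partial>lborel) * (\<integral>\<omega>. of_real (f (Y \<omega>)) * k \<omega> \<partial>N)"
      by (intro LIMSEQ_unique[OF gauss_conv_limit[OF M X h f B]]) (simp only: gauss_conv_limit[OF N Y k f B])
    then show ?thesis using integral_gauss_kernel_pos[where 'a='a] by simp
  qed
  have clos: "(\<integral>\<omega>. indicator C (X \<omega>) * h \<omega> \<partial>M) = (\<integral>\<omega>. indicator C (Y \<omega>) * k \<omega> \<partial>N)"
    if C: "closed C" for C
  proof (cases "C = {}")
    case False
    \<comment> \<open>Continuous and equal to 1 on \<open>C\<close>; off the closed set the distance
      is positive, so the values are eventually 0.\<close>
    define f where "f n x = max 0 (1 - real n * infdist x C)" for n x
    have fc: "continuous_on UNIV (f n)" for n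
      unfolding f_def by (intro continuous_intros)
    have fm [measurable]: "f n \<in> borel_measurable borel" for n
      using fc by (rule borel_measurable_continuous_onI)
    have fB: "\<bar>f n x\<bar> \<le> 1" for n x
      using infdist_nonneg[of x C] by (auto simp: f_def)
    have fl: "(\<lambda>n. f n x) \<longlonglongrightarrow> indicator C x" for x
    proof (cases "x \<in> C")
      case True then show ?thesis by (simp add: f_def)
    next
      case x: False
      then have pos: "infdist x C > 0"
        using C False in_closed_iff_infdist_zero[of C x] infdist_nonneg[of x C] by (metis less_eq_real_def)
      obtain N where N: "1 / infdist x C < real N" using reals_Archimedean2 by blast
      have "\<forall>\<^sub>F n in sequentially. f n x = indicator C x"
        using eventually_ge_at_top[of N]
      proof eventually_elim
        case (elim n)
        then have "1 / infdist x C < real n" using N by linarith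
        then have "1 < real n * infdist x C" using pos by (simp add: divide_simps)
        then show ?case using x by (simp add: f_def)
      qed
      then show ?thesis by (rule tendsto_eventually)
    qed
    have L: "(\<lambda>n. \<integral>\<omega>. of_real (f n (Z \<omega>)) * l \<omega> \<partial>P) \<longlonglongrightarrow> (\<integral>\<omega>. indicator C (Z \<omega>) * l \<omega> \<partial>P)"
      if [measurable]: "Z \<in> borel_measurable P" and l: "integrable P l" for P and Z :: "'d \<Rightarrow> 'a" and l :: "'d \<Rightarrow> complex"
    proof (rule integral_dominated_convergence)
      have [measurable]: "l \<in> borel_measurable P" using l by auto
      have [measurable]: "C \<in> sets borel" using C by auto
      show "integrable P (\<lambda>\<omega>. norm (l \<omega>))" using l by auto
      show "AE \<omega> in P. (\<lambda>n. of_real (f n (Z \<omega>)) * l \<omega>) \<longlonglongrightarrow> indicator C (Z \<omega>) * l \<omega>"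
      proof (intro AE_I2 tendsto_mult tendsto_const)
        fix \<omega>
        show "(\<lambda>n. complex_of_real (f n (Z \<omega>))) \<longlonglongrightarrow> indicator C (Z \<omega>)"
          using tendsto_of_real[OF fl[of "Z \<omega>"], where 'a=complex] by (cases "Z \<omega> \<in> C") auto
      qed
      show "(\<lambda>\<omega>. indicator C (Z \<omega>) * l \<omega>) \<in> borel_measurable P" by measurable
      show "(\<lambda>\<omega>. of_real (f n (Z \<omega>)) * l \<omega>) \<in> borel_measurable P" for n by measurable
      show "AE \<omega> in P. norm (of_real (f n (Z \<omega>)) * l \<omega>) \<le> norm (l \<omega>)" for n
        using fB by (auto simp: norm_mult intro!: AE_I2 mult_left_le_one_le)
    qed
    show ?thesis
      using LIMSEQ_unique[OF L[OF X h]] L[OF Y k] cont[OF fc fB] by simp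
  qed simp
  have int: "integrable P (\<lambda>\<omega>. indicator S (Z \<omega>) * l \<omega>)"
    if [measurable]: "Z \<in> borel_measurable P" "S \<in> sets borel" and l: "integrable P l" for P and Z :: "'d \<Rightarrow> 'a" and l :: "'d \<Rightarrow> complex" and S
    by (rule Bochner_Integration.integrable_bound[OF l]) (use l in \<open>auto simp: norm_mult indicator_def\<close>)
  have "Int_stable (Collect closed :: 'a set set)"
    by (auto simp: Int_stable_def)
  moreover have "Collect closed \<subseteq> Pow (UNIV :: 'a set)" by simp
  moreover have "A \<in> sigma_sets UNIV (Collect closed)"
    using A by (simp add: borel_eq_closed)
  ultimately show ?thesis
  proof (induction rule: sigma_sets_induct_disjoint)
    case (basic C) then show ?case using clos by simp
  next
    case empty show ?case by simp
  next
    case (compl S)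
    then have [measurable]: "S \<in> sets borel" by (simp add: borel_eq_closed)
    have "(\<integral>\<omega>. indicator (UNIV - S) (Z \<omega>) * l \<omega> \<partial>P) = (\<integral>\<omega>. l \<omega> \<partial>P) - (\<integral>\<omega>. indicator S (Z \<omega>) * l \<omega> \<partial>P)"
      if [measurable]: "Z \<in> borel_measurable P" and l: "integrable P l" for P and Z :: "'d \<Rightarrow> 'a" and l :: "'d \<Rightarrow> complex"
    proof -
      have "(\<lambda>\<omega>. indicator (UNIV - S) (Z \<omega>) * l \<omega>) = (\<lambda>\<omega>. l \<omega> - indicator S (Z \<omega>) * l \<omega>)"
        by (auto simp: indicator_def)
      then show ?thesis using int[of Z P S l] l by simp
    qed
    \<comment> \<open>Complements need equal total masses, which is the hypothesis at frequency
      0.\<close>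
    from this[OF X h] this[OF Y k] show ?case using compl eq[of 0] by simp
  next
    case (union S)
    then have [measurable]: "S n \<in> sets borel" for n by (auto simp: borel_eq_closed)
    have L: "(\<lambda>n. \<Sum>i<n. (\<integral>\<omega>. indicator (S i) (Z \<omega>) * l \<omega> \<partial>P)) \<longlonglongrightarrow> (\<integral>\<omega>. indicator (\<Union>i. S i) (Z \<omega>) * l \<omega> \<partial>P)"
      if [measurable]: "Z \<in> borel_measurable P" and l: "integrable P l" for P and Z :: "'d \<Rightarrow> 'a" and l :: "'d \<Rightarrow> complex"
    proof -
      have [measurable]: "l \<in> borel_measurable P" using l by auto
      have [measurable]: "(\<Union>i. S i) \<in> sets borel" by (intro sets.countable_UN) auto
      have [measurable]: "(\<Union>i<n. S i) \<in> sets borel" for n by (intro sets.finite_UN) auto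
      have s: "(\<Sum>i<n. indicator (S i) z) = (indicator (\<Union>i<n. S i) z :: complex)" for n z
        using union(1) by (subst indicator_UN_disjoint) (auto simp: disjoint_family_on_def)
      have "(\<lambda>n. \<integral>\<omega>. indicator (\<Union>i<n. S i) (Z \<omega>) * l \<omega> \<partial>P) \<longlonglongrightarrow> (\<integral>\<omega>. indicator (\<Union>i. S i) (Z \<omega>) * l \<omega> \<partial>P)"
      proof (rule integral_dominated_convergence)
        show "integrable P (\<lambda>\<omega>. norm (l \<omega>))" using l by auto
        show "AE \<omega> in P. (\<lambda>n. indicator (\<Union>i<n. S i) (Z \<omega>) * l \<omega>) \<longlonglongrightarrow> indicator (\<Union>i. S i) (Z \<omega>) * l \<omega>"
          by (intro AE_I2 tendsto_mult tendsto_const LIMSEQ_indicator_UN)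
        show "(\<lambda>\<omega>. indicator (\<Union>i. S i) (Z \<omega>) * l \<omega>) \<in> borel_measurable P" by measurable
        show "(\<lambda>\<omega>. indicator (\<Union>i<n. S i) (Z \<omega>) * l \<omega>) \<in> borel_measurable P" for n by measurable
      qed (auto simp: norm_mult indicator_def)
      also have "(\<lambda>n. \<integral>\<omega>. indicator (\<Union>i<n. S i) (Z \<omega>) * l \<omega> \<partial>P) = (\<lambda>n. \<Sum>i<n. (\<integral>\<omega>. indicator (S i) (Z \<omega>) * l \<omega> \<partial>P))"
        by (subst Bochner_Integration.integral_sum[symmetric])
           (auto simp: int l s[symmetric] sum_distrib_right)
      finally show ?thesis .
    qed
    show ?case using LIMSEQ_unique[OF L[OF X h]] L[OF Y k] union(3) by simp
  qed
qed

section \<open>One-dimensional marginals by subordination\<close>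

text \<open>The error function without its normalization.\<close>

definition gauss_prim :: "real \<Rightarrow> real" where
  "gauss_prim x = (LBINT u=0..ereal x. exp (- u\<^sup>2))"

lemma gauss_prim_deriv: "(gauss_prim has_real_derivative exp (- x\<^sup>2)) (at x)"
proof -
  have "((\<lambda>u. LBINT y=ereal 0..ereal u. exp (- y\<^sup>2)) has_vector_derivative exp (- x\<^sup>2))
      (at x within {- \<bar>x\<bar> - 1..\<bar>x\<bar> + 1})"
    by (rule interval_integral_FTC2) (auto intro!: continuous_intros)
  moreover have "at x within {- \<bar>x\<bar> - 1..\<bar>x\<bar> + 1} = at x"
    by (rule at_within_Icc_at) auto
  ultimately show ?thesis
    by (simp add: gauss_prim_def[abs_def] has_real_derivative_iff_has_vector_derivative zero_ereal_def)
qed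

lemma gauss_prim_at_top: "(gauss_prim \<longlongrightarrow> sqrt pi / 2) at_top"
proof -
  have "has_bochner_integral lborel (\<lambda>x. indicator {0..} x *\<^sub>R exp (- x\<^sup>2)) (sqrt pi / 2)"
    by (rule gaussian_moment_0)
  then have i: "integrable lborel (\<lambda>x::real. indicator {0..} x *\<^sub>R exp (- x\<^sup>2))"
    and e: "(\<integral>x. indicator {0..} x *\<^sub>R exp (- (x::real)\<^sup>2) \<partial>lborel) = sqrt pi / 2"
    by (auto simp: has_bochner_integral_iff)
  have "((\<lambda>y. \<integral>x. indicator {..y} x *\<^sub>R (indicator {0..} x *\<^sub>R exp (- x\<^sup>2)) \<partial>lborel) \<longlongrightarrow> sqrt pi / 2) at_top"
    unfolding e[symmetric] by (rule tendsto_integral_at_top[OF _ i]) simp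
  moreover have "\<forall>\<^sub>F y in at_top. (\<integral>x. indicator {..y} x *\<^sub>R (indicator {0..} x *\<^sub>R exp (- x\<^sup>2)) \<partial>lborel) = gauss_prim y"
    using eventually_ge_at_top[of 0]
  proof eventually_elim
    case (elim y)
    show ?case
      unfolding gauss_prim_def interval_integral_Icc[OF elim, folded zero_ereal_def] set_lebesgue_integral_def
      by (intro Bochner_Integration.integral_cong) (auto simp: indicator_def)
  qed
  ultimately show ?thesis by (rule Lim_transform_eventually)
qed

lemma gauss_prim_minus: "gauss_prim (- x) = - gauss_prim x"
proof -
  have "((\<lambda>x. gauss_prim (- x) + gauss_prim x) has_real_derivative 0) (at x)" for x
    by (auto intro!: derivative_eq_intros DERIV_chain2[OF gauss_prim_deriv] gauss_prim_deriv)
  then have "gauss_prim (- x) + gauss_prim x = gauss_prim (- 0) + gauss_prim 0"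
    using DERIV_isconst_all[of "\<lambda>x. gauss_prim (- x) + gauss_prim x" x 0] by simp
  then show ?thesis by (simp add: gauss_prim_def zero_ereal_def)
qed

lemma gauss_prim_at_bot: "(gauss_prim \<longlongrightarrow> - (sqrt pi / 2)) at_bot"
proof -
  have "((\<lambda>x. - gauss_prim (- x)) \<longlongrightarrow> - (sqrt pi / 2)) at_bot"
    by (intro tendsto_minus filterlim_compose[OF gauss_prim_at_top] filterlim_uminus_at_top_at_bot)
  then show ?thesis by (simp add: gauss_prim_minus)
qed

text \<open>Up to normalization this is the Laplace transform, at b^2, of the one-sided 1/2-stable
  density. It has a closed form because the integrand has an explicit primitive in terms of
  \<open>gauss_prim\<close>.\<close>

lemma levy_density_integral:
  assumes a: "a > 0" and b: "b \<ge> (0::real)"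
  defines "f \<equiv> \<lambda>s. a * s powr (-3/2) * exp (- (a\<^sup>2 / s) - b\<^sup>2 * s)"
  shows "set_integrable lborel {0<..} f" "(LBINT s:{0<..}. f s) = sqrt pi * exp (- (2 * a * b))"
proof -
  \<comment> \<open>The square can be completed in two ways: -a^2/s - b^2 s equals -(b sqrt s -
    a/sqrt s)^2 - 2ab and also -(b sqrt s + a/sqrt s)^2 + 2ab. In the derivative the contributions
    of b cancel and those of a add up to the integrand.\<close>
  define F where "F s = exp (- (2*a*b)) * gauss_prim (b * sqrt s - a / sqrt s) - exp (2*a*b) * gauss_prim (a / sqrt s + b * sqrt s)" for s
  define A where "A = - exp (- (2*a*b)) * (sqrt pi / 2) - exp (2*a*b) * (sqrt pi / 2)"
  \<comment> \<open>For b > 0 both arguments of \<open>gauss_prim\<close> in \<open>F\<close> tend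
    to infinity; for b = 0 they tend to 0.\<close>
  define B where "B = (if b = 0 then 0 else exp (- (2*a*b)) * (sqrt pi / 2) - exp (2*a*b) * (sqrt pi / 2))"
  have D: "(F has_real_derivative f s) (at s)" if s: "s > 0" for s
  proof -
    have e: "exp (- (2*a*b)) * exp (- (b * sqrt s - a / sqrt s)\<^sup>2) = exp (- (a\<^sup>2 / s) - b\<^sup>2 * s)"
      "exp (2*a*b) * exp (- (a / sqrt s + b * sqrt s)\<^sup>2) = exp (- (a\<^sup>2 / s) - b\<^sup>2 * s)"
      using s by (auto simp: exp_add[symmetric] power2_eq_square field_simps real_sqrt_mult[symmetric] simp del: exp_add)
    have p: "s powr (-3/2) = 1 / (s * sqrt s)"
      using s powr_add[of s 1 "1/2"] by (simp add: powr_minus powr_half_sqrt divide_simps)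
    have "(F has_real_derivative
        exp (- (2*a*b)) * (exp (- (b * sqrt s - a / sqrt s)\<^sup>2) * (b * (inverse (sqrt s) / 2) + a * (inverse (sqrt s) / 2) / s))
        - exp (2*a*b) * (exp (- (a / sqrt s + b * sqrt s)\<^sup>2) * (b * (inverse (sqrt s) / 2) - a * (inverse (sqrt s) / 2) / s))) (at s)"
      unfolding F_def using s
      by (auto intro!: derivative_eq_intros DERIV_chain2[OF gauss_prim_deriv] simp: power2_eq_square)
         (simp add: mult_ac)
    also have "exp (- (2*a*b)) * (exp (- (b * sqrt s - a / sqrt s)\<^sup>2) * (b * (inverse (sqrt s) / 2) + a * (inverse (sqrt s) / 2) / s))
        - exp (2*a*b) * (exp (- (a / sqrt s + b * sqrt s)\<^sup>2) * (b * (inverse (sqrt s) / 2) - a * (inverse (sqrt s) / 2) / s)) =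
        exp (- (a\<^sup>2 / s) - b\<^sup>2 * s) * (a / (s * sqrt s))"
      unfolding mult.assoc[symmetric] e using s by (simp add: field_simps)
    finally show ?thesis unfolding f_def p by (simp add: mult_ac)
  qed
  have cont: "isCont f s" if "s > 0" for s
    unfolding f_def using that by (auto intro!: continuous_intros)
  have LA: "(F \<longlongrightarrow> A) (at_right 0)"
  proof -
    have "filterlim (\<lambda>s. b * sqrt s - a / sqrt s) at_bot (at_right 0)" "filterlim (\<lambda>s. a / sqrt s + b * sqrt s) at_top (at_right 0)"
      using a by real_asymp+
    then show ?thesis unfolding F_def A_def
      by (auto intro!: tendsto_eq_intros filterlim_compose[OF gauss_prim_at_bot] filterlim_compose[OF gauss_prim_at_top])
  qed
  have LB: "(F \<longlongrightarrow> B) at_top"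
  proof (cases "b = 0")
    case True
    have "((\<lambda>s. a / sqrt s) \<longlongrightarrow> 0) at_top" by real_asymp
    moreover have "isCont gauss_prim 0" using gauss_prim_deriv DERIV_isCont by blast
    moreover have "gauss_prim 0 = 0" using gauss_prim_minus[of 0] by simp
    ultimately have "((\<lambda>s. gauss_prim (a / sqrt s)) \<longlongrightarrow> 0) at_top"
      by (metis isCont_tendsto_compose)
    then show ?thesis unfolding F_def B_def using True
      by (auto intro!: tendsto_eq_intros simp: gauss_prim_minus)
  next
    case False
    then have "b > 0" using b by simp
    then have "filterlim (\<lambda>s. b * sqrt s - a / sqrt s) at_top at_top" "filterlim (\<lambda>s. a / sqrt s + b * sqrt s) at_top at_top"
      by real_asymp+
    then show ?thesis unfolding F_def B_def using False
      by (auto intro!: tendsto_eq_intros filterlim_compose[OF gauss_prim_at_top])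
  qed
  have *: "set_integrable lborel (einterval 0 \<infinity>) f" "(LBINT s=0..\<infinity>. f s) = B - A"
  proof -
    have 1: "((F \<circ> real_of_ereal) \<longlongrightarrow> A) (at_right 0)"
      unfolding zero_ereal_def ereal_tendsto_simps using LA by simp
    have 2: "((F \<circ> real_of_ereal) \<longlongrightarrow> B) (at_left \<infinity>)"
      unfolding ereal_tendsto_simps using LB by simp
    have nn: "AE x in lborel. 0 < ereal x \<longrightarrow> ereal x < \<infinity> \<longrightarrow> 0 \<le> f x"
      using a by (auto simp: f_def)
    show "set_integrable lborel (einterval 0 \<infinity>) f" "(LBINT s=0..\<infinity>. f s) = B - A"
      using interval_integral_FTC_nonneg[of 0 \<infinity> F f A B, OF _ _ _ nn 1 2] D cont by auto
  qed
  show "set_integrable lborel {0<..} f" using *(1) by (simp add: zero_ereal_def)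
  have "(LBINT s:{0<..}. f s) = (LBINT s=0..\<infinity>. f s)"
    by (simp add: interval_lebesgue_integral_def zero_ereal_def)
  also have "\<dots> = sqrt pi * exp (- (2 * a * b))"
    unfolding *(2) A_def B_def by (auto simp: field_simps)
  finally show "(LBINT s:{0<..}. f s) = sqrt pi * exp (- (2 * a * b))" .
qed

text \<open>Time-\<open>h\<close> marginal of the subordinator with Laplace exponent sqrt(l + m^2) -
  m: the one-sided 1/2-stable density tilted by exp(-m^2 s) and renormalized by exp(h m).\<close>

definition subordinator_density :: "real \<Rightarrow> real \<Rightarrow> real \<Rightarrow> real" where
  "subordinator_density m h s = indicator {0<..} s * (h / (2 * sqrt pi) * s powr (-3/2) * exp (h * m - m\<^sup>2 * s - h\<^sup>2 / (4 * s)))"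

lemma subordinator_density_measurable [measurable]: "subordinator_density m h \<in> borel_measurable borel"
  unfolding subordinator_density_def[abs_def] by measurable

lemma subordinator_density_nonneg: "h > 0 \<Longrightarrow> 0 \<le> subordinator_density m h s"
  by (simp add: subordinator_density_def indicator_def)

lemma subordinator_density_laplace:
  assumes h: "h > 0" and m: "m \<ge> 0" and l: "l \<ge> 0"
  shows "has_bochner_integral lborel (\<lambda>s. subordinator_density m h s * exp (- l * s)) (exp (h * m - h * sqrt (l + m\<^sup>2)))"
proof -
  have [simp]: "(sqrt (l + m\<^sup>2))\<^sup>2 = l + m\<^sup>2" using l by simp
  let ?f = "\<lambda>s. h/2 * s powr (-3/2) * exp (- ((h/2)\<^sup>2 / s) - (sqrt (l + m\<^sup>2))\<^sup>2 * s)"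
  have *: "set_integrable lborel {0<..} ?f" "(LBINT s:{0<..}. ?f s) = sqrt pi * exp (- (2 * (h/2) * sqrt (l + m\<^sup>2)))"
    using levy_density_integral[of "h/2" "sqrt (l + m\<^sup>2)"] h l by auto
  have "has_bochner_integral lborel (\<lambda>s. indicator {0<..} s *\<^sub>R ?f s) (sqrt pi * exp (- (2 * (h/2) * sqrt (l + m\<^sup>2))))"
    using * by (simp add: has_bochner_integral_iff set_integrable_def set_lebesgue_integral_def)
  then have "has_bochner_integral lborel (\<lambda>s. exp (h * m) / sqrt pi * (indicator {0<..} s *\<^sub>R ?f s))
     (exp (h * m) / sqrt pi * (sqrt pi * exp (- (2 * (h/2) * sqrt (l + m\<^sup>2)))))"
    by (rule has_bochner_integral_mult_right)
  also have "(\<lambda>s. exp (h * m) / sqrt pi * (indicator {0<..} s *\<^sub>R ?f s)) = (\<lambda>s. subordinator_density m h s * exp (- l * s))"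
  proof
    fix s
    show "exp (h * m) / sqrt pi * (indicator {0<..} s *\<^sub>R ?f s) = subordinator_density m h s * exp (- l * s)"
    proof (cases "s > 0")
      case True
      have "exp (h * m) * exp (- ((h/2)\<^sup>2 / s) - (l + m\<^sup>2) * s) = exp (h * m - m\<^sup>2 * s - h\<^sup>2 / (4 * s)) * exp (- l * s)"
        unfolding exp_add[symmetric] using True by (simp add: field_simps power2_eq_square)
      then show ?thesis using True by (simp add: subordinator_density_def mult_ac)
    qed (simp add: subordinator_density_def)
  qed
  also have "exp (h * m) / sqrt pi * (sqrt pi * exp (- (2 * (h/2) * sqrt (l + m\<^sup>2)))) = exp (h * m - h * sqrt (l + m\<^sup>2))"
    by (simp add: exp_diff exp_minus field_simps)
  finally show ?thesis .
qed

definition subordinator :: "real \<Rightarrow> real \<Rightarrow> real measure" where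
  "subordinator m h = density lborel (\<lambda>s. ennreal (subordinator_density m h s))"

lemma sets_subordinator [simp, measurable_cong]: "sets (subordinator m h) = sets borel"
  by (simp add: subordinator_def)

lemma prob_space_subordinator:
  assumes h: "h > 0" and m: "m \<ge> 0" shows "prob_space (subordinator m h)"
proof
  have "has_bochner_integral lborel (subordinator_density m h) 1"
    using subordinator_density_laplace[OF assms, of 0] m by simp
  then have "(\<integral>\<^sup>+s. ennreal (subordinator_density m h s) \<partial>lborel) = 1"
    by (subst nn_integral_eq_integral) (auto simp: has_bochner_integral_iff subordinator_density_nonneg[OF h])
  then show "emeasure (subordinator m h) (space (subordinator m h)) = 1"
    by (simp add: subordinator_def emeasure_density)
qed

lemma subordinator_laplace:
  assumes h: "h > 0" and m: "m \<ge> 0" and l: "l \<ge> 0"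
  shows "(\<integral>s. exp (- l * s) \<partial>subordinator m h) = exp (h * m - h * sqrt (l + m\<^sup>2))"
  unfolding subordinator_def using subordinator_density_laplace[OF assms] subordinator_density_nonneg[OF h]
  by (subst integral_density) (auto simp: has_bochner_integral_iff)

definition rel_exponent :: "real \<Rightarrow> 'a::euclidean_space \<Rightarrow> real" where
  "rel_exponent m \<xi> = sqrt (norm \<xi> ^ 2 + m ^ 2) - m"

text \<open>The inequality sqrt(|\<xi>|^2 + m^2) \<le> |\<xi>| + m leaves no trace of the mass in
  the upper bound, from which the small-time estimates are drawn.\<close>

lemma rel_exponent_bounds: "m \<ge> 0 \<Longrightarrow> 0 \<le> rel_exponent m \<xi>" "m \<ge> 0 \<Longrightarrow> rel_exponent m \<xi> \<le> norm \<xi>"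
  using real_le_rsqrt[of m "norm \<xi> ^ 2 + m ^ 2"] sqrt_sum_squares_le_sum[of "norm \<xi>" m]
  by (auto simp: rel_exponent_def)

lemma rel_exponent_zero [simp]: "m \<ge> 0 \<Longrightarrow> rel_exponent m 0 = 0"
  by (simp add: rel_exponent_def)

text \<open>Brownian motion at a random time. The factor 2 makes the Gaussian characteristic
  function at time s equal to exp(-s |\<xi>|^2), so that the Laplace transform of the subordinator
  is evaluated at |\<xi>|^2.\<close>

definition rel_marginal :: "real \<Rightarrow> real \<Rightarrow> 'a::euclidean_space measure" where
  "rel_marginal m h = distr (subordinator m h \<Otimes>\<^sub>M gauss) borel (\<lambda>(s, z). sqrt (2 * s) *\<^sub>R z)"

lemma sets_rel_marginal [simp, measurable_cong]: "sets (rel_marginal m h) = sets borel"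
  by (simp add: rel_marginal_def)

lemma space_rel_marginal [simp]: "space (rel_marginal m h) = UNIV"
  by (simp add: rel_marginal_def)

lemma prob_space_rel_marginal:
  assumes h: "h > 0" and m: "m \<ge> 0" shows "prob_space (rel_marginal m h)"
proof -
  interpret s: prob_space "subordinator m h" by (rule prob_space_subordinator[OF assms])
  interpret g: prob_space "gauss :: 'a measure" by simp
  interpret pair_prob_space "subordinator m h" "gauss :: 'a measure" ..
  show ?thesis unfolding rel_marginal_def by (rule prob_space_distr) measurable
qed

lemma rel_marginal_cf:
  fixes \<xi> :: "'a::euclidean_space"
  assumes h: "h > 0" and m: "m \<ge> 0"
  shows "(\<integral>x. cis (\<xi> \<bullet> x) \<partial>rel_marginal m h) = of_real (exp (- (h * rel_exponent m \<xi>)))"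
proof -
  interpret s: prob_space "subordinator m h" by (rule prob_space_subordinator[OF assms])
  interpret g: prob_space "gauss :: 'a measure" by simp
  interpret pair_prob_space "subordinator m h" "gauss :: 'a measure" ..
  have int: "integrable (subordinator m h \<Otimes>\<^sub>M gauss) (\<lambda>(s, z). cis (\<xi> \<bullet> sqrt (2 * s) *\<^sub>R z))"
    by (rule integrable_const_bound[where B=1]) (auto simp: split_beta)
  have "(\<integral>x. cis (\<xi> \<bullet> x) \<partial>rel_marginal m h) = (\<integral>p. (case p of (s, z) \<Rightarrow> cis (\<xi> \<bullet> sqrt (2 * s) *\<^sub>R z)) \<partial>(subordinator m h \<Otimes>\<^sub>M gauss))"
    unfolding rel_marginal_def by (subst integral_distr) (auto simp: case_prod_unfold)
  also have "\<dots> = (\<integral>s. (\<integral>z. cis (\<xi> \<bullet> sqrt (2 * s) *\<^sub>R z) \<partial>gauss) \<partial>subordinator m h)"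
    using integral_fst'[OF int] by simp
  also have "\<dots> = (\<integral>s. complex_of_real (exp (- ((norm \<xi>)\<^sup>2) * s)) \<partial>subordinator m h)"
  proof (rule integral_cong_AE)
    \<comment> \<open>The subordinator charges only positive s, where squaring
      \<open>sqrt (2 * s)\<close> gives back 2 s.\<close>
    have "AE s in subordinator m h. s > 0"
      unfolding subordinator_def by (subst AE_density) (auto simp: subordinator_density_def indicator_def)
    then show "AE s in subordinator m h. (\<integral>z. cis (\<xi> \<bullet> sqrt (2 * s) *\<^sub>R z) \<partial>gauss) = complex_of_real (exp (- ((norm \<xi>)\<^sup>2) * s))"
    proof eventually_elim
      case (elim s)
      then show ?case using gauss_cf[of "sqrt (2 * s) *\<^sub>R \<xi>"] by (simp add: power_mult_distrib)
    qed
  qed measurable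
  also have "\<dots> = of_real (exp (- (h * rel_exponent m \<xi>)))"
    using subordinator_laplace[OF h m, of "(norm \<xi>)\<^sup>2"] by (simp add: rel_exponent_def algebra_simps)
  finally show ?thesis .
qed

text \<open>Both marginals mix the same Gaussians, so a pointwise bound between the mixing densities
  is enough; it comes from exp(-m^2 s) \<le> 1.\<close>

lemma rel_marginal_dominated:
  fixes F :: "'a::euclidean_space \<Rightarrow> ennreal"
  assumes h: "h > 0" and m: "m \<ge> 0" and [measurable]: "F \<in> borel_measurable borel"
  shows "(\<integral>\<^sup>+x. F x \<partial>rel_marginal m h) \<le> ennreal (exp (h * m)) * (\<integral>\<^sup>+x. F x \<partial>rel_marginal 0 h)"
proof -
  interpret s: prob_space "subordinator m h" by (rule prob_space_subordinator[OF assms(1,2)])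
  interpret s0: prob_space "subordinator 0 h" using h by (intro prob_space_subordinator) auto
  interpret g: prob_space "gauss :: 'a measure" by simp
  interpret pair_prob_space "subordinator m h" "gauss :: 'a measure" ..
  interpret p0: pair_prob_space "subordinator 0 h" "gauss :: 'a measure" ..
  define G where "G s = (\<integral>\<^sup>+z. F (sqrt (2 * s) *\<^sub>R z) \<partial>gauss)" for s
  have [measurable]: "G \<in> borel_measurable borel" unfolding G_def[abs_def] by measurable
  have eq: "(\<integral>\<^sup>+x. F x \<partial>rel_marginal k h) = (\<integral>\<^sup>+s. ennreal (subordinator_density k h s) * G s \<partial>lborel)"
    if "pair_sigma_finite (subordinator k h) (gauss :: 'a measure)" for k
  proof -
    have "(\<integral>\<^sup>+x. F x \<partial>rel_marginal k h) = (\<integral>\<^sup>+p. (case p of (s, z) \<Rightarrow> F (sqrt (2 * s) *\<^sub>R z)) \<partial>(subordinator k h \<Otimes>\<^sub>M gauss))"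
      unfolding rel_marginal_def by (subst nn_integral_distr) (auto simp: case_prod_unfold)
    also have "\<dots> = (\<integral>\<^sup>+s. G s \<partial>subordinator k h)"
      unfolding G_def by (subst g.nn_integral_fst[symmetric]) auto
    also have "\<dots> = (\<integral>\<^sup>+s. ennreal (subordinator_density k h s) * G s \<partial>lborel)"
      unfolding subordinator_def by (subst nn_integral_density) auto
    finally show ?thesis .
  qed
  have le: "subordinator_density m h s \<le> exp (h * m) * subordinator_density 0 h s" for s
  proof (cases "s > 0")
    case True
    have "exp (h * m - m\<^sup>2 * s - h\<^sup>2 / (4 * s)) \<le> exp (h * m) * exp (- (h\<^sup>2 / (4 * s)))"
      unfolding exp_add[symmetric] using True by simp
    then have "h / (2 * sqrt pi) * s powr (-3/2) * exp (h * m - m\<^sup>2 * s - h\<^sup>2 / (4 * s)) \<le>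
        h / (2 * sqrt pi) * s powr (-3/2) * (exp (h * m) * exp (- (h\<^sup>2 / (4 * s))))"
      using h by (intro mult_left_mono) auto
    then show ?thesis using True by (simp add: subordinator_density_def mult_ac)
  qed (simp add: subordinator_density_def)
  show ?thesis
    unfolding eq[OF pair_sigma_finite_axioms] eq[OF p0.pair_sigma_finite_axioms]
    by (subst nn_integral_cmult[symmetric])
       (auto intro!: nn_integral_mono mult_right_mono ennreal_leI le
          simp: mult.assoc[symmetric] ennreal_mult'[symmetric])
qed

section \<open>Small-time estimates from the characteristic function\<close>

lemma (in finite_measure) integral_indicator_complex:
  assumes [measurable]: "A \<in> sets M"
  shows "(\<integral>\<omega>. indicator A \<omega> \<partial>M) = complex_of_real (measure M A)"
proof -
  have "(\<integral>\<omega>. indicator A \<omega> \<partial>M) = (\<integral>\<omega>. complex_of_real (indicator A \<omega>) \<partial>M)"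
    by (intro Bochner_Integration.integral_cong) (auto simp: indicator_def)
  then show ?thesis by (simp only: integral_complex_of_real) simp
qed

lemma cf_unique:
  fixes M N :: "'a::euclidean_space measure"
  assumes M: "prob_space M" "sets M = sets borel" and N: "prob_space N" "sets N = sets borel"
    and eq: "\<And>\<xi>. (\<integral>x. cis (\<xi> \<bullet> x) \<partial>M) = (\<integral>x. cis (\<xi> \<bullet> x) \<partial>N)"
  shows "M = N"
proof (rule measure_eqI)
  interpret M: prob_space M by fact
  interpret N: prob_space N by fact
  have [measurable_cong]: "sets M = sets borel" "sets N = sets borel" by fact+
  have sp: "space M = UNIV" "space N = UNIV" using sets_eq_imp_space_eq[OF M(2)] sets_eq_imp_space_eq[OF N(2)] by simp_all
  fix A assume "A \<in> sets M"
  then have [measurable]: "A \<in> sets borel" using M by simp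
  have "(\<integral>x. indicator A x * 1 \<partial>M) = (\<integral>x. indicator A x * (1::complex) \<partial>N)"
    by (rule fourier_determines) (use eq in \<open>auto intro: M.finite_measure N.finite_measure\<close>)
  then have "complex_of_real (measure M A) = of_real (measure N A)"
    using M.integral_indicator_complex[of A] N.integral_indicator_complex[of A] M(2) N(2) by simp
  then show "emeasure M A = emeasure N A"
    by (simp add: M.emeasure_eq_measure N.emeasure_eq_measure)
qed (use M N in auto)

lemma integrable_norm_gauss: "integrable gauss (\<lambda>z::'a::euclidean_space. norm z)"
proof -
  let ?P = "\<Pi>\<^sub>M b\<in>(Basis::'a set). std_normal_distribution"
  have std: "prob_space std_normal_distribution"
    using real_dist_normal_dist real_distribution_def by blast
  have comp: "integrable ?P (\<lambda>f. \<bar>f b\<bar>)" if b: "b \<in> Basis" for b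
  proof -
    have "integrable (distr ?P std_normal_distribution (\<lambda>f. f b)) (\<lambda>x. \<bar>x\<bar>)"
      using integrable_std_normal_distribution_moment[of 1] distr_PiM_component[where I=Basis and i=b and M="\<lambda>_. std_normal_distribution", OF std b] by simp
    then show ?thesis
      by (subst (asm) integrable_distr_eq) (use b in \<open>auto intro!: measurable_component_singleton\<close>)
  qed
  have "integrable ?P (\<lambda>f. norm (\<Sum>b\<in>Basis. f b *\<^sub>R b))"
  proof (rule Bochner_Integration.integrable_bound)
    show "integrable ?P (\<lambda>f. \<Sum>b\<in>Basis. \<bar>f b\<bar>)" using comp by auto
    show "AE f in ?P. norm (norm (\<Sum>b\<in>(Basis::'a set). f b *\<^sub>R b)) \<le> norm (\<Sum>b\<in>(Basis::'a set). \<bar>f b\<bar>)"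
      by (auto intro!: AE_I2 order_trans[OF norm_sum] sum_mono simp: sum_nonneg)
  qed measurable
  then show ?thesis
    unfolding gauss_def by (subst integrable_distr_eq[OF measurable_basis_sum]) auto
qed

definition gauss_abs :: "'a::euclidean_space itself \<Rightarrow> real" where
  "gauss_abs _ = (\<integral>z. norm (z::'a) \<partial>gauss)"

lemma gauss_abs_nonneg: "0 \<le> gauss_abs TYPE('a::euclidean_space)"
  by (simp add: gauss_abs_def)

text \<open>The left integrand is the Gaussian average over \<xi> of 1 - cis(c \<xi> . x), so its
  integral is the average of 1 - exp(-h \<psi>(c \<xi>)) \<le> h c |\<xi>|. It is a smooth stand-in
  for min(1, (c |x|)^2) whose mean is at most linear in \<open>h\<close>.\<close>

lemma small_time_bound:
  fixes \<mu> :: "'a::euclidean_space measure"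
  assumes "prob_space \<mu>" and [measurable_cong, simp]: "sets \<mu> = sets borel"
    and cf: "\<And>\<xi>. (\<integral>x. cis (\<xi> \<bullet> x) \<partial>\<mu>) = of_real (exp (- (h * \<psi> \<xi>)))"
    and \<psi>: "\<And>\<xi>. 0 \<le> \<psi> \<xi>" "\<And>\<xi>. \<psi> \<xi> \<le> norm \<xi>" and h: "h \<ge> 0" and c: "c \<ge> 0"
  shows "(\<integral>x. (1 - exp (- (c * norm x)\<^sup>2 / 2)) \<partial>\<mu>) \<le> h * c * gauss_abs TYPE('a)"
proof -
  interpret \<mu>: prob_space \<mu> by fact
  interpret g: prob_space "gauss :: 'a measure" by simp
  define I where "I = (\<integral>x. exp (- (c * norm x)\<^sup>2 / 2) \<partial>\<mu>)"
  have iI: "integrable \<mu> (\<lambda>x. exp (- (c * norm x)\<^sup>2 / 2))"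
    by (rule \<mu>.integrable_const_bound[where B=1]) auto
  have icf: "integrable gauss (\<lambda>\<xi>. \<integral>x. cis ((c *\<^sub>R \<xi>) \<bullet> x) \<partial>\<mu>)"
  proof (rule g.integrable_const_bound[where B=1])
    show "AE \<xi> in gauss. norm (\<integral>x. cis ((c *\<^sub>R \<xi>) \<bullet> x) \<partial>\<mu>) \<le> 1"
      unfolding cf using \<psi> h by (auto intro!: AE_I2)
  qed measurable
  have "complex_of_real I = (\<integral>\<xi>. (\<integral>x. cis ((c *\<^sub>R \<xi>) \<bullet> x) \<partial>\<mu>) \<partial>gauss)"
    using gauss_smoothing[of \<mu> "\<lambda>x. x" "\<lambda>_. 1" c 0] \<mu>.finite_measure_axioms iI
    by (simp add: I_def)
  moreover have "(\<integral>\<xi>. 1 - (\<integral>x. cis ((c *\<^sub>R \<xi>) \<bullet> x) \<partial>\<mu>) \<partial>gauss) =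
      (\<integral>\<xi>. 1 \<partial>(gauss :: 'a measure)) - (\<integral>\<xi>. (\<integral>x. cis ((c *\<^sub>R \<xi>) \<bullet> x) \<partial>\<mu>) \<partial>gauss)"
    by (rule Bochner_Integration.integral_diff[OF _ icf]) (rule g.integrable_const)
  moreover have "(\<integral>\<xi>. 1 \<partial>(gauss :: 'a measure)) = (1 :: complex)"
    using g.prob_space by simp
  ultimately have "of_real (1 - I) = (\<integral>\<xi>. 1 - (\<integral>x. cis ((c *\<^sub>R \<xi>) \<bullet> x) \<partial>\<mu>) \<partial>gauss)"
    by (simp only: of_real_diff of_real_1)
  then have "norm (complex_of_real (1 - I)) = norm (\<integral>\<xi>. 1 - (\<integral>x. cis ((c *\<^sub>R \<xi>) \<bullet> x) \<partial>\<mu>) \<partial>gauss)"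
    by simp
  also have "\<dots> \<le> (\<integral>\<xi>. h * c * norm (\<xi>::'a) \<partial>gauss)"
  proof (rule Bochner_Integration.integral_norm_bound_integral)
    show "integrable gauss (\<lambda>\<xi>. 1 - (\<integral>x. cis ((c *\<^sub>R \<xi>) \<bullet> x) \<partial>\<mu>))" using icf by simp
    show "integrable gauss (\<lambda>\<xi>::'a. h * c * norm \<xi>)" by (intro integrable_mult_right integrable_norm_gauss)
    fix \<xi> :: 'a
    have "1 - exp (- (h * \<psi> (c *\<^sub>R \<xi>))) \<le> h * \<psi> (c *\<^sub>R \<xi>)"
      using exp_ge_add_one_self[of "- (h * \<psi> (c *\<^sub>R \<xi>))"] by linarith
    also have "\<dots> \<le> h * norm (c *\<^sub>R \<xi>)" by (intro mult_left_mono \<psi> h)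
    finally have "1 - exp (- (h * \<psi> (c *\<^sub>R \<xi>))) \<le> h * c * norm \<xi>" using c by simp
    moreover have "norm (1 - complex_of_real (exp (- (h * \<psi> (c *\<^sub>R \<xi>))))) = 1 - exp (- (h * \<psi> (c *\<^sub>R \<xi>)))"
      using \<psi> h by (subst of_real_1[symmetric], subst of_real_diff[symmetric], subst norm_of_real) auto
    ultimately show "norm (1 - (\<integral>x. cis ((c *\<^sub>R \<xi>) \<bullet> x) \<partial>\<mu>)) \<le> h * c * norm \<xi>"
      unfolding cf by simp
  qed
  also have "\<dots> = h * c * gauss_abs TYPE('a)"
    unfolding gauss_abs_def by (rule integral_mult_right_zero)
  finally have "\<bar>1 - I\<bar> \<le> h * c * gauss_abs TYPE('a)"
    by (simp only: norm_of_real)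
  moreover have "(\<integral>x. (1 - exp (- (c * norm x)\<^sup>2 / 2)) \<partial>\<mu>) = (\<integral>x. 1 \<partial>\<mu>) - I"
    unfolding I_def by (rule Bochner_Integration.integral_diff[OF _ iI]) (rule \<mu>.integrable_const)
  moreover have "(\<integral>x. 1 \<partial>\<mu>) = (1::real)"
    using \<mu>.prob_space by simp
  ultimately show ?thesis by linarith
qed

lemma small_time_tail:
  fixes \<mu> :: "'a::euclidean_space measure"
  assumes "prob_space \<mu>" and [measurable_cong, simp]: "sets \<mu> = sets borel"
    and cf: "\<And>\<xi>. (\<integral>x. cis (\<xi> \<bullet> x) \<partial>\<mu>) = of_real (exp (- (h * \<psi> \<xi>)))"
    and \<psi>: "\<And>\<xi>. 0 \<le> \<psi> \<xi>" "\<And>\<xi>. \<psi> \<xi> \<le> norm \<xi>" and h: "h \<ge> 0" and l: "l > 0"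
  shows "measure \<mu> {x. l \<le> norm x} \<le> 3 * h * gauss_abs TYPE('a) / l"
proof -
  interpret \<mu>: prob_space \<mu> by fact
  have sp [simp]: "space \<mu> = UNIV" using sets_eq_imp_space_eq[OF assms(2)] by simp
  have "measure \<mu> {x. l \<le> norm x} = (\<integral>x. indicator {x. l \<le> norm x} x \<partial>\<mu>)"
    by simp
  also have "\<dots> \<le> (\<integral>x. 3 * (1 - exp (- (1 / l * norm x)\<^sup>2 / 2)) \<partial>\<mu>)"
  proof (rule integral_mono)
    fix x :: 'a
    show "indicator {x. l \<le> norm x} x \<le> 3 * (1 - exp (- (1 / l * norm x)\<^sup>2 / 2))"
    proof (cases "l \<le> norm x")
      case True
      then have "1 \<le> 1 / l * norm x" using l by simp
      then have "1 \<le> (1 / l * norm x)\<^sup>2" by (metis one_power2 power_mono zero_le_one)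
      then have "exp (- (1 / l * norm x)\<^sup>2 / 2) \<le> exp (- (1/2))" by simp
      \<comment> \<open>Since 1 - exp(-1/2) \<ge> 1/3, the factor 3 lifts the smooth integrand above
        the indicator.\<close>
      moreover have "exp (- (1/2)) \<le> (2/3 :: real)"
        using exp_ge_add_one_self[of "1/2"] by (simp add: exp_minus field_simps)
      ultimately have "exp (- (1 / l * norm x)\<^sup>2 / 2) \<le> 2/3" by (rule order_trans)
      moreover have "1 \<le> 3 * (1 - e)" if "e \<le> 2/3" for e :: real
        using that by simp
      ultimately have "1 \<le> 3 * (1 - exp (- (1 / l * norm x)\<^sup>2 / 2))" by blast
      then show ?thesis using True by simp
    qed simp
    show "integrable \<mu> (\<lambda>x. 3 * (1 - exp (- (1 / l * norm x)\<^sup>2 / 2)))"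
      by (intro integrable_mult_right \<mu>.integrable_const_bound[where B=1]) auto
  qed (auto intro!: \<mu>.integrable_const_bound[where B=1])
  also have "\<dots> = 3 * (\<integral>x. (1 - exp (- (1 / l * norm x)\<^sup>2 / 2)) \<partial>\<mu>)"
    by (rule integral_mult_right_zero)
  also have "\<dots> \<le> 3 * (h * (1 / l) * gauss_abs TYPE('a))"
    by (intro mult_left_mono small_time_bound[OF assms(1-6), of "1/l"]) (use l in auto)
  finally show ?thesis by simp
qed

text \<open>On |x| < r the number u = |x|^2 / (2 r^2) is at most 1/2, where u/2 \<le> 1 - exp(-u).
  The resulting order r h, and not just h, is what makes the contribution of small jumps vanish with
  the cutoff.\<close>

lemma small_time_truncated_moment:
  fixes \<mu> :: "'a::euclidean_space measure"
  assumes "prob_space \<mu>" and [measurable_cong, simp]: "sets \<mu> = sets borel"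
    and cf: "\<And>\<xi>. (\<integral>x. cis (\<xi> \<bullet> x) \<partial>\<mu>) = of_real (exp (- (h * \<psi> \<xi>)))"
    and \<psi>: "\<And>\<xi>. 0 \<le> \<psi> \<xi>" "\<And>\<xi>. \<psi> \<xi> \<le> norm \<xi>" and h: "h \<ge> 0" and r: "r > 0"
  shows "(\<integral>x. indicator {x. norm x < r} x * (norm x)\<^sup>2 \<partial>\<mu>) \<le> 4 * r * h * gauss_abs TYPE('a)"
proof -
  interpret \<mu>: prob_space \<mu> by fact
  have "(\<integral>x. indicator {x. norm x < r} x * (norm x)\<^sup>2 \<partial>\<mu>) \<le> (\<integral>x. 4 * r\<^sup>2 * (1 - exp (- (1 / r * norm x)\<^sup>2 / 2)) \<partial>\<mu>)"
  proof (rule integral_mono)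
    fix x :: 'a
    show "indicator {x. norm x < r} x * (norm x)\<^sup>2 \<le> 4 * r\<^sup>2 * (1 - exp (- (1 / r * norm x)\<^sup>2 / 2))"
    proof (cases "norm x < r")
      case True
      define u where "u = (1 / r * norm x)\<^sup>2 / 2"
      have "1 / r * norm x \<le> 1" using True r by simp
      then have "(1 / r * norm x)\<^sup>2 \<le> 1" using r by (simp add: power_le_one)
      then have u: "0 \<le> u" "u \<le> 1/2" by (auto simp: u_def)
      have "exp (- u) * (1 + u) \<le> exp (- u) * exp u" by (intro mult_left_mono) auto
      then have "exp (- u) * (1 + u) \<le> 1" by (simp add: exp_minus)
      then have "exp (- u) \<le> 1 / (1 + u)" using u by (simp add: pos_le_divide_eq)
      also have "1 / (1 + u) \<le> 1 - u / 2"
      proof -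
        have "u * u \<le> u * 1" using u by (intro mult_left_mono) auto
        then have "1 \<le> (1 - u / 2) * (1 + u)" by (simp add: algebra_simps)
        then show ?thesis using u by (simp add: pos_divide_le_eq)
      qed
      finally have "u / 2 \<le> 1 - exp (- u)" by simp
      then have "4 * r\<^sup>2 * (u / 2) \<le> 4 * r\<^sup>2 * (1 - exp (- u))" by (intro mult_left_mono) auto
      moreover have "4 * r\<^sup>2 * (u / 2) = (norm x)\<^sup>2"
      proof -
        have "r\<^sup>2 * (1 / r * norm x)\<^sup>2 = (norm x)\<^sup>2"
          using r unfolding power_mult_distrib[symmetric] by simp
        then show ?thesis unfolding u_def by linarith
      qed
      ultimately have "(norm x)\<^sup>2 \<le> 4 * r\<^sup>2 * (1 - exp (- u))" by linarith
      moreover have "- u = - (1 / r * norm x)\<^sup>2 / 2" by (simp add: u_def)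
      ultimately show ?thesis using True by simp
    qed simp
  next
    show "integrable \<mu> (\<lambda>x. indicator {x. norm x < r} x * (norm x)\<^sup>2)"
      proof (rule \<mu>.integrable_const_bound[where B="r\<^sup>2"])
      show "AE x in \<mu>. norm (indicator {x. norm x < r} x * (norm x)\<^sup>2) \<le> r\<^sup>2"
      proof (rule AE_I2)
        fix x :: 'a
        show "norm (indicator {x. norm x < r} x * (norm x)\<^sup>2) \<le> r\<^sup>2"
          using power_mono[of "norm x" r 2] by (cases "norm x < r") auto
      qed
    qed measurable
    show "integrable \<mu> (\<lambda>x. 4 * r\<^sup>2 * (1 - exp (- (1 / r * norm x)\<^sup>2 / 2)))"
      by (intro integrable_mult_right \<mu>.integrable_const_bound[where B=1]) auto
  qed
  also have "\<dots> = 4 * r\<^sup>2 * (\<integral>x. (1 - exp (- (1 / r * norm x)\<^sup>2 / 2)) \<partial>\<mu>)"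
    by (rule integral_mult_right_zero)
  also have "\<dots> \<le> 4 * r\<^sup>2 * (h * (1 / r) * gauss_abs TYPE('a))"
    by (intro mult_left_mono small_time_bound[OF assms(1-6), of "1/r"]) (use r in auto)
  also have "\<dots> = 4 * r * h * gauss_abs TYPE('a)" using r by (simp add: power2_eq_square)
  finally show ?thesis .
qed

text \<open>Characters are traded for indicators one coordinate at a time. All other factors, the
  indicators already obtained and the characters still left, sit in the complex weight of
  \<open>fourier_determines\<close> while the frequency of one coordinate varies.\<close>

lemma (in prob_space) indep_vars_cf:
  fixes X :: "'i \<Rightarrow> 'a \<Rightarrow> 'b::euclidean_space"
  assumes I: "finite I" and X: "\<And>i. i \<in> I \<Longrightarrow> X i \<in> borel_measurable M"
    and eq: "\<And>\<theta>. (\<integral>\<omega>. (\<Prod>i\<in>I. cis (\<theta> i \<bullet> X i \<omega>)) \<partial>M) = (\<Prod>i\<in>I. \<integral>\<omega>. cis (\<theta> i \<bullet> X i \<omega>) \<partial>M)"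
  shows "indep_vars (\<lambda>_. borel) X I"
proof (cases "I = {}")
  case True then show ?thesis by (simp add: indep_vars_def indep_sets_def)
next
  case False
  note [measurable] = X
  have step: "(\<integral>\<omega>. (\<Prod>i\<in>S. indicator (B i) (X i \<omega>)) * (\<Prod>i\<in>I - S. cis (\<theta> i \<bullet> X i \<omega>)) \<partial>M) =
     (\<Prod>i\<in>S. complex_of_real (prob (X i -` B i \<inter> space M))) * (\<Prod>i\<in>I - S. \<integral>\<omega>. cis (\<theta> i \<bullet> X i \<omega>) \<partial>M)"
    if S: "finite S" "S \<subseteq> I" and B: "\<And>i. i \<in> I \<Longrightarrow> B i \<in> sets borel" for S \<theta> and B :: "'i \<Rightarrow> 'b set"
    using S
  proof (induction S arbitrary: \<theta> rule: finite_induct)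
    case empty
    then show ?case using eq by simp
  next
    case (insert j S)
    note [measurable] = B
    have jI: "j \<in> I" using insert by auto
    have Imj: "I - S = insert j (I - insert j S)" "j \<notin> I - insert j S" "finite (I - insert j S)" using insert I by auto
    define h where "h \<omega> = (\<Prod>i\<in>S. indicator (B i) (X i \<omega>)) * (\<Prod>i\<in>I - insert j S. cis (\<theta> i \<bullet> X i \<omega>))" for \<omega>
    define c where "c = (\<Prod>i\<in>S. complex_of_real (prob (X i -` B i \<inter> space M))) * (\<Prod>i\<in>I - insert j S. \<integral>\<omega>. cis (\<theta> i \<bullet> X i \<omega>) \<partial>M)"
    have hm: "h \<in> borel_measurable M"
      unfolding h_def using insert by (intro borel_measurable_times borel_measurable_prod) (auto intro!: borel_measurable_cis borel_measurable_indicator')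
    have nh: "norm (h \<omega>) \<le> 1" for \<omega>
      unfolding h_def norm_mult prod_norm[symmetric]
      by (auto intro!: prod_le_1 mult_le_one prod_nonneg simp: indicator_def)
    have hi: "integrable M h"
      by (rule integrable_const_bound[where B=1]) (use hm nh in auto)
    \<comment> \<open>The second copy of \<open>X j\<close> carries the constant weight
      \<open>c\<close>: as a function of the frequency \<xi> of coordinate j, the induction
      hypothesis reads E[cis(\<xi> . X j) h] = E[cis(\<xi> . X j) c].\<close>
    have "(\<integral>\<omega>. indicator (B j) (X j \<omega>) * h \<omega> \<partial>M) = (\<integral>\<omega>. indicator (B j) (X j \<omega>) * c \<partial>M)"
    proof (rule fourier_determines)
      fix \<xi>
      have split: "(\<Prod>i\<in>I - S. F ((\<theta>(j := \<xi>)) i) i) = F \<xi> j * (\<Prod>i\<in>I - insert j S. F (\<theta> i) i)"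
        for F :: "'b \<Rightarrow> 'i \<Rightarrow> complex"
        unfolding Imj(1) prod.insert[OF Imj(3,2)] by (auto intro!: prod.cong arg_cong2[where f="(*)"])
      have "(\<integral>\<omega>. cis (\<xi> \<bullet> X j \<omega>) * h \<omega> \<partial>M) =
        (\<integral>\<omega>. (\<Prod>i\<in>S. indicator (B i) (X i \<omega>)) * (\<Prod>i\<in>I - S. cis ((\<theta>(j := \<xi>)) i \<bullet> X i \<omega>)) \<partial>M)"
        unfolding split[of "\<lambda>t i. cis (t \<bullet> X i _)"] h_def
        by (intro Bochner_Integration.integral_cong refl) (simp only: mult_ac)
      also have "\<dots> = (\<Prod>i\<in>S. complex_of_real (prob (X i -` B i \<inter> space M))) *
          (\<Prod>i\<in>I - S. \<integral>\<omega>. cis ((\<theta>(j := \<xi>)) i \<bullet> X i \<omega>) \<partial>M)"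
        by (rule insert.IH) (use insert.prems in auto)
      also have "\<dots> = (\<integral>\<omega>. cis (\<xi> \<bullet> X j \<omega>) \<partial>M) * c"
        unfolding split[of "\<lambda>t i. \<integral>\<omega>. cis (t \<bullet> X i \<omega>) \<partial>M"] c_def by (simp only: mult_ac)
      finally show "(\<integral>\<omega>. cis (\<xi> \<bullet> X j \<omega>) * h \<omega> \<partial>M) = (\<integral>\<omega>. cis (\<xi> \<bullet> X j \<omega>) * c \<partial>M)"
        by simp
    qed (use hi jI B X in \<open>auto intro: finite_measure_axioms\<close>)
    also have "(\<integral>\<omega>. indicator (B j) (X j \<omega>) * c \<partial>M) = of_real (prob (X j -` B j \<inter> space M)) * c"
    proof -
      have "(\<integral>\<omega>. indicator (B j) (X j \<omega>) \<partial>M) = (\<integral>\<omega>. indicator (X j -` B j \<inter> space M) \<omega> \<partial>M :: complex)"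
        by (intro Bochner_Integration.integral_cong) (auto simp: indicator_def)
      then show ?thesis using jI B by (simp add: integral_indicator_complex)
    qed
    finally show ?case using insert by (simp add: h_def c_def mult_ac)
  qed
  show ?thesis
  proof (subst indep_vars_finite[OF False I, where E="\<lambda>_. sets borel"])
    show "\<forall>A\<in>I \<rightarrow> sets borel. prob (\<Inter>j\<in>I. X j -` A j \<inter> space M) = (\<Prod>j\<in>I. prob (X j -` A j \<inter> space M))"
    proof
      fix A :: "'i \<Rightarrow> 'b set" assume A: "A \<in> I \<rightarrow> sets borel"
      let ?S = "\<Inter>j\<in>I. X j -` A j \<inter> space M"
      have S: "?S \<in> sets M" using I False A X by (intro sets.finite_INT) (auto intro!: measurable_sets[OF X])
      have "(\<Prod>i\<in>I. indicator (A i) (X i \<omega>)) = (indicator ?S \<omega> :: complex)" if \<omega>: "\<omega> \<in> space M" for \<omega>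
      proof (cases "\<forall>i\<in>I. X i \<omega> \<in> A i")
        case True
        then have "\<omega> \<in> ?S" using \<omega> by blast
        moreover have "(\<Prod>i\<in>I. indicator (A i) (X i \<omega>)) = (1 :: complex)"
          using True by (intro prod.neutral) simp
        ultimately show ?thesis by (simp only: indicator_simps)
      next
        case not_in: False
        then obtain i where i: "i \<in> I" "X i \<omega> \<notin> A i" by auto
        then have "\<omega> \<notin> ?S" by blast
        moreover have "(\<Prod>i\<in>I. indicator (A i) (X i \<omega>)) = (0 :: complex)"
          using I i by (intro prod_zero) (auto intro!: bexI[of _ i])
        ultimately show ?thesis by (metis indicator_simps(2))
      qed
      then have "(\<integral>\<omega>. (\<Prod>i\<in>I. indicator (A i) (X i \<omega>)) \<partial>M) = complex_of_real (prob ?S)"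
        unfolding integral_indicator_complex[OF S, symmetric] by (intro Bochner_Integration.integral_cong refl)
      moreover have "(\<integral>\<omega>. (\<Prod>i\<in>I. indicator (A i) (X i \<omega>)) \<partial>M) = (\<Prod>j\<in>I. complex_of_real (prob (X j -` A j \<inter> space M)))"
        using step[OF I subset_refl, of A] A by (simp add: Pi_iff)
      ultimately have "complex_of_real (prob ?S) = of_real (\<Prod>j\<in>I. prob (X j -` A j \<inter> space M))"
        by simp
      then show "prob (\<Inter>j\<in>I. X j -` A j \<inter> space M) = (\<Prod>j\<in>I. prob (X j -` A j \<inter> space M))"
        by (simp only: of_real_eq_iff)
    qed
      show "sets borel = sigma_sets (space borel) (sets (borel :: 'b measure))"
      by (rule sets.sigma_sets_eq[symmetric])
  qed (use X in \<open>auto simp: Int_stable_def\<close>)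
qed

section \<open>Projective limit along the dyadic rationals\<close>

definition dyadic_rats :: "real set" where
  "dyadic_rats = {real k / 2 ^ n | k n. True}"

definition dyadic_level :: "nat \<Rightarrow> real set" where
  "dyadic_level n = {real k / 2 ^ n | k. True}"

lemma dyadic_level_mono: "n \<le> n' \<Longrightarrow> dyadic_level n \<subseteq> dyadic_level n'"
proof (induction n' rule: dec_induct)
  case (step i)
  have "dyadic_level i \<subseteq> dyadic_level (Suc i)"
  proof
    fix q assume "q \<in> dyadic_level i"
    then obtain k where "q = real k / 2 ^ i" by (auto simp: dyadic_level_def)
    then have "q = real (2 * k) / 2 ^ Suc i" by simp
    then show "q \<in> dyadic_level (Suc i)" unfolding dyadic_level_def by blast
  qed
  then show ?case using step by auto
qed simp

lemma dyadic_rats_eq: "dyadic_rats = (\<Union>n. dyadic_level n)"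
  by (auto simp: dyadic_rats_def dyadic_level_def)

lemma dyadic_level_subset: "dyadic_level n \<subseteq> dyadic_rats"
  by (auto simp: dyadic_rats_eq)

lemma finite_dyadic_level:
  assumes "finite J" "J \<subseteq> dyadic_rats" shows "\<exists>n. J \<subseteq> dyadic_level n"
  using assms
proof (induction J)
  case (insert q J)
  then obtain n where n: "J \<subseteq> dyadic_level n" by auto
  obtain n' where n': "q \<in> dyadic_level n'" using insert by (auto simp: dyadic_rats_eq)
  show ?case
    using n n' dyadic_level_mono[of n "max n n'"] dyadic_level_mono[of n' "max n n'"]
    by (intro exI[of _ "max n n'"]) auto
qed auto

text \<open>Path value at \<open>q\<close> rebuilt from increments over the mesh 2^-n; the floor is
  exact for \<open>q\<close> in \<open>dyadic_level n\<close>.\<close>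

definition dyadic_sum :: "nat \<Rightarrow> (nat \<Rightarrow> 'a::comm_monoid_add) \<Rightarrow> real \<Rightarrow> 'a" where
  "dyadic_sum n \<omega> q = (\<Sum>i<nat \<lfloor>q * 2 ^ n\<rfloor>. \<omega> i)"

definition pair_sum :: "(nat \<Rightarrow> 'a::plus) \<Rightarrow> nat \<Rightarrow> 'a" where
  "pair_sum \<omega> i = \<omega> (2 * i) + \<omega> (2 * i + 1)"

lemma dyadic_sum_level: "dyadic_sum n \<omega> (real k / 2 ^ n) = (\<Sum>i<k. \<omega> i)"
  by (simp add: dyadic_sum_def)

lemma dyadic_sum_pair:
  assumes "q \<in> dyadic_level n"
  shows "dyadic_sum (Suc n) \<omega> q = dyadic_sum n (pair_sum \<omega>) q"
proof -
  obtain k where k: "q = real k / 2 ^ n" using assms by (auto simp: dyadic_level_def)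
  then have k2: "q = real (2 * k) / 2 ^ Suc n" by simp
  have "dyadic_sum (Suc n) \<omega> q = (\<Sum>i<2 * k. \<omega> i)" unfolding k2 by (rule dyadic_sum_level)
  also have "\<dots> = (\<Sum>i<k. pair_sum \<omega> i)"
    by (induction k) (auto simp: pair_sum_def add.assoc)
  finally show ?thesis unfolding k by (simp only: dyadic_sum_level)
qed

text \<open>A convolution semigroup sampled at times 2^-n. The square relation says that two
  independent steps at level n + 1 make one step at level n, which is the consistency needed for a
  projective limit.\<close>

locale dyadic_semigroup =
  fixes p :: "nat \<Rightarrow> 'a::euclidean_space measure" and \<phi> :: "nat \<Rightarrow> 'a \<Rightarrow> complex"
  assumes prob_p: "\<And>n. prob_space (p n)" and sets_p [simp, measurable_cong]: "\<And>n. sets (p n) = sets borel"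
    and cf_p: "\<And>n \<xi>. (\<integral>x. cis (\<xi> \<bullet> x) \<partial>p n) = \<phi> n \<xi>"
    and cf_square: "\<And>n \<xi>. \<phi> n \<xi> = (\<phi> (Suc n) \<xi>)\<^sup>2"
begin

definition Q :: "nat \<Rightarrow> (nat \<Rightarrow> 'a) measure" where
  "Q n = (\<Pi>\<^sub>M i\<in>UNIV. p n)"

lemma sets_Q [simp, measurable_cong]: "sets (Q n) = sets (\<Pi>\<^sub>M i\<in>UNIV. borel)"
  unfolding Q_def by (intro sets_PiM_cong) auto

lemma space_Q [simp]: "space (Q n) = UNIV"
  using sets_eq_imp_space_eq[OF sets_Q[of n]] by (simp add: space_PiM)

lemma prob_Q: "prob_space (Q n)"
  unfolding Q_def by (intro prob_space_PiM prob_p)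

lemma distr_Q_component: "distr (Q n) borel (\<lambda>\<omega>. \<omega> i) = p n"
proof -
  have "distr (Q n) borel (\<lambda>\<omega>. \<omega> i) = distr (Q n) (p n) (\<lambda>\<omega>. \<omega> i)"
    by (intro distr_cong) auto
  then show ?thesis
    unfolding Q_def using distr_PiM_component[where I=UNIV and M="\<lambda>_. p n" and i=i] prob_p by simp
qed

lemma indep_Q: "prob_space.indep_vars (Q n) (\<lambda>_. borel) (\<lambda>i \<omega>. \<omega> i) UNIV"
proof -
  interpret prob_space "Q n" by (rule prob_Q)
  show ?thesis
  proof (subst indep_vars_iff_distr_eq_PiM)
    have "distr (Q n) (\<Pi>\<^sub>M i\<in>UNIV. borel) (\<lambda>x. \<lambda>i\<in>UNIV. x i) = distr (Q n) (Q n) (\<lambda>x. x)"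
      by (intro distr_cong) auto
    also have "\<dots> = (\<Pi>\<^sub>M i\<in>UNIV. p n)" by (simp add: distr_id2 Q_def[symmetric])
    finally show "distr (Q n) (\<Pi>\<^sub>M i\<in>UNIV. borel) (\<lambda>x. \<lambda>i\<in>UNIV. x i) = (\<Pi>\<^sub>M i\<in>UNIV. distr (Q n) borel (\<lambda>\<omega>. \<omega> i))"
      by (simp add: distr_Q_component)
  qed auto
qed

lemma pair_sum_measurable [measurable]: "pair_sum \<in> (\<Pi>\<^sub>M i\<in>UNIV. borel) \<rightarrow>\<^sub>M (\<Pi>\<^sub>M i\<in>(UNIV::nat set). (borel :: 'a measure))"
  unfolding pair_sum_def[abs_def] by (rule measurable_PiM_single') auto

text \<open>The pairs use disjoint blocks of coordinates, so their sums stay independent; the square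
  relation identifies the law of each sum.\<close>

lemma distr_pair_sum: "distr (Q (Suc n)) (\<Pi>\<^sub>M i\<in>UNIV. borel) pair_sum = Q n"
proof -
  interpret prob_space "Q (Suc n)" by (rule prob_Q)
  have "indep_vars (\<lambda>j. PiM {2*j, 2*j+1} (\<lambda>_. borel)) (\<lambda>j \<omega>. restrict (\<lambda>i. \<omega> i) {2*j, 2*j+1}) UNIV"
    by (rule indep_vars_restrict[OF indep_Q]) (auto simp: disjoint_family_on_def)
  then have "indep_vars (\<lambda>_. borel) (\<lambda>j \<omega>. (\<lambda>f. f (2*j) + f (2*j+1)) (restrict (\<lambda>i. \<omega> i) {2*j, 2*j+1})) (UNIV::nat set)"
    by (rule indep_vars_compose2) auto
  then have ind: "indep_vars (\<lambda>_. borel) (\<lambda>j \<omega>. pair_sum \<omega> j) UNIV"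
    by (simp add: pair_sum_def)
  have law: "distr (Q (Suc n)) borel (\<lambda>\<omega>. pair_sum \<omega> j) = p n" for j
  proof (rule cf_unique)
    fix \<xi> :: 'a
    have "(\<integral>x. cis (\<xi> \<bullet> x) \<partial>distr (Q (Suc n)) borel (\<lambda>\<omega>. pair_sum \<omega> j)) =
       (\<integral>\<omega>. (\<Prod>i\<in>{2*j, 2*j+1}. cis (\<xi> \<bullet> \<omega> i)) \<partial>Q (Suc n))"
      by (subst integral_distr) (auto simp: pair_sum_def cis_mult inner_add_right)
    also have "\<dots> = (\<Prod>i\<in>{2*j, 2*j+1}. \<integral>\<omega>. cis (\<xi> \<bullet> \<omega> i) \<partial>Q (Suc n))"
    proof (rule indep_vars_lebesgue_integral)
      show "indep_vars (\<lambda>_. borel) (\<lambda>i \<omega>. cis (\<xi> \<bullet> \<omega> i)) {2*j, 2*j+1}"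
        by (rule indep_vars_compose2[OF indep_vars_subset[OF indep_Q]]) auto
    qed (auto intro!: integrable_const_bound[where B=1])
    also have "\<dots> = (\<Prod>i\<in>{2*j, 2*j+1}. \<phi> (Suc n) \<xi>)"
    proof (intro prod.cong refl)
      fix i
      have "(\<integral>\<omega>. cis (\<xi> \<bullet> \<omega> i) \<partial>Q (Suc n)) = (\<integral>x. cis (\<xi> \<bullet> x) \<partial>distr (Q (Suc n)) borel (\<lambda>\<omega>. \<omega> i))"
        by (subst integral_distr) auto
      then show "(\<integral>\<omega>. cis (\<xi> \<bullet> \<omega> i) \<partial>Q (Suc n)) = \<phi> (Suc n) \<xi>"
        by (simp add: distr_Q_component cf_p)
    qed
    finally show "(\<integral>x. cis (\<xi> \<bullet> x) \<partial>distr (Q (Suc n)) borel (\<lambda>\<omega>. pair_sum \<omega> j)) = (\<integral>x. cis (\<xi> \<bullet> x) \<partial>p n)"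
      by (simp add: cf_p cf_square[of n] power2_eq_square)
  qed (auto intro!: prob_space_distr prob_p)
  have "distr (Q (Suc n)) (\<Pi>\<^sub>M i\<in>UNIV. borel) (\<lambda>\<omega>. \<lambda>i\<in>UNIV. pair_sum \<omega> i) = (\<Pi>\<^sub>M i\<in>UNIV. p n)"
    using ind by (subst (asm) indep_vars_iff_distr_eq_PiM) (auto simp: law)
  then show ?thesis by (simp add: Q_def restrict_UNIV)
qed

definition R :: "nat \<Rightarrow> real set \<Rightarrow> (real \<Rightarrow> 'a) measure" where
  "R n J = distr (Q n) (\<Pi>\<^sub>M i\<in>J. borel) (\<lambda>\<omega>. \<lambda>q\<in>J. dyadic_sum n \<omega> q)"

lemma dyadic_sum_measurable [measurable]: "(\<lambda>\<omega>. dyadic_sum n \<omega> q) \<in> (\<Pi>\<^sub>M i\<in>UNIV. borel) \<rightarrow>\<^sub>M (borel :: 'a measure)"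
  unfolding dyadic_sum_def by measurable

lemma R_Suc: "J \<subseteq> dyadic_level n \<Longrightarrow> R (Suc n) J = R n J"
proof -
  assume J: "J \<subseteq> dyadic_level n"
  have "R n J = distr (distr (Q (Suc n)) (\<Pi>\<^sub>M i\<in>UNIV. borel) pair_sum) (\<Pi>\<^sub>M i\<in>J. borel) (\<lambda>\<omega>. \<lambda>q\<in>J. dyadic_sum n \<omega> q)"
    by (simp add: R_def distr_pair_sum)
  also have "\<dots> = distr (Q (Suc n)) (\<Pi>\<^sub>M i\<in>J. borel) ((\<lambda>\<omega>. \<lambda>q\<in>J. dyadic_sum n \<omega> q) \<circ> pair_sum)"
    by (subst distr_distr) auto
  also have "\<dots> = R (Suc n) J"
    unfolding R_def using J by (intro distr_cong) (auto simp: dyadic_sum_pair subset_iff)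
  finally show ?thesis by simp
qed

lemma R_le: "n \<le> n' \<Longrightarrow> J \<subseteq> dyadic_level n \<Longrightarrow> R n' J = R n J"
proof (induction n' rule: dec_induct)
  case (step i)
  then have "J \<subseteq> dyadic_level i" using dyadic_level_mono[of n i] by auto
  then show ?case using R_Suc step by simp
qed simp

text \<open>By \<open>R_le\<close> every level containing \<open>J\<close> yields the same measure;
  the least one fixes a representative.\<close>

definition P :: "real set \<Rightarrow> (real \<Rightarrow> 'a) measure" where
  "P J = R (LEAST n. J \<subseteq> dyadic_level n) J"

lemma P_eq: "J \<subseteq> dyadic_level n \<Longrightarrow> P J = R n J"
  unfolding P_def by (rule R_le[symmetric]) (rule Least_le LeastI, assumption)+

lemma projective: "polish_projective dyadic_rats P"
proof (intro polish_projective.intro projective_family.intro)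
  fix J H :: "real set" assume H: "J \<subseteq> H" "finite H" "H \<subseteq> dyadic_rats"
  then obtain n where n: "H \<subseteq> dyadic_level n" using finite_dyadic_level by blast
  have "distr (P H) (\<Pi>\<^sub>M i\<in>J. borel) (\<lambda>f. restrict f J) = distr (Q n) (\<Pi>\<^sub>M i\<in>J. borel) ((\<lambda>f. restrict f J) \<circ> (\<lambda>\<omega>. \<lambda>q\<in>H. dyadic_sum n \<omega> q))"
    unfolding P_eq[OF n] R_def using H by (subst distr_distr) (auto intro!: measurable_restrict_subset)
  also have "\<dots> = P J"
    using H n P_eq[of J n] unfolding R_def by (auto intro!: distr_cong simp: Int_absorb1)
  finally show "P J = distr (P H) (\<Pi>\<^sub>M i\<in>J. borel) (\<lambda>f. restrict f J)" ..
next
  fix J :: "real set" assume "finite J" "J \<subseteq> dyadic_rats"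
  then obtain n where n: "J \<subseteq> dyadic_level n" using finite_dyadic_level by blast
  show "prob_space (P J)"
    unfolding P_eq[OF n] R_def by (intro prob_space.prob_space_distr prob_Q) measurable
qed

text \<open>Kolmogorov extension on the countable index set \<open>dyadic_rats\<close>. The law is
  recorded through consecutive increments at each level, the form from which independence and
  marginals are read off afterwards.\<close>

theorem dyadic_process:
  "\<exists>L :: (real \<Rightarrow> 'a) measure. prob_space L \<and> (\<forall>q\<in>dyadic_rats. (\<lambda>\<omega>. \<omega> q) \<in> borel_measurable L) \<and> (AE \<omega> in L. \<omega> 0 = 0) \<and>
    (\<forall>n N. distr L (\<Pi>\<^sub>M k\<in>{..<N}. borel) (\<lambda>\<omega>. \<lambda>k\<in>{..<N}. \<omega> (real (Suc k) / 2 ^ n) - \<omega> (real k / 2 ^ n)) = (\<Pi>\<^sub>M k\<in>{..<N}. p n))"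
proof -
  interpret pp: polish_projective dyadic_rats P by (rule projective)
  let ?L = "pp.lim"
  have sL [measurable_cong]: "sets ?L = sets (\<Pi>\<^sub>M i\<in>dyadic_rats. borel)" by simp
  have coord [measurable]: "(\<lambda>\<omega>. \<omega> q) \<in> borel_measurable ?L" if "q \<in> dyadic_rats" for q
    using that by measurable
  have rm: "(\<lambda>\<omega>. restrict \<omega> J) \<in> ?L \<rightarrow>\<^sub>M (\<Pi>\<^sub>M i\<in>J. borel)" if "J \<subseteq> dyadic_rats" for J
    by (subst measurable_cong_sets[OF sL refl]) (rule measurable_restrict_subset[OF that])
  have restr: "distr ?L (\<Pi>\<^sub>M i\<in>J. borel) (\<lambda>\<omega>. restrict \<omega> J) = P J" if J: "finite J" "J \<subseteq> dyadic_rats" for J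
  proof (rule measure_eqI)
    show "sets (distr ?L (\<Pi>\<^sub>M i\<in>J. borel) (\<lambda>\<omega>. restrict \<omega> J)) = sets (P J)"
      using pp.sets_P[OF J] by simp
    fix A assume "A \<in> sets (distr ?L (\<Pi>\<^sub>M i\<in>J. borel) (\<lambda>\<omega>. restrict \<omega> J))"
    then have A: "A \<in> sets (\<Pi>\<^sub>M i\<in>J. borel)" by simp
    have "emeasure (distr ?L (\<Pi>\<^sub>M i\<in>J. borel) (\<lambda>\<omega>. restrict \<omega> J)) A = emeasure ?L ((\<lambda>\<omega>. restrict \<omega> J) -` A \<inter> space ?L)"
      using A J by (intro emeasure_distr rm) auto
    also have "(\<lambda>\<omega>. restrict \<omega> J) -` A \<inter> space ?L = prod_emb dyadic_rats (\<lambda>_. borel) J A"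
      by (simp add: prod_emb_def space_PiM)
    also have "emeasure ?L \<dots> = emeasure (P J) A"
      using A J by (intro pp.emeasure_lim_emb) auto
    finally show "emeasure (distr ?L (\<Pi>\<^sub>M i\<in>J. borel) (\<lambda>\<omega>. restrict \<omega> J)) A = emeasure (P J) A" .
  qed
  have zero: "AE \<omega> in ?L. \<omega> 0 = 0"
  proof -
    have z: "{0} \<subseteq> dyadic_level 0" by (auto simp: dyadic_level_def intro: exI[of _ 0])
    then have zd: "{0} \<subseteq> dyadic_rats" using dyadic_level_subset by blast
    have "AE f in P {0}. f 0 = 0"
      unfolding P_eq[OF z] R_def by (subst AE_distr_iff) (auto simp: dyadic_sum_def)
    then have "AE f in distr ?L (\<Pi>\<^sub>M i\<in>{0}. borel) (\<lambda>\<omega>. restrict \<omega> {0}). f 0 = 0"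
      by (subst restr[OF _ zd]) simp_all
    then show ?thesis
      by (subst (asm) AE_distr_iff) (use zd in \<open>auto intro!: rm\<close>)
  qed
  have incr: "distr ?L (\<Pi>\<^sub>M k\<in>{..<N}. borel) (\<lambda>\<omega>. \<lambda>k\<in>{..<N}. \<omega> (real (Suc k) / 2 ^ n) - \<omega> (real k / 2 ^ n)) = (\<Pi>\<^sub>M k\<in>{..<N}. p n)" for n N
  proof -
    define J where "J = (\<lambda>k. real k / 2 ^ n) ` {..N}"
    have JD: "J \<subseteq> dyadic_level n" and J: "finite J" by (auto simp: J_def dyadic_level_def)
    then have Jd: "J \<subseteq> dyadic_rats" using dyadic_level_subset by blast
    have mem: "real k / 2 ^ n \<in> J" if "k \<le> N" for k using that by (auto simp: J_def)
    define D where "D f = (\<lambda>k\<in>{..<N}. f (real (Suc k) / 2 ^ n) - f (real k / 2 ^ n))" for f :: "real \<Rightarrow> 'a"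
    have Dm [measurable]: "D \<in> (\<Pi>\<^sub>M i\<in>J. borel) \<rightarrow>\<^sub>M (\<Pi>\<^sub>M k\<in>{..<N}. borel)"
      unfolding D_def by (intro measurable_restrict borel_measurable_diff measurable_component_singleton) (auto intro!: mem simp del: of_nat_Suc)
    have "distr ?L (\<Pi>\<^sub>M k\<in>{..<N}. borel) D = distr ?L (\<Pi>\<^sub>M k\<in>{..<N}. borel) (D \<circ> (\<lambda>\<omega>. restrict \<omega> J))"
      by (intro distr_cong) (auto simp: D_def fun_eq_iff restrict_def mem simp del: of_nat_Suc)
    also have "\<dots> = distr (distr ?L (\<Pi>\<^sub>M i\<in>J. borel) (\<lambda>\<omega>. restrict \<omega> J)) (\<Pi>\<^sub>M k\<in>{..<N}. borel) D"
      using Jd by (subst distr_distr) (auto intro!: rm)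
    also have "\<dots> = distr (R n J) (\<Pi>\<^sub>M k\<in>{..<N}. borel) D"
      using restr[OF J Jd] P_eq[OF JD] by simp
    also have "\<dots> = distr (Q n) (\<Pi>\<^sub>M k\<in>{..<N}. borel) (D \<circ> (\<lambda>\<omega>. \<lambda>q\<in>J. dyadic_sum n \<omega> q))"
      unfolding R_def by (subst distr_distr) auto
    also have "\<dots> = distr (Q n) (\<Pi>\<^sub>M k\<in>{..<N}. p n) (\<lambda>\<omega>. restrict \<omega> {..<N})"
    proof (intro distr_cong)
      fix \<omega> :: "nat \<Rightarrow> 'a"
      show "(D \<circ> (\<lambda>\<omega>. \<lambda>q\<in>J. dyadic_sum n \<omega> q)) \<omega> = restrict \<omega> {..<N}"
        using mem by (auto simp: D_def fun_eq_iff restrict_def dyadic_sum_level simp del: of_nat_Suc)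
    qed (auto intro!: sets_PiM_cong)
    also have "\<dots> = (\<Pi>\<^sub>M k\<in>{..<N}. p n)"
    proof -
      interpret product_prob_space "\<lambda>_. p n" UNIV
        by (simp add: product_prob_space_def product_prob_space_axioms_def product_sigma_finite_def prob_p prob_space_imp_sigma_finite)
      show ?thesis unfolding Q_def by (rule distr_PiM_restrict_finite) auto
    qed
    finally show ?thesis by (simp add: D_def[abs_def])
  qed
  show ?thesis
    by (intro exI[of _ ?L] conjI ballI allI coord zero incr) (simp_all add: pp.P.prob_space_axioms)
qed

end

section \<open>Cadlag regularization\<close>

text \<open>The smaller of two neighbouring increments is bounded, not each of them: a cadlag path
  may have one large increment at a jump, and what is excluded is a second one right next to
  it.\<close>

locale dyadic_modulus =
  fixes f :: "real \<Rightarrow> 'a::euclidean_space" and T n0 :: nat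
  assumes small: "\<And>n j. n \<ge> n0 \<Longrightarrow> j + 2 \<le> T * 2 ^ n \<Longrightarrow>
    min (norm (f (real (j + 1) / 2 ^ n) - f (real j / 2 ^ n)))
        (norm (f (real (j + 2) / 2 ^ n) - f (real (j + 1) / 2 ^ n))) \<le> (4/5) ^ n"
begin

text \<open>An odd grid point has two coarse neighbours, and the hypothesis makes the step to one of
  them small. The bounds by \<open>i div 2\<close> and \<open>(i + 1) div 2\<close> keep the
  rounding monotone in \<open>i\<close>.\<close>

lemma coarser_grid_point:
  assumes n: "Suc N \<ge> n0" and i: "i \<le> T * 2 ^ Suc N"
  shows "\<exists>i'. i div 2 \<le> i' \<and> i' \<le> (i + 1) div 2 \<and> norm (f (real i / 2 ^ Suc N) - f (real i' / 2 ^ N)) \<le> (4/5) ^ Suc N"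
proof (cases "even i")
  case True
  then obtain k where "i = 2 * k" by auto
  then show ?thesis by (intro exI[of _ k]) auto
next
  case False
  then obtain k where k: "i = 2 * k + 1" using oddE by blast
  have "2 * k + 2 \<le> T * 2 ^ Suc N"
  proof -
    have "2 * k + 1 \<le> 2 * (T * 2 ^ N)" using i k by simp
    then have "2 * k + 2 \<le> 2 * (T * 2 ^ N)" by presburger
    then show ?thesis by simp
  qed
  from small[OF n this]
  have *: "norm (f (real (2 * k + 1) / 2 ^ Suc N) - f (real (2 * k) / 2 ^ Suc N)) \<le> (4/5) ^ Suc N \<or>
     norm (f (real (2 * k + 2) / 2 ^ Suc N) - f (real (2 * k + 1) / 2 ^ Suc N)) \<le> (4/5) ^ Suc N"
    by linarith
  have e: "real (2 * k) / 2 ^ Suc N = real k / 2 ^ N" "real (2 * k + 2) / 2 ^ Suc N = real (k + 1) / 2 ^ N"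
    by (simp_all add: field_simps)
  from * show ?thesis
  proof
    assume "norm (f (real (2 * k + 1) / 2 ^ Suc N) - f (real (2 * k) / 2 ^ Suc N)) \<le> (4/5) ^ Suc N"
    then show ?thesis unfolding e k by (intro exI[of _ k]) auto
  next
    assume "norm (f (real (2 * k + 2) / 2 ^ Suc N) - f (real (2 * k + 1) / 2 ^ Suc N)) \<le> (4/5) ^ Suc N"
    then show ?thesis unfolding e k by (intro exI[of _ "k + 1"]) (auto simp: norm_minus_commute)
  qed
qed

text \<open>Rounding the three points to the next coarser grid preserves their order and changes
  each increment by at most 2 (4/5)^k on passing from level k to level k - 1. Summing over k from n
  + 1 to N gives 8 (4/5)^n - 8 (4/5)^N, to which level n itself adds (4/5)^n.\<close>

lemma three_point_level:
  assumes "n \<ge> n0" "n \<le> N" "a + 2 \<le> T * 2 ^ n"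
    and "a * 2 ^ (N - n) \<le> i1" "i1 \<le> i2" "i2 \<le> i3" "i3 \<le> (a + 2) * 2 ^ (N - n)"
  shows "min (norm (f (real i2 / 2 ^ N) - f (real i1 / 2 ^ N))) (norm (f (real i3 / 2 ^ N) - f (real i2 / 2 ^ N)))
    \<le> 9 * (4/5) ^ n - 8 * (4/5) ^ N"
  using assms(2) assms(1,3-)
proof (induction N arbitrary: i1 i2 i3 rule: dec_induct)
  case base
  show ?case
  \<comment> \<open>Three ordered points among a, a + 1, a + 2 are exactly these unless two
    neighbours coincide, and then the minimum is 0.\<close>
  proof (cases "i1 = i2 \<or> i2 = i3")
    case False
    then have "i1 = a" "i2 = a + 1" "i3 = a + 2" using base by auto
    then show ?thesis using small[of n a] base by (simp add: add.commute)
  qed auto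
next
  case (step N)
  have le: "(a + 2) * 2 ^ (Suc N - n) \<le> T * 2 ^ Suc N"
  proof -
    have "(a + 2) * 2 ^ (Suc N - n) \<le> T * 2 ^ n * 2 ^ (Suc N - n)"
      using step.prems by (intro mult_right_mono) auto
    also have "\<dots> = T * 2 ^ Suc N" using step.hyps by (simp add: mult.assoc power_add[symmetric])
    finally show ?thesis .
  qed
  have nN: "Suc N \<ge> n0" using step by simp
  have "\<forall>i. \<exists>i'. i \<le> T * 2 ^ Suc N \<longrightarrow>
     i div 2 \<le> i' \<and> i' \<le> (i + 1) div 2 \<and> norm (f (real i / 2 ^ Suc N) - f (real i' / 2 ^ N)) \<le> (4/5) ^ Suc N"
    using coarser_grid_point[OF nN] by blast
  then obtain m where m: "\<And>i. i \<le> T * 2 ^ Suc N \<Longrightarrow>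
     i div 2 \<le> m i \<and> m i \<le> (i + 1) div 2 \<and> norm (f (real i / 2 ^ Suc N) - f (real (m i) / 2 ^ N)) \<le> (4/5) ^ Suc N"
    by metis
  have iT: "i1 \<le> T * 2 ^ Suc N" "i2 \<le> T * 2 ^ Suc N" "i3 \<le> T * 2 ^ Suc N"
    using step.prems le by linarith+
  note M = m[OF iT(1)] m[OF iT(2)] m[OF iT(3)]
  have mono: "m i \<le> m j" if "i \<le> j" "j \<le> T * 2 ^ Suc N" for i j
  proof (cases "i = j")
    case False
    then have "(i + 1) div 2 \<le> j div 2" using that by (intro div_le_mono) simp
    then show ?thesis using m[of i] m[of j] that by linarith
  qed simp
  have s: "(2::nat) ^ (Suc N - n) = 2 * 2 ^ (N - n)" using step.hyps by (simp add: Suc_diff_le)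
  have "a * 2 ^ (N - n) \<le> m i1"
  proof -
    have "a * 2 ^ (N - n) = (a * 2 ^ (Suc N - n)) div 2" by (simp add: s)
    also have "\<dots> \<le> i1 div 2" using step.prems by (intro div_le_mono) simp
    also have "\<dots> \<le> m i1" using M by simp
    finally show ?thesis .
  qed
  moreover have "m i3 \<le> (a + 2) * 2 ^ (N - n)"
  proof -
    have "m i3 \<le> (i3 + 1) div 2" using M by simp
    also have "\<dots> \<le> ((a + 2) * 2 ^ (Suc N - n) + 1) div 2" using step.prems by (intro div_le_mono) simp
    also have "\<dots> = (a + 2) * 2 ^ (N - n)" by (simp add: s)
    finally show ?thesis .
  qed
  ultimately have "min (norm (f (real (m i2) / 2 ^ N) - f (real (m i1) / 2 ^ N))) (norm (f (real (m i3) / 2 ^ N) - f (real (m i2) / 2 ^ N)))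
    \<le> 9 * (4/5) ^ n - 8 * (4/5) ^ N"
    using step.IH[of "m i1" "m i2" "m i3"] step.prems iT mono[of i1 i2] mono[of i2 i3] by simp
  moreover have "norm (f (real i2 / 2 ^ Suc N) - f (real i1 / 2 ^ Suc N)) \<le> norm (f (real (m i2) / 2 ^ N) - f (real (m i1) / 2 ^ N)) + 2 * (4/5) ^ Suc N"
    using norm_triangle_ineq[of "f (real (m i2) / 2 ^ N) - f (real (m i1) / 2 ^ N)" "(f (real i2 / 2 ^ Suc N) - f (real (m i2) / 2 ^ N)) - (f (real i1 / 2 ^ Suc N) - f (real (m i1) / 2 ^ N))"]
      norm_triangle_ineq4[of "f (real i2 / 2 ^ Suc N) - f (real (m i2) / 2 ^ N)" "f (real i1 / 2 ^ Suc N) - f (real (m i1) / 2 ^ N)"] M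
    by (simp add: algebra_simps)
  moreover have "norm (f (real i3 / 2 ^ Suc N) - f (real i2 / 2 ^ Suc N)) \<le> norm (f (real (m i3) / 2 ^ N) - f (real (m i2) / 2 ^ N)) + 2 * (4/5) ^ Suc N"
    using norm_triangle_ineq[of "f (real (m i3) / 2 ^ N) - f (real (m i2) / 2 ^ N)" "(f (real i3 / 2 ^ Suc N) - f (real (m i3) / 2 ^ N)) - (f (real i2 / 2 ^ Suc N) - f (real (m i2) / 2 ^ N))"]
      norm_triangle_ineq4[of "f (real i3 / 2 ^ Suc N) - f (real (m i3) / 2 ^ N)" "f (real i2 / 2 ^ Suc N) - f (real (m i2) / 2 ^ N)"] M
    by (simp add: algebra_simps)
  moreover have "(4/5::real) ^ Suc N = (4/5) * (4/5) ^ N" by simp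
  ultimately show ?case by linarith
qed

end

section \<open>From the three-point condition to one-sided limits\<close>

text \<open>Says that the modulus usually written w'' in the theory of Skorokhod space tends to 0 on
  \<open>S\<close>.\<close>

definition three_point :: "real set \<Rightarrow> (real \<Rightarrow> 'a::real_normed_vector) \<Rightarrow> bool" where
  "three_point S f \<longleftrightarrow> (\<forall>\<eta>>0. \<exists>\<delta>>0. \<forall>q1\<in>S. \<forall>q2\<in>S. \<forall>q3\<in>S. q1 \<le> q2 \<longrightarrow> q2 \<le> q3 \<longrightarrow> q3 - q1 < \<delta> \<longrightarrow>
     min (norm (f q2 - f q1)) (norm (f q3 - f q2)) \<le> \<eta>)"

lemma (in dyadic_modulus) three_point_dyadics:
  assumes T: "T \<ge> T' + 2"
  shows "three_point (dyadic_rats \<inter> {0..real T'}) f"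
  unfolding three_point_def
proof (intro allI impI)
  fix \<eta> :: real assume \<eta>: "\<eta> > 0"
  have "(\<lambda>n. 9 * (4/5::real) ^ n) \<longlonglongrightarrow> 9 * 0" by (intro tendsto_mult tendsto_const LIMSEQ_realpow_zero) auto
  then have "\<forall>\<^sub>F n in sequentially. 9 * (4/5::real) ^ n < \<eta>" using \<eta> by (intro order_tendstoD) auto
  then have "\<exists>n. n \<ge> n0 \<and> 9 * (4/5::real) ^ n < \<eta>"
    using eventually_happens'[OF sequentially_bot eventually_conj[OF eventually_ge_at_top[of n0]]] by blast
  then obtain n where n: "n \<ge> n0" "9 * (4/5::real) ^ n < \<eta>" by blast
  show "\<exists>\<delta>>0. \<forall>q1\<in>dyadic_rats \<inter> {0..real T'}. \<forall>q2\<in>dyadic_rats \<inter> {0..real T'}. \<forall>q3\<in>dyadic_rats \<inter> {0..real T'}.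
     q1 \<le> q2 \<longrightarrow> q2 \<le> q3 \<longrightarrow> q3 - q1 < \<delta> \<longrightarrow> min (norm (f q2 - f q1)) (norm (f q3 - f q2)) \<le> \<eta>"
  proof (intro exI[of _ "1 / 2 ^ n"] conjI ballI impI)
    fix q1 q2 q3 assume q: "q1 \<in> dyadic_rats \<inter> {0..real T'}" "q2 \<in> dyadic_rats \<inter> {0..real T'}" "q3 \<in> dyadic_rats \<inter> {0..real T'}"
      and le: "q1 \<le> q2" "q2 \<le> q3" and d: "q3 - q1 < 1 / 2 ^ n"
    obtain N0 where "{q1, q2, q3} \<subseteq> dyadic_level N0" using finite_dyadic_level[of "{q1,q2,q3}"] q by auto
    then have "{q1, q2, q3} \<subseteq> dyadic_level (max N0 n)" using dyadic_level_mono[of N0 "max N0 n"] by auto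
    then obtain N i1 i2 i3 where N: "N \<ge> n" and i: "q1 = real i1 / 2 ^ N" "q2 = real i2 / 2 ^ N" "q3 = real i3 / 2 ^ N"
      by (auto simp: dyadic_level_def intro: that[of "max N0 n"])
    \<comment> \<open>The level-n cell that contains \<open>q1\<close>. As q3 - q1 < 2^-n, all three
      points lie in the two cells starting there.\<close>
    define a where "a = i1 div 2 ^ (N - n)"
    have p: "(2::real) ^ N = 2 ^ n * 2 ^ (N - n)" using N by (simp add: power_add[symmetric])
    have ile: "i1 \<le> i2" "i2 \<le> i3" using le unfolding i by (auto simp: divide_le_cancel)
    have "real i3 - real i1 < 2 ^ (N - n)"
    proof -
      have "real i3 - real i1 = (q3 - q1) * 2 ^ N" unfolding i by (simp add: field_simps)
      also have "\<dots> < 1 / 2 ^ n * 2 ^ N" using d by (intro mult_strict_right_mono) auto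
      also have "\<dots> = 2 ^ (N - n)" unfolding p by simp
      finally show ?thesis .
    qed
    then have "real i3 < real (i1 + 2 ^ (N - n))" by simp
    then have i3: "i3 < i1 + 2 ^ (N - n)" by (simp only: of_nat_less_iff)
    have a1: "a * 2 ^ (N - n) \<le> i1" "i1 < (a + 1) * 2 ^ (N - n)"
      unfolding a_def using div_times_less_eq_dividend[of i1 "2 ^ (N - n)"] dividend_less_div_times[of "2 ^ (N - n)" i1] by auto
    have a3: "i3 \<le> (a + 2) * 2 ^ (N - n)" using i3 a1 by (simp add: algebra_simps)
    \<comment> \<open>The cell index can be as large as T' 2^n; the margin of 2 in the horizon
      leaves room for the two cells.\<close>
    have "a + 2 \<le> T * 2 ^ n"
    proof -
      have "real i1 \<le> real T' * 2 ^ N" using q(1) unfolding i by (simp add: field_simps)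
      moreover have "real (a * 2 ^ (N - n)) \<le> real i1" using a1(1) by (simp only: of_nat_le_iff)
      ultimately have "real a * 2 ^ (N - n) \<le> real T' * 2 ^ n * 2 ^ (N - n)"
        unfolding p of_nat_mult of_nat_power of_nat_numeral mult.assoc by linarith
      then have "real a \<le> real T' * 2 ^ n" by simp
      then have "real a \<le> real (T' * 2 ^ n)" by simp
      then have "a \<le> T' * 2 ^ n" by (simp only: of_nat_le_iff)
      moreover have "(T' + 2) * 2 ^ n \<le> T * 2 ^ n" using T by (intro mult_right_mono) auto
      moreover have "(1::nat) \<le> 2 ^ n" by simp
      ultimately show ?thesis by (simp only: distrib_right)
    qed
    from three_point_level[OF n(1) N this a1(1) ile a3]
    have "min (norm (f q2 - f q1)) (norm (f q3 - f q2)) \<le> 9 * (4/5) ^ n - 8 * (4/5) ^ N"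
      unfolding i .
    also have "\<dots> \<le> \<eta>" using n(2) zero_less_power[of "4/5::real" N] by linarith
    finally show "min (norm (f q2 - f q1)) (norm (f q3 - f q2)) \<le> \<eta>" .
  qed auto
qed

text \<open>If the claim fails, two pairs with large oscillation can be placed at q3 < q4 < q1 < q2
  to the right of \<open>t\<close> and within \<delta>. The oscillation of the first pair forces
  \<open>f q1\<close> and \<open>f q2\<close> to lie near \<open>f q4\<close>, against the
  oscillation of the second.\<close>

lemma three_point_right_cauchy:
  assumes "three_point S f" "\<eta> > 0"
  shows "\<exists>\<rho>>0. \<forall>q\<in>S \<inter> {t<..<t + \<rho>}. \<forall>q'\<in>S \<inter> {t<..<t + \<rho>}. norm (f q - f q') \<le> 2 * \<eta>"
proof (rule ccontr)
  assume "\<not> ?thesis"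
  then have neg: "\<exists>q\<in>S \<inter> {t<..<t + \<rho>}. \<exists>q'\<in>S \<inter> {t<..<t + \<rho>}. norm (f q - f q') > 2 * \<eta>" if "\<rho> > 0" for \<rho>
    using that by (metis not_less)
  have ex: "\<exists>q\<in>S \<inter> {t<..<t + \<rho>}. \<exists>q'\<in>S \<inter> {t<..<t + \<rho>}. q < q' \<and> norm (f q' - f q) > 2 * \<eta>" if \<rho>: "\<rho> > 0" for \<rho>
  proof -
    obtain q q' where q: "q \<in> S \<inter> {t<..<t + \<rho>}" "q' \<in> S \<inter> {t<..<t + \<rho>}" "norm (f q - f q') > 2 * \<eta>"
      using neg[OF \<rho>] by blast
    then have "q \<noteq> q'" using assms by auto
    then have "q < q' \<or> q' < q" by auto
    then show ?thesis
    proof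
      assume "q < q'"
      then show ?thesis using q by (intro bexI[of _ q] bexI[of _ q']) (simp_all add: norm_minus_commute)
    next
      assume "q' < q"
      then show ?thesis using q by (intro bexI[of _ q'] bexI[of _ q]) simp_all
    qed
  qed
  from assms obtain \<delta> where \<delta>: "\<delta> > 0" and tp: "\<forall>q1\<in>S. \<forall>q2\<in>S. \<forall>q3\<in>S. q1 \<le> q2 \<longrightarrow> q2 \<le> q3 \<longrightarrow> q3 - q1 < \<delta> \<longrightarrow>
     min (norm (f q2 - f q1)) (norm (f q3 - f q2)) \<le> \<eta>"
    unfolding three_point_def by meson
  from ex[OF \<delta>] obtain q1 q2 where q0: "q1 \<in> S \<inter> {t<..<t + \<delta>}" "q2 \<in> S \<inter> {t<..<t + \<delta>}"
    and q12: "q1 < q2" "norm (f q2 - f q1) > 2 * \<eta>"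
    by blast
  then have q: "q1 \<in> S" "q2 \<in> S" "t < q1" "q2 < t + \<delta>" by simp_all
  then have "q1 - t > 0" by simp
  from ex[OF this] obtain q3 q4 where "q3 \<in> S \<inter> {t<..<t + (q1 - t)}" "q4 \<in> S \<inter> {t<..<t + (q1 - t)}"
    and q34: "q3 < q4" "norm (f q4 - f q3) > 2 * \<eta>"
    by blast
  then have q': "q3 \<in> S" "q4 \<in> S" "t < q3" "q4 < q1" by simp_all
  have "min (norm (f q4 - f q3)) (norm (f q1 - f q4)) \<le> \<eta>" "min (norm (f q4 - f q3)) (norm (f q2 - f q4)) \<le> \<eta>"
    using q q' q12(1) q34(1) by (auto intro!: tp[rule_format])
  then have "norm (f q1 - f q4) \<le> \<eta>" "norm (f q2 - f q4) \<le> \<eta>"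
    using q34(2) assms(2) by linarith+
  moreover have "norm (f q2 - f q1) \<le> norm (f q2 - f q4) + norm (f q1 - f q4)"
    using norm_triangle_ineq4[of "f q2 - f q4" "f q1 - f q4"] by simp
  ultimately show False
    using q12(2) by linarith
qed

text \<open>The three-point condition is invariant under time reversal.\<close>

lemma three_point_left_cauchy:
  assumes "three_point S f" "\<eta> > 0"
  shows "\<exists>\<rho>>0. \<forall>q\<in>S \<inter> {t - \<rho><..<t}. \<forall>q'\<in>S \<inter> {t - \<rho><..<t}. norm (f q - f q') \<le> 2 * \<eta>"
proof -
  have "three_point (uminus ` S) (\<lambda>q. f (- q))"
    unfolding three_point_def
  proof (intro allI impI)
    fix \<eta> :: real assume "\<eta> > 0"
    with assms(1) obtain \<delta> where \<delta>: "\<delta> > 0" and tp: "\<forall>q1\<in>S. \<forall>q2\<in>S. \<forall>q3\<in>S. q1 \<le> q2 \<longrightarrow> q2 \<le> q3 \<longrightarrow> q3 - q1 < \<delta> \<longrightarrow>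
       min (norm (f q2 - f q1)) (norm (f q3 - f q2)) \<le> \<eta>"
      unfolding three_point_def by meson
    show "\<exists>\<delta>>0. \<forall>q1\<in>uminus ` S. \<forall>q2\<in>uminus ` S. \<forall>q3\<in>uminus ` S. q1 \<le> q2 \<longrightarrow> q2 \<le> q3 \<longrightarrow> q3 - q1 < \<delta> \<longrightarrow>
       min (norm (f (- q2) - f (- q1))) (norm (f (- q3) - f (- q2))) \<le> \<eta>"
    proof (intro exI[of _ \<delta>] conjI ballI impI \<delta>)
      fix q1 q2 q3 assume "q1 \<in> uminus ` S" "q2 \<in> uminus ` S" "q3 \<in> uminus ` S" "q1 \<le> q2" "q2 \<le> q3" "q3 - q1 < \<delta>"
      then have "min (norm (f (- q2) - f (- q3))) (norm (f (- q1) - f (- q2))) \<le> \<eta>"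
        by (intro tp[rule_format]) auto
      then show "min (norm (f (- q2) - f (- q1))) (norm (f (- q3) - f (- q2))) \<le> \<eta>"
        by (simp only: norm_minus_commute min.commute)
    qed
  qed
  from three_point_right_cauchy[OF this assms(2), of "- t"]
  obtain \<rho> where \<rho>: "\<rho> > 0" "\<And>q q'. q \<in> uminus ` S \<inter> {- t<..<- t + \<rho>} \<Longrightarrow> q' \<in> uminus ` S \<inter> {- t<..<- t + \<rho>} \<Longrightarrow> norm (f (- q) - f (- q')) \<le> 2 * \<eta>"
    by blast
  show ?thesis
  proof (intro exI[of _ \<rho>] conjI ballI \<rho>(1))
    fix q q' assume "q \<in> S \<inter> {t - \<rho><..<t}" "q' \<in> S \<inter> {t - \<rho><..<t}"
    then show "norm (f q - f q') \<le> 2 * \<eta>" using \<rho>(2)[of "- q" "- q'"] by auto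
  qed
qed

text \<open>Strictly above \<open>t\<close> even when \<open>t\<close> is itself dyadic, so that
  limits along it are right limits.\<close>

definition dyadic_above :: "nat \<Rightarrow> real \<Rightarrow> real" where
  "dyadic_above n t = (real (nat \<lfloor>t * 2 ^ n\<rfloor>) + 1) / 2 ^ n"

lemma dyadic_above_in: "dyadic_above n t \<in> dyadic_rats"
  unfolding dyadic_above_def dyadic_rats_def by (rule CollectI) (metis of_nat_Suc add.commute)

lemma dyadic_above_bounds:
  assumes "t \<ge> 0" shows "t < dyadic_above n t" "dyadic_above n t \<le> t + 1 / 2 ^ n"
proof -
  have n: "real (nat \<lfloor>t * 2 ^ n\<rfloor>) = real_of_int \<lfloor>t * 2 ^ n\<rfloor>" using assms by simp
  have "t * 2 ^ n < real_of_int \<lfloor>t * 2 ^ n\<rfloor> + 1" "real_of_int \<lfloor>t * 2 ^ n\<rfloor> \<le> t * 2 ^ n" by linarith+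
  then show "t < dyadic_above n t" "dyadic_above n t \<le> t + 1 / 2 ^ n"
    unfolding dyadic_above_def n by (auto simp: field_simps)
qed

lemma dyadic_above_tendsto:
  assumes "t \<ge> 0" shows "(\<lambda>n. dyadic_above n t) \<longlonglongrightarrow> t"
proof (rule tendsto_sandwich[of "\<lambda>_. t" _ _ "\<lambda>n. t + 1 / 2 ^ n"])
  show "(\<lambda>n. t + 1 / 2 ^ n) \<longlonglongrightarrow> t" using tendsto_add[OF tendsto_const LIMSEQ_inverse_realpow_zero[of 2], of t] by (simp add: inverse_eq_divide)
qed (use dyadic_above_bounds[OF assms] in \<open>auto intro!: always_eventually less_imp_le\<close>)

lemma dyadic_above_eventually:
  assumes "t \<ge> 0" "t < b" shows "\<forall>\<^sub>F n in sequentially. dyadic_above n t \<in> {t<..<b}"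
  using order_tendstoD(2)[OF dyadic_above_tendsto[OF assms(1)] assms(2)]
  by eventually_elim (use dyadic_above_bounds(1)[OF assms(1)] in auto)

definition regularize :: "(real \<Rightarrow> 'a::euclidean_space) \<Rightarrow> real \<Rightarrow> 'a" where
  "regularize f t = (if t < 0 then 0 else lim (\<lambda>n. f (dyadic_above n t)))"

text \<open>The second assumption is the right limit at 0, since \<open>dyadic_above n 0\<close> is
  2^-n; it makes the modified path start at 0.\<close>

locale regularizable =
  fixes f :: "real \<Rightarrow> 'a::euclidean_space"
  assumes tp: "\<And>T :: nat. three_point (dyadic_rats \<inter> {0..real T}) f"
    and zero: "(\<lambda>n. f (1 / 2 ^ n)) \<longlonglongrightarrow> 0"
begin

lemma right_cauchy:
  assumes t: "t \<ge> 0" and \<eta>: "\<eta> > 0"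
  shows "\<exists>\<rho>>0. \<forall>q\<in>dyadic_rats \<inter> {t<..<t + \<rho>}. \<forall>q'\<in>dyadic_rats \<inter> {t<..<t + \<rho>}. norm (f q - f q') \<le> \<eta>"
proof -
  obtain T :: nat where T: "t < real T" using reals_Archimedean2 by blast
  obtain \<rho> where \<rho>: "\<rho> > 0" "\<forall>q\<in>(dyadic_rats \<inter> {0..real T}) \<inter> {t<..<t + \<rho>}. \<forall>q'\<in>(dyadic_rats \<inter> {0..real T}) \<inter> {t<..<t + \<rho>}. norm (f q - f q') \<le> 2 * (\<eta>/2)"
    using three_point_right_cauchy[OF tp[of T], of "\<eta>/2" t] \<eta> by auto
  show ?thesis
  proof (intro exI[of _ "min \<rho> (real T - t)"] conjI ballI)
    fix q q' assume "q \<in> dyadic_rats \<inter> {t<..<t + min \<rho> (real T - t)}" "q' \<in> dyadic_rats \<inter> {t<..<t + min \<rho> (real T - t)}"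
    then have "q \<in> (dyadic_rats \<inter> {0..real T}) \<inter> {t<..<t + \<rho>}" "q' \<in> (dyadic_rats \<inter> {0..real T}) \<inter> {t<..<t + \<rho>}"
      using t by auto
    then have "norm (f q - f q') \<le> 2 * (\<eta>/2)" using \<rho>(2) by blast
    then show "norm (f q - f q') \<le> \<eta>" by simp
  qed (use \<rho> T in auto)
qed

lemma left_cauchy:
  assumes t: "t > 0" and \<eta>: "\<eta> > 0"
  shows "\<exists>\<rho>>0. \<rho> \<le> t \<and> (\<forall>q\<in>dyadic_rats \<inter> {t - \<rho><..<t}. \<forall>q'\<in>dyadic_rats \<inter> {t - \<rho><..<t}. norm (f q - f q') \<le> \<eta>)"
proof -
  obtain T :: nat where T: "t < real T" using reals_Archimedean2 by blast
  obtain \<rho> where \<rho>: "\<rho> > 0" "\<forall>q\<in>(dyadic_rats \<inter> {0..real T}) \<inter> {t - \<rho><..<t}. \<forall>q'\<in>(dyadic_rats \<inter> {0..real T}) \<inter> {t - \<rho><..<t}. norm (f q - f q') \<le> 2 * (\<eta>/2)"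
    using three_point_left_cauchy[OF tp[of T], of "\<eta>/2" t] \<eta> by auto
  show ?thesis
  proof (intro exI[of _ "min \<rho> t"] conjI ballI)
    fix q q' assume "q \<in> dyadic_rats \<inter> {t - min \<rho> t<..<t}" "q' \<in> dyadic_rats \<inter> {t - min \<rho> t<..<t}"
    then have "q \<in> (dyadic_rats \<inter> {0..real T}) \<inter> {t - \<rho><..<t}" "q' \<in> (dyadic_rats \<inter> {0..real T}) \<inter> {t - \<rho><..<t}"
      using T by auto
    then have "norm (f q - f q') \<le> 2 * (\<eta>/2)" using \<rho>(2) by blast
    then show "norm (f q - f q') \<le> \<eta>" by simp
  qed (use \<rho> t in auto)
qed

lemma regularize_lim:
  assumes t: "t \<ge> 0" shows "(\<lambda>n. f (dyadic_above n t)) \<longlonglongrightarrow> regularize f t"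
proof -
  have "Cauchy (\<lambda>n. f (dyadic_above n t))"
  proof (rule metric_CauchyI)
    fix e :: real assume e: "e > 0"
    obtain \<rho> where \<rho>: "\<rho> > 0" "\<forall>q\<in>dyadic_rats \<inter> {t<..<t + \<rho>}. \<forall>q'\<in>dyadic_rats \<inter> {t<..<t + \<rho>}. norm (f q - f q') \<le> e/2"
      using right_cauchy[OF t, of "e/2"] e by auto
    obtain M where M: "\<And>n. n \<ge> M \<Longrightarrow> dyadic_above n t \<in> {t<..<t + \<rho>}"
      using dyadic_above_eventually[OF t, of "t + \<rho>"] \<rho> by (auto simp: eventually_sequentially)
    show "\<exists>M. \<forall>m\<ge>M. \<forall>n\<ge>M. dist (f (dyadic_above m t)) (f (dyadic_above n t)) < e"
    proof (intro exI[of _ M] allI impI)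
      fix m n assume "M \<le> m" "M \<le> n"
      then have "norm (f (dyadic_above m t) - f (dyadic_above n t)) \<le> e/2"
        using \<rho>(2) M dyadic_above_in by blast
      then show "dist (f (dyadic_above m t)) (f (dyadic_above n t)) < e" using e by (simp add: dist_norm)
    qed
  qed
  then show ?thesis using t by (auto simp: regularize_def Cauchy_convergent_iff convergent_LIMSEQ_iff)
qed

lemma regularize_close:
  assumes "\<forall>q\<in>dyadic_rats \<inter> {a<..<b}. \<forall>q'\<in>dyadic_rats \<inter> {a<..<b}. norm (f q - f q') \<le> \<eta>"
    and s: "a \<le> s" "s < b" "0 \<le> s" and u: "a \<le> u" "u < b" "0 \<le> u"
  shows "norm (regularize f s - regularize f u) \<le> \<eta>"
proof (rule Lim_norm_ubound)
  show "(\<lambda>n. f (dyadic_above n s) - f (dyadic_above n u)) \<longlonglongrightarrow> regularize f s - regularize f u"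
    using s u by (intro tendsto_diff regularize_lim)
  show "\<forall>\<^sub>F n in sequentially. norm (f (dyadic_above n s) - f (dyadic_above n u)) \<le> \<eta>"
    using dyadic_above_eventually[OF s(3,2)] dyadic_above_eventually[OF u(3,2)]
  proof eventually_elim
    case (elim n)
    then show ?case using assms(1) s u dyadic_above_in by auto
  qed
qed simp

lemma regularize_D0: "regularize f \<in> D0"
  unfolding D0_def
proof (intro CollectI conjI allI impI)
  have "dyadic_above n 0 = 1 / 2 ^ n" for n by (simp add: dyadic_above_def)
  then show "regularize f 0 = 0" using regularize_lim[of 0] zero LIMSEQ_unique by fastforce
  fix t :: real
  show "regularize f t = 0" if "t < 0" using that by (simp add: regularize_def)
  show "continuous (at_right t) (regularize f)" if t: "0 \<le> t"
    unfolding continuous_within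
  proof (rule tendstoI)
    fix e :: real assume e: "e > 0"
    obtain \<rho> where \<rho>: "\<rho> > 0" "\<forall>q\<in>dyadic_rats \<inter> {t<..<t + \<rho>}. \<forall>q'\<in>dyadic_rats \<inter> {t<..<t + \<rho>}. norm (f q - f q') \<le> e/2"
      using right_cauchy[OF t, of "e/2"] e by auto
    have "\<forall>\<^sub>F u in at_right t. u \<in> {t<..<t + \<rho>}" using \<rho> by (intro eventually_at_right_real) auto
    then show "\<forall>\<^sub>F u in at_right t. dist (regularize f u) (regularize f t) < e"
    proof eventually_elim
      case (elim u)
      then show ?case using regularize_close[OF \<rho>(2), of u t] e t by (auto simp: dist_norm)
    qed
  qed
  show "\<exists>l. (regularize f \<longlongrightarrow> l) (at_left t)" if t: "0 < t"
  proof -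
    \<comment> \<open>A sequence in [0, t) tending to \<open>t\<close>, which singles out the
      candidate for the left limit; the Cauchy property then extends the convergence to all
      approaches from the left.\<close>
    define s where "s n = t - t / real (n + 2)" for n
    have sl: "s \<longlonglongrightarrow> t"
    proof -
      have "(\<lambda>n. t - t * inverse (real (Suc (n + 1)))) \<longlonglongrightarrow> t - t * 0"
        by (intro tendsto_diff tendsto_const tendsto_mult LIMSEQ_ignore_initial_segment[OF LIMSEQ_inverse_real_of_nat])
      then show ?thesis unfolding s_def[abs_def] by (simp add: divide_inverse)
    qed
    have s0: "0 \<le> s n" "s n < t" for n using t by (auto simp: s_def field_simps)
    have cl: "\<exists>\<rho>>0. \<rho> \<le> t \<and> (\<forall>u\<in>{t - \<rho>..<t}. \<forall>v\<in>{t - \<rho>..<t}. norm (regularize f u - regularize f v) \<le> \<eta>)" if "\<eta> > 0" for \<eta>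
    proof -
      obtain \<rho> where "\<rho> > 0" "\<rho> \<le> t" "\<forall>q\<in>dyadic_rats \<inter> {t - \<rho><..<t}. \<forall>q'\<in>dyadic_rats \<inter> {t - \<rho><..<t}. norm (f q - f q') \<le> \<eta>"
        using left_cauchy[OF t \<open>\<eta> > 0\<close>] by auto
      then show ?thesis using regularize_close by (intro exI[of _ \<rho>]) auto
    qed
    have ev: "\<forall>\<^sub>F n in sequentially. s n \<in> {t - \<rho>..<t}" if "\<rho> > 0" for \<rho>
    proof -
      have "\<forall>\<^sub>F n in sequentially. t - \<rho> < s n" using that by (intro order_tendstoD(1)[OF sl]) simp
      then show ?thesis by eventually_elim (use s0 in auto)
    qed
    have "Cauchy (\<lambda>n. regularize f (s n))"
    proof (rule metric_CauchyI)
      fix e :: real assume e: "e > 0"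
      obtain \<rho> where \<rho>: "\<rho> > 0" "\<forall>u\<in>{t - \<rho>..<t}. \<forall>v\<in>{t - \<rho>..<t}. norm (regularize f u - regularize f v) \<le> e/2"
        using cl[of "e/2"] e by auto
      obtain M where "\<And>n. n \<ge> M \<Longrightarrow> s n \<in> {t - \<rho>..<t}" using ev[OF \<rho>(1)] by (auto simp: eventually_sequentially)
      then have "\<forall>m\<ge>M. \<forall>n\<ge>M. norm (regularize f (s m) - regularize f (s n)) \<le> e/2"
        using \<rho>(2) by blast
      then show "\<exists>M. \<forall>m\<ge>M. \<forall>n\<ge>M. dist (regularize f (s m)) (regularize f (s n)) < e"
        using e by (intro exI[of _ M]) (fastforce simp: dist_norm)
    qed
    then obtain l where l: "(\<lambda>n. regularize f (s n)) \<longlonglongrightarrow> l" using Cauchy_convergent_iff convergent_def by blast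
    have "(regularize f \<longlongrightarrow> l) (at_left t)"
    proof (rule tendstoI)
      fix e :: real assume e: "e > 0"
      obtain \<rho> where \<rho>: "\<rho> > 0" "\<forall>u\<in>{t - \<rho>..<t}. \<forall>v\<in>{t - \<rho>..<t}. norm (regularize f u - regularize f v) \<le> e/2"
        using cl[of "e/2"] e by auto
      have "\<forall>\<^sub>F u in at_left t. u \<in> {t - \<rho><..<t}" using \<rho> by (intro eventually_at_left_real) auto
      then show "\<forall>\<^sub>F u in at_left t. dist (regularize f u) l < e"
      proof eventually_elim
        case (elim u)
        have "norm (regularize f u - l) \<le> e/2"
        proof (rule Lim_norm_ubound)
          show "(\<lambda>n. regularize f u - regularize f (s n)) \<longlonglongrightarrow> regularize f u - l" by (intro tendsto_diff tendsto_const l)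
          show "\<forall>\<^sub>F n in sequentially. norm (regularize f u - regularize f (s n)) \<le> e/2"
            using ev[OF \<rho>(1)] by eventually_elim (use \<rho>(2) elim in auto)
        qed simp
        then show ?case using e by (simp add: dist_norm)
      qed
    qed
    then show ?thesis by blast
  qed
qed

end

section \<open>Second moment of the Levy density\<close>

text \<open>The function u^p exp(-u) attains its maximum at u = p.\<close>

lemma exp_minus_le_powr:
  assumes "p > 0" "u > (0::real)"
  shows "exp (- u) \<le> (exp (- p) * p powr p) * u powr (- p)"
proof -
  have "ln (u / p) \<le> u / p - 1" using assms by (intro ln_le_minus_one) auto
  then have "p * ln (u / p) \<le> p * (u / p - 1)" using assms by (intro mult_left_mono) auto
  then have "p * ln u - p * ln p \<le> u - p" using assms by (simp add: ln_div right_diff_distrib)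
  then have "- u \<le> - p + p * ln p + - p * ln u" by linarith
  then have "exp (- u) \<le> exp (- p + p * ln p + - p * ln u)" by simp
  also have "\<dots> = (exp (- p) * p powr p) * u powr (- p)" using assms by (simp only: exp_add powr_def) simp
  finally show ?thesis .
qed

lemma integrable_exp_half: "integrable lborel (\<lambda>s::real. indicator {0..} s * exp (- s / 2))"
proof -
  have "has_bochner_integral lborel (\<lambda>x::real. x ^ 0 * exp (- x) * indicator {0..} x) (fact 0)"
    by (rule has_bochner_integral_I0i_power_exp_m')
  then have "integrable lborel (\<lambda>x::real. exp (- x) * indicator {0..} x)" by (simp add: has_bochner_integral_iff)
  then have "integrable lborel (\<lambda>x::real. exp (- (0 + (1/2) * x)) * indicator {0..} (0 + (1/2) * x))"
    by (rule lborel_integrable_real_affine) simp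
  then show ?thesis by (rule Bochner_Integration.integrable_cong[THEN iffD1, rotated 2]) (auto simp: indicator_def)
qed

text \<open>The power exceeds the order \<nu> of the singularity by 1/2. Bounding exp(-z cosh s) by
  the power -(\<nu> + 1/2) of z exp(s)/2 leaves the integrable factor exp(-s/2), and the loss is
  affordable because the second moment of the density still converges at 0.\<close>

lemma besselK_bound:
  assumes \<nu>: "\<nu> > 0"
  shows "\<exists>C\<ge>0. \<forall>z>0. besselK \<nu> z \<le> C * z powr (- (\<nu> + 1/2))"
proof -
  define p where "p = \<nu> + 1/2"
  define c where "c = exp (- p) * p powr p"
  define J where "J = (\<integral>s. indicator {0..} s * exp (- s / 2) \<partial>(lborel :: real measure))"
  have p: "p > 0" using \<nu> by (simp add: p_def)
  have J0: "0 \<le> J" unfolding J_def by simp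
  have c0: "0 \<le> c" by (simp add: c_def)
  have "besselK \<nu> z \<le> (c * 2 powr p * J) * z powr (- p)" if z: "z > 0" for z
  proof -
    have "besselK \<nu> z = (\<integral>s. indicator {0..} s *\<^sub>R (exp (- z * cosh s) * cosh (\<nu> * s)) \<partial>lborel)"
      by (simp add: besselK_def set_lebesgue_integral_def)
    also have "\<dots> \<le> (\<integral>s. (c * 2 powr p * z powr (- p)) * (indicator {0..} s * exp (- s / 2)) \<partial>lborel)"
    proof (rule integral_mono')
      show "integrable lborel (\<lambda>s. (c * 2 powr p * z powr (- p)) * (indicator {0..} s * exp (- s / 2)))"
        by (intro integrable_mult_right integrable_exp_half)
      fix s :: real
      show "0 \<le> (c * 2 powr p * z powr (- p)) * (indicator {0..} s * exp (- s / 2))"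
        using c0 by simp
      show "indicator {0..} s *\<^sub>R (exp (- z * cosh s) * cosh (\<nu> * s)) \<le> (c * 2 powr p * z powr (- p)) * (indicator {0..} s * exp (- s / 2))"
      proof (cases "s \<ge> 0")
        case True
        have ch: "exp s / 2 \<le> cosh s" by (simp add: cosh_def)
        have "exp (- z * cosh s) \<le> exp (- (z * (exp s / 2)))" using z ch by simp
        also have "\<dots> \<le> c * (z * (exp s / 2)) powr (- p)"
          unfolding c_def using z p by (intro exp_minus_le_powr) auto
        also have "(z * (exp s / 2)) powr (- p) = z powr (- p) * (exp (- p * s) * 2 powr p)"
          using z by (simp add: powr_mult powr_divide powr_minus exp_powr_real divide_simps exp_minus)
        finally have 1: "exp (- z * cosh s) \<le> c * (z powr (- p) * (exp (- p * s) * 2 powr p))" .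
        have "exp (- (\<nu> * s)) \<le> exp (\<nu> * s)" using \<nu> True by simp
        then have 2: "cosh (\<nu> * s) \<le> exp (\<nu> * s)" by (simp add: cosh_def)
        have "exp (- z * cosh s) * cosh (\<nu> * s) \<le> c * (z powr (- p) * (exp (- p * s) * 2 powr p)) * exp (\<nu> * s)"
          using c0 by (intro mult_mono 1 2) auto
        also have "\<dots> = (c * 2 powr p * z powr (- p)) * (exp (- p * s) * exp (\<nu> * s))" by (simp add: mult_ac)
        also have "exp (- p * s) * exp (\<nu> * s) = exp (- s / 2)"
          unfolding exp_add[symmetric] by (simp add: p_def algebra_simps)
        finally show ?thesis using True by simp
      qed simp
    qed
    also have "\<dots> = (c * 2 powr p * z powr (- p)) * J" unfolding J_def by (rule integral_mult_right_zero)
    finally show ?thesis by (simp add: mult_ac)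
  qed
  then show ?thesis using J0 c0 unfolding p_def by (intro exI[of _ "c * 2 powr (\<nu> + 1/2) * J"]) auto
qed

lemma besselK_nonneg: "0 \<le> besselK \<nu> z"
  unfolding besselK_def set_lebesgue_integral_def by (intro integral_nonneg_AE AE_I2) (simp add: cosh_real_nonneg)

lemma besselK_measurable [measurable]: "besselK \<nu> \<in> borel_measurable borel"
  unfolding besselK_def[abs_def] set_lebesgue_integral_def cosh_def by measurable

lemma nden_measurable [measurable]: "nden TYPE('a::euclidean_space) m \<in> borel_measurable borel"
  unfolding nden_def[abs_def] Let_def by measurable

lemma nden_nonneg: "m \<ge> 0 \<Longrightarrow> 0 \<le> nden TYPE('a::euclidean_space) m r"
  by (auto simp: nden_def Let_def besselK_nonneg intro!: mult_nonneg_nonneg divide_nonneg_nonneg Gamma_real_nonneg)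

lemma nden_bound:
  assumes m: "m \<ge> 0"
  shows "\<exists>C\<ge>0. \<forall>r>0. r < 1 \<longrightarrow> nden TYPE('a::euclidean_space) m r \<le> C * r powr (- (real DIM('a) + 3/2))"
proof (cases "m > 0")
  case True
  define \<nu> where "\<nu> = (real DIM('a) + 1) / 2"
  have "\<nu> > 0" by (simp add: \<nu>_def)
  then obtain C where C: "C \<ge> 0" "\<And>z. z > 0 \<Longrightarrow> besselK \<nu> z \<le> C * z powr (- (\<nu> + 1/2))" using besselK_bound by blast
  define C' where "C' = 2 * (m / (2 * pi)) powr \<nu> * (C * m powr (- (\<nu> + 1/2)))"
  show ?thesis
  proof (intro exI[of _ C'] conjI allI impI)
    show "0 \<le> C'" using C by (simp add: C'_def)
    fix r :: real assume r: "r > 0"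
    have "nden TYPE('a) m r = 2 * (m / (2 * pi)) powr \<nu> * besselK \<nu> (m * r) / r powr \<nu>"
      using True by (simp add: nden_def Let_def \<nu>_def)
    also have "\<dots> \<le> 2 * (m / (2 * pi)) powr \<nu> * (C * (m * r) powr (- (\<nu> + 1/2))) / r powr \<nu>"
      using C(2)[of "m * r"] True r by (intro divide_right_mono mult_left_mono) auto
    also have "\<dots> = C' * (r powr (- (\<nu> + 1/2)) * r powr (- \<nu>))"
      using r True by (simp add: C'_def powr_mult powr_minus divide_simps)
    also have "r powr (- (\<nu> + 1/2)) * r powr (- \<nu>) = r powr (- (real DIM('a) + 3/2))"
    proof -
      have "- (\<nu> + 1/2) + - \<nu> = - (real DIM('a) + 3/2)" unfolding \<nu>_def by (simp add: field_simps)
      then show ?thesis by (simp only: powr_add[symmetric])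
    qed
    finally show "nden TYPE('a) m r \<le> C' * r powr (- (real DIM('a) + 3/2))" .
  qed
next
  case False
  let ?C = "Gamma ((real DIM('a) + 1) / 2) / pi powr ((real DIM('a) + 1) / 2)"
  have "0 \<le> Gamma ((real DIM('a) + 1) / 2)" by (intro Gamma_real_nonneg) auto
  then have C: "?C \<ge> 0" by simp
  show ?thesis
  proof (intro exI[of _ ?C] conjI allI impI C)
    \<comment> \<open>Below radius 1 the power d + 1 of the massless density is weakened to d + 3/2,
      the one obtained for positive mass.\<close>
    fix r :: real assume "r > 0" "r < 1"
    then have "r powr (- (real DIM('a) + 1)) \<le> r powr (- (real DIM('a) + 3/2))" by (intro powr_mono') auto
    then show "nden TYPE('a) m r \<le> ?C * r powr (- (real DIM('a) + 3/2))"
      using False mult_left_mono[OF _ C] by (simp add: nden_def Let_def del: times_divide_eq_left)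
  qed
qed

text \<open>Dyadic shells: where 2^-(k+1) \<le> |y| < 2^-k the integrand is at most 2^((k+1) q) with
  q = d - 1/2, and the ball of radius 2^-k has volume of order 2^(-k d). The products form a
  geometric series of ratio 2^(-1/2).\<close>

lemma integrable_singular_ball:
  "integrable lborel (\<lambda>y::'a::euclidean_space. indicator {y. 0 < norm y \<and> norm y < 1} y * norm y powr (1/2 - real DIM('a)))"
proof (rule integrableI_bounded)
  let ?d = "real DIM('a)"
  define q where "q = ?d - 1/2"
  have "1 \<le> ?d" using DIM_ge_Suc0[where 'a='a] by simp
  then have q: "q > 0" unfolding q_def by linarith
  let ?f = "\<lambda>k (y::'a). ennreal (2 powr (real (Suc k) * q)) * indicator (ball 0 ((1/2) ^ k)) y"
  have pw: "ennreal (norm (indicator {y. 0 < norm y \<and> norm y < 1} y * norm y powr (1/2 - ?d))) \<le> (\<Sum>k. ?f k y)" for y :: 'a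
  proof (cases "0 < norm y \<and> norm y < 1")
    case True
    define k where "k = (LEAST k. (1/2) ^ Suc k \<le> norm y)"
    have lim: "(\<lambda>k. (1/2::real) ^ Suc k) \<longlonglongrightarrow> 0" by (intro LIMSEQ_Suc LIMSEQ_realpow_zero) auto
    have "\<forall>\<^sub>F k in sequentially. (1/2) ^ Suc k < norm y" using True by (intro order_tendstoD(2)[OF lim]) auto
    then have ex: "\<exists>k. (1/2) ^ Suc k \<le> norm y" by (auto simp: eventually_sequentially intro: less_imp_le)
    have k1: "(1/2) ^ Suc k \<le> norm y" unfolding k_def by (rule LeastI_ex[where P="\<lambda>k. (1/2) ^ Suc k \<le> norm y", OF ex])
    have k2: "norm y < (1/2) ^ k"
    proof (cases k)
      case (Suc j)
      then have "j < (LEAST k. (1/2) ^ Suc k \<le> norm y)" unfolding k_def by simp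
      then have "\<not> (1/2) ^ Suc j \<le> norm y" by (rule not_less_Least[where P="\<lambda>k. (1/2) ^ Suc k \<le> norm y"])
      then show ?thesis using Suc by simp
    qed (use True in simp)
    have "norm y powr (- q) \<le> ((1/2) ^ Suc k) powr (- q)" using k1 q by (intro powr_mono2') auto
    also have "((1/2::real) ^ Suc k) powr (- q) = 2 powr (real (Suc k) * q)"
    proof -
      have "(1/2::real) ^ Suc k = 2 powr (- real (Suc k))" by (simp add: powr_minus powr_realpow power_one_over inverse_eq_divide del: of_nat_Suc power_Suc)
      then show ?thesis by (simp only: powr_powr minus_mult_minus)
    qed
    finally have "ennreal (norm y powr (1/2 - ?d)) \<le> ?f k y" using k2 by (simp add: q_def ennreal_leI)
    also have "\<dots> \<le> (\<Sum>k. ?f k y)"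
    proof -
      have "g k \<le> (\<Sum>k. g k)" for g :: "nat \<Rightarrow> ennreal"
        using sum_le_suminf[of g "{k}"] by simp
      then show ?thesis .
    qed
    finally show ?thesis using True by simp
  qed simp
  have "(\<integral>\<^sup>+y. ennreal (norm (indicator {y. 0 < norm y \<and> norm y < 1} y * norm y powr (1/2 - ?d))) \<partial>(lborel :: 'a measure)) \<le> (\<integral>\<^sup>+y. (\<Sum>k. ?f k y) \<partial>lborel)"
    by (intro nn_integral_mono pw)
  also have "\<dots> = (\<Sum>k. \<integral>\<^sup>+y. ?f k y \<partial>lborel)" by (intro nn_integral_suminf borel_measurable_times_ennreal borel_measurable_const borel_measurable_indicator) simp
  also have "\<dots> = (\<Sum>k. ennreal (unit_ball_vol ?d * 2 powr q * (2 powr (-1/2)) ^ k))"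
  proof (intro suminf_cong)
    fix k
    have "(\<integral>\<^sup>+y. ?f k y \<partial>lborel) = ennreal (2 powr (real (Suc k) * q)) * emeasure lborel (ball (0::'a) ((1/2) ^ k))"
      by (subst nn_integral_cmult_indicator) auto
    also have "\<dots> = ennreal (2 powr (real (Suc k) * q) * (unit_ball_vol ?d * ((1/2) ^ k) ^ DIM('a)))"
      by (simp add: emeasure_ball ennreal_mult' )
    also have "2 powr (real (Suc k) * q) * (unit_ball_vol ?d * ((1/2) ^ k) ^ DIM('a)) = unit_ball_vol ?d * 2 powr q * (2 powr (-1/2)) ^ k"
    proof -
      have "((1/2::real) ^ k) ^ DIM('a) = 2 powr (- (real k * ?d))"
      proof -
        have half: "(1/2::real) ^ N = 2 powr (- real N)" for N
          by (simp add: powr_minus powr_realpow power_one_over inverse_eq_divide)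
        show ?thesis unfolding power_mult[symmetric] unfolding half by simp
      qed
      moreover have "(2 powr (-1/2)) ^ k = 2 powr (real k * (-1/2))" by (simp add: powr_power mult.commute)
      moreover have "2 powr (real (Suc k) * q) * 2 powr (- (real k * ?d)) = 2 powr q * 2 powr (real k * (-1/2))"
      proof -
        have "real (Suc k) * q + - (real k * ?d) = q + real k * (-1/2)" by (simp add: q_def field_simps)
        then show ?thesis by (simp only: powr_add[symmetric])
      qed
      ultimately show ?thesis by (simp add: mult_ac)
    qed
    finally show "(\<integral>\<^sup>+y. ?f k y \<partial>lborel) = ennreal (unit_ball_vol ?d * 2 powr q * (2 powr (-1/2)) ^ k)" .
  qed
  also have "\<dots> < \<infinity>"
  proof -
    have "(2::real) powr (-1/2) < 2 powr 0" by (intro powr_less_mono) auto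
    then have "summable (\<lambda>k. unit_ball_vol ?d * 2 powr q * (2 powr (-1/2)) ^ k)"
      by (intro summable_mult summable_geometric) auto
    then have "(\<Sum>k. ennreal (unit_ball_vol ?d * 2 powr q * (2 powr (-1/2)) ^ k)) \<noteq> top"
      by (rule ennreal_suminf_neq_top) (auto intro!: mult_nonneg_nonneg)
    then show ?thesis by (simp add: less_top)
  qed
  finally show "(\<integral>\<^sup>+y. ennreal (norm (indicator {y. 0 < norm y \<and> norm y < 1} y * norm y powr (1/2 - ?d))) \<partial>(lborel :: 'a measure)) < \<infinity>" .
qed measurable

lemma nden_second_moment:
  assumes m: "m \<ge> 0"
  shows "integrable lborel (\<lambda>y::'a::euclidean_space. indicator {y. 0 < norm y \<and> norm y < 1} y * ((norm y)\<^sup>2 * nden TYPE('a) m (norm y)))"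
proof -
  obtain C where C: "C \<ge> 0" "\<And>r. r > 0 \<Longrightarrow> r < 1 \<Longrightarrow> nden TYPE('a) m r \<le> C * r powr (- (real DIM('a) + 3/2))"
    using nden_bound[OF m] by blast
  show ?thesis
  proof (rule Bochner_Integration.integrable_bound[OF integrable_mult_right[OF integrable_singular_ball, of C]])
    show "AE y in lborel. norm (indicator {y. 0 < norm y \<and> norm y < 1} y * ((norm y)\<^sup>2 * nden TYPE('a) m (norm y)))
       \<le> norm (C * (indicator {y. 0 < norm y \<and> norm y < 1} y * norm (y::'a) powr (1/2 - real DIM('a))))"
    proof (rule AE_I2)
      fix y :: 'a
      show "norm (indicator {y. 0 < norm y \<and> norm y < 1} y * ((norm y)\<^sup>2 * nden TYPE('a) m (norm y)))
       \<le> norm (C * (indicator {y. 0 < norm y \<and> norm y < 1} y * norm y powr (1/2 - real DIM('a))))"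
      proof (cases "0 < norm y \<and> norm y < 1")
        case True
        have "(norm y)\<^sup>2 * nden TYPE('a) m (norm y) \<le> (norm y)\<^sup>2 * (C * norm y powr (- (real DIM('a) + 3/2)))"
          using C True by (intro mult_left_mono) auto
        also have "\<dots> = C * (norm y powr 2 * norm y powr (- (real DIM('a) + 3/2)))" using True by (simp add: powr_numeral)
        also have "norm y powr 2 * norm y powr (- (real DIM('a) + 3/2)) = norm y powr (1/2 - real DIM('a))"
          unfolding powr_add[symmetric] by (simp add: algebra_simps)
        finally show ?thesis using True C nden_nonneg[OF m, of "norm y", where 'a='a] by (simp add: abs_mult)
      qed simp
    qed
  qed measurable
qed

section \<open>Existence of the Levy law\<close>

lemma space_cyl [simp]: "space cyl_space = D0"
  unfolding cyl_space_def by (rule space_measure_of) auto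

lemma cyl_gen: "{{X \<in> D0. X t \<in> B} | t B. 0 \<le> t \<and> B \<in> sets borel} \<subseteq> Pow D0"
  by auto

lemma D0_neg: "X \<in> D0 \<Longrightarrow> t < 0 \<Longrightarrow> X t = 0"
  by (simp add: D0_def)

lemma D0_zero: "X \<in> D0 \<Longrightarrow> X 0 = 0"
  by (simp add: D0_def)

lemma zero_D0: "(\<lambda>_. 0) \<in> D0"
  by (auto simp: D0_def intro!: exI[of _ 0])

lemma measurable_coord [measurable]: "(\<lambda>X. X t) \<in> cyl_space \<rightarrow>\<^sub>M (borel :: 'a::euclidean_space measure)"
proof (cases "t < 0")
  case True
  have "(\<lambda>X. 0) \<in> cyl_space \<rightarrow>\<^sub>M (borel :: 'a measure)" by simp
  then show ?thesis by (rule measurable_cong[THEN iffD1, rotated]) (use True in \<open>auto simp: D0_neg\<close>)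
next
  case False
  show ?thesis
  proof (rule measurableI)
    fix B :: "'a set" assume "B \<in> sets borel"
    then have "{X \<in> D0. X t \<in> B} \<in> sets cyl_space"
      unfolding cyl_space_def sets_measure_of[OF cyl_gen] using False \<open>B \<in> sets borel\<close>
      by (intro sigma_sets.Basic CollectI exI[of _ t] exI[of _ B]) auto
    then show "(\<lambda>X. X t) -` B \<inter> space cyl_space \<in> sets cyl_space"
      by (simp add: vimage_def Int_def conj_commute)
  qed simp
qed

lemma measurable_into_cyl:
  assumes "\<And>\<omega>. \<omega> \<in> space M \<Longrightarrow> F \<omega> \<in> D0" and [measurable]: "\<And>t. 0 \<le> t \<Longrightarrow> (\<lambda>\<omega>. F \<omega> t) \<in> borel_measurable M"
  shows "F \<in> M \<rightarrow>\<^sub>M (cyl_space :: (real \<Rightarrow> 'a::euclidean_space) measure)"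
  unfolding cyl_space_def
proof (rule measurable_measure_of[OF cyl_gen])
  show "F \<in> space M \<rightarrow> D0" using assms(1) by auto
  fix Y :: "(real \<Rightarrow> 'a) set" assume "Y \<in> {{X \<in> D0. X t \<in> B} | t B. 0 \<le> t \<and> B \<in> sets borel}"
  then obtain t B where Y: "Y = {X \<in> D0. X t \<in> B}" "0 \<le> t" and [measurable]: "B \<in> sets borel" by auto
  have "F -` Y \<inter> space M = (\<lambda>\<omega>. F \<omega> t) -` B \<inter> space M"
    using assms(1) by (auto simp: Y)
  then show "F -` Y \<inter> space M \<in> sets M" using assms(2)[OF Y(2)] by (auto intro: measurable_sets)
qed

text \<open>The joint characteristic functions of increments contain the whole definition:
  independence by factorization, stationarity because only differences of times enter, and the
  marginal law by starting at time 0.\<close>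

lemma levy_law_criterion:
  fixes M :: "(real \<Rightarrow> 'a::euclidean_space) measure"
  assumes "prob_space M" and sM [measurable_cong]: "sets M = sets cyl_space" and m: "m \<ge> 0"
    and jc: "\<And>(ts :: nat \<Rightarrow> real) N \<theta>. 0 \<le> ts 0 \<Longrightarrow> (\<And>k. k < N \<Longrightarrow> ts k < ts (Suc k)) \<Longrightarrow>
      (\<integral>X. (\<Prod>k<N. cis (\<theta> k \<bullet> (X (ts (Suc k)) - X (ts k)))) \<partial>M) =
      of_real (exp (- (\<Sum>k<N. (ts (Suc k) - ts k) * rel_exponent m (\<theta> k))))"
  shows "is_rel_levy_law m M"
proof -
  interpret prob_space M by fact
  have sp: "space M = D0" using sets_eq_imp_space_eq[OF sM] by simp
  have one: "(\<integral>X. cis (\<theta> \<bullet> (X t - X s)) \<partial>M) = of_real (exp (- ((t - s) * rel_exponent m \<theta>)))"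
    if "0 \<le> s" "s \<le> t" for s t and \<theta> :: 'a
  proof (cases "s = t")
    case False
    then show ?thesis
      using jc[of "\<lambda>k. if k = 0 then s else t" 1 "\<lambda>_. \<theta>"] that by simp
  qed (use prob_space in simp)
  have zero: "(\<integral>X. cis (\<theta> \<bullet> X t) \<partial>M) = of_real (exp (- (t * rel_exponent m \<theta>)))" if "0 \<le> t" for t and \<theta> :: 'a
  proof -
    have "(\<integral>X. cis (\<theta> \<bullet> X t) \<partial>M) = (\<integral>X. cis (\<theta> \<bullet> (X t - X 0)) \<partial>M)"
      by (intro Bochner_Integration.integral_cong) (auto simp: sp D0_zero)
    then show ?thesis using one[of 0 t] that by simp
  qed
  show ?thesis
    unfolding is_rel_levy_law_def
  proof (intro conjI allI impI)
    fix ts :: "nat \<Rightarrow> real" and n assume ts: "0 \<le> ts 0 \<and> (\<forall>k<n. ts k < ts (Suc k))"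
    have pos: "0 \<le> ts k" if "k < n" for k
      using that
    proof (induction k)
      case (Suc k) then show ?case using ts by (meson Suc_lessD less_imp_le order_trans)
    qed (use ts in auto)
    show "indep_vars (\<lambda>_. borel) (\<lambda>k X. X (ts (Suc k)) - X (ts k)) {..<n}"
    proof (rule indep_vars_cf)
      fix \<theta> :: "nat \<Rightarrow> 'a"
      have "(\<Prod>k<n. \<integral>X. cis (\<theta> k \<bullet> (X (ts (Suc k)) - X (ts k))) \<partial>M) =
         (\<Prod>k<n. complex_of_real (exp (- ((ts (Suc k) - ts k) * rel_exponent m (\<theta> k)))))"
        using ts pos by (intro prod.cong refl one) auto
      also have "\<dots> = of_real (exp (- (\<Sum>k<n. (ts (Suc k) - ts k) * rel_exponent m (\<theta> k))))"
        by (simp add: exp_sum sum_negf[symmetric] exp_minus[symmetric] of_real_prod[symmetric] del: of_real_prod)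
      finally show "(\<integral>X. (\<Prod>i<n. cis (\<theta> i \<bullet> (X (ts (Suc i)) - X (ts i)))) \<partial>M) =
          (\<Prod>i<n. \<integral>X. cis (\<theta> i \<bullet> (X (ts (Suc i)) - X (ts i))) \<partial>M)"
        using jc[of ts n \<theta>] ts by simp
    qed auto
  next
    fix s t :: real assume st: "0 \<le> s \<and> s \<le> t"
    show "distr M borel (\<lambda>X. X t - X s) = distr M borel (\<lambda>X. X (t - s))"
    proof (rule cf_unique)
      fix \<xi> :: 'a
      have "(\<integral>x. cis (\<xi> \<bullet> x) \<partial>distr M borel (\<lambda>X. X t - X s)) = (\<integral>X. cis (\<xi> \<bullet> (X t - X s)) \<partial>M)"
        by (subst integral_distr) auto
      also have "\<dots> = (\<integral>X. cis (\<xi> \<bullet> X (t - s)) \<partial>M)" using one[of s t \<xi>] zero[of "t - s" \<xi>] st by simp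
      also have "\<dots> = (\<integral>x. cis (\<xi> \<bullet> x) \<partial>distr M borel (\<lambda>X. X (t - s)))"
        by (subst integral_distr) auto
      finally show "(\<integral>x. cis (\<xi> \<bullet> x) \<partial>distr M borel (\<lambda>X. X t - X s)) = (\<integral>x. cis (\<xi> \<bullet> x) \<partial>distr M borel (\<lambda>X. X (t - s)))" .
    qed (auto intro!: prob_space_distr)
  next
    fix t :: real and \<xi> :: 'a assume "0 \<le> t"
    then show "(\<integral>X. cis (\<xi> \<bullet> X t) \<partial>M) = exp (- complex_of_real (t * (sqrt (norm \<xi> ^ 2 + m ^ 2) - m)))"
      using zero[of t \<xi>] by (simp only: rel_exponent_def exp_of_real of_real_minus[symmetric])
  qed (fact+)
qed

locale dyadic_levy =
  fixes m :: real and L :: "(real \<Rightarrow> 'a::euclidean_space) measure"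
  assumes m: "m \<ge> 0" and prob_L: "prob_space L"
    and coord_L: "\<And>q. q \<in> dyadic_rats \<Longrightarrow> (\<lambda>\<omega>. \<omega> q) \<in> borel_measurable L"
    and zero_L: "AE \<omega> in L. \<omega> 0 = 0"
    and incr_L: "\<And>n N. distr L (\<Pi>\<^sub>M k\<in>{..<N}. borel) (\<lambda>\<omega>. \<lambda>k\<in>{..<N}. \<omega> (real (Suc k) / 2 ^ n) - \<omega> (real k / 2 ^ n)) = (\<Pi>\<^sub>M k\<in>{..<N}. rel_marginal m (1 / 2 ^ n))"
begin

sublocale prob_space L by (rule prob_L)

lemma coord_level [measurable]: "(\<lambda>\<omega>. \<omega> (real k / 2 ^ n)) \<in> borel_measurable L"
  by (rule coord_L) (auto simp: dyadic_rats_def)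

lemma coord_above [measurable]: "(\<lambda>\<omega>. \<omega> (dyadic_above n t)) \<in> borel_measurable L"
  by (rule coord_L) (rule dyadic_above_in)

lemma prob_rel_marginal: "prob_space (rel_marginal m (1 / 2 ^ n) :: 'a measure)"
  using m by (intro prob_space_rel_marginal) auto

lemma law_incr: "distr L borel (\<lambda>\<omega>. \<omega> (real (Suc k) / 2 ^ n) - \<omega> (real k / 2 ^ n)) = rel_marginal m (1 / 2 ^ n)"
proof -
  let ?D = "\<lambda>\<omega>. \<lambda>j\<in>{..<Suc k}. \<omega> (real (Suc j) / 2 ^ n) - \<omega> (real j / 2 ^ n)"
  have "distr L borel (\<lambda>\<omega>. \<omega> (real (Suc k) / 2 ^ n) - \<omega> (real k / 2 ^ n)) = distr (distr L (\<Pi>\<^sub>M k\<in>{..<Suc k}. borel) ?D) borel (\<lambda>f. f k)"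
    by (subst distr_distr) (auto simp: comp_def simp del: of_nat_Suc intro!: measurable_restrict)
  also have "\<dots> = distr (\<Pi>\<^sub>M k\<in>{..<Suc k}. rel_marginal m (1 / 2 ^ n)) (rel_marginal m (1 / 2 ^ n)) (\<lambda>f. f k)"
    unfolding incr_L by (intro distr_cong) auto
  also have "\<dots> = rel_marginal m (1 / 2 ^ n)"
    by (rule distr_PiM_component) (auto intro: prob_rel_marginal)
  finally show ?thesis .
qed

lemma indep_incr: "indep_vars (\<lambda>_. borel) (\<lambda>k \<omega>. \<omega> (real (Suc k) / 2 ^ n) - \<omega> (real k / 2 ^ n)) {..<N}"
proof (cases "N = 0")
  case True then show ?thesis by (simp add: indep_vars_def indep_sets_def)
next
  case False
  then show ?thesis
    by (subst indep_vars_iff_distr_eq_PiM') (auto simp: incr_L law_incr simp del: of_nat_Suc)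
qed

lemma incr_cf: "(\<integral>\<omega>. cis (\<xi> \<bullet> (\<omega> (real (Suc k) / 2 ^ n) - \<omega> (real k / 2 ^ n))) \<partial>L) = of_real (exp (- (1 / 2 ^ n * rel_exponent m \<xi>)))"
proof -
  have "(\<integral>\<omega>. cis (\<xi> \<bullet> (\<omega> (real (Suc k) / 2 ^ n) - \<omega> (real k / 2 ^ n))) \<partial>L) =
     (\<integral>x. cis (\<xi> \<bullet> x) \<partial>distr L borel (\<lambda>\<omega>. \<omega> (real (Suc k) / 2 ^ n) - \<omega> (real k / 2 ^ n)))"
    by (subst integral_distr) (auto simp del: of_nat_Suc)
  then show ?thesis unfolding law_incr using m by (subst (asm) rel_marginal_cf) auto
qed

lemma grid_cf:
  fixes a :: "nat \<Rightarrow> nat" and \<theta> :: "nat \<Rightarrow> 'a"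
  assumes a: "\<And>k. k < N \<Longrightarrow> a k \<le> a (Suc k)"
  shows "(\<integral>\<omega>. (\<Prod>k<N. cis (\<theta> k \<bullet> (\<omega> (real (a (Suc k)) / 2 ^ n) - \<omega> (real (a k) / 2 ^ n)))) \<partial>L) =
    of_real (exp (- (\<Sum>k<N. (real (a (Suc k)) / 2 ^ n - real (a k) / 2 ^ n) * rel_exponent m (\<theta> k))))"
proof -
  have mono: "a k \<le> a k'" if "k \<le> k'" "k' \<le> N" for k k'
    using that by (induction k' rule: dec_induct) (use a in \<open>auto intro: order_trans\<close>)
  define D where "D j \<omega> = \<omega> (real (Suc j) / 2 ^ n) - \<omega> (real j / 2 ^ n)" for j and \<omega> :: "real \<Rightarrow> 'a"
  define In where "In j k \<longleftrightarrow> a k \<le> j \<and> j < a (Suc k)" for j k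
  \<comment> \<open>The frequency seen by the fine increment \<open>j\<close>: that of the one block
    containing \<open>j\<close>, or 0 outside all blocks, where the exponent vanishes.\<close>
  define \<theta>' where "\<theta>' j = (\<Sum>k<N. if In j k then \<theta> k else 0)" for j
  have uniq: "k = k'" if "k < N" "k' < N" "In j k" "In j k'" for j k k'
  proof (rule ccontr)
    assume "k \<noteq> k'"
    then consider "Suc k \<le> k'" | "Suc k' \<le> k" by linarith
    then show False using that mono[of "Suc k" k'] mono[of "Suc k'" k] by cases (auto simp: In_def)
  qed
  have filt: "(\<Sum>j<a N. if In j k then g j else 0) = (\<Sum>j\<in>{a k..<a (Suc k)}. g j)"
    if k: "k < N" for k and g :: "nat \<Rightarrow> 'c::comm_monoid_add"
  proof -
    have "{j \<in> {..<a N}. In j k} = {a k..<a (Suc k)}"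
      using mono[of "Suc k" N] k by (auto simp: In_def)
    then show ?thesis by (subst sum.inter_filter[symmetric]) simp_all
  qed
  have tele: "\<omega> (real (a (Suc k)) / 2 ^ n) - \<omega> (real (a k) / 2 ^ n) = (\<Sum>j<a N. if In j k then D j \<omega> else 0)" if k: "k < N" for k \<omega>
  proof -
    have "(\<Sum>j<a N. if In j k then D j \<omega> else 0) = (\<Sum>j\<in>{a k..<a (Suc k)}. D j \<omega>)"
      by (rule filt[OF k])
    also have "\<dots> = \<omega> (real (a (Suc k)) / 2 ^ n) - \<omega> (real (a k) / 2 ^ n)"
      unfolding D_def using a[OF k] by (rule sum_Suc_diff')
    finally show ?thesis ..
  qed
  have "(\<Sum>k<N. \<theta> k \<bullet> (\<omega> (real (a (Suc k)) / 2 ^ n) - \<omega> (real (a k) / 2 ^ n))) = (\<Sum>j<a N. \<theta>' j \<bullet> D j \<omega>)" for \<omega>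
  proof -
    have "(\<Sum>k<N. \<theta> k \<bullet> (\<omega> (real (a (Suc k)) / 2 ^ n) - \<omega> (real (a k) / 2 ^ n))) =
      (\<Sum>k<N. \<Sum>j<a N. \<theta> k \<bullet> (if In j k then D j \<omega> else 0))"
      by (intro sum.cong refl) (simp add: tele inner_sum_right)
    also have "\<dots> = (\<Sum>j<a N. \<Sum>k<N. \<theta> k \<bullet> (if In j k then D j \<omega> else 0))" by (rule sum.swap)
    also have "\<dots> = (\<Sum>j<a N. \<theta>' j \<bullet> D j \<omega>)"
      unfolding \<theta>'_def inner_sum_left by (intro sum.cong refl) auto
    finally show ?thesis .
  qed
  moreover have cis_sum: "(\<Prod>k\<in>I. cis (g k)) = cis (\<Sum>k\<in>I. g k)" for g :: "nat \<Rightarrow> real" and I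
    by (induction I rule: infinite_finite_induct) (auto simp: cis_mult)
  ultimately have "(\<integral>\<omega>. (\<Prod>k<N. cis (\<theta> k \<bullet> (\<omega> (real (a (Suc k)) / 2 ^ n) - \<omega> (real (a k) / 2 ^ n)))) \<partial>L) =
     (\<integral>\<omega>. (\<Prod>j<a N. cis (\<theta>' j \<bullet> D j \<omega>)) \<partial>L)"
    by simp
  also have "\<dots> = (\<Prod>j<a N. \<integral>\<omega>. cis (\<theta>' j \<bullet> D j \<omega>) \<partial>L)"
  proof (rule indep_vars_lebesgue_integral)
    show "indep_vars (\<lambda>_. borel) (\<lambda>j \<omega>. cis (\<theta>' j \<bullet> D j \<omega>)) {..<a N}"
      unfolding D_def by (rule indep_vars_compose2[OF indep_incr]) auto
  qed (auto intro!: integrable_const_bound[where B=1] simp: D_def simp del: of_nat_Suc)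
  also have "\<dots> = (\<Prod>j<a N. complex_of_real (exp (- (1 / 2 ^ n * rel_exponent m (\<theta>' j)))))"
    by (simp add: D_def incr_cf del: of_nat_Suc)
  also have "\<dots> = of_real (exp (- (\<Sum>j<a N. 1 / 2 ^ n * rel_exponent m (\<theta>' j))))"
    by (simp add: exp_sum sum_negf[symmetric] of_real_prod[symmetric] del: of_real_prod)
  also have "(\<Sum>j<a N. 1 / 2 ^ n * rel_exponent m (\<theta>' j)) = (\<Sum>j<a N. \<Sum>k<N. if In j k then 1 / 2 ^ n * rel_exponent m (\<theta> k) else 0)"
  proof (intro sum.cong refl)
    fix j
    show "1 / 2 ^ n * rel_exponent m (\<theta>' j) = (\<Sum>k<N. if In j k then 1 / 2 ^ n * rel_exponent m (\<theta> k) else 0)"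
    proof (cases "\<exists>k<N. In j k")
      case True
      then obtain k0 where k0: "k0 < N" "In j k0" by auto
      then have "In j k \<longleftrightarrow> k = k0" if "k < N" for k using uniq that by blast
      then have e: "(\<Sum>k<N. if In j k then g k else 0) = g k0" for g :: "nat \<Rightarrow> 'c::comm_monoid_add"
        using k0(1) by (subst sum.cong[OF refl, of _ _ "\<lambda>k. if k = k0 then g k else 0"]) auto
      show ?thesis unfolding \<theta>'_def e ..
    next
      case False
      then show ?thesis using m by (simp add: \<theta>'_def)
    qed
  qed
  also have "\<dots> = (\<Sum>k<N. \<Sum>j<a N. if In j k then 1 / 2 ^ n * rel_exponent m (\<theta> k) else 0)" by (rule sum.swap)
  also have "\<dots> = (\<Sum>k<N. (real (a (Suc k)) / 2 ^ n - real (a k) / 2 ^ n) * rel_exponent m (\<theta> k))"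
  proof (intro sum.cong refl)
    fix k assume "k \<in> {..<N}"
    then have k: "k < N" by simp
    have "(\<Sum>j<a N. if In j k then 1 / 2 ^ n * rel_exponent m (\<theta> k) else 0) = (\<Sum>j\<in>{a k..<a (Suc k)}. 1 / 2 ^ n * rel_exponent m (\<theta> k))"
      by (rule filt[OF k])
    also have "\<dots> = (real (a (Suc k)) / 2 ^ n - real (a k) / 2 ^ n) * rel_exponent m (\<theta> k)"
      using a[OF k] by (simp add: of_nat_diff diff_divide_distrib[symmetric])
    finally show "(\<Sum>j<a N. if In j k then 1 / 2 ^ n * rel_exponent m (\<theta> k) else 0) = (real (a (Suc k)) / 2 ^ n - real (a k) / 2 ^ n) * rel_exponent m (\<theta> k)" .
  qed
  finally show ?thesis .
qed

lemma tail_incr: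
  assumes l: "l > 0"
  shows "prob {\<omega> \<in> space L. norm (\<omega> (real (Suc k) / 2 ^ n) - \<omega> (real k / 2 ^ n)) > l} \<le> 3 * gauss_abs TYPE('a) / (2 ^ n * l)"
proof -
  interpret mu: prob_space "rel_marginal m (1 / 2 ^ n) :: 'a measure" by (rule prob_rel_marginal)
  have "prob {\<omega> \<in> space L. norm (\<omega> (real (Suc k) / 2 ^ n) - \<omega> (real k / 2 ^ n)) > l} =
    measure (distr L borel (\<lambda>\<omega>. \<omega> (real (Suc k) / 2 ^ n) - \<omega> (real k / 2 ^ n))) {x. norm x > l}"
    by (subst measure_distr) (auto simp del: of_nat_Suc intro!: arg_cong[where f=prob])
  also have "\<dots> \<le> measure (rel_marginal m (1 / 2 ^ n)) {x::'a. l \<le> norm x}"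
    unfolding law_incr by (intro mu.finite_measure_mono) auto
  also have "\<dots> \<le> 3 * (1 / 2 ^ n) * gauss_abs TYPE('a) / l"
    using m l rel_exponent_bounds[OF m] by (intro small_time_tail[OF prob_rel_marginal _ rel_marginal_cf]) auto
  finally show ?thesis by (simp add: mult.commute)
qed

lemma two_incr:
  assumes l: "l > 0"
  shows "prob {\<omega> \<in> space L. norm (\<omega> (real (Suc k) / 2 ^ n) - \<omega> (real k / 2 ^ n)) > l \<and>
     norm (\<omega> (real (Suc (Suc k)) / 2 ^ n) - \<omega> (real (Suc k) / 2 ^ n)) > l} \<le> (3 * gauss_abs TYPE('a) / (2 ^ n * l))\<^sup>2"
proof -
  let ?X = "\<lambda>k \<omega>. \<omega> (real (Suc k) / 2 ^ n) - \<omega> (real k / 2 ^ n) :: 'a"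
  have e: "?X j -` {x. norm x > l} \<inter> space L = {\<omega> \<in> space L. norm (?X j \<omega>) > l}" for j by auto
  have "prob (\<Inter>j\<in>{k, Suc k}. ?X j -` {x. norm x > l} \<inter> space L) = (\<Prod>j\<in>{k, Suc k}. prob (?X j -` {x. norm x > l} \<inter> space L))"
    by (rule indep_varsD[OF indep_incr[of n "Suc (Suc k)"]]) auto
  also have "(\<Prod>j\<in>{k, Suc k}. prob (?X j -` {x. norm x > l} \<inter> space L)) \<le> (3 * gauss_abs TYPE('a) / (2 ^ n * l))\<^sup>2"
  proof -
    have pr: "(\<Prod>j\<in>{k, Suc k}. g j) = g k * g (Suc k)" for g :: "nat \<Rightarrow> real" by simp
    show ?thesis
      unfolding e pr power2_eq_square using l
      by (intro mult_mono tail_incr[OF l]) (auto simp: gauss_abs_nonneg)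
  qed
  also have "(\<Inter>j\<in>{k, Suc k}. ?X j -` {x. norm x > l} \<inter> space L) = {\<omega> \<in> space L. norm (\<omega> (real (Suc k) / 2 ^ n) - \<omega> (real k / 2 ^ n)) > l \<and>
     norm (\<omega> (real (Suc (Suc k)) / 2 ^ n) - \<omega> (real (Suc k) / 2 ^ n)) > l}" by auto
  finally show ?thesis .
qed

text \<open>Two consecutive increments over a mesh \<open>2\<^sup>-\<^sup>n\<close> both exceed \<open>l\<close> with probability
  \<open>O((2\<^sup>-\<^sup>n / l)\<^sup>2)\<close>. There are about \<open>2\<^sup>n\<close> of them, so \<open>l = (4/5)\<^sup>n\<close> is small enough to be summable
  and large enough for Borel-Cantelli: the probabilities sum like \<open>(25/32)\<^sup>n\<close>.\<close>

lemma AE_modulus: "AE \<omega> in L. \<exists>n0. dyadic_modulus \<omega> T n0"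
proof -
  define A where "A n = (\<Union>k<T * 2 ^ n. {\<omega> \<in> space L. norm (\<omega> (real (Suc k) / 2 ^ n) - \<omega> (real k / 2 ^ n)) > (4/5) ^ n \<and>
     norm (\<omega> (real (Suc (Suc k)) / 2 ^ n) - \<omega> (real (Suc k) / 2 ^ n)) > (4/5) ^ n})" for n
  define C where "C = real T * (3 * gauss_abs TYPE('a))\<^sup>2"
  have Am [measurable]: "A n \<in> sets L" for n unfolding A_def by measurable
  have bound: "prob (A n) \<le> C * (25/32) ^ n" for n
  proof -
    have "prob (A n) \<le> (\<Sum>k<T * 2 ^ n. prob {\<omega> \<in> space L. norm (\<omega> (real (Suc k) / 2 ^ n) - \<omega> (real k / 2 ^ n)) > (4/5) ^ n \<and>
     norm (\<omega> (real (Suc (Suc k)) / 2 ^ n) - \<omega> (real (Suc k) / 2 ^ n)) > (4/5) ^ n})"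
      unfolding A_def by (rule finite_measure_subadditive_finite) (auto simp del: of_nat_Suc)
    also have "\<dots> \<le> (\<Sum>k<T * 2 ^ n. (3 * gauss_abs TYPE('a) / (2 ^ n * (4/5) ^ n))\<^sup>2)"
      by (intro sum_mono two_incr) simp
    also have "\<dots> = real T * 2 ^ n * (3 * gauss_abs TYPE('a) / (2 ^ n * (4/5) ^ n))\<^sup>2" by simp
    also have "\<dots> = C * (25/32) ^ n"
    proof -
      have "(25/32::real) ^ n = 2 ^ n / (2 ^ n * (4/5) ^ n)\<^sup>2"
        by (simp add: power_mult_distrib[symmetric] power_divide[symmetric] power2_eq_square)
      moreover have "real T * 2 ^ n * (c / d)\<^sup>2 = real T * c\<^sup>2 * (2 ^ n / d\<^sup>2)" for c d :: real
        by (simp add: power_divide)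
      ultimately show ?thesis by (simp only: C_def)
    qed
    finally show ?thesis .
  qed
  have "summable (\<lambda>n. prob (A n))"
  proof (rule summable_comparison_test')
    show "summable (\<lambda>n. C * (25/32) ^ n)" by (intro summable_mult summable_geometric) simp
  qed (use bound in simp)
  then have "AE \<omega> in L. \<forall>\<^sub>F n in sequentially. \<omega> \<in> space L - A n"
    by (intro borel_cantelli_AE1) (auto simp: emeasure_eq_measure)
  then show ?thesis
  proof eventually_elim
    case (elim \<omega>)
    then obtain n0 where n0: "\<And>n. n \<ge> n0 \<Longrightarrow> \<omega> \<in> space L - A n" by (auto simp: eventually_sequentially)
    have "dyadic_modulus \<omega> T n0"
    proof
      fix n j assume "n0 \<le> n" "j + 2 \<le> T * 2 ^ n"
      then show "min (norm (\<omega> (real (j + 1) / 2 ^ n) - \<omega> (real j / 2 ^ n))) (norm (\<omega> (real (j + 2) / 2 ^ n) - \<omega> (real (j + 1) / 2 ^ n))) \<le> (4/5) ^ n"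
        using n0[of n] by (fastforce simp: A_def min_le_iff_disj not_less)
    qed
    then show ?case by blast
  qed
qed

text \<open>Each level contributes a single increment starting at 0, so the first-order tail bound
  is already summable, with ratio (1/2) / (4/5) = 5/8.\<close>

lemma AE_zero: "AE \<omega> in L. (\<lambda>n. \<omega> (1 / 2 ^ n)) \<longlonglongrightarrow> 0"
proof -
  define A where "A n = {\<omega> \<in> space L. norm (\<omega> (real (Suc 0) / 2 ^ n) - \<omega> (real 0 / 2 ^ n)) > (4/5) ^ n}" for n
  have Am [measurable]: "A n \<in> sets L" for n unfolding A_def by measurable
  have bound: "prob (A n) \<le> 3 * gauss_abs TYPE('a) * (5/8) ^ n" for n
  proof -
    have "prob (A n) \<le> 3 * gauss_abs TYPE('a) / (2 ^ n * (4/5) ^ n)"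
      unfolding A_def by (rule tail_incr) simp
    also have "(2 ^ n * (4/5) ^ n) = (8/5::real) ^ n" by (simp add: power_mult_distrib[symmetric])
    also have "3 * gauss_abs TYPE('a) / (8/5) ^ n = 3 * gauss_abs TYPE('a) * (5/8) ^ n" by (simp add: power_divide)
    finally show ?thesis .
  qed
  have "summable (\<lambda>n. prob (A n))"
  proof (rule summable_comparison_test')
    show "summable (\<lambda>n. 3 * gauss_abs TYPE('a) * (5/8) ^ n)" by (intro summable_mult summable_geometric) simp
  qed (use bound in simp)
  then have "AE \<omega> in L. \<forall>\<^sub>F n in sequentially. \<omega> \<in> space L - A n"
    by (intro borel_cantelli_AE1) (auto simp: emeasure_eq_measure)
  with zero_L show ?thesis
  proof eventually_elim
    case (elim \<omega>)
    show ?case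
    proof (rule Lim_null_comparison)
      show "\<forall>\<^sub>F n in sequentially. norm (\<omega> (1 / 2 ^ n)) \<le> (4/5) ^ n"
        using elim(2) by eventually_elim (use elim(1) in \<open>auto simp: A_def\<close>)
      show "(\<lambda>n. (4/5::real) ^ n) \<longlonglongrightarrow> 0" by (rule LIMSEQ_realpow_zero) auto
    qed
  qed
qed

lemma AE_regularizable: "AE \<omega> in L. regularizable \<omega>"
proof -
  have "AE \<omega> in L. \<forall>T. \<exists>n0. dyadic_modulus \<omega> (T + 2) n0"
    using AE_modulus by (simp add: AE_all_countable)
  then show ?thesis using AE_zero
  proof eventually_elim
    case (elim \<omega>)
    show ?case
    proof
      fix T :: nat
      obtain n0 where "dyadic_modulus \<omega> (T + 2) n0" using elim by blast
      then interpret dyadic_modulus \<omega> "T + 2" n0 .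
      show "three_point (dyadic_rats \<inter> {0..real T}) \<omega>" by (rule three_point_dyadics) simp
    qed (use elim in simp)
  qed
qed

lemma levy_law_exists: "\<exists>M. is_rel_levy_law m (M :: (real \<Rightarrow> 'a) measure)"
proof -
  \<comment> \<open>On a measurable null set containing all bad paths the zero path is substituted,
    so that \<open>F\<close> takes values in \<open>D0\<close> everywhere.\<close>
  obtain Nu where Nu: "Nu \<in> null_sets L" "{\<omega> \<in> space L. \<not> regularizable \<omega>} \<subseteq> Nu"
    using AE_regularizable by (auto simp: eventually_ae_filter)
  then have [measurable]: "Nu \<in> sets L" by auto
  define F where "F \<omega> = (if \<omega> \<in> Nu then (\<lambda>_. 0) else regularize \<omega>)" for \<omega> :: "real \<Rightarrow> 'a"
  have FD: "F \<omega> \<in> D0" if "\<omega> \<in> space L" for \<omega>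
    using that Nu regularizable.regularize_D0 by (auto simp: F_def zero_D0)
  have regm: "(\<lambda>\<omega>. regularize \<omega> t) \<in> borel_measurable L" if "0 \<le> t" for t
    using that unfolding regularize_def by (simp add: borel_measurable_lim_metric)
  have Fm [measurable]: "F \<in> L \<rightarrow>\<^sub>M cyl_space"
  proof (rule measurable_into_cyl[OF FD])
    fix t :: real assume t: "0 \<le> t"
    have "(\<lambda>\<omega>. F \<omega> t) = (\<lambda>\<omega>. if \<omega> \<in> Nu then 0 else regularize \<omega> t)" by (auto simp: F_def)
    then show "(\<lambda>\<omega>. F \<omega> t) \<in> borel_measurable L" using regm[OF t] by simp
  qed
  have AEF: "AE \<omega> in L. \<forall>t\<ge>0. (\<lambda>n. \<omega> (dyadic_above n t)) \<longlonglongrightarrow> F \<omega> t"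
    using AE_not_in[OF Nu(1)] AE_regularizable
    by eventually_elim (auto simp: F_def intro: regularizable.regularize_lim)
  have "is_rel_levy_law m (distr L cyl_space F)"
  proof (rule levy_law_criterion)
    show "prob_space (distr L cyl_space F)" by (rule prob_space_distr) measurable
    show "0 \<le> m" by (rule m)
    fix ts :: "nat \<Rightarrow> real" and N and \<theta> :: "nat \<Rightarrow> 'a"
    assume ts0: "0 \<le> ts 0" and ts: "\<And>k. k < N \<Longrightarrow> ts k < ts (Suc k)"
    have pos: "0 \<le> ts k" if "k \<le> N" for k
      using that
    proof (induction k)
      case (Suc k) then show ?case using ts[of k] by simp
    qed (use ts0 in auto)
    let ?P = "\<lambda>X. \<Prod>k<N. cis (\<theta> k \<bullet> (X (ts (Suc k)) - X (ts k)))"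
    let ?Pn = "\<lambda>n \<omega>. \<Prod>k<N. cis (\<theta> k \<bullet> (\<omega> (dyadic_above n (ts (Suc k))) - \<omega> (dyadic_above n (ts k))))"
    have n1: "norm (\<Prod>k<N. cis (g k)) = 1" for g :: "nat \<Rightarrow> real" by (simp add: prod_norm[symmetric])
    have Fc: "(\<lambda>\<omega>. F \<omega> t) \<in> borel_measurable L" for t
      using measurable_compose[OF Fm measurable_coord] .
    \<comment> \<open>The times are replaced by the dyadic points just above them. There the joint
      characteristic function is known exactly, and right limits carry it to the given
      times.\<close>
    have lim: "(\<lambda>n. \<integral>\<omega>. ?Pn n \<omega> \<partial>L) \<longlonglongrightarrow> (\<integral>\<omega>. ?P (F \<omega>) \<partial>L)"
    proof (rule integral_dominated_convergence[where w="\<lambda>_. 1"])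
      show "AE \<omega> in L. (\<lambda>n. ?Pn n \<omega>) \<longlonglongrightarrow> ?P (F \<omega>)"
        using AEF
      proof eventually_elim
        case (elim \<omega>)
        have c: "isCont cis x" for x using continuous_on_cis[OF continuous_on_id, of UNIV] by (simp add: continuous_on_eq_continuous_at)
        show ?case
          using elim pos by (intro tendsto_prod isCont_tendsto_compose[OF c] tendsto_inner tendsto_diff tendsto_const) auto
      qed
      show "(\<lambda>\<omega>. ?P (F \<omega>)) \<in> borel_measurable L" using Fc by measurable
    qed (simp_all add: n1)
    have "(\<integral>\<omega>. ?Pn n \<omega> \<partial>L) = of_real (exp (- (\<Sum>k<N. (dyadic_above n (ts (Suc k)) - dyadic_above n (ts k)) * rel_exponent m (\<theta> k))))" for n
    proof -
      define a where "a k = nat \<lfloor>ts k * 2 ^ n\<rfloor> + 1" for k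
      have d: "dyadic_above n (ts k) = real (a k) / 2 ^ n" for k by (simp add: a_def dyadic_above_def)
      have "a k \<le> a (Suc k)" if "k < N" for k
        using ts[OF that] by (auto simp: a_def intro!: nat_mono floor_mono mult_right_mono)
      from grid_cf[of N a \<theta> n, OF this] show ?thesis unfolding d .
    qed
    moreover have "(\<lambda>n. complex_of_real (exp (- (\<Sum>k<N. (dyadic_above n (ts (Suc k)) - dyadic_above n (ts k)) * rel_exponent m (\<theta> k)))))
       \<longlonglongrightarrow> of_real (exp (- (\<Sum>k<N. (ts (Suc k) - ts k) * rel_exponent m (\<theta> k))))"
      using pos by (intro tendsto_of_real tendsto_exp tendsto_minus tendsto_sum tendsto_mult tendsto_diff dyadic_above_tendsto tendsto_const) auto
    ultimately have "(\<integral>\<omega>. ?P (F \<omega>) \<partial>L) = of_real (exp (- (\<Sum>k<N. (ts (Suc k) - ts k) * rel_exponent m (\<theta> k))))"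
      using lim LIMSEQ_unique by simp
    moreover have "(\<integral>X. ?P X \<partial>distr L cyl_space F) = (\<integral>\<omega>. ?P (F \<omega>) \<partial>L)"
      by (rule integral_distr) measurable
    ultimately show "(\<integral>X. ?P X \<partial>distr L cyl_space F) = of_real (exp (- (\<Sum>k<N. (ts (Suc k) - ts k) * rel_exponent m (\<theta> k))))"
      by simp
  qed simp
  then show ?thesis by blast
qed

end

theorem rel_levy_law_exists:
  assumes m: "m \<ge> 0" shows "\<exists>M. is_rel_levy_law m (M :: (real \<Rightarrow> 'a::euclidean_space) measure)"
proof -
  interpret dyadic_semigroup "\<lambda>n. rel_marginal m (1 / 2 ^ n) :: 'a measure" "\<lambda>n \<xi>. of_real (exp (- (1 / 2 ^ n * rel_exponent m \<xi>)))"
  proof (unfold dyadic_semigroup_def, intro conjI allI)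
    show "prob_space (rel_marginal m (1 / 2 ^ n) :: 'a measure)" for n using m by (intro prob_space_rel_marginal) auto
    show "sets (rel_marginal m (1 / 2 ^ n) :: 'a measure) = sets borel" for n by simp
    show "(\<integral>x. cis (\<xi> \<bullet> x) \<partial>rel_marginal m (1 / 2 ^ n)) = of_real (exp (- (1 / 2 ^ n * rel_exponent m \<xi>)))" for n and \<xi> :: 'a
      using m by (intro rel_marginal_cf) auto
    show "complex_of_real (exp (- (1 / 2 ^ n * rel_exponent m \<xi>))) = (complex_of_real (exp (- (1 / 2 ^ Suc n * rel_exponent m \<xi>))))\<^sup>2" for n and \<xi> :: 'a
      unfolding power2_eq_square of_real_mult[symmetric] exp_add[symmetric] by simp
  qed
  from dyadic_process obtain L :: "(real \<Rightarrow> 'a) measure" where L: "prob_space L"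
    "\<forall>q\<in>dyadic_rats. (\<lambda>\<omega>. \<omega> q) \<in> borel_measurable L" "AE \<omega> in L. \<omega> 0 = 0"
    "\<forall>n N. distr L (\<Pi>\<^sub>M k\<in>{..<N}. borel) (\<lambda>\<omega>. \<lambda>k\<in>{..<N}. \<omega> (real (Suc k) / 2 ^ n) - \<omega> (real k / 2 ^ n)) = (\<Pi>\<^sub>M k\<in>{..<N}. rel_marginal m (1 / 2 ^ n))"
    by (elim exE conjE)
  interpret dyadic_levy m L
    by (intro dyadic_levy.intro m L(1) L(2)[rule_format] L(3) L(4)[rule_format])
  show ?thesis by (rule levy_law_exists)
qed

section \<open>Mass comparison on a finite time horizon\<close>

text \<open>Tonelli, one coordinate at a time; each coordinate costs one factor
  \<open>c\<close>.\<close>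

lemma PiM_dominated:
  fixes \<mu> \<nu> :: "'b measure" and c :: ennreal and I :: "'i set"
  assumes "prob_space \<mu>" "prob_space \<nu>" and s [measurable_cong]: "sets \<mu> = sets \<nu>"
    and dom: "\<And>F. F \<in> borel_measurable \<nu> \<Longrightarrow> (\<integral>\<^sup>+x. F x \<partial>\<mu>) \<le> c * (\<integral>\<^sup>+x. F x \<partial>\<nu>)"
    and I: "finite I" and F: "F \<in> borel_measurable (\<Pi>\<^sub>M i\<in>I. \<nu>)"
  shows "(\<integral>\<^sup>+x. F x \<partial>(\<Pi>\<^sub>M i\<in>I. \<mu>)) \<le> c ^ card I * (\<integral>\<^sup>+x. F x \<partial>(\<Pi>\<^sub>M i\<in>I. \<nu>))"
proof -
  interpret \<mu>: prob_space \<mu> by fact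
  interpret \<nu>: prob_space \<nu> by fact
  interpret M: product_sigma_finite "\<lambda>_. \<mu>" by standard
  interpret N: product_sigma_finite "\<lambda>_. \<nu>" by standard
  have sP: "sets (\<Pi>\<^sub>M i\<in>J. \<mu>) = sets (\<Pi>\<^sub>M i\<in>J. \<nu>)" for J :: "'i set"
    by (intro sets_PiM_cong s refl)
  show ?thesis
    using I F
  proof (induction I arbitrary: F rule: finite_induct)
    case empty
    have "(\<Pi>\<^sub>M i\<in>({} :: 'i set). \<mu>) = (\<Pi>\<^sub>M i\<in>{}. \<nu>)" by (simp add: PiM_empty)
    then show ?case by simp
  next
    case (insert i I)
    note [measurable] = insert.prems
    have [measurable]: "(\<lambda>(x, y). F (x(i := y))) \<in> borel_measurable ((\<Pi>\<^sub>M i\<in>I. \<nu>) \<Otimes>\<^sub>M \<nu>)"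
      using measurable_compose[OF measurable_add_dim insert.prems] by (simp add: split_beta')
    have slice: "(\<lambda>y. F (x(i := y))) \<in> borel_measurable \<nu>" if "x \<in> space (\<Pi>\<^sub>M i\<in>I. \<nu>)" for x
      using that by measurable
    have Gm: "(\<lambda>x. \<integral>\<^sup>+y. F (x(i := y)) \<partial>\<nu>) \<in> borel_measurable (\<Pi>\<^sub>M i\<in>I. \<nu>)"
      by measurable
    have "(\<integral>\<^sup>+x. F x \<partial>(\<Pi>\<^sub>M i\<in>insert i I. \<mu>)) = (\<integral>\<^sup>+x. (\<integral>\<^sup>+y. F (x(i := y)) \<partial>\<mu>) \<partial>(\<Pi>\<^sub>M i\<in>I. \<mu>))"
      using insert by (intro M.product_nn_integral_insert) (auto simp: measurable_cong_sets[OF sP refl])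
    also have "\<dots> \<le> (\<integral>\<^sup>+x. c * (\<integral>\<^sup>+y. F (x(i := y)) \<partial>\<nu>) \<partial>(\<Pi>\<^sub>M i\<in>I. \<mu>))"
      by (intro nn_integral_mono dom slice) (simp add: sets_eq_imp_space_eq[OF sP])
    also have "\<dots> \<le> c ^ card I * (\<integral>\<^sup>+x. c * (\<integral>\<^sup>+y. F (x(i := y)) \<partial>\<nu>) \<partial>(\<Pi>\<^sub>M i\<in>I. \<nu>))"
      by (intro insert.IH borel_measurable_times_ennreal borel_measurable_const Gm)
    also have "\<dots> = c ^ card (insert i I) * (\<integral>\<^sup>+x. (\<integral>\<^sup>+y. F (x(i := y)) \<partial>\<nu>) \<partial>(\<Pi>\<^sub>M i\<in>I. \<nu>))"
      using Gm insert by (subst nn_integral_cmult) (auto simp: mult_ac)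
    also have "(\<integral>\<^sup>+x. (\<integral>\<^sup>+y. F (x(i := y)) \<partial>\<nu>) \<partial>(\<Pi>\<^sub>M i\<in>I. \<nu>)) = (\<integral>\<^sup>+x. F x \<partial>(\<Pi>\<^sub>M i\<in>insert i I. \<nu>))"
      using insert by (intro N.product_nn_integral_insert[symmetric]) auto
    finally show ?case .
  qed
qed

section \<open>Domination carried from an algebra to the sigma-algebra it generates\<close>

text \<open>One set approximates \<open>B\<close> under both measures at once, since a comparison
  between the two is to be transferred. A countable union is first cut off at finitely many sets,
  which are then approximated separately.\<close>

lemma algebra_approx:
  assumes alg: "algebra \<Omega> \<A>" and A: "\<A> \<subseteq> sets M" "sets N = sets M" and fin: "finite_measure M" "finite_measure N"
    and sp: "space M = \<Omega>" "space N = \<Omega>"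
    and B: "B \<in> sigma_sets \<Omega> \<A>" and e: "e > 0"
  shows "\<exists>A\<in>\<A>. measure M ((A - B) \<union> (B - A)) < e \<and> measure N ((A - B) \<union> (B - A)) < e"
proof -
  interpret algebra \<Omega> \<A> by fact
  interpret M: finite_measure M by fact
  interpret N: finite_measure N by fact
  have SM: "X \<in> sets M" "X \<in> sets N" if "X \<in> sigma_sets \<Omega> \<A>" for X
    using sets.sigma_sets_subset[OF A(1)] that A(2) sp by auto
  show ?thesis
    using B e
  proof (induction arbitrary: e rule: sigma_sets.induct)
    case (Basic a)
    then show ?case by (intro bexI[of _ a]) auto
  next
    case Empty
    then show ?case by (intro bexI[of _ "{}"]) auto
  next
    case (Compl a)
    obtain A' where A': "A' \<in> \<A>" "measure M ((A' - a) \<union> (a - A')) < e" "measure N ((A' - a) \<union> (a - A')) < e"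
      using Compl.IH[OF Compl.prems] by blast
    have "((\<Omega> - A') - (\<Omega> - a)) \<union> ((\<Omega> - a) - (\<Omega> - A')) = (A' - a) \<union> (a - A')"
      using space_closed A'(1) sigma_sets_into_sp[OF space_closed Compl.hyps] by auto
    then show ?case using A' by (intro bexI[of _ "\<Omega> - A'"]) auto
  next
    case (Union a)
    define U where "U n = (\<Union>i<n. a i)" for n :: nat
    have UM: "U n \<in> sets M" "U n \<in> sets N" for n
      unfolding U_def using SM Union.hyps by (auto intro!: sets.finite_UN)
    have aM: "(\<Union>i. a i) \<in> sets M" "(\<Union>i. a i) \<in> sets N"
      using SM Union.hyps by (auto intro!: sets.countable_UN)
    have inc: "incseq U" unfolding U_def incseq_def by force
    have UU: "(\<Union>i. U i) = (\<Union>i. a i)" unfolding U_def by auto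
    have "(\<lambda>n. measure M (U n)) \<longlonglongrightarrow> measure M (\<Union>i. a i)" "(\<lambda>n. measure N (U n)) \<longlonglongrightarrow> measure N (\<Union>i. a i)"
      using M.finite_Lim_measure_incseq[OF _ inc] N.finite_Lim_measure_incseq[OF _ inc] UM UU by auto
    then have "\<forall>\<^sub>F n in sequentially. measure M (\<Union>i. a i) - e/2 < measure M (U n) \<and> measure N (\<Union>i. a i) - e/2 < measure N (U n)"
      using Union.prems by (intro eventually_conj order_tendstoD(1)) auto
    then obtain n where n: "measure M (\<Union>i. a i) - e/2 < measure M (U n)" "measure N (\<Union>i. a i) - e/2 < measure N (U n)"
      using eventually_happens'[OF sequentially_bot] by blast
    have sub: "U n \<subseteq> (\<Union>i. a i)" by (auto simp: U_def)
    have d: "measure M ((\<Union>i. a i) - U n) < e/2" "measure N ((\<Union>i. a i) - U n) < e/2"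
      using n M.finite_measure_Diff[OF aM(1) UM(1) sub] N.finite_measure_Diff[OF aM(2) UM(2) sub] by auto
    \<comment> \<open>The cutoff uses up half of \<open>e\<close> and the other half is split over
      the n sets, with \<open>Suc n\<close> so that n = 0 causes no division by zero.\<close>
    define d where "d = e / (2 * real (Suc n))"
    have "d > 0" using Union.prems by (simp add: d_def)
    note IH = Union.IH[OF this]
    define A' where "A' i = (SOME A. A \<in> \<A> \<and> measure M ((A - a i) \<union> (a i - A)) < d \<and> measure N ((A - a i) \<union> (a i - A)) < d)" for i
    have "A' i \<in> \<A> \<and> measure M ((A' i - a i) \<union> (a i - A' i)) < d \<and> measure N ((A' i - a i) \<union> (a i - A' i)) < d" for i
      unfolding A'_def by (rule someI_ex) (use IH[of i] in blast)
    then have A': "\<And>i. A' i \<in> \<A>" "\<And>i. measure M ((A' i - a i) \<union> (a i - A' i)) < d" "\<And>i. measure N ((A' i - a i) \<union> (a i - A' i)) < d"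
      by simp_all
    define S where "S i = (A' i - a i) \<union> (a i - A' i)" for i
    have SS: "S i \<in> sets M" "S i \<in> sets N" for i
      unfolding S_def using A'(1) A SM Union.hyps by (auto intro!: sets.Un sets.Diff)
    let ?A = "\<Union>i<n. A' i"
    have Aalg: "?A \<in> \<A>" using A'(1) by (intro finite_UN) auto
    have incl: "(?A - (\<Union>i. a i)) \<union> ((\<Union>i. a i) - ?A) \<subseteq> ((\<Union>i. a i) - U n) \<union> (\<Union>i<n. S i)"
      by (auto simp: U_def S_def)
    have bound: "measure P ((?A - (\<Union>i. a i)) \<union> ((\<Union>i. a i) - ?A)) < e"
      if "finite_measure P" and PS: "\<And>i. S i \<in> sets P" "U n \<in> sets P" "(\<Union>i. a i) \<in> sets P" "?A \<in> sets P"
        and P: "measure P ((\<Union>i. a i) - U n) < e/2" "\<And>i. measure P (S i) < d" for P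
    proof -
      interpret P: finite_measure P by fact
      have "measure P ((?A - (\<Union>i. a i)) \<union> ((\<Union>i. a i) - ?A)) \<le> measure P (((\<Union>i. a i) - U n) \<union> (\<Union>i<n. S i))"
        by (rule P.finite_measure_mono[OF incl sets.Un[OF sets.Diff[OF PS(3,2)] sets.finite_UN]]) (use PS in auto)
      also have "\<dots> \<le> measure P ((\<Union>i. a i) - U n) + measure P (\<Union>i<n. S i)"
        by (rule measure_Un_le[OF sets.Diff[OF PS(3,2)] sets.finite_UN]) (use PS in auto)
      also have "measure P (\<Union>i<n. S i) \<le> (\<Sum>i<n. measure P (S i))"
        using PS by (intro P.finite_measure_subadditive_finite) auto
      also have "\<dots> \<le> (\<Sum>i<n. d)" using P(2) by (intro sum_mono less_imp_le)
      also have "\<dots> \<le> e/2" using Union.prems by (simp add: d_def field_simps)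
      finally show ?thesis using P(1) by simp
    qed
    have AS: "?A \<in> sets M" "?A \<in> sets N" using Aalg A by auto
    have "measure M ((?A - (\<Union>i. a i)) \<union> ((\<Union>i. a i) - ?A)) < e"
      by (rule bound[OF fin(1) SS(1) UM(1) aM(1) AS(1) d(1) A'(2)[folded S_def]])
    moreover have "measure N ((?A - (\<Union>i. a i)) \<union> ((\<Union>i. a i) - ?A)) < e"
      by (rule bound[OF fin(2) SS(2) UM(2) aM(2) AS(2) d(2) A'(3)[folded S_def]])
    ultimately show ?case using Aalg by blast
  qed
qed

text \<open>The inequality does not pass to complements, so the usual induction over generated sets
  fails; approximation by sets of the algebra carries it over.\<close>

lemma algebra_dominated:
  assumes alg: "algebra \<Omega> \<A>" and A: "\<A> \<subseteq> sets M" "sets N = sets M" and fin: "finite_measure M" "finite_measure N"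
    and sp: "space M = \<Omega>" "space N = \<Omega>"
    and dom: "\<And>A. A \<in> \<A> \<Longrightarrow> measure M A \<le> c * measure N A" and c: "c \<ge> 0"
    and B: "B \<in> sigma_sets \<Omega> \<A>"
  shows "measure M B \<le> c * measure N B"
proof (rule field_le_epsilon)
  interpret M: finite_measure M by fact
  interpret N: finite_measure N by fact
  fix e :: real assume e: "e > 0"
  \<comment> \<open>The approximation error enters once as it is and once multiplied by
    \<open>c\<close>.\<close>
  define d where "d = e / (1 + c)"
  have d: "d > 0" using e c by (simp add: d_def)
  obtain A' where A': "A' \<in> \<A>" "measure M ((A' - B) \<union> (B - A')) < d" "measure N ((A' - B) \<union> (B - A')) < d"
    using algebra_approx[OF alg A fin sp B d] by blast
  have BM: "B \<in> sets M" "B \<in> sets N"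
    using sets.sigma_sets_subset[OF A(1)] B A(2) sp by auto
  have AM: "A' \<in> sets M" "A' \<in> sets N" using A'(1) A by auto
  have "measure M B \<le> measure M (A' \<union> ((A' - B) \<union> (B - A')))"
    using BM AM by (intro M.finite_measure_mono) auto
  also have "\<dots> \<le> measure M A' + measure M ((A' - B) \<union> (B - A'))"
    using BM AM by (intro measure_Un_le) auto
  also have "\<dots> \<le> c * measure N A' + d" using dom[OF A'(1)] A'(2) by simp
  also have "measure N A' \<le> measure N (B \<union> ((A' - B) \<union> (B - A')))"
    using BM AM by (intro N.finite_measure_mono) auto
  also have "\<dots> \<le> measure N B + measure N ((A' - B) \<union> (B - A'))"
    using BM AM by (intro measure_Un_le) auto
  also have "\<dots> \<le> measure N B + d" using A'(3) by simp
  finally have "measure M B \<le> c * (measure N B + d) + d" using c by (simp add: mult_left_mono)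
  also have "\<dots> = c * measure N B + d * (1 + c)" by (simp add: algebra_simps)
  also have "d * (1 + c) = e" using c by (simp add: d_def)
  finally show "measure M B \<le> c * measure N B + e" .
qed

text \<open>The one-sided bound is applied to the nonnegative functions K + f and K - f. As both
  measures have mass 1, this bounds the difference of the integrals from both sides by 2 K (c - 1);
  the final 4 comes from adding real and imaginary parts.\<close>

lemma dominated_integral_diff:
  fixes \<Phi> :: "'b \<Rightarrow> complex"
  assumes "prob_space \<mu>" "prob_space \<nu>" and s [measurable_cong]: "sets \<mu> = sets \<nu>"
    and dom: "\<And>B. B \<in> sets \<nu> \<Longrightarrow> measure \<mu> B \<le> c * measure \<nu> B" and c: "c \<ge> 1"
    and [measurable]: "\<Phi> \<in> borel_measurable \<nu>" and K: "\<And>x. x \<in> space \<nu> \<Longrightarrow> norm (\<Phi> x) \<le> K"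
  shows "norm ((\<integral>x. \<Phi> x \<partial>\<mu>) - (\<integral>x. \<Phi> x \<partial>\<nu>)) \<le> 4 * K * (c - 1)"
proof -
  interpret \<mu>: prob_space \<mu> by fact
  interpret \<nu>: prob_space \<nu> by fact
  have spc: "space \<mu> = space \<nu>" by (rule sets_eq_imp_space_eq[OF s])
  have le: "\<mu> \<le> scale_measure (ennreal c) \<nu>"
  proof (subst le_measure)
    show "\<forall>B\<in>sets \<mu>. emeasure \<mu> B \<le> emeasure (scale_measure (ennreal c) \<nu>) B"
    proof
    fix B assume "B \<in> sets \<mu>"
    then have "measure \<mu> B \<le> c * measure \<nu> B" using dom s by simp
    then show "emeasure \<mu> B \<le> emeasure (scale_measure (ennreal c) \<nu>) B"
      using c by (simp add: \<mu>.emeasure_eq_measure \<nu>.emeasure_eq_measure ennreal_mult'[symmetric] ennreal_leI)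
    qed
  qed (use s in auto)
  have pos: "(\<integral>x. F x \<partial>\<mu>) \<le> c * (\<integral>x. F x \<partial>\<nu>)"
    if [measurable]: "F \<in> borel_measurable \<nu>" and F: "\<And>x. x \<in> space \<nu> \<Longrightarrow> 0 \<le> F x" "\<And>x. x \<in> space \<nu> \<Longrightarrow> F x \<le> L" for F and L :: real
  proof -
    have i: "integrable \<mu> F" "integrable \<nu> F"
      using F s by (auto intro!: \<mu>.integrable_const_bound[where B=L] \<nu>.integrable_const_bound[where B=L] AE_I2 simp: spc)
    have "ennreal (\<integral>x. F x \<partial>\<mu>) = (\<integral>\<^sup>+x. F x \<partial>\<mu>)"
      using i F by (subst nn_integral_eq_integral) (auto simp: spc)
    also have "\<dots> \<le> (\<integral>\<^sup>+x. F x \<partial>scale_measure (ennreal c) \<nu>)"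
      using le by (intro nn_integral_mono_measure) (auto simp: s)
    also have "\<dots> = ennreal c * (\<integral>\<^sup>+x. F x \<partial>\<nu>)" by (intro nn_integral_scale_measure) measurable
    also have "(\<integral>\<^sup>+x. F x \<partial>\<nu>) = ennreal (\<integral>x. F x \<partial>\<nu>)"
      using i F by (subst nn_integral_eq_integral) auto
    finally have "ennreal (\<integral>x. F x \<partial>\<mu>) \<le> ennreal (c * (\<integral>x. F x \<partial>\<nu>))"
      using c by (simp add: ennreal_mult')
    moreover have "0 \<le> c * (\<integral>x. F x \<partial>\<nu>)" using c F by (intro mult_nonneg_nonneg integral_nonneg_AE AE_I2) auto
    ultimately show ?thesis by (simp only: ennreal_le_iff)
  qed
  have diff: "\<bar>(\<integral>x. f x \<partial>\<mu>) - (\<integral>x. f x \<partial>\<nu>)\<bar> \<le> 2 * K * (c - 1)"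
    if [measurable]: "f \<in> borel_measurable \<nu>" and f: "\<And>x. x \<in> space \<nu> \<Longrightarrow> \<bar>f x\<bar> \<le> K" for f
  proof -
    have i: "integrable \<mu> f" "integrable \<nu> f"
      using f s by (auto intro!: \<mu>.integrable_const_bound[where B=K] \<nu>.integrable_const_bound[where B=K] AE_I2 simp: spc)
    have "(\<integral>x. K + f x \<partial>\<mu>) \<le> c * (\<integral>x. K + f x \<partial>\<nu>)"
    proof (rule pos)
      show "0 \<le> K + f x" "K + f x \<le> 2 * K" if "x \<in> space \<nu>" for x
        using f[OF that] by (simp_all add: abs_le_iff)
    qed measurable
    then have 1: "K + (\<integral>x. f x \<partial>\<mu>) \<le> c * (K + (\<integral>x. f x \<partial>\<nu>))"
      using i by (simp add: \<mu>.prob_space \<nu>.prob_space)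
    have "(\<integral>x. K - f x \<partial>\<mu>) \<le> c * (\<integral>x. K - f x \<partial>\<nu>)"
    proof (rule pos)
      show "0 \<le> K - f x" "K - f x \<le> 2 * K" if "x \<in> space \<nu>" for x
        using f[OF that] by (simp_all add: abs_le_iff)
    qed measurable
    then have 2: "K - (\<integral>x. f x \<partial>\<mu>) \<le> c * (K - (\<integral>x. f x \<partial>\<nu>))"
      using i by (simp add: \<mu>.prob_space \<nu>.prob_space)
    have "\<bar>\<integral>x. f x \<partial>\<nu>\<bar> \<le> (\<integral>x. \<bar>f x\<bar> \<partial>\<nu>)" by (rule integral_abs_bound)
    also have "\<dots> \<le> K" using f i by (intro \<nu>.integral_le_const) auto
    finally have 3: "\<bar>\<integral>x. f x \<partial>\<nu>\<bar> \<le> K" .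
    have "(c - 1) * \<bar>\<integral>x. f x \<partial>\<nu>\<bar> \<le> (c - 1) * K" using c 3 by (intro mult_left_mono) auto
    moreover have "\<bar>(c - 1) * (\<integral>x. f x \<partial>\<nu>)\<bar> = (c - 1) * \<bar>\<integral>x. f x \<partial>\<nu>\<bar>" using c by (simp add: abs_mult)
    ultimately show ?thesis using 1 2 by (simp add: algebra_simps abs_le_iff)
  qed
  have i: "integrable \<mu> \<Phi>" "integrable \<nu> \<Phi>"
    using K s by (auto intro!: \<mu>.integrable_const_bound[where B=K] \<nu>.integrable_const_bound[where B=K] AE_I2 simp: spc)
  have "norm ((\<integral>x. \<Phi> x \<partial>\<mu>) - (\<integral>x. \<Phi> x \<partial>\<nu>)) \<le> \<bar>Re ((\<integral>x. \<Phi> x \<partial>\<mu>) - (\<integral>x. \<Phi> x \<partial>\<nu>))\<bar> + \<bar>Im ((\<integral>x. \<Phi> x \<partial>\<mu>) - (\<integral>x. \<Phi> x \<partial>\<nu>))\<bar>"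
    by (rule cmod_le)
  also have "\<dots> = \<bar>(\<integral>x. Re (\<Phi> x) \<partial>\<mu>) - (\<integral>x. Re (\<Phi> x) \<partial>\<nu>)\<bar> + \<bar>(\<integral>x. Im (\<Phi> x) \<partial>\<mu>) - (\<integral>x. Im (\<Phi> x) \<partial>\<nu>)\<bar>"
    using i by simp
  also have "\<dots> \<le> 2 * K * (c - 1) + 2 * K * (c - 1)"
    using K abs_Re_le_cmod abs_Im_le_cmod by (intro add_mono diff) (auto intro: order_trans)
  finally show ?thesis by simp
qed

section \<open>The past of a path up to a fixed time\<close>

text \<open>Encodes the past: events decided by time \<open>T\<close> are preimages under
  \<open>stop T\<close>, and a functional of the path up to \<open>T\<close> is one invariant under
  it.\<close>

definition stop :: "real \<Rightarrow> (real \<Rightarrow> 'a) \<Rightarrow> real \<Rightarrow> 'a" where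
  "stop T X s = X (min s T)"

lemma stop_D0:
  fixes X :: "real \<Rightarrow> 'a::euclidean_space"
  assumes X: "X \<in> D0" and T: "T \<ge> 0" shows "stop T X \<in> D0"
  unfolding D0_def
proof (intro CollectI conjI allI impI)
  show "stop T X 0 = 0" using X T by (simp add: stop_def D0_def)
  fix t :: real
  show "stop T X t = 0" if "t < 0" using that X T by (simp add: stop_def D0_def min_def)
  show "continuous (at_right t) (stop T X)" if "0 \<le> t"
  proof (cases "t < T")
    case True
    have "\<forall>\<^sub>F u in at_right t. u \<in> {t<..<T}" using True by (rule eventually_at_right_real)
    then have "\<forall>\<^sub>F u in at_right t. X u = stop T X u" by eventually_elim (simp add: stop_def)
    moreover have "(X \<longlongrightarrow> X t) (at_right t)" using X that by (simp add: D0_def continuous_within)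
    ultimately show ?thesis using True by (simp add: continuous_within stop_def[of T X t] tendsto_cong)
  next
    case False
    have "\<forall>\<^sub>F u in at_right t. X T = stop T X u"
      unfolding eventually_at_filter using False by (auto simp: stop_def min_def)
    then have "(stop T X \<longlongrightarrow> X T) (at_right t)" by (rule Lim_transform_eventually[OF tendsto_const])
    then show ?thesis using False by (auto simp: continuous_within stop_def[of T X t] min_def)
  qed
  show "\<exists>l. (stop T X \<longlongrightarrow> l) (at_left t)" if t: "0 < t"
  proof (cases "t \<le> T")
    case True
    obtain l where "(X \<longlongrightarrow> l) (at_left t)" using X t by (auto simp: D0_def)
    moreover have "\<forall>\<^sub>F u in at_left t. X u = stop T X u"
      unfolding eventually_at_filter using True by (auto simp: stop_def)
    ultimately show ?thesis by (blast intro: Lim_transform_eventually)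
  next
    case False
    then have "\<forall>\<^sub>F u in at_left t. u \<in> {T<..<t}" by (intro eventually_at_left_real) auto
    then have "\<forall>\<^sub>F u in at_left t. X T = stop T X u" by eventually_elim (simp add: stop_def)
    then show ?thesis by (blast intro: Lim_transform_eventually[OF tendsto_const])
  qed
qed

lemma stop_stop: "T \<le> T' \<Longrightarrow> stop T (stop T' X) = stop T X"
  by (auto simp: stop_def fun_eq_iff min_def)

definition grid_incr :: "nat \<Rightarrow> nat \<Rightarrow> (real \<Rightarrow> 'a::euclidean_space) \<Rightarrow> nat \<Rightarrow> 'a" where
  "grid_incr T n X = (\<lambda>k\<in>{..<T * 2 ^ n}. X (real (Suc k) / 2 ^ n) - X (real k / 2 ^ n))"

lemma grid_incr_measurable [measurable]:
  "grid_incr T n \<in> (cyl_space :: (real \<Rightarrow> 'a::euclidean_space) measure) \<rightarrow>\<^sub>M (\<Pi>\<^sub>M k\<in>{..<T * 2 ^ n}. borel)"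
  unfolding grid_incr_def[abs_def] by (intro measurable_restrict borel_measurable_diff measurable_coord)

text \<open>They form an algebra because an event of one dyadic level is also one of every finer
  level, so two events can always be written on a common grid.\<close>

definition grid_sets :: "nat \<Rightarrow> (real \<Rightarrow> 'a::euclidean_space) set set" where
  "grid_sets T = {grid_incr T n -` B \<inter> D0 | n B. B \<in> sets (\<Pi>\<^sub>M k\<in>{..<T * 2 ^ n}. borel)}"

lemma grid_sets_sub: "grid_sets T \<subseteq> sets cyl_space"
  by (auto simp: grid_sets_def simp flip: space_cyl intro!: measurable_sets[OF grid_incr_measurable])

definition coarsen :: "nat \<Rightarrow> nat \<Rightarrow> (nat \<Rightarrow> 'a::euclidean_space) \<Rightarrow> nat \<Rightarrow> 'a" where
  "coarsen K r f = (\<lambda>k\<in>{..<K}. \<Sum>j\<in>{k * r..<Suc k * r}. f j)"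

lemma coarsen_measurable: "coarsen K r \<in> (\<Pi>\<^sub>M k\<in>{..<K * r}. borel) \<rightarrow>\<^sub>M (\<Pi>\<^sub>M k\<in>{..<K}. borel)"
  unfolding coarsen_def[abs_def]
proof (intro measurable_restrict borel_measurable_sum measurable_component_singleton)
  fix k j assume "k \<in> {..<K}" "j \<in> {k * r..<Suc k * r}"
  then have "j < Suc k * r" "Suc k * r \<le> K * r" by (auto intro: mult_right_mono simp del: mult_Suc)
  then show "j \<in> {..<K * r}" by simp
qed

lemma grid_incr_coarsen:
  assumes "n \<le> n'" shows "grid_incr T n X = coarsen (T * 2 ^ n) (2 ^ (n' - n)) (grid_incr T n' X)"
proof
  fix k
  let ?r = "2 ^ (n' - n) :: nat"
  have r: "(2::nat) ^ n * ?r = 2 ^ n'" using assms by (simp add: power_add[symmetric])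
  have rr: "(2::real) ^ n' = 2 ^ n * 2 ^ (n' - n)" using assms by (simp add: power_add[symmetric])
  show "grid_incr T n X k = coarsen (T * 2 ^ n) ?r (grid_incr T n' X) k"
  proof (cases "k < T * 2 ^ n")
    case True
    then have "Suc k * ?r \<le> T * 2 ^ n * ?r" by (intro mult_right_mono) auto
    then have le: "Suc k * ?r \<le> T * 2 ^ n'" by (simp add: mult.assoc r)
    have "(\<Sum>j\<in>{k * ?r..<Suc k * ?r}. grid_incr T n' X j) = (\<Sum>j\<in>{k * ?r..<Suc k * ?r}. X (real (Suc j) / 2 ^ n') - X (real j / 2 ^ n'))"
      using le by (intro sum.cong refl) (auto simp: grid_incr_def)
    also have "\<dots> = X (real (Suc k * ?r) / 2 ^ n') - X (real (k * ?r) / 2 ^ n')"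
      by (rule sum_Suc_diff'[of _ _ "\<lambda>j. X (real j / 2 ^ n')"]) simp
    also have "\<dots> = X (real (Suc k) / 2 ^ n) - X (real k / 2 ^ n)"
      unfolding rr of_nat_mult by simp
    finally show ?thesis using True by (simp add: coarsen_def grid_incr_def del: of_nat_Suc)
  qed (simp add: coarsen_def grid_incr_def)
qed

lemma grid_sets_level:
  assumes A: "A = grid_incr T n -` B \<inter> D0" "B \<in> sets (\<Pi>\<^sub>M k\<in>{..<T * 2 ^ n}. borel)" and n: "n \<le> n'"
  shows "\<exists>B'\<in>sets (\<Pi>\<^sub>M k\<in>{..<T * 2 ^ n'}. borel). A = grid_incr T n' -` B' \<inter> (D0 :: (real \<Rightarrow> 'a::euclidean_space) set)"
proof -
  let ?c = "coarsen (T * 2 ^ n) (2 ^ (n' - n)) :: (nat \<Rightarrow> 'a) \<Rightarrow> nat \<Rightarrow> 'a"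
  let ?P = "\<Pi>\<^sub>M k\<in>{..<T * 2 ^ n'}. (borel :: 'a measure)"
  have e: "T * 2 ^ n * 2 ^ (n' - n) = T * 2 ^ n'" using n by (simp add: mult.assoc power_add[symmetric])
  have c: "?c \<in> ?P \<rightarrow>\<^sub>M (\<Pi>\<^sub>M k\<in>{..<T * 2 ^ n}. borel)"
    using coarsen_measurable[of "T * 2 ^ n" "2 ^ (n' - n)"] unfolding e .
  have "A = grid_incr T n' -` (?c -` B \<inter> space ?P) \<inter> D0"
  proof -
    have gi: "grid_incr T n X = ?c (grid_incr T n' X)" for X :: "real \<Rightarrow> 'a" by (rule grid_incr_coarsen[OF n])
    have "grid_incr T n' X \<in> space ?P" for X :: "real \<Rightarrow> 'a" by (simp add: grid_incr_def space_PiM)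
    then show ?thesis unfolding A(1) by (auto simp: gi)
  qed
  then show ?thesis using measurable_sets[OF c A(2)] by blast
qed

lemma algebra_grid_sets: "algebra D0 (grid_sets T :: (real \<Rightarrow> 'a::euclidean_space) set set)"
  unfolding algebra_iff_Un
proof (intro conjI ballI)
  show "grid_sets T \<subseteq> Pow D0" by (auto simp: grid_sets_def)
  show "{} \<in> (grid_sets T :: (real \<Rightarrow> 'a) set set)" unfolding grid_sets_def by (intro CollectI exI[of _ 0] exI[of _ "{}"]) auto
  fix A :: "(real \<Rightarrow> 'a) set" assume "A \<in> grid_sets T"
  then obtain n A' where A: "A = grid_incr T n -` A' \<inter> D0" "A' \<in> sets (\<Pi>\<^sub>M k\<in>{..<T * 2 ^ n}. borel)"
    unfolding grid_sets_def by blast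
  have "D0 - A = grid_incr T n -` (space (\<Pi>\<^sub>M k\<in>{..<T * 2 ^ n}. borel) - A') \<inter> D0"
    using A(1) by (auto simp: space_PiM grid_incr_def)
  moreover have "space (\<Pi>\<^sub>M k\<in>{..<T * 2 ^ n}. borel) - A' \<in> sets (\<Pi>\<^sub>M k\<in>{..<T * 2 ^ n}. (borel :: 'a measure))"
    using A(2) by auto
  ultimately show "D0 - A \<in> grid_sets T" unfolding grid_sets_def by blast
  fix B :: "(real \<Rightarrow> 'a) set" assume "B \<in> grid_sets T"
  then obtain n' B' where B: "B = grid_incr T n' -` B' \<inter> D0" "B' \<in> sets (\<Pi>\<^sub>M k\<in>{..<T * 2 ^ n'}. borel)"
    unfolding grid_sets_def by blast
  obtain A2 B2 where A2: "A2 \<in> sets (\<Pi>\<^sub>M k\<in>{..<T * 2 ^ max n n'}. borel)" "A = grid_incr T (max n n') -` A2 \<inter> D0"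
    and B2: "B2 \<in> sets (\<Pi>\<^sub>M k\<in>{..<T * 2 ^ max n n'}. borel)" "B = grid_incr T (max n n') -` B2 \<inter> D0"
    using grid_sets_level[OF A, of "max n n'"] grid_sets_level[OF B, of "max n n'"] by auto
  show "A \<union> B \<in> grid_sets T" unfolding grid_sets_def
    by (intro CollectI exI[of _ "max n n'"] exI[of _ "A2 \<union> B2"]) (use A2 B2 in auto)
qed

text \<open>By right-continuity the value at a time t < T is a limit of values at dyadic points
  above \<open>t\<close>, and the value at \<open>T\<close> is itself a sum of grid increments.
  Hence the grid events generate the whole past.\<close>

lemma stop_grid_measurable: "stop (real T) \<in> sigma D0 (grid_sets T) \<rightarrow>\<^sub>M (cyl_space :: (real \<Rightarrow> 'a::euclidean_space) measure)"
proof (rule measurable_into_cyl)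
  interpret algebra D0 "grid_sets T :: (real \<Rightarrow> 'a) set set" by (rule algebra_grid_sets)
  have sp: "space (sigma D0 (grid_sets T)) = (D0 :: (real \<Rightarrow> 'a) set)" using space_closed by (rule space_measure_of)
  show "stop (real T) X \<in> D0" if "X \<in> space (sigma D0 (grid_sets T))" for X :: "real \<Rightarrow> 'a"
    using that unfolding sp by (rule stop_D0) simp
  have gm: "grid_incr T n \<in> sigma D0 (grid_sets T) \<rightarrow>\<^sub>M (\<Pi>\<^sub>M k\<in>{..<T * 2 ^ n}. (borel :: 'a measure))" for n
  proof (rule measurableI)
    fix B assume "B \<in> sets (\<Pi>\<^sub>M k\<in>{..<T * 2 ^ n}. (borel :: 'a measure))"
    then have "grid_incr T n -` B \<inter> D0 \<in> grid_sets T"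
      unfolding grid_sets_def by blast
    then show "grid_incr T n -` B \<inter> space (sigma D0 (grid_sets T)) \<in> sets (sigma D0 (grid_sets T))"
      by (simp only: sp sets_measure_of[OF space_closed] sigma_sets.Basic)
  qed (auto simp: space_PiM grid_incr_def)
  have pt: "(\<lambda>X. X (real k / 2 ^ n)) \<in> sigma D0 (grid_sets T) \<rightarrow>\<^sub>M (borel :: 'a measure)" if k: "k \<le> T * 2 ^ n" for k n
  proof -
    have "(\<lambda>X. \<Sum>j<k. grid_incr T n X j) \<in> sigma D0 (grid_sets T) \<rightarrow>\<^sub>M (borel :: 'a measure)"
      using k by (intro borel_measurable_sum measurable_compose[OF gm] measurable_component_singleton) auto
    moreover have "(\<Sum>j<k. grid_incr T n X j) = X (real k / 2 ^ n)" if "X \<in> D0" for X :: "real \<Rightarrow> 'a"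
    proof -
      have "(\<Sum>j<k. grid_incr T n X j) = (\<Sum>j<k. X (real (Suc j) / 2 ^ n) - X (real j / 2 ^ n))"
        using k by (intro sum.cong refl) (auto simp: grid_incr_def)
      also have "\<dots> = X (real k / 2 ^ n) - X (real 0 / 2 ^ n)" by (rule sum_lessThan_telescope)
      finally show ?thesis using that by (simp add: D0_zero)
    qed
    ultimately show ?thesis by (subst measurable_cong[where g="\<lambda>X. \<Sum>j<k. grid_incr T n X j"]) (auto simp: sp)
  qed
  fix t :: real assume t: "0 \<le> t"
  show "(\<lambda>X. stop (real T) X t) \<in> sigma D0 (grid_sets T) \<rightarrow>\<^sub>M (borel :: 'a measure)"
  proof (cases "t < T")
    case True
    \<comment> \<open>Capping at T 2^n keeps the point inside the grid; as t < T it still lies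
      strictly above \<open>t\<close>.\<close>
    define q where "q n = min (nat \<lfloor>t * 2 ^ n\<rfloor> + 1) (T * 2 ^ n)" for n :: nat
    have qe: "real (q n) / 2 ^ n = min (dyadic_above n t) (real T)" for n
      by (simp add: q_def dyadic_above_def of_nat_min min_divide_distrib_right add.commute)
    have "(\<lambda>X. lim (\<lambda>n. X (real (q n) / 2 ^ n))) \<in> sigma D0 (grid_sets T) \<rightarrow>\<^sub>M (borel :: 'a measure)"
      by (intro borel_measurable_lim_metric pt) (simp add: q_def)
    moreover have "lim (\<lambda>n. X (real (q n) / 2 ^ n)) = stop (real T) X t" if X: "X \<in> D0" for X :: "real \<Rightarrow> 'a"
    proof (rule limI)
      have "filterlim (\<lambda>n. min (dyadic_above n t) (real T)) (at_right t) sequentially"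
        unfolding filterlim_at
      proof
        show "\<forall>\<^sub>F n in sequentially. min (dyadic_above n t) (real T) \<in> {t<..} \<and> min (dyadic_above n t) (real T) \<noteq> t"
        proof (intro always_eventually allI)
          fix n
          have "t < min (dyadic_above n t) (real T)" using dyadic_above_bounds(1)[OF t, of n] True by simp
          then show "min (dyadic_above n t) (real T) \<in> {t<..} \<and> min (dyadic_above n t) (real T) \<noteq> t"
            by (metis greaterThan_iff less_irrefl)
        qed
        show "(\<lambda>n. min (dyadic_above n t) (real T)) \<longlonglongrightarrow> t"
          using tendsto_min[OF dyadic_above_tendsto[OF t] tendsto_const[of "real T"]] True by simp
      qed
      moreover have "(X \<longlongrightarrow> X t) (at_right t)" using X t by (simp add: D0_def continuous_within)
      ultimately show "(\<lambda>n. X (real (q n) / 2 ^ n)) \<longlonglongrightarrow> stop (real T) X t"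
        unfolding qe using True by (auto simp: stop_def intro: filterlim_compose)
    qed
    ultimately show ?thesis by (subst measurable_cong[where g="\<lambda>X. lim (\<lambda>n. X (real (q n) / 2 ^ n))"]) (auto simp: sp)
  next
    case False
    then have "(\<lambda>X::real \<Rightarrow> 'a. stop (real T) X t) = (\<lambda>X. X (real T / 2 ^ 0))" by (auto simp: stop_def min_def)
    then show ?thesis using pt[of T 0] by simp
  qed
qed

lemma stop_measurable: "T \<ge> 0 \<Longrightarrow> stop T \<in> cyl_space \<rightarrow>\<^sub>M (cyl_space :: (real \<Rightarrow> 'a::euclidean_space) measure)"
  by (rule measurable_into_cyl) (auto simp: stop_D0, auto simp: stop_def)

section \<open>Comparison and uniqueness of the Levy laws\<close>

text \<open>Stated for an arbitrary measure with the law rather than for \<open>lam m\<close>,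
  because uniqueness has to compare two of them.\<close>

locale rel_levy =
  fixes m :: real and M :: "(real \<Rightarrow> 'a::euclidean_space) measure"
  assumes m: "m \<ge> 0" and law: "is_rel_levy_law m M"
begin

sublocale prob_space M using law by (simp add: is_rel_levy_law_def)

lemma sets_M [measurable_cong, simp]: "sets M = sets cyl_space"
  using law by (simp add: is_rel_levy_law_def)

lemma space_M [simp]: "space M = D0"
  using sets_eq_imp_space_eq[OF sets_M] by simp

lemma indep_increments:
  "0 \<le> ts 0 \<Longrightarrow> (\<And>k. k < n \<Longrightarrow> ts k < ts (Suc k)) \<Longrightarrow> indep_vars (\<lambda>_. borel) (\<lambda>k X. X (ts (Suc k)) - X (ts k)) {..<n}"
  using law unfolding is_rel_levy_law_def by blast

lemma stationary: "0 \<le> s \<Longrightarrow> s \<le> t \<Longrightarrow> distr M borel (\<lambda>X. X t - X s) = distr M borel (\<lambda>X. X (t - s))"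
  using law unfolding is_rel_levy_law_def by blast

lemma cf: "0 \<le> t \<Longrightarrow> (\<integral>X. cis (\<xi> \<bullet> X t) \<partial>M) = of_real (exp (- (t * rel_exponent m \<xi>)))"
  using law unfolding is_rel_levy_law_def rel_exponent_def by (simp only: exp_of_real[symmetric] of_real_minus)

lemma law_increment:
  assumes "0 \<le> s" "s < t" shows "distr M borel (\<lambda>X. X t - X s) = rel_marginal m (t - s)"
proof -
  have "distr M borel (\<lambda>X. X (t - s)) = rel_marginal m (t - s)"
  proof (rule cf_unique)
    fix \<xi> :: 'a
    have "(\<integral>x. cis (\<xi> \<bullet> x) \<partial>distr M borel (\<lambda>X. X (t - s))) = (\<integral>X. cis (\<xi> \<bullet> X (t - s)) \<partial>M)"
      by (subst integral_distr) auto
    then show "(\<integral>x. cis (\<xi> \<bullet> x) \<partial>distr M borel (\<lambda>X. X (t - s))) = (\<integral>x. cis (\<xi> \<bullet> x) \<partial>rel_marginal m (t - s))"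
      using assms m by (simp add: cf rel_marginal_cf)
  qed (use assms m in \<open>auto intro!: prob_space_distr prob_space_rel_marginal\<close>)
  then show ?thesis using stationary[of s t] assms by simp
qed

lemma grid_law: "distr M (\<Pi>\<^sub>M k\<in>{..<T * 2 ^ n}. borel) (grid_incr T n) = (\<Pi>\<^sub>M k\<in>{..<T * 2 ^ n}. rel_marginal m (1 / 2 ^ n))"
\<comment> \<open>For horizon 0 the index set is empty, a case excluded by the criterion that
  expresses independence through product laws.\<close>
proof (cases "T * 2 ^ n = 0")
  case True
  then have e: "{..<T * 2 ^ n} = {}" by auto
  let ?D = "distr M (\<Pi>\<^sub>M k\<in>{..<T * 2 ^ n}. borel) (grid_incr T n)" and ?P = "\<Pi>\<^sub>M k\<in>{..<T * 2 ^ n}. (rel_marginal m (1 / 2 ^ n) :: 'a measure)"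
  have gM: "grid_incr T n \<in> M \<rightarrow>\<^sub>M (\<Pi>\<^sub>M k\<in>{..<T * 2 ^ n}. (borel :: 'a measure))" by measurable
  interpret D: prob_space ?D by (rule prob_space_distr[OF gM])
  interpret P: prob_space ?P using m by (intro prob_space_PiM prob_space_rel_marginal) auto
  show ?thesis
  proof (rule measure_eqI)
    show sets: "sets ?D = sets ?P" by (simp add: e sets_PiM_empty)
    fix A assume "A \<in> sets ?D"
    then have "A = {} \<or> A = space ?P" by (simp add: e sets_PiM_empty space_PiM)
    then show "emeasure ?D A = emeasure ?P A"
      using D.emeasure_space_1 P.emeasure_space_1 sets_eq_imp_space_eq[OF sets] by auto
  qed
next
  case False
  have ind: "indep_vars (\<lambda>_. borel) (\<lambda>k X. X (real (Suc k) / 2 ^ n) - X (real k / 2 ^ n)) {..<T * 2 ^ n}"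
    by (rule indep_increments[of "\<lambda>k. real k / 2 ^ n"]) (auto simp: divide_strict_right_mono)
  have "distr M borel (\<lambda>X. X (real (Suc k) / 2 ^ n) - X (real k / 2 ^ n)) = rel_marginal m (1 / 2 ^ n)" for k
    by (subst law_increment) (auto simp: divide_strict_right_mono diff_divide_distrib[symmetric])
  moreover have "0 \<in> {..<T * 2 ^ n}" using False by simp
  then have "{..<T * 2 ^ n} \<noteq> {}" by blast
  ultimately show ?thesis
    using ind by (subst (asm) indep_vars_iff_distr_eq_PiM') (auto simp: grid_incr_def[abs_def] simp del: of_nat_Suc)
qed

end

text \<open>The loss per grid step is exp(a 2^-n) and there are T 2^n steps, so the total exp(T a)
  is the same at every level and survives the passage to the generated sigma-algebra. Two general
  masses serve both applications: a = m compares \<open>m\<close> with 0, and a = 0 compares equal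
  masses.\<close>

lemma stop_dominated:
  fixes M N :: "(real \<Rightarrow> 'a::euclidean_space) measure"
  assumes M: "rel_levy m M" and N: "rel_levy m' N" and a: "a \<ge> 0"
    and dom: "\<And>n (F :: 'a \<Rightarrow> ennreal). F \<in> borel_measurable borel \<Longrightarrow>
      (\<integral>\<^sup>+x. F x \<partial>rel_marginal m (1 / 2 ^ n)) \<le> ennreal (exp (1 / 2 ^ n * a)) * (\<integral>\<^sup>+x. F x \<partial>rel_marginal m' (1 / 2 ^ n))"
    and B: "B \<in> sets cyl_space"
  shows "measure (distr M cyl_space (stop (real T))) B \<le> exp (real T * a) * measure (distr N cyl_space (stop (real T))) B"
proof -
  interpret M: rel_levy m M by fact
  interpret N: rel_levy m' N by fact
  interpret G: algebra D0 "grid_sets T :: (real \<Rightarrow> 'a) set set" by (rule algebra_grid_sets)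
  have sp: "space (sigma D0 (grid_sets T)) = (D0 :: (real \<Rightarrow> 'a) set)" using G.space_closed by (rule space_measure_of)
  have ss: "sets (sigma D0 (grid_sets T)) = sigma_sets D0 (grid_sets T :: (real \<Rightarrow> 'a) set set)"
    by (rule sets_measure_of[OF G.space_closed])
  have base: "measure M A \<le> exp (real T * a) * measure N A" if "A \<in> grid_sets T" for A
  proof -
    from that obtain n C where A: "A = grid_incr T n -` C \<inter> D0" and C: "C \<in> sets (\<Pi>\<^sub>M k\<in>{..<T * 2 ^ n}. (borel :: 'a measure))"
      unfolding grid_sets_def by (elim CollectE exE conjE)
    let ?h = "1 / 2 ^ n :: real"
    have pm: "prob_space (rel_marginal m ?h :: 'a measure)" "prob_space (rel_marginal m' ?h :: 'a measure)"
      using M.m N.m by (auto intro!: prob_space_rel_marginal)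
    have sC: "sets (\<Pi>\<^sub>M k\<in>{..<T * 2 ^ n}. (rel_marginal k' ?h :: 'a measure)) = sets (\<Pi>\<^sub>M k\<in>{..<T * 2 ^ n}. borel)" for k'
      by (intro sets_PiM_cong) auto
    have em: "emeasure P A = (\<integral>\<^sup>+x. indicator C x \<partial>(\<Pi>\<^sub>M k\<in>{..<T * 2 ^ n}. rel_marginal k' ?h))" if "rel_levy k' P" for P k'
    proof -
      interpret P: rel_levy k' P by fact
      have "emeasure P A = emeasure (distr P (\<Pi>\<^sub>M k\<in>{..<T * 2 ^ n}. borel) (grid_incr T n)) C"
        using C by (subst emeasure_distr) (auto simp: A measurable_cong_sets[OF P.sets_M refl] grid_incr_measurable)
      then show ?thesis unfolding P.grid_law using C by (simp add: sC)
    qed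
    have "emeasure M A \<le> ennreal (exp (?h * a)) ^ card {..<T * 2 ^ n} * emeasure N A"
      unfolding em[OF M] em[OF N]
    proof (rule PiM_dominated[OF pm])
      show "indicator C \<in> borel_measurable (\<Pi>\<^sub>M i\<in>{..<T * 2 ^ n}. (rel_marginal m' ?h :: 'a measure))"
        using C by (intro borel_measurable_indicator) (simp add: sC)
      fix F :: "'a \<Rightarrow> ennreal" assume "F \<in> borel_measurable (rel_marginal m' ?h)"
      then have "F \<in> borel_measurable borel" by (simp add: measurable_cong_sets[OF sets_rel_marginal refl])
      then show "(\<integral>\<^sup>+x. F x \<partial>rel_marginal m ?h) \<le> ennreal (exp (?h * a)) * (\<integral>\<^sup>+x. F x \<partial>rel_marginal m' ?h)" by (rule dom)
    qed auto
    also have "ennreal (exp (?h * a)) ^ card {..<T * 2 ^ n} = ennreal (exp (real T * a))"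
      by (simp add: ennreal_power exp_of_nat_mult[symmetric])
    finally show ?thesis
      by (simp add: M.emeasure_eq_measure N.emeasure_eq_measure ennreal_mult'[symmetric])
  qed
  have pre: "stop (real T) -` B \<inter> D0 \<in> sigma_sets D0 (grid_sets T)"
    using measurable_sets[OF stop_grid_measurable B, of T] unfolding sp ss .
  have "measure M (stop (real T) -` B \<inter> D0) \<le> exp (real T * a) * measure N (stop (real T) -` B \<inter> D0)"
    by (rule algebra_dominated[OF algebra_grid_sets _ _ _ _ _ _ base _ pre])
       (use grid_sets_sub M.finite_measure_axioms N.finite_measure_axioms in auto)
  moreover have "measure (distr P cyl_space (stop (real T))) B = measure P (stop (real T) -` B \<inter> D0)" if "rel_levy k' P" for P k'
  proof -
    interpret P: rel_levy k' P by fact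
    show ?thesis
      using B by (subst measure_distr) (auto simp: measurable_cong_sets[OF P.sets_M refl] stop_measurable)
  qed
  ultimately show ?thesis using M N by simp
qed

lemma rel_levy_law_unique:
  fixes M N :: "(real \<Rightarrow> 'a::euclidean_space) measure"
  assumes m: "m \<ge> 0" and "is_rel_levy_law m M" "is_rel_levy_law m N"
  shows "M = N"
proof -
  have M: "rel_levy m M" and N: "rel_levy m N" using assms by (auto simp: rel_levy_def)
  interpret M: rel_levy m M by fact
  interpret N: rel_levy m N by fact
  let ?E = "{stop (real T) -` B \<inter> D0 | T B. B \<in> sets (cyl_space :: (real \<Rightarrow> 'a) measure)}"
  have st: "X \<in> D0 \<Longrightarrow> stop (real T) X \<in> D0" for X :: "real \<Rightarrow> 'a" and T :: nat by (rule stop_D0) auto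
  have E: "?E \<subseteq> sets cyl_space"
  proof safe
    fix T :: nat and B :: "(real \<Rightarrow> 'a) set" assume B: "B \<in> sets cyl_space"
    have "stop (real T) -` B \<inter> space cyl_space \<in> sets cyl_space"
      by (rule measurable_sets[OF stop_measurable B]) simp
    then show "stop (real T) -` B \<inter> D0 \<in> sets cyl_space" by simp
  qed
  have le: "measure P (stop (real T) -` B \<inter> D0) \<le> measure P' (stop (real T) -` B \<inter> D0)"
    if P: "rel_levy m P" "rel_levy m P'" and B: "B \<in> sets cyl_space" for P P' B and T :: nat
  proof -
    interpret P: rel_levy m P by fact
    interpret P': rel_levy m P' by fact
    \<comment> \<open>For equal marginals the loss is a = 0 and the constant is 1; exchanging the
      two laws gives the reverse inequality.\<close>
    have "measure (distr P cyl_space (stop (real T))) B \<le> exp (real T * 0) * measure (distr P' cyl_space (stop (real T))) B"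
      by (rule stop_dominated[OF P _ _ B]) auto
    then show ?thesis
      using B by (subst (asm) (1 2) measure_distr)
         (auto simp: measurable_cong_sets[OF P.sets_M refl] measurable_cong_sets[OF P'.sets_M refl] stop_measurable)
  qed
  show ?thesis
  proof (rule measure_eqI_generator_eq[where E="?E" and \<Omega>="D0" and A="\<lambda>_. D0"])
    show "Int_stable ?E"
    proof (rule Int_stableI)
      fix A A' assume "A \<in> ?E" "A' \<in> ?E"
      then obtain T T' :: nat and B B' where A: "A = stop (real T) -` B \<inter> D0" "B \<in> sets cyl_space"
        and A': "A' = stop (real T') -` B' \<inter> D0" "B' \<in> sets cyl_space" by blast
      define S where "S = max T T'"
      have S: "real T \<le> real S" "real T' \<le> real S" by (auto simp: S_def)
      \<comment> \<open>A past event for one horizon is also one for any larger horizon, which makes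
        the generator closed under intersections.\<close>
      have "A \<inter> A' = stop (real S) -` ((stop (real T) -` B \<inter> D0) \<inter> (stop (real T') -` B' \<inter> D0)) \<inter> D0"
        unfolding A A' by (auto simp: st stop_stop[OF S(1)] stop_stop[OF S(2)])
      moreover have "(stop (real T) -` B \<inter> D0) \<inter> (stop (real T') -` B' \<inter> D0) \<in> sets cyl_space"
        using E A(2) A'(2) by blast
      ultimately show "A \<inter> A' \<in> ?E" by blast
    qed
    show "?E \<subseteq> Pow D0" by auto
    show "emeasure M X = emeasure N X" if "X \<in> ?E" for X
      using that le[OF M N] le[OF N M] by (auto simp: M.emeasure_eq_measure N.emeasure_eq_measure intro!: antisym)
    have gen: "sets cyl_space = sigma_sets D0 ?E"
    proof (intro antisym)
      show "sigma_sets D0 ?E \<subseteq> sets cyl_space" using sets.sigma_sets_subset[OF E] by simp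
      have "{{X \<in> D0. X t \<in> B} | t B. 0 \<le> t \<and> B \<in> sets borel} \<subseteq> ?E"
      proof safe
        fix t :: real and B :: "'a set" assume t: "0 \<le> t" and B: "B \<in> sets borel"
        obtain T :: nat where T: "t \<le> real T" using real_arch_simple by blast
        \<comment> \<open>Stopping at or after time \<open>t\<close> leaves the value at
          \<open>t\<close> unchanged.\<close>
        have "{X \<in> D0. X t \<in> B} = stop (real T) -` {X \<in> D0. X t \<in> B} \<inter> D0"
          using T by (auto simp: st) (auto simp: stop_def min_def split: if_splits)
        moreover have "{X \<in> D0. X t \<in> B} \<in> sets cyl_space"
          using measurable_sets[OF measurable_coord[of t] B] by (simp add: vimage_def Int_def conj_commute)
        ultimately show "\<exists>T Ba. {X \<in> D0. X t \<in> B} = stop (real T) -` Ba \<inter> D0 \<and> Ba \<in> sets cyl_space"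
          by blast
      qed
      then show "sets cyl_space \<subseteq> sigma_sets D0 ?E"
        unfolding cyl_space_def sets_measure_of[OF cyl_gen] by (intro sigma_sets_mono') auto
    qed
    show "sets M = sigma_sets D0 ?E" "sets N = sigma_sets D0 ?E" using gen by simp_all
    have "stop (real 0) -` D0 \<inter> D0 = (D0 :: (real \<Rightarrow> 'a) set)" using st[of _ 0] by auto
    moreover have "D0 \<in> sets (cyl_space :: (real \<Rightarrow> 'a) measure)" using sets.top[of cyl_space] by simp
    ultimately show "range (\<lambda>_. D0) \<subseteq> ?E" by blast
  qed auto
qed

lemma lam_law:
  assumes "m \<ge> 0" shows "is_rel_levy_law m (lam m :: (real \<Rightarrow> 'a::euclidean_space) measure)"
  unfolding lam_def using rel_levy_law_exists[OF assms] rel_levy_law_unique[OF assms] by (metis theI)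

lemma rel_levy_lam: "m \<ge> 0 \<Longrightarrow> rel_levy m (lam m :: (real \<Rightarrow> 'a::euclidean_space) measure)"
  by (simp add: rel_levy_def lam_law)

text \<open>Invariance under \<open>stop\<close> replaces each law by its image under stopping, and
  these images satisfy the domination with constant exp(T m).\<close>

theorem lam_total_variation:
  fixes \<Phi> :: "(real \<Rightarrow> 'a::euclidean_space) \<Rightarrow> complex"
  assumes m: "m \<ge> 0" and \<Phi>: "\<Phi> \<in> borel_measurable cyl_space" and K: "\<And>X. X \<in> D0 \<Longrightarrow> norm (\<Phi> X) \<le> K"
    and st: "\<And>X. X \<in> D0 \<Longrightarrow> \<Phi> (stop (real T) X) = \<Phi> X"
  shows "norm ((\<integral>X. \<Phi> X \<partial>lam m) - (\<integral>X. \<Phi> X \<partial>lam 0)) \<le> 4 * K * (exp (real T * m) - 1)"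
proof -
  interpret M: rel_levy m "lam m :: (real \<Rightarrow> 'a) measure" using m by (rule rel_levy_lam)
  interpret N: rel_levy 0 "lam 0 :: (real \<Rightarrow> 'a) measure" by (rule rel_levy_lam) simp
  have sM: "stop (real T) \<in> lam m \<rightarrow>\<^sub>M (cyl_space :: (real \<Rightarrow> 'a) measure)" "stop (real T) \<in> lam 0 \<rightarrow>\<^sub>M (cyl_space :: (real \<Rightarrow> 'a) measure)"
    by (auto simp: measurable_cong_sets[OF M.sets_M refl] measurable_cong_sets[OF N.sets_M refl] stop_measurable)
  have "norm ((\<integral>X. \<Phi> X \<partial>distr (lam m) cyl_space (stop (real T))) - (\<integral>X. \<Phi> X \<partial>distr (lam 0) cyl_space (stop (real T)))) \<le> 4 * K * (exp (real T * m) - 1)"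
  proof (rule dominated_integral_diff)
    show "measure (distr (lam m) cyl_space (stop (real T))) B \<le> exp (real T * m) * measure (distr (lam 0) cyl_space (stop (real T))) B"
      if "B \<in> sets (distr (lam 0 :: (real \<Rightarrow> 'a) measure) cyl_space (stop (real T)))" for B
    proof (rule stop_dominated[OF M.rel_levy_axioms N.rel_levy_axioms m])
      fix n and F :: "'a \<Rightarrow> ennreal" assume "F \<in> borel_measurable borel"
      then show "(\<integral>\<^sup>+x. F x \<partial>rel_marginal m (1 / 2 ^ n)) \<le> ennreal (exp (1 / 2 ^ n * m)) * (\<integral>\<^sup>+x. F x \<partial>rel_marginal 0 (1 / 2 ^ n))"
        using m by (intro rel_marginal_dominated) simp_all
    qed (use that in simp)
  qed (use m \<Phi> K sM in \<open>auto intro!: M.prob_space_distr N.prob_space_distr\<close>)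
  moreover have "(\<integral>X. \<Phi> X \<partial>distr (lam m) cyl_space (stop (real T))) = (\<integral>X. \<Phi> X \<partial>lam m)"
    using st by (subst integral_distr[OF sM(1) \<Phi>]) (auto intro!: Bochner_Integration.integral_cong)
  moreover have "(\<integral>X. \<Phi> X \<partial>distr (lam 0) cyl_space (stop (real T))) = (\<integral>X. \<Phi> X \<partial>lam 0)"
    using st by (subst integral_distr[OF sM(2) \<Phi>]) (auto intro!: Bochner_Integration.integral_cong)
  ultimately show ?thesis by simp
qed

section \<open>Jump sums as limits of Riemann sums\<close>

lemma D0_right: "X \<in> D0 \<Longrightarrow> 0 \<le> s \<Longrightarrow> continuous (at s within {s..}) X"
  using at_within_Ici_at_right[of s] by (simp add: D0_def)

lemma D0_right_dist:
  assumes "X \<in> D0" "0 \<le> s" "e > 0"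
  shows "\<exists>d>0. \<forall>u\<in>{s..<s + d}. norm (X u - X s) < e"
proof -
  from D0_right[OF assms(1,2)] assms(3) obtain d where "d > 0" "\<forall>u\<in>{s..}. dist u s < d \<longrightarrow> dist (X u) (X s) < e"
    unfolding continuous_within_eps_delta by blast
  then show ?thesis by (intro exI[of _ d]) (auto simp: dist_norm)
qed

lemma lft_tendsto:
  assumes "X \<in> D0" "0 < s" shows "(X \<longlongrightarrow> lft X s) (at_left s)"
proof -
  obtain l where l: "(X \<longlongrightarrow> l) (at_left s)" using assms by (auto simp: D0_def)
  have "lft X s = l" unfolding lft_def by (rule tendsto_Lim[OF _ l]) simp
  then show ?thesis using l by simp
qed

lemma lft_dist:
  assumes "X \<in> D0" "0 < s" "e > 0"
  shows "\<exists>d>0. d \<le> s \<and> (\<forall>u\<in>{s - d<..<s}. norm (X u - lft X s) < e)"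
proof -
  have "\<forall>\<^sub>F u in at_left s. dist (X u) (lft X s) < e" using lft_tendsto[OF assms(1,2)] assms(3) by (rule tendstoD)
  then obtain b where b: "b < s" "\<And>u. b < u \<Longrightarrow> u < s \<Longrightarrow> dist (X u) (lft X s) < e"
    using eventually_at_left[of "s - 1" s] by auto
  show ?thesis
    by (intro exI[of _ "min (s - b) s"]) (use b assms in \<open>auto simp: dist_norm\<close>)
qed

text \<open>Just before \<open>s\<close> the path is close to its left limit and from
  \<open>s\<close> on it is close to \<open>X s\<close>, so only an increment across
  \<open>s\<close> sees the jump.\<close>

lemma small_increment_local:
  assumes X: "X \<in> D0" and s: "0 \<le> s" and \<eta>: "\<eta> > 0"
  shows "\<exists>d>0. \<forall>a b. 0 \<le> a \<longrightarrow> a < b \<longrightarrow> a \<in> ball s d \<longrightarrow> b \<in> ball s d \<longrightarrow> \<not> (a < s \<and> s \<le> b \<and> \<eta> \<le> norm (jump X s)) \<longrightarrow>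
    norm (X b - X a) < \<eta>"
proof -
  \<comment> \<open>For a jump below \<eta> the tolerance is half of what the jump leaves, so that 2
    \<theta> + |jump| = \<eta>. A larger jump is not crossed by the increments considered, and
    \<eta>/2 suffices.\<close>
  define \<theta> where "\<theta> = (if norm (jump X s) < \<eta> then (\<eta> - norm (jump X s)) / 2 else \<eta> / 2)"
  have \<theta>: "\<theta> > 0" "\<theta> \<le> \<eta> / 2" using \<eta> by (auto simp: \<theta>_def)
  obtain d1 where d1: "d1 > 0" "\<forall>u\<in>{s..<s + d1}. norm (X u - X s) < \<theta>" using D0_right_dist[OF X s \<theta>(1)] by auto
  have "\<exists>d2>0. (\<forall>u\<in>{s - d2<..<s}. 0 \<le> u \<longrightarrow> norm (X u - lft X s) < \<theta>)"
  proof (cases "s = 0")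
    case False
    then show ?thesis using lft_dist[OF X _ \<theta>(1), of s] s by auto
  qed (auto intro!: exI[of _ 1])
  then obtain d2 where d2: "d2 > 0" "\<forall>u\<in>{s - d2<..<s}. 0 \<le> u \<longrightarrow> norm (X u - lft X s) < \<theta>" by auto
  show ?thesis
  proof (intro exI[of _ "min d1 d2"] conjI allI impI)
    fix a b assume a: "0 \<le> a" and ab: "a < b" and "a \<in> ball s (min d1 d2)" "b \<in> ball s (min d1 d2)"
      and nj: "\<not> (a < s \<and> s \<le> b \<and> \<eta> \<le> norm (jump X s))"
    then have ball: "s - d2 < a" "b < s + d1" "s - d2 < b" "a < s + d1" by (auto simp: dist_real_def)
    consider "b < s" | "s \<le> a" | "a < s" "s \<le> b" by linarith
    then show "norm (X b - X a) < \<eta>"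
    proof cases
      case 1
      then have "norm (X a - lft X s) < \<theta>" "norm (X b - lft X s) < \<theta>" using d2 ball a ab by auto
      then show ?thesis using norm_triangle_ineq4[of "X b - lft X s" "X a - lft X s"] \<theta> by simp
    next
      case 2
      then have "norm (X a - X s) < \<theta>" "norm (X b - X s) < \<theta>" using d1 ball a ab by auto
      then show ?thesis using norm_triangle_ineq4[of "X b - X s" "X a - X s"] \<theta> by simp
    next
      case 3
      then have "norm (jump X s) < \<eta>" using nj by simp
      then have t: "2 * \<theta> + norm (jump X s) = \<eta>" by (simp add: \<theta>_def field_simps)
      have "norm (X a - lft X s) < \<theta>" "norm (X b - X s) < \<theta>" using 3 d1 d2 ball a ab by auto
      moreover have "X b - X a = (X b - X s) - (X a - lft X s) + jump X s" by (simp add: jump_def)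
      then have "norm (X b - X a) = norm ((X b - X s) - (X a - lft X s) + jump X s)" by (rule arg_cong)
      moreover have "norm ((X b - X s) - (X a - lft X s) + jump X s) \<le> norm (X b - X s) + norm (X a - lft X s) + norm (jump X s)"
        by (meson norm_triangle_ineq norm_triangle_ineq4 add_right_mono order_trans)
      ultimately show ?thesis using t by linarith
    qed
  qed (use d1 d2 in auto)
qed

text \<open>The uniform distance is a Lebesgue number for the cover of [0, t] by the balls of the
  local statement.\<close>

lemma small_increment_uniform:
  assumes X: "X \<in> D0" and \<eta>: "\<eta> > 0"
  shows "\<exists>d>0. \<forall>a b. 0 \<le> a \<longrightarrow> a < b \<longrightarrow> b \<le> t \<longrightarrow> b - a < d \<longrightarrow> (\<forall>s\<in>{a<..b}. norm (jump X s) < \<eta>) \<longrightarrow> norm (X b - X a) < \<eta>"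
proof -
  have "\<forall>s\<in>{0..t}. \<exists>d>0. \<forall>a b. 0 \<le> a \<longrightarrow> a < b \<longrightarrow> a \<in> ball s d \<longrightarrow> b \<in> ball s d \<longrightarrow> \<not> (a < s \<and> s \<le> b \<and> \<eta> \<le> norm (jump X s)) \<longrightarrow>
    norm (X b - X a) < \<eta>"
    using small_increment_local[OF X _ \<eta>] by auto
  then obtain d where d: "\<And>s. s \<in> {0..t} \<Longrightarrow> d s > 0"
    "\<And>s a b. s \<in> {0..t} \<Longrightarrow> 0 \<le> a \<Longrightarrow> a < b \<Longrightarrow> a \<in> ball s (d s) \<Longrightarrow> b \<in> ball s (d s) \<Longrightarrow>
       \<not> (a < s \<and> s \<le> b \<and> \<eta> \<le> norm (jump X s)) \<Longrightarrow> norm (X b - X a) < \<eta>"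
    by (subst (asm) bchoice_iff) blast
  have "\<exists>e>0. \<forall>x\<in>{0..t}. \<exists>G\<in>(\<lambda>s. ball s (d s)) ` {0..t}. ball x e \<subseteq> G"
  proof (rule Heine_Borel_lemma)
    show "{0..t} \<subseteq> \<Union>((\<lambda>s. ball s (d s)) ` {0..t})" using d(1) by force
  qed auto
  then obtain e where e: "e > 0" "\<forall>x\<in>{0..t}. \<exists>G\<in>(\<lambda>s. ball s (d s)) ` {0..t}. ball x e \<subseteq> G" by auto
  show ?thesis
  proof (intro exI[of _ e] conjI allI impI e(1))
    fix a b assume ab: "0 \<le> a" "a < b" "b \<le> t" "b - a < e" and nj: "\<forall>s\<in>{a<..b}. norm (jump X s) < \<eta>"
    then have "a \<in> {0..t}" by auto
    then obtain s where s: "s \<in> {0..t}" "ball a e \<subseteq> ball s (d s)" using e(2) by blast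
    have "a \<in> ball a e" "b \<in> ball a e" using ab e(1) by (auto simp: dist_real_def)
    then have "a \<in> ball s (d s)" "b \<in> ball s (d s)" using s(2) by blast+
    moreover have "\<not> (a < s \<and> s \<le> b \<and> \<eta> \<le> norm (jump X s))" using nj by (metis greaterThanAtMost_iff not_le)
    ultimately show "norm (X b - X a) < \<eta>" using d(2)[OF s(1) ab(1,2)] by blast
  qed
qed

definition big_jumps :: "real \<Rightarrow> real \<Rightarrow> (real \<Rightarrow> 'a::euclidean_space) \<Rightarrow> real set" where
  "big_jumps \<eta> t X = {s \<in> {0<..t}. \<eta> \<le> norm (jump X s)}"

text \<open>Near an accumulation point of large jumps the local statement with \<eta>/2 bounds the
  increments that do not cross that point. Shrinking such an increment onto a nearby jump time
  bounds the jump by \<eta>/2, a contradiction.\<close>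

lemma finite_big_jumps:
  assumes X: "X \<in> D0" and \<eta>: "\<eta> > 0"
  shows "finite (big_jumps \<eta> t X)"
proof (rule ccontr)
  assume "infinite (big_jumps \<eta> t X)"
  moreover have "big_jumps \<eta> t X \<subseteq> {0..t}" by (auto simp: big_jumps_def)
  ultimately obtain s where s: "s \<in> {0..t}" "s islimpt big_jumps \<eta> t X"
    using compact_Icc[of 0 t] unfolding compact_eq_Bolzano_Weierstrass by blast
  obtain d where d: "d > 0" "\<And>a b. 0 \<le> a \<Longrightarrow> a < b \<Longrightarrow> a \<in> ball s d \<Longrightarrow> b \<in> ball s d \<Longrightarrow> \<not> (a < s \<and> s \<le> b \<and> \<eta>/2 \<le> norm (jump X s)) \<Longrightarrow> norm (X b - X a) < \<eta>/2"
    using small_increment_local[OF X, of s "\<eta>/2"] s \<eta> by auto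
  obtain u where u: "u \<in> big_jumps \<eta> t X" "u \<in> ball s d" "u \<noteq> s"
    using s(2) d(1) unfolding islimpt_approachable by (metis mem_ball dist_commute)
  then have u0: "0 < u" and ju: "\<eta> \<le> norm (jump X u)" by (auto simp: big_jumps_def)
  \<comment> \<open>The left end of the increment is kept nonnegative, inside the ball, and on the
    same side of \<open>s\<close> as \<open>u\<close>.\<close>
  define c where "c = Max {0, s - d, (if s < u then s else 0)}"
  have cu: "c < u" using u u0 by (auto simp: c_def dist_real_def)
  have "\<forall>\<^sub>F a in at_left u. a \<in> {c<..<u}" using cu by (rule eventually_at_left_real)
  then have "\<forall>\<^sub>F a in at_left u. norm (X u - X a) \<le> \<eta>/2"
  proof eventually_elim
    case (elim a)
    then have a: "0 \<le> a" "s - d < a" "s < u \<longrightarrow> s < a" by (auto simp: c_def split: if_splits)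
    then have "a \<in> ball s d" using elim u(2) by (auto simp: dist_real_def)
    moreover have "\<not> (a < s \<and> s \<le> u \<and> \<eta>/2 \<le> norm (jump X s))" using a u(3) by auto
    ultimately show ?case using d(2)[of a u] a elim u(2) by auto
  qed
  moreover have "((\<lambda>a. X u - X a) \<longlongrightarrow> X u - lft X u) (at_left u)"
    by (intro tendsto_diff tendsto_const lft_tendsto X u0)
  ultimately have "norm (X u - lft X u) \<le> \<eta>/2"
    by (intro Lim_norm_ubound[of "at_left u"]) auto
  then show False using ju \<eta> by (simp add: jump_def)
qed

definition jsum :: "real \<Rightarrow> ('a::euclidean_space \<Rightarrow> 'a \<Rightarrow> real) \<Rightarrow> real \<Rightarrow> (real \<Rightarrow> 'a) \<Rightarrow> real" where
  "jsum \<eta> F t X = (\<Sum>s\<in>big_jumps \<eta> t X. F (lft X s) (jump X s))"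

text \<open>The first argument is the value at the left end of each interval: it converges to the
  left limit used in \<open>jsum\<close>, and under a Levy law it is independent of the
  increment.\<close>

definition rsum :: "nat \<Rightarrow> ('a::euclidean_space \<Rightarrow> 'a \<Rightarrow> real) \<Rightarrow> real \<Rightarrow> (real \<Rightarrow> 'a) \<Rightarrow> real" where
  "rsum n F t X = (\<Sum>j<n. F (X (t * real j / real n)) (X (t * real (Suc j) / real n) - X (t * real j / real n)))"

text \<open>Index of the interval containing \<open>s\<close>. Intervals are open on the left and
  closed on the right, hence ceiling minus 1: a jump exactly at a grid point is picked up by the
  interval that ends there.\<close>

definition cell :: "real \<Rightarrow> nat \<Rightarrow> real \<Rightarrow> nat" where
  "cell t n s = nat \<lceil>s * real n / t\<rceil> - 1"

lemma cell_bounds: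
  assumes t: "t > 0" and n: "n > 0" and s: "s \<in> {0<..t}"
  shows "t * real (cell t n s) / real n < s" "s \<le> t * real (Suc (cell t n s)) / real n" "cell t n s < n"
proof -
  have p: "0 < s * real n / t" using t n s by auto
  then have c: "\<lceil>s * real n / t\<rceil> \<ge> 1" by linarith
  then have e: "real (cell t n s) = of_int \<lceil>s * real n / t\<rceil> - 1"
    unfolding cell_def by (simp add: of_nat_diff nat_le_iff le_nat_iff)
  have "real (cell t n s) < s * real n / t" "s * real n / t \<le> real (cell t n s) + 1"
    unfolding e by linarith+
  then show "t * real (cell t n s) / real n < s" "s \<le> t * real (Suc (cell t n s)) / real n"
    using t n by (auto simp: field_simps)
  have "s * real n \<le> t * real n" using s by (intro mult_right_mono) auto
  then have "s * real n / t \<le> real n" using t by (simp add: field_simps)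
  then have "\<lceil>s * real n / t\<rceil> \<le> int n" by linarith
  then show "cell t n s < n" using c n unfolding cell_def by linarith
qed

lemma cell_unique:
  assumes t: "t > 0" and n: "n > 0" and s: "t * real j / real n < s" "s \<le> t * real (Suc j) / real n"
  shows "cell t n s = j"
proof -
  have "real j < s * real n / t" "s * real n / t \<le> real j + 1"
    using s t n by (auto simp: field_simps)
  then have "\<lceil>s * real n / t\<rceil> = int j + 1" by linarith
  then show ?thesis by (simp add: cell_def nat_add_distrib)
qed

text \<open>On a fine mesh every interval holds at most one jump of size at least \<eta>. Without
  such a jump the increment is below \<eta>, where \<open>F\<close> vanishes; with one, the left
  limit, right-continuity and continuity of \<open>F\<close> give the limit of the term.\<close>

lemma rsum_tendsto:
  assumes X: "X \<in> D0" and \<eta>: "\<eta> > 0" and t: "t > 0"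
    and F: "continuous_on UNIV (\<lambda>(p, y). F p y)" and F0: "\<And>p y. norm y < \<eta> \<Longrightarrow> F p y = 0"
  shows "(\<lambda>n. rsum n F t X) \<longlonglongrightarrow> jsum \<eta> F t X"
proof -
  let ?J = "big_jumps \<eta> t X"
  have finJ: "finite ?J" by (rule finite_big_jumps[OF X \<eta>])
  have J: "s \<in> {0<..t}" if "s \<in> ?J" for s using that by (auto simp: big_jumps_def)
  define a where "a n s = t * real (cell t n s) / real n" for n s
  define b where "b n s = t * real (Suc (cell t n s)) / real n" for n s
  have tn: "(\<lambda>n. t / real n) \<longlonglongrightarrow> 0" by (rule lim_const_over_n)
  have ab: "a n s < s" "s \<le> b n s" "s - t / real n \<le> a n s" "b n s \<le> s + t / real n" "0 \<le> a n s" if "n > 0" "s \<in> ?J" for n s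
  proof -
    have "b n s = a n s + t / real n" by (simp add: a_def b_def distrib_left add_divide_distrib)
    then show "a n s < s" "s \<le> b n s" "s - t / real n \<le> a n s" "b n s \<le> s + t / real n" "0 \<le> a n s"
      using cell_bounds[OF t that(1) J[OF that(2)]] t unfolding a_def b_def by auto
  qed
  have term_lim: "(\<lambda>n. F (X (a n s)) (X (b n s) - X (a n s))) \<longlonglongrightarrow> F (lft X s) (jump X s)" if s: "s \<in> ?J" for s
  proof -
    have s0: "0 < s" using J[OF s] by simp
    have "\<forall>\<^sub>F n in sequentially. s - t / real n \<le> a n s \<and> a n s \<le> s \<and> s \<le> b n s \<and> b n s \<le> s + t / real n \<and> a n s < s"
      using eventually_gt_at_top[of 0] by eventually_elim (use ab s in \<open>auto intro: less_imp_le\<close>)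
    then have ev: "\<forall>\<^sub>F n in sequentially. s - t / real n \<le> a n s" "\<forall>\<^sub>F n in sequentially. a n s \<le> s"
      "\<forall>\<^sub>F n in sequentially. s \<le> b n s" "\<forall>\<^sub>F n in sequentially. b n s \<le> s + t / real n" "\<forall>\<^sub>F n in sequentially. a n s < s"
      by (auto elim: eventually_mono)
    have l1: "(\<lambda>n. s - t / real n) \<longlonglongrightarrow> s" "(\<lambda>n. s + t / real n) \<longlonglongrightarrow> s"
      using tendsto_diff[OF tendsto_const tn, of s] tendsto_add[OF tendsto_const tn, of s] by auto
    have al: "(\<lambda>n. a n s) \<longlonglongrightarrow> s" by (rule tendsto_sandwich[OF ev(1,2) l1(1) tendsto_const])
    have bl: "(\<lambda>n. b n s) \<longlonglongrightarrow> s" by (rule tendsto_sandwich[OF ev(3,4) tendsto_const l1(2)])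
    have "filterlim (\<lambda>n. a n s) (at_left s) sequentially"
      unfolding filterlim_at using al ev(5) by (auto elim: eventually_mono)
    then have Xa: "(\<lambda>n. X (a n s)) \<longlonglongrightarrow> lft X s" by (rule filterlim_compose[OF lft_tendsto[OF X s0]])
    have Xb: "(\<lambda>n. X (b n s)) \<longlonglongrightarrow> X s"
    proof (rule tendstoI)
      fix e :: real assume "e > 0"
      then obtain d where d: "d > 0" "\<forall>u\<in>{s..<s + d}. norm (X u - X s) < e" using D0_right_dist[OF X, of s e] s0 by auto
      have "\<forall>\<^sub>F n in sequentially. b n s < s + d" using d(1) by (intro order_tendstoD(2)[OF bl]) simp
      with ev(3) show "\<forall>\<^sub>F n in sequentially. dist (X (b n s)) (X s) < e"
        by eventually_elim (use d(2) in \<open>auto simp: dist_norm\<close>)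
    qed
    have "(\<lambda>n. (X (a n s), X (b n s) - X (a n s))) \<longlonglongrightarrow> (lft X s, X s - lft X s)"
      by (intro tendsto_Pair tendsto_diff Xa Xb)
    then have "(\<lambda>n. (\<lambda>(p, y). F p y) (X (a n s), X (b n s) - X (a n s))) \<longlonglongrightarrow> (\<lambda>(p, y). F p y) (lft X s, X s - lft X s)"
      using F by (intro isCont_tendsto_compose[where g="\<lambda>(p, y). F p y"]) (auto simp: continuous_on_eq_continuous_at)
    then show ?thesis by (simp add: jump_def)
  qed
  have "(\<lambda>n. \<Sum>s\<in>?J. F (X (a n s)) (X (b n s) - X (a n s))) \<longlonglongrightarrow> jsum \<eta> F t X"
    unfolding jsum_def by (intro tendsto_sum term_lim)
  moreover have "\<forall>\<^sub>F n in sequentially. (\<Sum>s\<in>?J. F (X (a n s)) (X (b n s) - X (a n s))) = rsum n F t X"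
  proof -
    obtain d where d: "d > 0" "\<And>a b. 0 \<le> a \<Longrightarrow> a < b \<Longrightarrow> b \<le> t \<Longrightarrow> b - a < d \<Longrightarrow> (\<forall>s\<in>{a<..b}. norm (jump X s) < \<eta>) \<Longrightarrow> norm (X b - X a) < \<eta>"
      using small_increment_uniform[OF X \<eta>, of t] by blast
    have "\<forall>s\<in>?J. \<forall>s'\<in>?J. s \<noteq> s' \<longrightarrow> (\<forall>\<^sub>F n in sequentially. t / real n < \<bar>s - s'\<bar>)"
      using order_tendstoD(2)[OF tn] by auto
    then have "\<forall>\<^sub>F n in sequentially. \<forall>s\<in>?J. \<forall>s'\<in>?J. s \<noteq> s' \<longrightarrow> t / real n < \<bar>s - s'\<bar>"
      using finJ by (auto intro!: eventually_ball_finite simp: eventually_conj_iff imp_conv_disj)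
    moreover have "\<forall>\<^sub>F n in sequentially. t / real n < d" using order_tendstoD(2)[OF tn] d(1) by auto
    ultimately show ?thesis using eventually_gt_at_top[of 0]
    proof eventually_elim
      case (elim n)
      have inj: "inj_on (cell t n) ?J"
      proof (rule inj_onI, rule ccontr)
        fix s s' assume s: "s \<in> ?J" "s' \<in> ?J" "cell t n s = cell t n s'" "s \<noteq> s'"
        then have "a n s = a n s'" "b n s = b n s'" by (auto simp: a_def b_def)
        moreover have "b n s = a n s + t / real n" by (simp add: a_def b_def distrib_left add_divide_distrib)
        ultimately have "\<bar>s - s'\<bar> \<le> t / real n" using ab[OF elim(3) s(1)] ab[OF elim(3) s(2)] by (auto simp: abs_if)
        then show False using elim(1) s by fastforce
      qed
      have "rsum n F t X = (\<Sum>j\<in>cell t n ` ?J. F (X (t * real j / real n)) (X (t * real (Suc j) / real n) - X (t * real j / real n)))"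
        unfolding rsum_def
      proof (rule sum.mono_neutral_right)
        show "cell t n ` ?J \<subseteq> {..<n}" using cell_bounds(3)[OF t elim(3)] J by auto
        show "\<forall>j\<in>{..<n} - cell t n ` ?J. F (X (t * real j / real n)) (X (t * real (Suc j) / real n) - X (t * real j / real n)) = 0"
        proof
          fix j assume j: "j \<in> {..<n} - cell t n ` ?J"
          have "norm (X (t * real (Suc j) / real n) - X (t * real j / real n)) < \<eta>"
          proof (rule d(2))
            show "0 \<le> t * real j / real n" "t * real j / real n < t * real (Suc j) / real n" using t elim(3) by (auto simp: divide_strict_right_mono)
            have "t * real (Suc j) \<le> t * real n" using t j by (intro mult_left_mono) auto
            then show le: "t * real (Suc j) / real n \<le> t" using elim(3) by (simp add: field_simps)
            have "t * real (Suc j) / real n - t * real j / real n = t / real n" by (simp add: distrib_left add_divide_distrib)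
            then show "t * real (Suc j) / real n - t * real j / real n < d" using elim(2) by simp
            show "\<forall>s\<in>{t * real j / real n<..t * real (Suc j) / real n}. norm (jump X s) < \<eta>"
            proof (rule ballI, rule ccontr)
              fix s assume s: "s \<in> {t * real j / real n<..t * real (Suc j) / real n}" "\<not> norm (jump X s) < \<eta>"
              have "0 \<le> t * real j / real n" using t by simp
              then have "0 < s" "s \<le> t" using s(1) le by (auto simp del: of_nat_Suc)
              then have "s \<in> ?J" using s by (auto simp: big_jumps_def)
              moreover have "cell t n s = j" using s(1) by (intro cell_unique[OF t elim(3)]) auto
              ultimately show False using j by auto
            qed
          qed
          then show "F (X (t * real j / real n)) (X (t * real (Suc j) / real n) - X (t * real j / real n)) = 0" by (rule F0)
        qed
      qed simp
      also have "\<dots> = (\<Sum>s\<in>?J. F (X (a n s)) (X (b n s) - X (a n s)))"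
        unfolding sum.reindex[OF inj] by (simp add: a_def b_def)
      finally show ?case by simp
    qed
  qed
  ultimately show ?thesis by (rule Lim_transform_eventually)
qed

lemma rsum_measurable:
  assumes F: "continuous_on UNIV (\<lambda>(p, y). F p y)"
  shows "rsum n F t \<in> borel_measurable (cyl_space :: (real \<Rightarrow> 'a::euclidean_space) measure)"
proof -
  have "(\<lambda>X. (\<lambda>(p, y). F p y) (X u, X v - X u)) \<in> borel_measurable (cyl_space :: (real \<Rightarrow> 'a) measure)" for u v
    by (rule measurable_compose[OF _ borel_measurable_continuous_onI[OF F]]) (intro borel_measurable_Pair borel_measurable_diff measurable_coord)
  then show ?thesis unfolding rsum_def[abs_def] by (intro borel_measurable_sum) simp
qed

lemma jsum_measurable:
  assumes \<eta>: "\<eta> > 0" and F: "continuous_on UNIV (\<lambda>(p, y). F p y)" and F0: "\<And>p y. norm y < \<eta> \<Longrightarrow> F p y = 0"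
  shows "jsum \<eta> F t \<in> borel_measurable (cyl_space :: (real \<Rightarrow> 'a::euclidean_space) measure)"
proof (cases "t > 0")
  case True
  show ?thesis
    by (rule borel_measurable_LIMSEQ_real[OF _ rsum_measurable[OF F]]) (use rsum_tendsto[OF _ \<eta> True F F0] in simp)
next
  case False
  then have "jsum \<eta> F t = (\<lambda>X. 0)" by (auto simp: jsum_def big_jumps_def fun_eq_iff)
  then show ?thesis by simp
qed

lemma jsum_limit:
  assumes "\<And>p y. (\<lambda>k. F k p y) \<longlonglongrightarrow> G p y"
  shows "(\<lambda>k. jsum \<eta> (F k) t X) \<longlonglongrightarrow> jsum \<eta> G t X"
  unfolding jsum_def by (intro tendsto_sum assms)

lemma jsum_stop:
  assumes "t \<le> T" shows "jsum \<eta> F t (stop T X) = jsum \<eta> F t X"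
proof -
  have l: "lft (stop T X) s = lft X s" if "s \<le> T" for s
  proof -
    have "\<forall>\<^sub>F u in at_left s. stop T X u = X u"
      unfolding eventually_at_filter using that by (auto simp: stop_def)
    then have "(stop T X \<longlongrightarrow> l) (at_left s) \<longleftrightarrow> (X \<longlongrightarrow> l) (at_left s)" for l by (rule tendsto_cong)
    then show ?thesis unfolding lft_def Topological_Spaces.Lim_def by simp
  qed
  have j: "jump (stop T X) s = jump X s" if "s \<le> T" for s using l[OF that] that by (simp add: jump_def stop_def)
  have "big_jumps \<eta> t (stop T X) = big_jumps \<eta> t X" using j assms by (auto simp: big_jumps_def)
  moreover have "s \<le> T" if "s \<in> big_jumps \<eta> t X" for s using that assms by (auto simp: big_jumps_def)
  ultimately show ?thesis unfolding jsum_def using l j by (intro sum.cong) auto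
qed

section \<open>Probabilistic bound for the small jumps\<close>

definition jump_int :: "('a::euclidean_space \<Rightarrow> 'a) \<Rightarrow> 'a \<Rightarrow> (real \<Rightarrow> real) \<Rightarrow> 'a \<Rightarrow> 'a \<Rightarrow> real" where
  "jump_int A x w p y = (A (x + p + (1/2) *\<^sub>R y) \<bullet> y) * w (norm y)"

text \<open>The characteristic function is even, so the marginal law is invariant under
  reflection.\<close>

lemma rel_marginal_odd_integral:
  fixes b :: "'a::euclidean_space"
  assumes h: "h > 0" and m: "m \<ge> 0" and [measurable]: "w \<in> borel_measurable borel"
  shows "(\<integral>y. (y \<bullet> b) * w (norm y) \<partial>rel_marginal m h) = 0"
proof -
  have um: "uminus \<in> rel_marginal m h \<rightarrow>\<^sub>M (borel :: 'a measure)"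
    unfolding measurable_cong_sets[OF sets_rel_marginal refl] by measurable
  have "distr (rel_marginal m h) borel uminus = (rel_marginal m h :: 'a measure)"
  proof (rule cf_unique)
    fix \<xi> :: 'a
    have "(\<integral>x. cis (\<xi> \<bullet> x) \<partial>distr (rel_marginal m h) borel uminus) = (\<integral>x. cis ((- \<xi>) \<bullet> x) \<partial>rel_marginal m h)"
    proof (subst integral_distr[OF um])
      show "(\<lambda>x. cis (\<xi> \<bullet> x)) \<in> borel_measurable borel"
        by (intro borel_measurable_cis borel_measurable_inner borel_measurable_const measurable_ident_sets refl)
    qed simp
    then show "(\<integral>x. cis (\<xi> \<bullet> x) \<partial>distr (rel_marginal m h) borel uminus) = (\<integral>x. cis (\<xi> \<bullet> x) \<partial>rel_marginal m h)"
      using rel_marginal_cf[OF h m, of \<xi>] rel_marginal_cf[OF h m, of "- \<xi>"] by (simp add: rel_exponent_def)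
      show "prob_space (distr (rel_marginal m h) borel uminus :: 'a measure)"
      by (rule prob_space.prob_space_distr[OF prob_space_rel_marginal[OF h m] um])
  qed (use h m in \<open>auto intro!: prob_space_rel_marginal\<close>)
  then have "(\<integral>y. (y \<bullet> b) * w (norm y) \<partial>rel_marginal m h) = (\<integral>y. (y \<bullet> b) * w (norm y) \<partial>distr (rel_marginal m h) borel uminus)"
    by simp
  also have "\<dots> = (\<integral>y. - ((y \<bullet> b) * w (norm y)) \<partial>rel_marginal m h)"
    by (subst integral_distr[OF um]) auto
  finally show ?thesis by simp
qed

lemma rel_marginal_truncated_moment:
  assumes h: "h > 0" and m: "m \<ge> 0" and r: "r > 0"
  shows "(\<integral>x. indicator {x. norm x < r} x * (norm x)\<^sup>2 \<partial>(rel_marginal m h :: 'a::euclidean_space measure)) \<le> 4 * r * h * gauss_abs TYPE('a)"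
  using h by (intro small_time_truncated_moment[OF prob_space_rel_marginal[OF h m] sets_rel_marginal rel_marginal_cf[OF h m] rel_exponent_bounds(1)[OF m] rel_exponent_bounds(2)[OF m] _ r]) simp

locale jump_estimate = rel_levy m M for m :: real and M :: "(real \<Rightarrow> 'a::euclidean_space) measure" +
  fixes A :: "'a \<Rightarrow> 'a" and KA L :: real
  assumes contA: "continuous_on UNIV A" and boundA: "\<And>x. norm (A x) \<le> KA" and lipA: "\<And>x y. norm (A x - A y) \<le> L * norm (x - y)"
    and L0: "L \<ge> 0"
begin

lemma KA0: "KA \<ge> 0" using boundA[of 0] norm_ge_zero order_trans by blast

lemma measurable_A [measurable]: "A \<in> borel_measurable borel"
  using contA by (rule borel_measurable_continuous_onI)

text \<open>Replacing the midpoint by the left end moves the argument of \<open>A\<close> by y/2,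
  which the Lipschitz bound turns into a quadratic error; the cutoff confines it to |y| <
  \<rho>.\<close>

lemma jump_int_bounds:
  assumes w: "\<And>r. 0 \<le> w r" "\<And>r. w r \<le> 1" "\<And>r. r \<ge> \<rho> \<Longrightarrow> w r = 0"
  shows "\<bar>jump_int A x w p y - (A (x + p) \<bullet> y) * w (norm y)\<bar> \<le> L / 2 * (indicator {y. norm y < \<rho>} y * (norm y)\<^sup>2)"
proof (cases "norm y < \<rho>")
  case True
  have "\<bar>jump_int A x w p y - (A (x + p) \<bullet> y) * w (norm y)\<bar> = \<bar>(A (x + p + (1/2) *\<^sub>R y) - A (x + p)) \<bullet> y\<bar> * w (norm y)"
    using w(1)[of "norm y"] by (simp add: jump_int_def inner_diff_left left_diff_distrib[symmetric] abs_mult)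
  also have "\<dots> \<le> \<bar>(A (x + p + (1/2) *\<^sub>R y) - A (x + p)) \<bullet> y\<bar> * 1" using w by (intro mult_left_mono) auto
  also have "\<dots> \<le> norm (A (x + p + (1/2) *\<^sub>R y) - A (x + p)) * norm y" by (simp add: Cauchy_Schwarz_ineq2)
  also have "\<dots> \<le> (L * norm ((1/2) *\<^sub>R y)) * norm y" using lipA[of "x + p + (1/2) *\<^sub>R y" "x + p"] by (intro mult_right_mono) auto
  finally show ?thesis using True by (simp add: power2_eq_square)
qed (use w in \<open>auto simp: jump_int_def\<close>)

context
  fixes n :: nat and t :: real and w :: "real \<Rightarrow> real" and \<rho> :: real and x :: 'a
  assumes n: "n > 0" and t: "t > 0" and wm [measurable]: "w \<in> borel_measurable borel"
    and w: "\<And>r. 0 \<le> w r" "\<And>r. w r \<le> 1" "\<And>r. r \<ge> \<rho> \<Longrightarrow> w r = 0" and \<rho>: "\<rho> > 0"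
begin

definition D :: "nat \<Rightarrow> (real \<Rightarrow> 'a) \<Rightarrow> 'a" where
  "D j X = X (t * real (Suc j) / real n) - X (t * real j / real n)"

definition G :: "nat \<Rightarrow> (real \<Rightarrow> 'a) \<Rightarrow> real" where
  "G j X = (A (x + X (t * real j / real n)) \<bullet> D j X) * w (norm (D j X))"

lemma D_measurable [measurable]: "D j \<in> borel_measurable M"
  unfolding D_def by measurable

lemma G_measurable [measurable]: "G j \<in> borel_measurable M"
  unfolding G_def by measurable

lemma D_indep: "indep_vars (\<lambda>_. borel) D {..<n}"
  unfolding D_def using n t
  by (intro indep_increments[of "\<lambda>k. t * real k / real n"]) (auto simp: divide_strict_right_mono)

lemma D_law: "distr M borel (D j) = rel_marginal m (t / real n)"
proof -
  have e: "t * real (Suc j) / real n - t * real j / real n = t / real n" by (simp add: distrib_left add_divide_distrib)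
  have "distr M borel (D j) = distr M borel (\<lambda>X. X (t * real (Suc j) / real n) - X (t * real j / real n))"
    by (simp add: D_def[abs_def])
  also have "\<dots> = rel_marginal m (t / real n)"
    using law_increment[of "t * real j / real n" "t * real (Suc j) / real n"] n t
    unfolding e by (simp add: divide_strict_right_mono)
  finally show ?thesis .
qed

lemma D_expectation: "\<psi> \<in> borel_measurable borel \<Longrightarrow> (\<integral>X. \<psi> (D j X) \<partial>M) = (\<integral>y. (\<psi> y :: real) \<partial>rel_marginal m (t / real n))"
  unfolding D_law[of j, symmetric] by (subst integral_distr) auto

lemma w_bound: "norm y * w (norm y) \<le> \<rho>"
proof (cases "norm y < \<rho>")
  case True
  then have "norm y * w (norm y) \<le> \<rho> * 1" using w \<rho> by (intro mult_mono) auto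
  then show ?thesis by simp
qed (use w \<rho> in auto)

lemma w_bound2: "(norm y * w (norm y))\<^sup>2 \<le> indicator {y. norm y < \<rho>} y * (norm y)\<^sup>2"
proof (cases "norm y < \<rho>")
  case True
  have "norm y * w (norm y) \<le> norm y * 1" using w by (intro mult_left_mono) auto
  then have "(norm y * w (norm y))\<^sup>2 \<le> (norm y)\<^sup>2" using w by (intro power_mono) auto
  then show ?thesis using True by simp
qed (use w in auto)

lemma inner_w_bound: "\<bar>(a \<bullet> y) * w (norm y)\<bar> \<le> norm a * (norm y * w (norm y))"
proof -
  have "\<bar>(a \<bullet> y) * w (norm y)\<bar> = \<bar>a \<bullet> y\<bar> * w (norm y)" using w by (simp add: abs_mult)
  also have "\<dots> \<le> (norm a * norm y) * w (norm y)" using w by (intro mult_right_mono Cauchy_Schwarz_ineq2)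
  finally show ?thesis by (simp add: mult.assoc)
qed

lemma G_bound: "\<bar>G j X\<bar> \<le> KA * (norm (D j X) * w (norm (D j X)))"
  unfolding G_def using w
  by (intro order_trans[OF inner_w_bound] mult_right_mono boundA mult_nonneg_nonneg) auto

lemma G_bound': "\<bar>G j X\<bar> \<le> KA * \<rho>"
  using G_bound[of j X] mult_left_mono[OF w_bound[of "D j X"] KA0] by linarith

text \<open>The partial sum of the \<open>G j\<close> as a function of the first \<open>k\<close>
  increments alone, each path value being the sum of the earlier increments. This exhibits it as a
  quantity of the past, independent of the next increment.\<close>

definition u :: "nat \<Rightarrow> (nat \<Rightarrow> 'a) \<Rightarrow> real" where
  "u k f = (\<Sum>j<k. (A (x + (\<Sum>l<j. f l)) \<bullet> f j) * w (norm (f j)))"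

lemma u_D:
  assumes "X \<in> D0" shows "u k (restrict (\<lambda>i. D i X) {..<k}) = (\<Sum>j<k. G j X)"
    and "(\<Sum>l<k. restrict (\<lambda>i. D i X) {..<k} l) = X (t * real k / real n)"
proof -
  have tele: "(\<Sum>l<j. D l X) = X (t * real j / real n)" for j
    using sum_lessThan_telescope[of "\<lambda>l. X (t * real l / real n)" j] assms by (simp add: D_def D0_zero)
  then show "(\<Sum>l<k. restrict (\<lambda>i. D i X) {..<k} l) = X (t * real k / real n)" by simp
  have "(\<Sum>l<j. restrict (\<lambda>i. D i X) {..<k} l) = (\<Sum>l<j. D l X)" if "j < k" for j
    using that by (intro sum.cong) auto
  then show "u k (restrict (\<lambda>i. D i X) {..<k}) = (\<Sum>j<k. G j X)"
    unfolding u_def G_def by (intro sum.cong refl) (auto simp: tele)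
qed

lemma u_measurable: "u k \<in> borel_measurable (\<Pi>\<^sub>M i\<in>{..<k}. borel)"
  unfolding u_def
proof (intro borel_measurable_sum)
  fix j assume "j \<in> {..<k}"
  then have [measurable]: "(\<lambda>f. f l) \<in> borel_measurable (\<Pi>\<^sub>M i\<in>{..<k}. (borel :: 'a measure))" if "l \<le> j" for l
    using that by (intro measurable_component_singleton) auto
  have [measurable]: "(\<lambda>f. \<Sum>l<j. f l) \<in> borel_measurable (\<Pi>\<^sub>M i\<in>{..<k}. (borel :: 'a measure))"
    by (intro borel_measurable_sum) auto
  have [measurable]: "(\<lambda>f. f j) \<in> borel_measurable (\<Pi>\<^sub>M i\<in>{..<k}. (borel :: 'a measure))"
    using \<open>j \<in> {..<k}\<close> by (intro measurable_component_singleton)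
  show "(\<lambda>f. (A (x + (\<Sum>l<j. f l)) \<bullet> f j) * w (norm (f j))) \<in> borel_measurable (\<Pi>\<^sub>M i\<in>{..<k}. borel)"
    by measurable
qed

text \<open>\<open>G k\<close> couples past and future in an inner product. Expanding it over
  \<open>Basis\<close> gives a sum of products, each a function of the past times a truncated
  component of the next increment, and the latter has mean 0 by symmetry.\<close>

lemma orthogonal:
  assumes k: "k < n" shows "(\<integral>X. (\<Sum>j<k. G j X) * G k X \<partial>M) = 0"
proof -
  define Ub where "Ub b f = u k f * (A (x + (\<Sum>l<k. f l)) \<bullet> b)" for b f
  define Vb where "Vb b f = (f k \<bullet> b) * w (norm (f k))" for b and f :: "nat \<Rightarrow> 'a"
  let ?R1 = "\<lambda>X. restrict (\<lambda>i. D i X) {..<k}" and ?R2 = "\<lambda>X. restrict (\<lambda>i. D i X) {k}"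
  have [measurable]: "(\<lambda>f. \<Sum>l<k. f l) \<in> borel_measurable (\<Pi>\<^sub>M i\<in>{..<k}. (borel :: 'a measure))"
    by (intro borel_measurable_sum measurable_component_singleton)
  note [measurable] = u_measurable
  have Um: "Ub b \<in> borel_measurable (\<Pi>\<^sub>M i\<in>{..<k}. borel)" for b
    unfolding Ub_def by measurable
  have [measurable]: "(\<lambda>f. f k) \<in> borel_measurable (\<Pi>\<^sub>M i\<in>{k}. (borel :: 'a measure))"
    by (intro measurable_component_singleton) simp
  have Vm: "Vb b \<in> borel_measurable (\<Pi>\<^sub>M i\<in>{k}. borel)" for b
    unfolding Vb_def by measurable
  have ub: "\<bar>u k f\<bar> \<le> real k * (KA * \<rho>)" for f
  proof -
    have "\<bar>u k f\<bar> \<le> (\<Sum>j<k. \<bar>(A (x + (\<Sum>l<j. f l)) \<bullet> f j) * w (norm (f j))\<bar>)" unfolding u_def by (rule sum_abs)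
    also have "\<dots> \<le> (\<Sum>j<k. KA * \<rho>)"
      using w by (intro sum_mono order_trans[OF inner_w_bound] mult_mono boundA w_bound KA0) auto
    finally show ?thesis by simp
  qed
  have R1: "?R1 \<in> M \<rightarrow>\<^sub>M (\<Pi>\<^sub>M i\<in>{..<k}. borel)" and R2: "?R2 \<in> M \<rightarrow>\<^sub>M (\<Pi>\<^sub>M i\<in>{k}. borel)"
    by (auto intro!: measurable_restrict)
  have iU: "integrable M (Ub b \<circ> ?R1)" for b
  proof (rule integrable_const_bound)
    show "AE X in M. norm ((Ub b \<circ> ?R1) X) \<le> real k * (KA * \<rho>) * (KA * norm b)"
    proof (rule AE_I2)
      fix X
      have "\<bar>A y \<bullet> b\<bar> \<le> KA * norm b" for y
        using Cauchy_Schwarz_ineq2[of "A y" b] mult_right_mono[OF boundA, of "norm b" y] by simp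
      then show "norm ((Ub b \<circ> ?R1) X) \<le> real k * (KA * \<rho>) * (KA * norm b)"
        unfolding Ub_def comp_def real_norm_def abs_mult using ub KA0 \<rho> by (intro mult_mono) auto
    qed
    show "Ub b \<circ> ?R1 \<in> borel_measurable M" by (rule measurable_comp[OF R1 Um])
  qed
  have iV: "integrable M (Vb b \<circ> ?R2)" for b
  proof (rule integrable_const_bound)
    show "AE X in M. norm ((Vb b \<circ> ?R2) X) \<le> norm b * \<rho>"
      using inner_w_bound[of b] w_bound
      by (intro AE_I2) (auto simp: Vb_def inner_commute intro!: order_trans[OF inner_w_bound] mult_left_mono)
    show "Vb b \<circ> ?R2 \<in> borel_measurable M" by (rule measurable_comp[OF R2 Vm])
  qed
  have ind: "indep_var borel (Ub b \<circ> ?R1) borel (Vb b \<circ> ?R2)" for b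
    by (rule indep_var_compose[OF indep_var_restrict[OF D_indep] Um Vm]) (use k in auto)
  have "(\<integral>X. (\<Sum>j<k. G j X) * G k X \<partial>M) = (\<integral>X. (\<Sum>b\<in>Basis. (Ub b \<circ> ?R1) X * (Vb b \<circ> ?R2) X) \<partial>M)"
  proof (intro Bochner_Integration.integral_cong refl)
    fix X assume "X \<in> space M"
    then have X: "X \<in> D0" by simp
    have "(\<Sum>j<k. G j X) * G k X = (\<Sum>j<k. G j X) * ((\<Sum>b\<in>Basis. (A (x + X (t * real k / real n)) \<bullet> b) * (D k X \<bullet> b)) * w (norm (D k X)))"
      by (simp only: G_def[of k] euclidean_inner[symmetric])
    also have "\<dots> = (\<Sum>b\<in>Basis. (Ub b \<circ> ?R1) X * (Vb b \<circ> ?R2) X)"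
      unfolding Ub_def Vb_def comp_def u_D[OF X]
      by (simp add: sum_distrib_left sum_distrib_right mult_ac)
    finally show "(\<Sum>j<k. G j X) * G k X = (\<Sum>b\<in>Basis. (Ub b \<circ> ?R1) X * (Vb b \<circ> ?R2) X)" .
  qed
  also have "\<dots> = (\<Sum>b\<in>Basis. (\<integral>X. (Ub b \<circ> ?R1) X * (Vb b \<circ> ?R2) X \<partial>M))"
    by (intro Bochner_Integration.integral_sum indep_var_integrable[OF ind iU iV])
  also have "\<dots> = (\<Sum>b\<in>Basis. (\<integral>X. (Ub b \<circ> ?R1) X \<partial>M) * (\<integral>X. (Vb b \<circ> ?R2) X \<partial>M))"
    by (intro sum.cong refl indep_var_lebesgue_integral[OF ind iU iV])
  also have "\<dots> = 0"
  proof (intro sum.neutral ballI)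
    fix b :: 'a
    have "(\<integral>X. (Vb b \<circ> ?R2) X \<partial>M) = (\<integral>X. (D k X \<bullet> b) * w (norm (D k X)) \<partial>M)" by (simp add: Vb_def)
    also have "\<dots> = (\<integral>y. (y \<bullet> b) * w (norm y) \<partial>rel_marginal m (t / real n))" by (rule D_expectation) measurable
    also have "\<dots> = 0" using n t m by (intro rel_marginal_odd_integral) auto
    finally show "(\<integral>X. (Ub b \<circ> ?R1) X \<partial>M) * (\<integral>X. (Vb b \<circ> ?R2) X \<partial>M) = 0" by simp
  qed
  finally show ?thesis .
qed

lemma moment_D: "(\<integral>X. indicator {y. norm y < \<rho>} (D j X) * (norm (D j X))\<^sup>2 \<partial>M) \<le> 4 * \<rho> * (t / real n) * gauss_abs TYPE('a)"
  using rel_marginal_truncated_moment[of "t / real n" m \<rho>, where 'a='a] n t m \<rho>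
  by (subst D_expectation) auto

lemma integrable_moment_D: "integrable M (\<lambda>X. indicator {y. norm y < \<rho>} (D j X) * (norm (D j X))\<^sup>2)"
proof (rule integrable_const_bound[where B="\<rho>\<^sup>2"])
  show "AE X in M. norm (indicator {y. norm y < \<rho>} (D j X) * (norm (D j X))\<^sup>2) \<le> \<rho>\<^sup>2"
    using power_mono[of "norm (D j _)" \<rho> 2] by (intro AE_I2) (auto simp: indicator_def)
qed measurable

lemma sum_G_bound: "\<bar>\<Sum>j<k. G j X\<bar> \<le> real k * (KA * \<rho>)"
proof -
  have "\<bar>\<Sum>j<k. G j X\<bar> \<le> (\<Sum>j<k. \<bar>G j X\<bar>)" by (rule sum_abs)
  also have "\<dots> \<le> (\<Sum>j<k. KA * \<rho>)" by (intro sum_mono G_bound')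
  finally show ?thesis by simp
qed

lemma sum_G_square_bound: "(\<Sum>j<k. G j X)\<^sup>2 \<le> (real k * (KA * \<rho>))\<^sup>2"
  using sum_G_bound[where k=k and X=X] by (intro abs_le_square_iff[THEN iffD1]) linarith

text \<open>Orthogonality removes the cross terms, so n steps of order \<rho> t/n add up to a bound
  of order \<rho> t that does not grow with n.\<close>

lemma second_moment:
  "k \<le> n \<Longrightarrow> (\<integral>X. (\<Sum>j<k. G j X)\<^sup>2 \<partial>M) \<le> real k * (KA\<^sup>2 * (4 * \<rho> * (t / real n) * gauss_abs TYPE('a)))"
proof (induction k)
  case (Suc k)
  have kn: "k < n" using Suc by simp
  have i1: "integrable M (\<lambda>X. (\<Sum>j<k. G j X)\<^sup>2)"
  proof (rule integrable_const_bound)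
    show "AE X in M. norm ((\<Sum>j<k. G j X)\<^sup>2) \<le> (real k * (KA * \<rho>))\<^sup>2"
      using sum_G_square_bound by (intro AE_I2) simp
  qed measurable
  have i2: "integrable M (\<lambda>X. (\<Sum>j<k. G j X) * G k X)"
  proof (rule integrable_const_bound)
    show "AE X in M. norm ((\<Sum>j<k. G j X) * G k X) \<le> (real k * (KA * \<rho>)) * (KA * \<rho>)"
      unfolding real_norm_def abs_mult using sum_G_bound G_bound' KA0 \<rho> by (intro AE_I2 mult_mono) auto
  qed measurable
  have G2: "(G k X)\<^sup>2 \<le> KA\<^sup>2 * (indicator {y. norm y < \<rho>} (D k X) * (norm (D k X))\<^sup>2)" for X
  proof -
    have "(G k X)\<^sup>2 \<le> (KA * (norm (D k X) * w (norm (D k X))))\<^sup>2"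
      using G_bound[of k X] abs_ge_zero power_mono[of "\<bar>G k X\<bar>" _ 2] by fastforce
    also have "\<dots> = KA\<^sup>2 * (norm (D k X) * w (norm (D k X)))\<^sup>2" by (simp add: power_mult_distrib)
    also have "\<dots> \<le> KA\<^sup>2 * (indicator {y. norm y < \<rho>} (D k X) * (norm (D k X))\<^sup>2)"
      by (intro mult_left_mono w_bound2) simp
    finally show ?thesis .
  qed
  have i3: "integrable M (\<lambda>X. (G k X)\<^sup>2)"
    by (rule Bochner_Integration.integrable_bound[OF integrable_mult_right[OF integrable_moment_D[of k], of "KA\<^sup>2"]])
       (auto intro!: AE_I2 order_trans[OF G2])
  have "(\<integral>X. (G k X)\<^sup>2 \<partial>M) \<le> (\<integral>X. KA\<^sup>2 * (indicator {y. norm y < \<rho>} (D k X) * (norm (D k X))\<^sup>2) \<partial>M)"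
    by (intro integral_mono i3 integrable_mult_right integrable_moment_D G2)
  also have "\<dots> = KA\<^sup>2 * (\<integral>X. indicator {y. norm y < \<rho>} (D k X) * (norm (D k X))\<^sup>2 \<partial>M)" by (rule integral_mult_right_zero)
  also have "\<dots> \<le> KA\<^sup>2 * (4 * \<rho> * (t / real n) * gauss_abs TYPE('a))" by (intro mult_left_mono moment_D) simp
  finally have G3: "(\<integral>X. (G k X)\<^sup>2 \<partial>M) \<le> KA\<^sup>2 * (4 * \<rho> * (t / real n) * gauss_abs TYPE('a))" .
  have "(\<integral>X. (\<Sum>j<Suc k. G j X)\<^sup>2 \<partial>M) = (\<integral>X. (\<Sum>j<k. G j X)\<^sup>2 + (2 * ((\<Sum>j<k. G j X) * G k X) + (G k X)\<^sup>2) \<partial>M)"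
    by (intro Bochner_Integration.integral_cong refl) (simp add: power2_sum)
  also have "\<dots> = (\<integral>X. (\<Sum>j<k. G j X)\<^sup>2 \<partial>M) + (2 * (\<integral>X. (\<Sum>j<k. G j X) * G k X \<partial>M) + (\<integral>X. (G k X)\<^sup>2 \<partial>M))"
    using i1 i2 i3 by simp
  also have "\<dots> \<le> real k * (KA\<^sup>2 * (4 * \<rho> * (t / real n) * gauss_abs TYPE('a))) + KA\<^sup>2 * (4 * \<rho> * (t / real n) * gauss_abs TYPE('a))"
    using Suc.IH orthogonal[OF kn] G3 kn by simp
  finally show ?case by (simp add: algebra_simps add_divide_distrib)
qed simp

text \<open>The sum is split into the odd part and the quadratic remainder, each allowed \<delta>/2:
  Chebyshev for the first, Markov for the second. The bound is independent of \<open>n\<close> and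
  linear in the cutoff \<rho>, so it survives the limits taken later.\<close>

lemma rsum_tail:
  assumes \<delta>: "\<delta> > 0"
  shows "prob {X \<in> space M. \<bar>rsum n (jump_int A x w) t X\<bar> > \<delta>} \<le> \<rho> * t * gauss_abs TYPE('a) * (16 * KA\<^sup>2 / \<delta>\<^sup>2 + 4 * L / \<delta>)"
proof -
  let ?S = "\<lambda>X. \<Sum>j<n. G j X" and ?g = "gauss_abs TYPE('a)"
  define B where "B X = (\<Sum>j<n. indicator {y. norm y < \<rho>} (D j X) * (norm (D j X))\<^sup>2)" for X
  have Bm [measurable]: "B \<in> borel_measurable M" unfolding B_def by measurable
  have B0: "0 \<le> B X" for X by (auto simp: B_def intro: sum_nonneg)
  have iB: "integrable M B" unfolding B_def by (intro Bochner_Integration.integrable_sum integrable_moment_D)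
  have "(\<integral>X. B X \<partial>M) = (\<Sum>j<n. \<integral>X. indicator {y. norm y < \<rho>} (D j X) * (norm (D j X))\<^sup>2 \<partial>M)"
    unfolding B_def by (intro Bochner_Integration.integral_sum integrable_moment_D)
  also have "\<dots> \<le> (\<Sum>j<n. 4 * \<rho> * (t / real n) * ?g)" by (intro sum_mono moment_D)
  also have "\<dots> = 4 * \<rho> * t * ?g" using n by simp
  finally have EB: "(\<integral>X. B X \<partial>M) \<le> 4 * \<rho> * t * ?g" .
  have ES: "(\<integral>X. (?S X)\<^sup>2 \<partial>M) \<le> 4 * KA\<^sup>2 * \<rho> * t * ?g"
    using second_moment[of n] n by (simp add: mult_ac)
  have iS: "integrable M (\<lambda>X. (?S X)\<^sup>2)"
  proof (rule integrable_const_bound)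
    show "AE X in M. norm ((?S X)\<^sup>2) \<le> (real n * (KA * \<rho>))\<^sup>2"
      using sum_G_square_bound by (intro AE_I2) simp
  qed measurable
  have split: "\<bar>rsum n (jump_int A x w) t X - ?S X\<bar> \<le> L / 2 * B X" for X
  proof -
    have "\<bar>rsum n (jump_int A x w) t X - ?S X\<bar> = \<bar>\<Sum>j<n. (jump_int A x w (X (t * real j / real n)) (D j X) - G j X)\<bar>"
      by (simp add: rsum_def D_def sum_subtractf)
    also have "\<dots> \<le> (\<Sum>j<n. \<bar>jump_int A x w (X (t * real j / real n)) (D j X) - G j X\<bar>)" by (rule sum_abs)
    also have "\<dots> \<le> (\<Sum>j<n. L / 2 * (indicator {y. norm y < \<rho>} (D j X) * (norm (D j X))\<^sup>2))"
      unfolding G_def by (intro sum_mono jump_int_bounds w)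
    finally show ?thesis unfolding B_def sum_distrib_left .
  qed
  have sub: "{X \<in> space M. \<bar>rsum n (jump_int A x w) t X\<bar> > \<delta>} \<subseteq> {X \<in> space M. (\<delta>/2)\<^sup>2 \<le> (?S X)\<^sup>2} \<union> {X \<in> space M. \<delta> / 2 \<le> L / 2 * B X}"
  proof
    fix X assume X: "X \<in> {X \<in> space M. \<bar>rsum n (jump_int A x w) t X\<bar> > \<delta>}"
    then have "\<delta> < \<bar>rsum n (jump_int A x w) t X\<bar>" by simp
    then have "\<delta>/2 \<le> \<bar>?S X\<bar> \<or> \<delta>/2 \<le> L / 2 * B X" using split[of X] by linarith
    moreover have "(\<delta>/2)\<^sup>2 \<le> (?S X)\<^sup>2" if "\<delta>/2 \<le> \<bar>?S X\<bar>" using that \<delta> power_mono[of "\<delta>/2" "\<bar>?S X\<bar>" 2] by simp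
    ultimately show "X \<in> {X \<in> space M. (\<delta>/2)\<^sup>2 \<le> (?S X)\<^sup>2} \<union> {X \<in> space M. \<delta> / 2 \<le> L / 2 * B X}" using X by auto
  qed
  have "prob {X \<in> space M. \<bar>rsum n (jump_int A x w) t X\<bar> > \<delta>} \<le> prob ({X \<in> space M. (\<delta>/2)\<^sup>2 \<le> (?S X)\<^sup>2} \<union> {X \<in> space M. \<delta> / 2 \<le> L / 2 * B X})"
    by (intro finite_measure_mono sub) measurable
  also have "\<dots> \<le> prob {X \<in> space M. (\<delta>/2)\<^sup>2 \<le> (?S X)\<^sup>2} + prob {X \<in> space M. \<delta> / 2 \<le> L / 2 * B X}"
    by (intro measure_Un_le) measurable
  also have "prob {X \<in> space M. (\<delta>/2)\<^sup>2 \<le> (?S X)\<^sup>2} \<le> (\<integral>X. (?S X)\<^sup>2 \<partial>M) / (\<delta>/2)\<^sup>2"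
    using \<delta> iS by (intro integral_Markov_inequality_measure[where A="{}"]) auto
  also have "\<dots> \<le> (4 * KA\<^sup>2 * \<rho> * t * ?g) / (\<delta>/2)\<^sup>2" using ES by (intro divide_right_mono) auto
  also have "prob {X \<in> space M. \<delta> / 2 \<le> L / 2 * B X} \<le> (\<integral>X. L / 2 * B X \<partial>M) / (\<delta>/2)"
    using \<delta> iB B0 L0 by (intro integral_Markov_inequality_measure[where A="{}"]) auto
  also have "(\<integral>X. L / 2 * B X \<partial>M) = L / 2 * (\<integral>X. B X \<partial>M)" by (rule integral_mult_right_zero)
  also have "L / 2 * (\<integral>X. B X \<partial>M) / (\<delta>/2) \<le> L / 2 * (4 * \<rho> * t * ?g) / (\<delta>/2)" using EB L0 \<delta> by (intro divide_right_mono mult_left_mono) auto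
  finally have "prob {X \<in> space M. \<bar>rsum n (jump_int A x w) t X\<bar> > \<delta>} \<le> (4 * KA\<^sup>2 * \<rho> * t * ?g) / (\<delta>/2)\<^sup>2 + L / 2 * (4 * \<rho> * t * ?g) / (\<delta>/2)"
    by simp
  also have "\<dots> = \<rho> * t * ?g * (16 * KA\<^sup>2 / \<delta>\<^sup>2 + 4 * L / \<delta>)"
    using \<delta> by (simp add: field_simps power2_eq_square)
  finally show ?thesis .
qed

end

end

section \<open>Continuous cutoffs for the size of a jump\<close>

definition ramp :: "real \<Rightarrow> real" where
  "ramp u = max 0 (min 1 u)"

text \<open>The slope k + 2/a grows with k but is at least 2/a from the start, so every member
  equals 1 from \<open>a\<close> on and vanishes below a/2. Sums with this cutoff thus involve
  finitely many jumps.\<close>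

definition soft_ge :: "real \<Rightarrow> nat \<Rightarrow> real \<Rightarrow> real" where
  "soft_ge a k r = ramp ((real k + 2 / a) * (r - a) + 1)"

text \<open>The second factor vanishes from \<open>b\<close> on and tends to 1 below
  \<open>b\<close>, which produces a half-open interval in the limit.\<close>

definition soft_Ico :: "real \<Rightarrow> real \<Rightarrow> nat \<Rightarrow> real \<Rightarrow> real" where
  "soft_Ico a b k r = soft_ge a k r * ramp (real k * (b - r))"

lemma ramp_cont: "continuous_on UNIV ramp"
  unfolding ramp_def by (intro continuous_intros)

lemma ramp_bounds: "0 \<le> ramp u" "ramp u \<le> 1"
  by (auto simp: ramp_def)

lemma ramp_zero: "u \<le> 0 \<Longrightarrow> ramp u = 0"
  by (simp add: ramp_def)

lemma soft_ge_cont: "continuous_on UNIV (soft_ge a k)"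
  unfolding soft_ge_def by (intro continuous_on_compose2[OF ramp_cont] continuous_intros) auto

lemma soft_Ico_cont: "continuous_on UNIV (soft_Ico a b k)"
  unfolding soft_Ico_def
  by (intro continuous_on_mult soft_ge_cont continuous_on_compose2[OF ramp_cont] continuous_intros) auto

lemma soft_ge_zero:
  assumes "a > 0" "r < a / 2" shows "soft_ge a k r = 0"
proof -
  have "(real k + 2 / a) * (r - a) \<le> (2 / a) * (r - a)" using assms by (intro mult_right_mono_neg) auto
  also have "\<dots> \<le> (2 / a) * (- (a / 2))" using assms by (intro mult_left_mono) auto
  also have "\<dots> = -1" using assms by simp
  finally show ?thesis by (simp add: soft_ge_def ramp_def)
qed

lemma ramp_eventually_zero:
  assumes "c < 0" shows "\<forall>\<^sub>F k in sequentially. ramp ((real k + d) * c + e) = 0"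
proof -
  have "filterlim (\<lambda>k. (real k + d) * (- c) - e) at_top sequentially"
    using assms by real_asymp
  then have "\<forall>\<^sub>F k in sequentially. (real k + d) * (- c) - e \<ge> 0" unfolding filterlim_at_top by blast
  then show ?thesis by eventually_elim (simp add: ramp_def algebra_simps)
qed

lemma soft_ge_tendsto:
  assumes "a > 0" shows "(\<lambda>k. soft_ge a k r) \<longlonglongrightarrow> indicator {a..} r"
proof (cases "a \<le> r")
  case True
  then have "0 \<le> (real k + 2 / a) * (r - a)" for k using assms by (intro mult_nonneg_nonneg) auto
  then have "soft_ge a k r = 1" for k by (simp add: soft_ge_def ramp_def)
  then show ?thesis using True by simp
next
  case False
  then have "\<forall>\<^sub>F k in sequentially. soft_ge a k r = 0"
    unfolding soft_ge_def by (intro ramp_eventually_zero) simp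
  then show ?thesis using False by (simp add: tendsto_eventually)
qed

lemma soft_Ico_tendsto:
  assumes "a > 0" shows "(\<lambda>k. soft_Ico a b k r) \<longlonglongrightarrow> indicator {a..<b} r"
proof (cases "r < b")
  case True
  have "filterlim (\<lambda>k. real k * (b - r)) at_top sequentially" using True by real_asymp
  then have "\<forall>\<^sub>F k in sequentially. real k * (b - r) \<ge> 1" by (simp add: filterlim_at_top)
  then have "\<forall>\<^sub>F k in sequentially. ramp (real k * (b - r)) = 1" by eventually_elim (simp add: ramp_def)
  then have "(\<lambda>k. ramp (real k * (b - r))) \<longlonglongrightarrow> 1" by (rule tendsto_eventually)
  from tendsto_mult[OF soft_ge_tendsto[OF assms, of r] this] show ?thesis
    using True by (simp add: soft_Ico_def indicator_def)
next
  case False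
  then have "real k * (b - r) \<le> 0" for k by (simp add: mult_nonneg_nonpos)
  then have "ramp (real k * (b - r)) = 0" for k by (simp add: ramp_zero)
  then show ?thesis using False by (simp add: soft_Ico_def)
qed

lemma soft_Ico_bounds: "0 \<le> soft_Ico a b k r" "soft_Ico a b k r \<le> 1"
  unfolding soft_Ico_def soft_ge_def using ramp_bounds by (auto intro: mult_nonneg_nonneg mult_le_one)

lemma soft_Ico_zero: "r \<ge> b \<Longrightarrow> soft_Ico a b k r = 0"
  by (simp add: soft_Ico_def ramp_zero mult_nonneg_nonpos)

text \<open>The condition |Y| > \<delta> is strict, so where \<open>Z n\<close> converges to
  \<open>Y\<close> it eventually holds for \<open>Z n\<close> as well: up to a null set the event
  lies in the increasing union of the \<open>B N\<close>.\<close>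

lemma (in prob_space) tail_limit:
  fixes Z :: "nat \<Rightarrow> 'a \<Rightarrow> real"
  assumes [measurable]: "\<And>n. Z n \<in> borel_measurable M" "Y \<in> borel_measurable M"
    and lim: "AE X in M. (\<lambda>n. Z n X) \<longlonglongrightarrow> Y X"
    and c: "\<And>n. prob {X \<in> space M. \<bar>Z n X\<bar> > \<delta>} \<le> c"
  shows "prob {X \<in> space M. \<bar>Y X\<bar> > \<delta>} \<le> c"
proof -
  define B where "B N = {X \<in> space M. \<forall>n\<ge>N. \<bar>Z n X\<bar> > \<delta>}" for N
  have [measurable]: "B N \<in> sets M" for N unfolding B_def by measurable
  have "incseq B" by (auto simp: incseq_def B_def)
  then have L: "(\<lambda>N. prob (B N)) \<longlonglongrightarrow> prob (\<Union>N. B N)" by (intro finite_Lim_measure_incseq) auto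
  have le: "prob (B N) \<le> c" for N
    by (rule order_trans[OF finite_measure_mono c[of N]]) (auto simp: B_def)
  have "AE X in M. X \<in> {X \<in> space M. \<bar>Y X\<bar> > \<delta>} \<longrightarrow> X \<in> (\<Union>N. B N)"
    using lim
  proof eventually_elim
    case (elim X)
    show ?case
    proof
      assume X: "X \<in> {X \<in> space M. \<bar>Y X\<bar> > \<delta>}"
      then have "\<forall>\<^sub>F n in sequentially. \<bar>Z n X\<bar> > \<delta>"
        using order_tendstoD(1)[OF tendsto_rabs[OF elim], of \<delta>] by simp
      then show "X \<in> (\<Union>N. B N)" using X by (auto simp: eventually_sequentially B_def)
    qed
  qed
  then have "prob {X \<in> space M. \<bar>Y X\<bar> > \<delta>} \<le> prob (\<Union>N. B N)"
    by (intro finite_measure_mono_AE) auto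
  also have "\<dots> \<le> c" using L le by (intro LIMSEQ_le_const2) auto
  finally show ?thesis .
qed

section \<open>Sums over bands of jump sizes and their limit at size zero\<close>

lemma jump_int_cont:
  assumes "continuous_on UNIV A" "continuous_on UNIV w"
  shows "continuous_on UNIV (\<lambda>(p, y). jump_int A x w p y)"
  unfolding jump_int_def case_prod_unfold
  by (intro continuous_on_mult continuous_on_inner continuous_on_compose2[OF assms(1)] continuous_on_compose2[OF assms(2)] continuous_intros) auto

text \<open>The threshold \<open>a / 2\<close> only keeps the sum finite. It lies below \<open>a\<close> so that the continuous
  cutoffs approximating the indicator are covered as well.\<close>

definition band_sum :: "('a::euclidean_space \<Rightarrow> 'a) \<Rightarrow> 'a \<Rightarrow> real \<Rightarrow> real \<Rightarrow> real \<Rightarrow> (real \<Rightarrow> 'a) \<Rightarrow> real" where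
  "band_sum A x t a b X = jsum (a / 2) (jump_int A x (indicator {a..<b})) t X"

definition big_jump_sum :: "('a::euclidean_space \<Rightarrow> 'a) \<Rightarrow> 'a \<Rightarrow> real \<Rightarrow> (real \<Rightarrow> 'a) \<Rightarrow> real" where
  "big_jump_sum A x t X = jsum (1 / 2) (jump_int A x (indicator {1..})) t X"

lemma jsum_soft_Ico_tendsto: "a > 0 \<Longrightarrow> (\<lambda>k. jsum \<eta> (jump_int A x (soft_Ico a b k)) t X) \<longlonglongrightarrow> jsum \<eta> (jump_int A x (indicator {a..<b})) t X"
  unfolding jump_int_def by (intro jsum_limit tendsto_mult tendsto_const soft_Ico_tendsto)

lemma jsum_soft_ge_tendsto: "a > 0 \<Longrightarrow> (\<lambda>k. jsum \<eta> (jump_int A x (soft_ge a k)) t X) \<longlonglongrightarrow> jsum \<eta> (jump_int A x (indicator {a..})) t X"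
  unfolding jump_int_def by (intro jsum_limit tendsto_mult tendsto_const soft_ge_tendsto)

lemma jsum_soft_Ico_measurable:
  assumes "continuous_on UNIV A" "a > 0"
  shows "jsum (a / 2) (jump_int A x (soft_Ico a b k)) t \<in> borel_measurable (cyl_space :: (real \<Rightarrow> 'a::euclidean_space) measure)"
  using assms by (intro jsum_measurable jump_int_cont soft_Ico_cont) (auto simp: jump_int_def soft_Ico_def soft_ge_zero)

lemma band_sum_measurable:
  assumes "continuous_on UNIV A" "a > 0"
  shows "band_sum A x t a b \<in> borel_measurable (cyl_space :: (real \<Rightarrow> 'a::euclidean_space) measure)"
  unfolding band_sum_def[abs_def]
  by (rule borel_measurable_LIMSEQ_real[OF jsum_soft_Ico_tendsto jsum_soft_Ico_measurable]) (use assms in auto)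

lemma big_jump_sum_measurable:
  assumes "continuous_on UNIV A"
  shows "big_jump_sum A x t \<in> borel_measurable (cyl_space :: (real \<Rightarrow> 'a::euclidean_space) measure)"
  unfolding big_jump_sum_def[abs_def]
  by (rule borel_measurable_LIMSEQ_real[OF jsum_soft_ge_tendsto])
     (use assms in \<open>auto intro!: jsum_measurable jump_int_cont soft_ge_cont simp: jump_int_def soft_ge_zero\<close>)

lemma jump_sum_eq_jsum:
  assumes X: "X \<in> D0" and \<eta>: "\<eta> > 0" and S: "\<And>r. r \<in> S \<Longrightarrow> \<eta> \<le> r"
  shows "(\<Sum>s \<in> {s \<in> {0<..t}. norm (jump X s) \<in> S}. A (x + lft X s + (1/2) *\<^sub>R jump X s) \<bullet> jump X s) = jsum \<eta> (jump_int A x (indicator S)) t X"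
  unfolding jsum_def jump_int_def
  by (intro sum.mono_neutral_cong_left finite_big_jumps[OF X \<eta>]) (auto simp: big_jumps_def S)

lemma band_sum_eq:
  assumes "X \<in> D0" "a > 0"
  shows "band_sum A x t a b X = (\<Sum>s \<in> {s \<in> {0<..t}. a \<le> norm (jump X s) \<and> norm (jump X s) < b}. A (x + lft X s + (1/2) *\<^sub>R jump X s) \<bullet> jump X s)"
  unfolding band_sum_def using assms by (subst jump_sum_eq_jsum[symmetric]) auto

lemma big_jump_sum_eq:
  assumes "X \<in> D0"
  shows "big_jump_sum A x t X = (\<Sum>s \<in> {s \<in> {0<..t}. norm (jump X s) \<ge> 1}. A (x + lft X s + (1/2) *\<^sub>R jump X s) \<bullet> jump X s)"
  unfolding big_jump_sum_def using assms by (subst jump_sum_eq_jsum[symmetric]) auto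

lemma band_sum_diff:
  assumes X: "X \<in> D0" and a: "0 < a" "a \<le> b" "b \<le> c"
  shows "band_sum A x t a c X - band_sum A x t b c X = band_sum A x t a b X"
proof -
  let ?S = "\<lambda>a b. {s \<in> {0<..t}. a \<le> norm (jump X s) \<and> norm (jump X s) < b}"
  have fin: "finite (?S a' b')" if "a' > 0" for a' b'
    by (rule finite_subset[OF _ finite_big_jumps[OF X that, of t]]) (auto simp: big_jumps_def)
  have "?S a c = ?S a b \<union> ?S b c" using a by auto
  moreover have "?S a b \<inter> ?S b c = {}" by auto
  ultimately show ?thesis
    using X a fin by (simp add: band_sum_eq sum.union_disjoint)
qed

lemma band_sum_stop: "t \<le> T \<Longrightarrow> band_sum A x t a b (stop T X) = band_sum A x t a b X"
  by (simp add: band_sum_def jsum_stop)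

lemma big_jump_sum_stop: "t \<le> T \<Longrightarrow> big_jump_sum A x t (stop T X) = big_jump_sum A x t X"
  by (simp add: big_jump_sum_def jsum_stop)

text \<open>No compensator and no mass appear here: the symmetry of the jumps makes the uncompensated sums
  converge, along \<open>8\<^sup>-\<^sup>j\<close> almost surely under every \<open>lam m\<close>.\<close>

definition small_jump_limit :: "('a::euclidean_space \<Rightarrow> 'a) \<Rightarrow> 'a \<Rightarrow> real \<Rightarrow> (real \<Rightarrow> 'a) \<Rightarrow> real" where
  "small_jump_limit A x t X = lim (\<lambda>j. band_sum A x t ((1/8) ^ Suc j) 1 X)"

lemma small_jump_limit_stop: "t \<le> T \<Longrightarrow> small_jump_limit A x t (stop T X) = small_jump_limit A x t X"
  by (simp add: small_jump_limit_def band_sum_stop)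

lemma small_jump_limit_measurable:
  assumes "continuous_on UNIV A"
  shows "small_jump_limit A x t \<in> borel_measurable (cyl_space :: (real \<Rightarrow> 'a::euclidean_space) measure)"
  unfolding small_jump_limit_def[abs_def] by (intro borel_measurable_lim_metric band_sum_measurable assms) simp

context jump_estimate
begin

definition tail_const :: "real \<Rightarrow> real \<Rightarrow> real" where
  "tail_const t \<delta> = t * gauss_abs TYPE('a) * (16 * KA\<^sup>2 / \<delta>\<^sup>2 + 4 * L / \<delta>)"

text \<open>Two successive limits of \<open>rsum_tail\<close>: the mesh tends to 0 for a fixed
  continuous cutoff, then the cutoff tends to the indicator. The bound sees the band only through
  its upper end.\<close>

lemma band_sum_tail:
  assumes a: "0 < a" "a < b" and t: "0 \<le> t" and \<delta>: "\<delta> > 0"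
  shows "prob {X \<in> space M. \<bar>band_sum A x t a b X\<bar> > \<delta>} \<le> b * tail_const t \<delta>"
proof (cases "t = 0")
  case True
  then have "band_sum A x t a b X = 0" for X by (simp add: band_sum_def jsum_def big_jumps_def)
  then show ?thesis using True \<delta> by (simp add: tail_const_def)
next
  case False
  then have t: "t > 0" using t by simp
  have cong: "f \<in> borel_measurable M \<longleftrightarrow> f \<in> borel_measurable cyl_space" for f :: "(real \<Rightarrow> 'a) \<Rightarrow> real"
    by (simp only: measurable_cong_sets[OF sets_M refl])
  have soft: "prob {X \<in> space M. \<bar>jsum (a / 2) (jump_int A x (soft_Ico a b k)) t X\<bar> > \<delta>} \<le> b * tail_const t \<delta>" for k
  \<comment> \<open>The index is shifted because the bound for Riemann sums needs at least one
    interval.\<close>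
  proof (rule tail_limit[where Z="\<lambda>n. rsum (Suc n) (jump_int A x (soft_Ico a b k)) t"])
    have c: "continuous_on UNIV (\<lambda>(p, y). jump_int A x (soft_Ico a b k) p y)"
      by (rule jump_int_cont[OF contA soft_Ico_cont])
    show "rsum (Suc n) (jump_int A x (soft_Ico a b k)) t \<in> borel_measurable M" for n
      unfolding cong by (rule rsum_measurable[OF c])
    show "jsum (a / 2) (jump_int A x (soft_Ico a b k)) t \<in> borel_measurable M"
      unfolding cong using a by (intro jsum_soft_Ico_measurable contA)
    show "AE X in M. (\<lambda>n. rsum (Suc n) (jump_int A x (soft_Ico a b k)) t X) \<longlonglongrightarrow> jsum (a / 2) (jump_int A x (soft_Ico a b k)) t X"
    proof (rule AE_I2)
      fix X assume "X \<in> space M"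
      then have "(\<lambda>n. rsum n (jump_int A x (soft_Ico a b k)) t X) \<longlonglongrightarrow> jsum (a / 2) (jump_int A x (soft_Ico a b k)) t X"
        using a by (intro rsum_tendsto[OF _ _ t c]) (auto simp: jump_int_def soft_Ico_def soft_ge_zero)
      then show "(\<lambda>n. rsum (Suc n) (jump_int A x (soft_Ico a b k)) t X) \<longlonglongrightarrow> jsum (a / 2) (jump_int A x (soft_Ico a b k)) t X"
        by (rule LIMSEQ_Suc)
    qed
    show "prob {X \<in> space M. \<delta> < \<bar>rsum (Suc n) (jump_int A x (soft_Ico a b k)) t X\<bar>} \<le> b * tail_const t \<delta>" for n
      using rsum_tail[of "Suc n" t "soft_Ico a b k" b \<delta> x] a t \<delta> soft_Ico_bounds soft_Ico_zero
        borel_measurable_continuous_onI[OF soft_Ico_cont]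
      by (simp add: tail_const_def mult.assoc)
  qed
  show ?thesis
  proof (rule tail_limit[OF _ _ _ soft])
    show "jsum (a / 2) (jump_int A x (soft_Ico a b k)) t \<in> borel_measurable M" for k
      unfolding cong using a by (intro jsum_soft_Ico_measurable contA)
    show "band_sum A x t a b \<in> borel_measurable M" unfolding cong using a by (intro band_sum_measurable contA)
    show "AE X in M. (\<lambda>k. jsum (a / 2) (jump_int A x (soft_Ico a b k)) t X) \<longlonglongrightarrow> band_sum A x t a b X"
      unfolding band_sum_def using a by (intro AE_I2 jsum_soft_Ico_tendsto)
  qed
qed

lemma band_sum_meas: "a > 0 \<Longrightarrow> band_sum A x t a b \<in> borel_measurable M"
  unfolding measurable_cong_sets[OF sets_M refl] by (intro band_sum_measurable contA)

lemma small_jump_limit_meas: "small_jump_limit A x t \<in> borel_measurable M"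
  unfolding measurable_cong_sets[OF sets_M refl] by (intro small_jump_limit_measurable contA)

text \<open>Borel-Cantelli over the bands between consecutive powers of 1/8, with threshold 2^-j for
  band j. The worst term of the tail bound divides the band size, of order 8^-j, by the squared
  threshold 4^-j and leaves 2^-j; so both the probabilities and the thresholds are summable.\<close>

lemma AE_small_jump_limit:
  assumes t: "0 \<le> t"
  shows "AE X in M. (\<lambda>j. band_sum A x t ((1/8) ^ Suc j) 1 X) \<longlonglongrightarrow> small_jump_limit A x t X"
proof -
  define a where "a j = (1/8::real) ^ Suc j" for j
  have a: "0 < a j" "a (Suc j) < a j" for j by (auto simp: a_def)
  have a1: "a j \<le> 1" for j unfolding a_def by (rule power_le_one) auto
  define E where "E j = {X \<in> space M. \<bar>band_sum A x t (a (Suc j)) (a j) X\<bar> > (1/2) ^ j}" for j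
  have Em [measurable]: "E j \<in> sets M" for j
    unfolding E_def using band_sum_meas[OF a(1)] by measurable
  define C where "C = t * gauss_abs TYPE('a) * (16 * KA\<^sup>2 + 4 * L)"
  have C0: "0 \<le> t * gauss_abs TYPE('a)" by (intro mult_nonneg_nonneg t gauss_abs_nonneg)
  have bound: "prob (E j) \<le> C * (1/2) ^ j" for j
  proof -
    have "prob (E j) \<le> a j * tail_const t ((1/2) ^ j)"
      unfolding E_def by (rule band_sum_tail[OF a(1,2) t]) simp
    also have "\<dots> = t * gauss_abs TYPE('a) * (16 * KA\<^sup>2 * (a j / ((1/2) ^ j)\<^sup>2) + 4 * L * (a j / (1/2) ^ j))"
      by (simp add: tail_const_def algebra_simps)
    also have "\<dots> \<le> t * gauss_abs TYPE('a) * (16 * KA\<^sup>2 * (1/2) ^ j + 4 * L * (1/2) ^ j)"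
    proof (intro mult_left_mono add_mono C0)
      have e1: "a j / ((1/2) ^ j)\<^sup>2 = (1/8) * (1/2) ^ j"
      proof -
        have "(1/8::real) ^ j = ((1/2) ^ j)\<^sup>2 * (1/2) ^ j"
          by (simp add: power_mult_distrib[symmetric] power2_eq_square)
        then have "a j = ((1/2) ^ j)\<^sup>2 * ((1/8) * (1/2) ^ j)" by (simp add: a_def)
        then show ?thesis by simp
      qed
      have e2: "a j / (1/2) ^ j = (1/8) * (1/4) ^ j"
      proof -
        have "(1/8::real) ^ j = (1/2) ^ j * (1/4) ^ j" by (simp add: power_mult_distrib[symmetric])
        then have "a j = (1/2) ^ j * ((1/8) * (1/4) ^ j)" by (simp add: a_def)
        then show ?thesis by simp
      qed
      have "(1/4::real) ^ j \<le> (1/2) ^ j" by (intro power_mono) auto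
      then show "a j / ((1/2) ^ j)\<^sup>2 \<le> (1/2) ^ j" "a j / (1/2) ^ j \<le> (1/2) ^ j"
        unfolding e1 e2 using zero_le_power[of "1/2::real" j] by linarith+
    qed (use L0 in auto)
    finally show ?thesis by (simp add: C_def algebra_simps)
  qed
  have "summable (\<lambda>j. prob (E j))"
  proof (rule summable_comparison_test')
    show "summable (\<lambda>j. C * (1/2) ^ j)" by (intro summable_mult summable_geometric) simp
  qed (use bound in simp)
  then have "AE X in M. \<forall>\<^sub>F j in sequentially. X \<in> space M - E j"
    by (intro borel_cantelli_AE1 Em) (auto simp: emeasure_eq_measure)
  then show ?thesis
  proof (rule AE_mp, intro AE_I2 impI)
    fix X assume X: "X \<in> space M" and ev: "\<forall>\<^sub>F j in sequentially. X \<in> space M - E j"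
    \<comment> \<open>Consecutive differences of \<open>y\<close> are band sums, eventually at most
      2^-j, so \<open>y\<close> converges as a telescoping series.\<close>
    define y where "y j = band_sum A x t (a j) 1 X" for j
    have d: "y (Suc j) - y j = band_sum A x t (a (Suc j)) (a j) X" for j
      unfolding y_def using X a[of j] a[of "Suc j"] a1[of j] by (intro band_sum_diff) auto
    have "summable (\<lambda>j. y (Suc j) - y j)"
    proof (rule summable_comparison_test_ev)
      show "\<forall>\<^sub>F j in sequentially. norm (y (Suc j) - y j) \<le> (1/2) ^ j"
        using ev by eventually_elim (auto simp: d E_def)
      show "summable (\<lambda>j. (1/2::real) ^ j)" by (intro summable_geometric) simp
    qed
    then have "convergent (\<lambda>n. \<Sum>j<n. y (Suc j) - y j)" by (simp add: summable_iff_convergent)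
    then have "convergent y"
      unfolding sum_lessThan_telescope by (simp add: convergent_diff_const_right_iff)
    then have "y \<longlonglongrightarrow> lim y" by (simp add: convergent_LIMSEQ_iff)
    then show "(\<lambda>j. band_sum A x t ((1/8) ^ Suc j) 1 X) \<longlonglongrightarrow> small_jump_limit A x t X"
      by (simp add: y_def[abs_def] a_def small_jump_limit_def)
  qed
qed

text \<open>\<open>Y_small\<close> asks for a limit along all real cutoffs, while the almost sure
  limit is taken along powers of 1/8. The sum over the band from a small power up to
  \<open>e\<close> links the two and obeys the same tail bound.\<close>

lemma small_jump_limit_tail:
  assumes e: "0 < e" "e < 1" and t: "0 \<le> t" and \<delta>: "\<delta> > 0"
  shows "prob {X \<in> space M. \<bar>band_sum A x t e 1 X - small_jump_limit A x t X\<bar> > \<delta>} \<le> e * tail_const t \<delta>"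
proof -
  have "(\<lambda>j. (1/8::real) ^ Suc j) \<longlonglongrightarrow> 0" by (intro LIMSEQ_Suc LIMSEQ_realpow_zero) auto
  then have "\<forall>\<^sub>F j in sequentially. (1/8::real) ^ Suc j < e" using e by (intro order_tendstoD(2)) auto
  then obtain N where N: "\<And>j. j \<ge> N \<Longrightarrow> (1/8::real) ^ Suc j < e" by (auto simp: eventually_sequentially)
  show ?thesis
  proof (rule tail_limit[where Z="\<lambda>n X. band_sum A x t e 1 X - band_sum A x t ((1/8) ^ Suc (n + N)) 1 X"])
    show "(\<lambda>X. band_sum A x t e 1 X - band_sum A x t ((1/8) ^ Suc (n + N)) 1 X) \<in> borel_measurable M" for n
      using e by (intro borel_measurable_diff band_sum_meas) auto
    show "(\<lambda>X. band_sum A x t e 1 X - small_jump_limit A x t X) \<in> borel_measurable M"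
      using e by (intro borel_measurable_diff band_sum_meas small_jump_limit_meas) auto
    show "AE X in M. (\<lambda>n. band_sum A x t e 1 X - band_sum A x t ((1/8) ^ Suc (n + N)) 1 X) \<longlonglongrightarrow> band_sum A x t e 1 X - small_jump_limit A x t X"
      using AE_small_jump_limit[OF t, of x]
    proof eventually_elim
      case (elim X)
      show ?case by (intro tendsto_diff tendsto_const LIMSEQ_ignore_initial_segment[OF elim])
    qed
    fix n
    have n: "(1/8::real) ^ Suc (n + N) < e" by (rule N) simp
    have "prob {X \<in> space M. \<delta> < \<bar>band_sum A x t e 1 X - band_sum A x t ((1/8) ^ Suc (n + N)) 1 X\<bar>} = prob {X \<in> space M. \<bar>band_sum A x t ((1/8) ^ Suc (n + N)) e X\<bar> > \<delta>}"
    proof (intro arg_cong[where f=prob] Collect_cong conj_cong refl)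
      fix X assume "X \<in> space M"
      then have "band_sum A x t ((1/8) ^ Suc (n + N)) 1 X - band_sum A x t e 1 X = band_sum A x t ((1/8) ^ Suc (n + N)) e X"
        using n e by (intro band_sum_diff) auto
      then show "(\<delta> < \<bar>band_sum A x t e 1 X - band_sum A x t ((1/8) ^ Suc (n + N)) 1 X\<bar>) = (\<delta> < \<bar>band_sum A x t ((1/8) ^ Suc (n + N)) e X\<bar>)"
        by linarith
    qed
    also have "\<dots> \<le> e * tail_const t \<delta>" using n by (intro band_sum_tail t \<delta>) auto
    finally show "prob {X \<in> space M. \<delta> < \<bar>band_sum A x t e 1 X - band_sum A x t ((1/8) ^ Suc (n + N)) 1 X\<bar>} \<le> e * tail_const t \<delta>" .
  qed
qed

end

declare measurable_coord [measurable del]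

section \<open>The phase in terms of jump sums\<close>

lemma bounded_compact_support:
  fixes f :: "'a::euclidean_space \<Rightarrow> 'b::real_normed_vector"
  assumes f: "continuous_on UNIV f" and S: "compact S" "\<And>x. x \<notin> S \<Longrightarrow> f x = 0"
  shows "\<exists>K\<ge>0. \<forall>x. norm (f x) \<le> K"
proof -
  have "compact (f ` S)" by (rule compact_continuous_image[OF continuous_on_subset[OF f] S(1)]) simp
  then obtain K where K: "K > 0" "\<And>x. x \<in> S \<Longrightarrow> norm (f x) \<le> K"
    using compact_imp_bounded[of "f ` S"] unfolding bounded_pos by auto
  have "norm (f x) \<le> K" for x using K S(2)[of x] by (cases "x \<in> S") auto
  then show ?thesis using K(1) by (intro exI[of _ K]) simp
qed

lemma smooth_fun_differentiable: "smooth_fun f \<Longrightarrow> f differentiable (at x)"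
  by (erule smooth_fun.cases) simp

lemma smooth_fun_derivative: "smooth_fun f \<Longrightarrow> smooth_fun (\<lambda>x. frechet_derivative f (at x) v)"
  by (erule smooth_fun.cases) simp

lemma smooth_fun_continuous: "smooth_fun f \<Longrightarrow> continuous_on UNIV f"
  by (simp add: continuous_on_eq_continuous_at differentiable_imp_continuous_within smooth_fun_differentiable)

text \<open>Each directional derivative is again smooth, hence continuous, and vanishes off the
  support of \<open>A\<close>, hence is bounded. Summing the bounds over \<open>Basis\<close>
  controls the operator norm of the derivative and so the Lipschitz constant.\<close>

lemma C0_smooth_bounds:
  assumes "C0_smooth (A :: 'a::euclidean_space \<Rightarrow> 'a)"
  shows "continuous_on UNIV A" "\<exists>K. \<forall>x. norm (A x) \<le> K" "\<exists>L\<ge>0. \<forall>x y. norm (A x - A y) \<le> L * norm (x - y)"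
proof -
  have sm: "smooth_fun A" and S: "compact (closure {x. A x \<noteq> 0})" using assms by (auto simp: C0_smooth_def has_compact_support_def)
  let ?S = "closure {x. A x \<noteq> 0}"
  show c: "continuous_on UNIV A" by (rule smooth_fun_continuous[OF sm])
  have out: "A x = 0" if "x \<notin> ?S" for x using that closure_subset[of "{x. A x \<noteq> 0}"] by auto
  show "\<exists>K. \<forall>x. norm (A x) \<le> K" using bounded_compact_support[OF c S out] by blast
  define D where "D v x = frechet_derivative A (at x) v" for v x
  have hd: "(A has_derivative (\<lambda>v. D v x)) (at x)" for x
    unfolding D_def using smooth_fun_differentiable[OF sm, of x] by (simp add: frechet_derivative_works[symmetric])
  have Dc: "continuous_on UNIV (D v)" for v
    unfolding D_def by (rule smooth_fun_continuous[OF smooth_fun_derivative[OF sm]])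
  have D0: "D v x = 0" if x: "x \<notin> ?S" for v x
  proof -
    have "((\<lambda>_. 0) has_derivative (\<lambda>_. 0)) (at x)" by simp
    then have "(A has_derivative (\<lambda>_. 0)) (at x)"
    proof (rule has_derivative_transform_within_open)
      show "open (- ?S)" by (rule open_Compl) simp
      show "x \<in> - ?S" using x by simp
      show "0 = A y" if "y \<in> - ?S" for y using out[of y] that by simp
    qed
    from fun_cong[OF has_derivative_unique[OF hd this], of v] show ?thesis .
  qed
  have "\<exists>K. \<forall>b\<in>Basis. \<forall>x. norm (D b x) \<le> K b"
    by (rule bchoice) (use bounded_compact_support[OF Dc S D0] in blast)
  then obtain K where K: "\<And>b x. b \<in> Basis \<Longrightarrow> norm (D b x) \<le> K b" by blast
  define L where "L = (\<Sum>b\<in>(Basis::'a set). K b)"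
  have K0: "0 \<le> K b" if "b \<in> Basis" for b using K[OF that, of 0] norm_ge_zero order_trans by blast
  have L0: "L \<ge> 0" unfolding L_def using K0 by (intro sum_nonneg) auto
  have on: "onorm (\<lambda>v. D v x) \<le> L" for x
  proof (rule onorm_bound[OF L0])
    fix v :: 'a
    interpret linear "\<lambda>v. D v x" using hd[of x] by (rule has_derivative_linear)
    have "D v x = D (\<Sum>b\<in>Basis. (v \<bullet> b) *\<^sub>R b) x" by (simp add: euclidean_representation)
    also have "\<dots> = (\<Sum>b\<in>Basis. (v \<bullet> b) *\<^sub>R D b x)" by (simp add: sum scale)
    finally have "norm (D v x) \<le> (\<Sum>b\<in>Basis. norm ((v \<bullet> b) *\<^sub>R D b x))" by (simp only: norm_sum)
    also have "\<dots> \<le> (\<Sum>b\<in>Basis. norm v * K b)"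
      using K Basis_le_norm by (intro sum_mono) (auto intro!: mult_mono)
    finally show "norm (D v x) \<le> L * norm v" by (simp add: L_def sum_distrib_left mult.commute)
  qed
  have "norm (A x - A y) \<le> L * norm (x - y)" for x y
    by (rule differentiable_bound[OF convex_UNIV _ on]) (use hd in auto)
  then show "\<exists>L\<ge>0. \<forall>x y. norm (A x - A y) \<le> L * norm (x - y)" using L0 by blast
qed

lemma C_infty_bounded:
  assumes "C_infty g" shows "\<exists>K\<ge>0. \<forall>x. norm (g x) \<le> K"
proof -
  have c: "continuous_on UNIV g" and l: "(g \<longlongrightarrow> 0) at_infinity" using assms by (auto simp: C_infty_def)
  have "\<forall>\<^sub>F x in at_infinity. dist (g x) 0 < 1" using l by (rule tendstoD) simp
  then obtain R where R: "\<And>x. norm x \<ge> R \<Longrightarrow> norm (g x) < 1" by (auto simp: eventually_at_infinity)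
  have "compact (g ` cball 0 R)" by (rule compact_continuous_image[OF continuous_on_subset[OF c]]) auto
  then obtain K where K: "K > 0" "\<And>x. x \<in> cball 0 R \<Longrightarrow> norm (g x) \<le> K"
    using compact_imp_bounded[of "g ` cball 0 R"] unfolding bounded_pos by auto
  have "norm (g x) \<le> max K 1" for x
  proof (cases "norm x \<le> R")
    case True then show ?thesis using K(2)[of x] by simp
  next
    case False then show ?thesis using R[of x] by simp
  qed
  then show ?thesis using K(1) by (intro exI[of _ "max K 1"]) auto
qed

section \<open>Measurability and integration along a path\<close>

text \<open>Joint measurability in time and path comes from right-continuity: the approximating
  times \<open>dyadic_above n\<close> take countably many values.\<close>

lemma eval_measurable: "(\<lambda>p. snd p (fst p)) \<in> borel_measurable (borel \<Otimes>\<^sub>M (cyl_space :: (real \<Rightarrow> 'a::euclidean_space) measure))"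
proof -
  let ?M = "borel \<Otimes>\<^sub>M (cyl_space :: (real \<Rightarrow> 'a) measure)"
  have step: "(\<lambda>p. snd p (dyadic_above n (fst p))) \<in> borel_measurable ?M" for n
    unfolding dyadic_above_def
  proof (rule measurable_compose_countable[where f="\<lambda>k p. snd p ((real k + 1) / 2 ^ n)" and g="\<lambda>p. nat \<lfloor>(fst p :: real) * 2 ^ n\<rfloor>"])
    show "(\<lambda>p. snd p ((real k + 1) / 2 ^ n)) \<in> borel_measurable ?M" for k
      by (rule measurable_compose[OF measurable_snd measurable_coord])
    show "(\<lambda>p. nat \<lfloor>(fst p :: real) * 2 ^ n\<rfloor>) \<in> ?M \<rightarrow>\<^sub>M count_space UNIV" by measurable
  qed
  have "(\<lambda>p. if 0 \<le> fst p then lim (\<lambda>n. snd p (dyadic_above n (fst p))) else 0) \<in> borel_measurable ?M"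
    by (intro measurable_If borel_measurable_lim_metric step) measurable
  moreover have "snd p (fst p) = (if 0 \<le> fst p then lim (\<lambda>n. snd p (dyadic_above n (fst p))) else 0)" if "p \<in> space ?M" for p
  proof -
    have X: "snd p \<in> D0" using that by (auto simp: space_pair_measure)
    show ?thesis
    proof (cases "0 \<le> fst p")
      case True
      have "(\<lambda>n. snd p (dyadic_above n (fst p))) \<longlonglongrightarrow> snd p (fst p)"
      proof (rule tendstoI)
        fix e :: real assume "e > 0"
        then obtain d where d: "d > 0" "\<forall>u\<in>{fst p..<fst p + d}. norm (snd p u - snd p (fst p)) < e" using D0_right_dist[OF X True] by blast
        have "\<forall>\<^sub>F n in sequentially. dyadic_above n (fst p) \<in> {fst p<..<fst p + d}" using True d(1) by (intro dyadic_above_eventually) auto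
        then show "\<forall>\<^sub>F n in sequentially. dist (snd p (dyadic_above n (fst p))) (snd p (fst p)) < e"
          by eventually_elim (use d(2) in \<open>auto simp: dist_norm\<close>)
      qed
      then show ?thesis using True by (simp add: limI)
    qed (use D0_neg[OF X] in simp)
  qed
  ultimately show ?thesis by (subst measurable_cong) auto
qed

lemma eval_measurable': "(\<lambda>p. fst p (snd p)) \<in> borel_measurable ((cyl_space :: (real \<Rightarrow> 'a::euclidean_space) measure) \<Otimes>\<^sub>M borel)"
proof -
  have "(\<lambda>p. (snd p, fst p)) \<in> (cyl_space :: (real \<Rightarrow> 'a) measure) \<Otimes>\<^sub>M borel \<rightarrow>\<^sub>M borel \<Otimes>\<^sub>M cyl_space" by measurable
  from measurable_compose[OF this eval_measurable] show ?thesis by simp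
qed

lemma path_measurable:
  assumes "X \<in> D0" shows "X \<in> borel_measurable borel"
proof -
  have "(\<lambda>s. (s, X)) \<in> borel \<rightarrow>\<^sub>M borel \<Otimes>\<^sub>M cyl_space" using assms by (intro measurable_Pair measurable_ident_sets measurable_const) auto
  from measurable_compose[OF this eval_measurable] show ?thesis by simp
qed

lemma time_integral_measurable:
  fixes c :: "'a::euclidean_space \<Rightarrow> real"
  assumes [measurable]: "c \<in> borel_measurable borel"
  shows "(\<lambda>X. LBINT s:{0<..t}. c (X s)) \<in> borel_measurable (cyl_space :: (real \<Rightarrow> 'a) measure)"
  unfolding set_lebesgue_integral_def
proof (rule lborel.borel_measurable_lebesgue_integral)
  have "(\<lambda>p. c (fst p (snd p))) \<in> borel_measurable ((cyl_space :: (real \<Rightarrow> 'a) measure) \<Otimes>\<^sub>M borel)"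
    by (rule measurable_compose[OF eval_measurable' assms])
  then have "(\<lambda>p. c (fst p (snd p))) \<in> borel_measurable ((cyl_space :: (real \<Rightarrow> 'a) measure) \<Otimes>\<^sub>M lborel)"
    by (simp add: measurable_cong_sets[OF sets_pair_measure_cong[OF refl sets_lborel] refl])
  then show "(\<lambda>(X, s). indicator {0<..t} s *\<^sub>R c (X s)) \<in> borel_measurable ((cyl_space :: (real \<Rightarrow> 'a) measure) \<Otimes>\<^sub>M lborel)"
    unfolding case_prod_unfold by (intro borel_measurable_scaleR measurable_compose[OF measurable_snd]) (simp_all)
qed

lemma time_integrable:
  fixes c :: "'a::euclidean_space \<Rightarrow> real"
  assumes X: "X \<in> D0" and c: "c \<in> borel_measurable borel" and K: "\<And>p. \<bar>c p\<bar> \<le> K"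
  shows "set_integrable lborel {0<..t} (\<lambda>s. c (X s))"
proof -
  have [measurable]: "(\<lambda>s. c (X s)) \<in> borel_measurable borel"
    by (rule measurable_compose[OF path_measurable[OF X] c])
  have "integrable lborel (\<lambda>s. indicator {0<..t} s *\<^sub>R K)"
    by (cases "0 \<le> t") auto
  then show ?thesis unfolding set_integrable_def
    by (rule Bochner_Integration.integrable_bound) (use K in \<open>auto intro!: AE_I2 order_trans[OF K] simp: indicator_def\<close>)
qed

lemma time_integral_bound:
  fixes c :: "'a::euclidean_space \<Rightarrow> real"
  assumes X: "X \<in> D0" and c: "c \<in> borel_measurable borel" and K: "\<And>p. \<bar>c p\<bar> \<le> K" and t: "0 \<le> t"
  shows "\<bar>LBINT s:{0<..t}. c (X s)\<bar> \<le> t * K"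
proof -
  have "norm (LBINT s:{0<..t}. c (X s)) \<le> (\<integral>s. indicator {0<..t} s * K \<partial>lborel)"
    unfolding set_lebesgue_integral_def
  proof (rule Bochner_Integration.integral_norm_bound_integral)
    show "integrable lborel (\<lambda>s. indicator {0<..t} s *\<^sub>R c (X s))"
      using time_integrable[OF X c K] by (simp add: set_integrable_def)
    show "integrable lborel (\<lambda>s. indicator {0<..t} s * K)" using t by auto
  qed (use K in \<open>auto simp: indicator_def\<close>)
  then show ?thesis using t by simp
qed

lemma countable_jumps:
  assumes "X \<in> D0" shows "countable {s \<in> {0<..t}. lft X s \<noteq> X s}"
proof (rule countable_subset)
  show "{s \<in> {0<..t}. lft X s \<noteq> X s} \<subseteq> (\<Union>n. big_jumps (1 / real (Suc n)) t X)"
  proof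
    fix s assume s: "s \<in> {s \<in> {0<..t}. lft X s \<noteq> X s}"
    then have "norm (jump X s) > 0" by (auto simp: jump_def)
    then obtain n where "inverse (real (Suc n)) < norm (jump X s)" using reals_Archimedean by blast
    then have "1 / real (Suc n) \<le> norm (jump X s)" by (simp add: inverse_eq_divide)
    then show "s \<in> (\<Union>n. big_jumps (1 / real (Suc n)) t X)" using s by (auto simp: big_jumps_def simp del: of_nat_Suc)
  qed
  show "countable (\<Union>n. big_jumps (1 / real (Suc n)) t X)"
    by (rule countable_UN[OF countableI_type countable_finite[OF finite_big_jumps[OF assms]]]) simp
qed

text \<open>A cadlag path differs from its left limits at countably many times only, a Lebesgue null
  set. The compensator is written with left limits and the drift with \<open>X s\<close>; this makes
  them comparable.\<close>

lemma time_integral_lft: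
  assumes X: "X \<in> D0"
  shows "(LBINT s:{0<..t}. (c (lft X s) :: real)) = (LBINT s:{0<..t}. c (X s))"
  unfolding set_lebesgue_integral_def
  by (rule integral_discrete_difference[OF countable_jumps[OF X, of t]]) (auto simp: indicator_def)

section \<open>Cancellation of compensator and drift\<close>

definition comp_int :: "real \<Rightarrow> ('a::euclidean_space \<Rightarrow> 'a) \<Rightarrow> 'a \<Rightarrow> real \<Rightarrow> 'a \<Rightarrow> real" where
  "comp_int m A x e p = (LBINT y:{y. e \<le> norm y \<and> norm y < 1}. (A (x + p + (1/2) *\<^sub>R y) \<bullet> y) * nden TYPE('a) m (norm y))"

definition drift_int :: "real \<Rightarrow> ('a::euclidean_space \<Rightarrow> 'a) \<Rightarrow> 'a \<Rightarrow> 'a \<Rightarrow> real" where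
  "drift_int m A x p = (LBINT y:{y. 0 < norm y \<and> norm y < 1}. ((A (x + p + (1/2) *\<^sub>R y) - A (x + p)) \<bullet> y) * nden TYPE('a) m (norm y))"

definition moment_int :: "'a::euclidean_space itself \<Rightarrow> real \<Rightarrow> real \<Rightarrow> real" where
  "moment_int _ m e = integral\<^sup>L lborel (\<lambda>y::'a. indicator {y. 0 < norm y \<and> norm y < e} y * ((norm y)\<^sup>2 * nden TYPE('a) m (norm y)))"

lemma moment_integrable:
  assumes m: "m \<ge> 0" and e: "e \<le> 1"
  shows "integrable lborel (\<lambda>y::'a::euclidean_space. indicator {y. 0 < norm y \<and> norm y < e} y * ((norm y)\<^sup>2 * nden TYPE('a) m (norm y)))"
  by (rule Bochner_Integration.integrable_bound[OF nden_second_moment[OF m]])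
     (use e nden_nonneg[OF m] in \<open>auto intro!: AE_I2 simp: indicator_def\<close>)

lemma moment_int_tendsto:
  assumes m: "m \<ge> 0" shows "((\<lambda>e. moment_int TYPE('a::euclidean_space) m e) \<longlongrightarrow> 0) (at_right 0)"
proof (rule tendsto_at_right_sequentially[where b=1])
  fix S :: "nat \<Rightarrow> real" assume S: "\<And>n. 0 < S n" "\<And>n. S n < 1" "S \<longlonglongrightarrow> 0"
  have "(\<lambda>n. moment_int TYPE('a) m (S n)) \<longlonglongrightarrow> integral\<^sup>L lborel (\<lambda>y::'a. 0)"
    unfolding moment_int_def
  proof (rule integral_dominated_convergence[OF _ _ nden_second_moment[OF m]])
    show "AE y::'a in lborel. (\<lambda>n. indicator {y. 0 < norm y \<and> norm y < S n} y * ((norm y)\<^sup>2 * nden TYPE('a) m (norm y))) \<longlonglongrightarrow> 0"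
    proof (rule AE_I2)
      fix y :: 'a
      show "(\<lambda>n. indicator {y. 0 < norm y \<and> norm y < S n} y * ((norm y)\<^sup>2 * nden TYPE('a) m (norm y))) \<longlonglongrightarrow> 0"
      proof (cases "y = 0")
        case False
        then have "\<forall>\<^sub>F n in sequentially. S n < norm y" using S(3) by (intro order_tendstoD(2)) auto
        then show ?thesis by (intro tendsto_eventually) (auto elim!: eventually_mono)
      qed simp
    qed
    show "AE y::'a in lborel. norm (indicator {y. 0 < norm y \<and> norm y < S n} y * ((norm y)\<^sup>2 * nden TYPE('a) m (norm y)))
      \<le> indicator {y. 0 < norm y \<and> norm y < 1} y * ((norm y)\<^sup>2 * nden TYPE('a) m (norm y))" for n
      using S(2)[of n] nden_nonneg[OF m, where 'a='a] by (auto intro!: AE_I2 simp: indicator_def)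
  qed measurable
  then show "(\<lambda>n. moment_int TYPE('a) m (S n)) \<longlonglongrightarrow> 0" by simp
qed simp

lemma lborel_uminus: "distr lborel borel uminus = (lborel :: 'a::euclidean_space measure)"
  using lborel_affine[of "-1" "0 :: 'a"] by (simp add: density_1 uminus_add_conv_diff)

lemma lborel_integral_reflect:
  fixes f :: "'a::euclidean_space \<Rightarrow> real"
  assumes "f \<in> borel_measurable borel" shows "(\<integral>y. f (- y) \<partial>lborel) = (\<integral>y. f y \<partial>lborel)"
proof -
  have "(\<integral>y. f y \<partial>distr lborel borel uminus) = (\<integral>y. f (- y) \<partial>lborel)"
    by (rule integral_distr) (use assms in auto)
  then show ?thesis by (simp add: lborel_uminus)
qed

context jump_estimate
begin

lemma increment_bound: "\<bar>((A (x + p + (1/2) *\<^sub>R y) - A (x + p)) \<bullet> y) * nden TYPE('a) m (norm y)\<bar> \<le> L / 2 * ((norm y)\<^sup>2 * nden TYPE('a) m (norm y))"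
proof -
  have "\<bar>(A (x + p + (1/2) *\<^sub>R y) - A (x + p)) \<bullet> y\<bar> \<le> norm (A (x + p + (1/2) *\<^sub>R y) - A (x + p)) * norm y" by (rule Cauchy_Schwarz_ineq2)
  also have "\<dots> \<le> (L * norm ((1/2) *\<^sub>R y)) * norm y" using lipA[of "x + p + (1/2) *\<^sub>R y" "x + p"] by (intro mult_right_mono) auto
  finally have "\<bar>(A (x + p + (1/2) *\<^sub>R y) - A (x + p)) \<bullet> y\<bar> \<le> L / 2 * (norm y)\<^sup>2" by (simp add: power2_eq_square)
  then show ?thesis
    using mult_right_mono[OF _ nden_nonneg[OF m, of "norm y", where 'a='a], of _ "L / 2 * (norm y)\<^sup>2"] nden_nonneg[OF m, of "norm y", where 'a='a]
    by (simp only: abs_mult abs_of_nonneg mult.assoc[symmetric])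
qed

lemma increment_integrable:
  assumes [measurable]: "S \<in> sets borel" and S: "S \<subseteq> {y. 0 < norm y \<and> norm y < 1}"
  shows "integrable lborel (\<lambda>y. indicator S y *\<^sub>R (((A (x + p + (1/2) *\<^sub>R y) - A (x + p)) \<bullet> y) * nden TYPE('a) m (norm y)))"
proof (rule Bochner_Integration.integrable_bound[OF integrable_mult_right[OF nden_second_moment[OF m], of "L / 2"]])
  show "AE y in lborel. norm (indicator S y *\<^sub>R (((A (x + p + (1/2) *\<^sub>R y) - A (x + p)) \<bullet> y) * nden TYPE('a) m (norm y)))
    \<le> norm (L / 2 * (indicator {y. 0 < norm y \<and> norm y < 1} y * ((norm y)\<^sup>2 * nden TYPE('a) m (norm y))))"
  proof (rule AE_I2)
    fix y :: 'a
    show "norm (indicator S y *\<^sub>R (((A (x + p + (1/2) *\<^sub>R y) - A (x + p)) \<bullet> y) * nden TYPE('a) m (norm y)))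
      \<le> norm (L / 2 * (indicator {y. 0 < norm y \<and> norm y < 1} y * ((norm y)\<^sup>2 * nden TYPE('a) m (norm y))))"
    proof (cases "y \<in> S")
      case True
      then have "0 < norm y \<and> norm y < 1" using S by auto
      then show ?thesis using True increment_bound[of x p y] by (simp del: zero_less_norm_iff)
    qed simp
  qed
qed measurable

text \<open>The term \<open>A (x + p) \<bullet> y\<close> of the compensator integrates to zero because the Levy density is
  even. What remains is the drift, up to jumps below \<open>e\<close>.\<close>

lemma comp_drift_diff:
  assumes e: "0 < e" "e \<le> 1"
  shows "\<bar>drift_int m A x p - comp_int m A x e p\<bar> \<le> L / 2 * moment_int TYPE('a) m e"
proof -
  let ?N = "\<lambda>y::'a. nden TYPE('a) m (norm y)"
  let ?B = "\<lambda>y. ((A (x + p + (1/2) *\<^sub>R y) - A (x + p)) \<bullet> y) * ?N y"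
  let ?I = "\<lambda>y::'a. indicator {y. e \<le> norm y \<and> norm y < 1} y :: real"
  let ?J = "\<lambda>y::'a. indicator {y. 0 < norm y \<and> norm y < 1} y :: real"
  have iB: "integrable lborel (\<lambda>y. ?I y *\<^sub>R ?B y)" using e by (intro increment_integrable) auto
  have iB0: "integrable lborel (\<lambda>y. ?J y *\<^sub>R ?B y)" by (intro increment_integrable) auto
  \<comment> \<open>Away from 0 the linear term is dominated by the second moment, since |y| \<le>
    |y|^2 / e there; this permits splitting the integral.\<close>
  have iA: "integrable lborel (\<lambda>y. ?I y *\<^sub>R ((A (x + p) \<bullet> y) * ?N y))"
  proof (rule Bochner_Integration.integrable_bound[OF integrable_mult_right[OF nden_second_moment[OF m], of "KA / e"]])
    show "AE y in lborel. norm (?I y *\<^sub>R ((A (x + p) \<bullet> y) * ?N y)) \<le> norm (KA / e * (?J y * ((norm y)\<^sup>2 * ?N y)))"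
    proof (rule AE_I2)
      fix y :: 'a
      show "norm (?I y *\<^sub>R ((A (x + p) \<bullet> y) * ?N y)) \<le> norm (KA / e * (?J y * ((norm y)\<^sup>2 * ?N y)))"
      proof (cases "e \<le> norm y \<and> norm y < 1")
        case True
        then have y: "0 < norm y \<and> norm y < 1" using e by auto
        have "\<bar>A (x + p) \<bullet> y\<bar> \<le> norm (A (x + p)) * norm y" by (rule Cauchy_Schwarz_ineq2)
        also have "\<dots> \<le> KA * norm y" by (intro mult_right_mono boundA) simp
        also have "\<dots> \<le> KA * ((norm y)\<^sup>2 / e)"
        proof (intro mult_left_mono KA0)
          have "e * norm y \<le> norm y * norm y" using True by (intro mult_right_mono) auto
          then show "norm y \<le> (norm y)\<^sup>2 / e" using e by (simp add: pos_le_divide_eq power2_eq_square mult.commute)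
        qed
        finally have "\<bar>A (x + p) \<bullet> y\<bar> * ?N y \<le> KA / e * ((norm y)\<^sup>2 * ?N y)"
          using mult_right_mono[OF _ nden_nonneg[OF m, of "norm y", where 'a='a]] by fastforce
        then show ?thesis using True y nden_nonneg[OF m, of "norm y", where 'a='a] KA0 e
          by (simp add: abs_mult del: zero_less_norm_iff)
      qed simp
    qed
  qed measurable
  have odd: "(\<integral>y. ?I y *\<^sub>R ((A (x + p) \<bullet> y) * ?N y) \<partial>lborel) = 0"
  proof -
    have "(\<integral>y. ?I y *\<^sub>R ((A (x + p) \<bullet> y) * ?N y) \<partial>lborel) = (\<integral>y. ?I (- y) *\<^sub>R ((A (x + p) \<bullet> - y) * ?N (- y)) \<partial>lborel)"
      by (rule lborel_integral_reflect[symmetric]) measurable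
    also have "\<dots> = - (\<integral>y. ?I y *\<^sub>R ((A (x + p) \<bullet> y) * ?N y) \<partial>lborel)"
      by (simp add: indicator_def)
    finally show ?thesis by simp
  qed
  have "comp_int m A x e p = (\<integral>y. ?I y *\<^sub>R ?B y + ?I y *\<^sub>R ((A (x + p) \<bullet> y) * ?N y) \<partial>lborel)"
    unfolding comp_int_def set_lebesgue_integral_def
    by (intro Bochner_Integration.integral_cong refl) (simp add: inner_diff_left algebra_simps)
  also have "\<dots> = (\<integral>y. ?I y *\<^sub>R ?B y \<partial>lborel)"
    using iB iA odd by simp
  finally have diff: "drift_int m A x p - comp_int m A x e p = (\<integral>y. ?J y *\<^sub>R ?B y - ?I y *\<^sub>R ?B y \<partial>lborel)"
    unfolding drift_int_def set_lebesgue_integral_def using iB iB0 by simp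
  have "\<bar>\<integral>y. ?J y *\<^sub>R ?B y - ?I y *\<^sub>R ?B y \<partial>lborel\<bar> \<le> (\<integral>y. L / 2 * (indicator {y. 0 < norm y \<and> norm y < e} y * ((norm y)\<^sup>2 * ?N y)) \<partial>lborel)"
    unfolding real_norm_def[symmetric]
  proof (rule Bochner_Integration.integral_norm_bound_integral)
    show "integrable lborel (\<lambda>y. ?J y *\<^sub>R ?B y - ?I y *\<^sub>R ?B y)" using iB iB0 by simp
    show "integrable lborel (\<lambda>y. L / 2 * (indicator {y. 0 < norm y \<and> norm y < e} y * ((norm y)\<^sup>2 * ?N y)))"
      using e by (intro integrable_mult_right moment_integrable m)
    fix y :: 'a
    have J: "?J y = ?I y + indicator {y. 0 < norm y \<and> norm y < e} y" using e by (auto simp: indicator_def)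
    have "?J y *\<^sub>R ?B y - ?I y *\<^sub>R ?B y = indicator {y. 0 < norm y \<and> norm y < e} y * ?B y"
      by (simp only: J real_scaleR_def distrib_right add_diff_cancel_left')
    moreover have "\<bar>indicator {y. 0 < norm y \<and> norm y < e} y * ?B y\<bar> \<le> L / 2 * (indicator {y. 0 < norm y \<and> norm y < e} y * ((norm y)\<^sup>2 * ?N y))"
    proof (cases "y \<in> {y. 0 < norm y \<and> norm y < e}")
      case True
      then show ?thesis using increment_bound[of x p y] by (simp only: indicator_simps mult_1_left)
    next
      case False
      then have "indicator {y. 0 < norm y \<and> norm y < e} y = (0 :: real)" by (rule indicator_simps(2))
      then show ?thesis by (simp only: mult_zero_left mult_zero_right abs_zero order_refl)
    qed
    ultimately show "norm (?J y *\<^sub>R ?B y - ?I y *\<^sub>R ?B y) \<le> L / 2 * (indicator {y. 0 < norm y \<and> norm y < e} y * ((norm y)\<^sup>2 * ?N y))"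
      by (simp only: real_norm_def)
  qed
  also have "\<dots> = L / 2 * moment_int TYPE('a) m e" unfolding moment_int_def by (rule integral_mult_right_zero)
  finally show ?thesis by (simp only: diff)
qed

text \<open>At cutoff 1 the compensator is an integral over the empty set.\<close>

lemma drift_bound: "\<bar>drift_int m A x p\<bar> \<le> L / 2 * moment_int TYPE('a) m 1"
proof -
  have "{y :: 'a. 1 \<le> norm y \<and> norm y < 1} = {}" by auto
  then have "comp_int m A x 1 p = 0"
    by (simp add: comp_int_def set_lebesgue_integral_def)
  then show ?thesis using comp_drift_diff[of 1 x p] by simp
qed

lemma comp_int_measurable [measurable]: "comp_int m A x e \<in> borel_measurable borel"
  unfolding comp_int_def[abs_def] set_lebesgue_integral_def
proof (rule lborel.borel_measurable_lebesgue_integral)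
  show "(\<lambda>(p, y). indicator {y. e \<le> norm y \<and> norm y < 1} y *\<^sub>R ((A (x + p + (1/2) *\<^sub>R y) \<bullet> y) * nden TYPE('a) m (norm y))) \<in> borel_measurable (borel \<Otimes>\<^sub>M lborel)"
    unfolding case_prod_unfold
    by (intro borel_measurable_scaleR borel_measurable_times borel_measurable_inner measurable_compose[OF _ measurable_A] measurable_compose[OF _ nden_measurable]) measurable
qed

lemma drift_int_measurable [measurable]: "drift_int m A x \<in> borel_measurable borel"
  unfolding drift_int_def[abs_def] set_lebesgue_integral_def
proof (rule lborel.borel_measurable_lebesgue_integral)
  show "(\<lambda>(p, y). indicator {y. 0 < norm y \<and> norm y < 1} y *\<^sub>R (((A (x + p + (1/2) *\<^sub>R y) - A (x + p)) \<bullet> y) * nden TYPE('a) m (norm y))) \<in> borel_measurable (borel \<Otimes>\<^sub>M lborel)"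
    unfolding case_prod_unfold
    by (intro borel_measurable_scaleR borel_measurable_times borel_measurable_inner borel_measurable_diff measurable_compose[OF _ measurable_A] measurable_compose[OF _ nden_measurable]) measurable
qed

lemma comp_bound:
  assumes "0 < e" "e \<le> 1"
  shows "\<bar>comp_int m A x e p\<bar> \<le> L / 2 * moment_int TYPE('a) m 1 + L / 2 * moment_int TYPE('a) m e"
  using comp_drift_diff[OF assms, of x p] drift_bound[of x p] by linarith

end

lemma borel_measurable_cexp: "(exp :: complex \<Rightarrow> complex) \<in> borel_measurable borel"
  by (intro borel_measurable_continuous_onI continuous_intros)

context jump_estimate
begin

definition drift :: "'a \<Rightarrow> real \<Rightarrow> (real \<Rightarrow> 'a) \<Rightarrow> real" where
  "drift x t X = (LBINT s:{0<..t}. drift_int m A x (X s))"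

lemma Y_drift_eq: "Y_drift m A t x X = drift x t X"
  unfolding Y_drift_def drift_def drift_int_def ..

lemma Y_trunc_eq:
  assumes X: "X \<in> D0" and e: "0 < e"
  shows "Y_trunc m A t x e X = band_sum A x t e 1 X - (LBINT s:{0<..t}. comp_int m A x e (X s))"
proof -
  have "(LBINT s:{0<..t}. comp_int m A x e (lft X s)) = (LBINT s:{0<..t}. comp_int m A x e (X s))"
    by (rule time_integral_lft[OF X])
  then show ?thesis by (simp only: Y_trunc_def band_sum_eq[OF X e] comp_int_def)
qed

lemma measurable_cyl: "f \<in> borel_measurable cyl_space \<Longrightarrow> f \<in> borel_measurable M"
  using measurable_cong_sets[OF sets_M refl] by blast

lemma drift_measurable: "drift x t \<in> borel_measurable M"
  unfolding drift_def[abs_def] by (rule measurable_cyl[OF time_integral_measurable[OF drift_int_measurable]])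

lemma Y_trunc_measurable:
  assumes "0 < e" shows "Y_trunc m A t x e \<in> borel_measurable M"
proof -
  have "(\<lambda>X. band_sum A x t e 1 X - (LBINT s:{0<..t}. comp_int m A x e (X s))) \<in> borel_measurable M"
    by (intro borel_measurable_diff band_sum_meas assms measurable_cyl[OF time_integral_measurable[OF comp_int_measurable]])
  then show ?thesis by (subst measurable_cong[OF Y_trunc_eq[OF _ assms]]) (simp_all add: space_M)
qed

text \<open>The time integral of the compensator is the drift up to the second moment of jumps below
  \<open>e\<close>, so the truncated compensated sum approximates \<open>small_jump_limit\<close>
  minus the drift.\<close>

lemma Y_trunc_close:
  assumes X: "X \<in> D0" and e: "0 < e" "e \<le> 1" and t: "0 \<le> t"
  shows "\<bar>Y_trunc m A t x e X - (small_jump_limit A x t X - drift x t X)\<bar> \<le> \<bar>band_sum A x t e 1 X - small_jump_limit A x t X\<bar> + t * (L / 2 * moment_int TYPE('a) m e)"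
proof -
  have i1: "set_integrable lborel {0<..t} (\<lambda>s. drift_int m A x (X s))"
    by (rule time_integrable[OF X drift_int_measurable drift_bound])
  have i2: "set_integrable lborel {0<..t} (\<lambda>s. comp_int m A x e (X s))"
    by (rule time_integrable[OF X comp_int_measurable comp_bound[OF e]])
  have c: "(\<lambda>p. drift_int m A x p - comp_int m A x e p) \<in> borel_measurable borel"
    by (intro borel_measurable_diff drift_int_measurable comp_int_measurable)
  have "drift x t X - (LBINT s:{0<..t}. comp_int m A x e (X s)) = (LBINT s:{0<..t}. drift_int m A x (X s) - comp_int m A x e (X s))"
    unfolding drift_def by (rule set_integral_diff(2)[OF i1 i2, symmetric])
  also have "\<bar>\<dots>\<bar> \<le> t * (L / 2 * moment_int TYPE('a) m e)"
    by (rule time_integral_bound[OF X c comp_drift_diff[OF e] t])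
  finally show ?thesis unfolding Y_trunc_eq[OF X e(1)] by linarith
qed

text \<open>The deterministic error falls below \<delta>/2 for small \<open>e\<close>, which leaves
  the random one to exceed \<delta>/2.\<close>

lemma Y_trunc_tail:
  assumes t: "0 \<le> t" and \<delta>: "\<delta> > 0"
  shows "((\<lambda>e. prob {X \<in> space M. \<bar>Y_trunc m A t x e X - (small_jump_limit A x t X - drift x t X)\<bar> > \<delta>}) \<longlongrightarrow> 0) (at_right 0)"
proof (rule Lim_null_comparison)
  have "((\<lambda>e. t * (L / 2 * moment_int TYPE('a) m e)) \<longlongrightarrow> t * (L / 2 * 0)) (at_right 0)"
    by (intro tendsto_mult tendsto_const moment_int_tendsto m)
  then have "\<forall>\<^sub>F e in at_right 0. t * (L / 2 * moment_int TYPE('a) m e) < \<delta> / 2"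
    using \<delta> by (intro order_tendstoD(2)) auto
  moreover have "\<forall>\<^sub>F e in at_right (0::real). e \<in> {0<..<1}" by (rule eventually_at_right_real) simp
  ultimately show "\<forall>\<^sub>F e in at_right 0. norm (prob {X \<in> space M. \<bar>Y_trunc m A t x e X - (small_jump_limit A x t X - drift x t X)\<bar> > \<delta>}) \<le> e * tail_const t (\<delta> / 2)"
  proof eventually_elim
    case (elim e)
    have e: "0 < e" "e < 1" using elim(2) by auto
    have [measurable]: "band_sum A x t e 1 \<in> borel_measurable M" "small_jump_limit A x t \<in> borel_measurable M"
      by (rule band_sum_meas[OF e(1)], rule small_jump_limit_meas)
    have "prob {X \<in> space M. \<bar>Y_trunc m A t x e X - (small_jump_limit A x t X - drift x t X)\<bar> > \<delta>} \<le> prob {X \<in> space M. \<bar>band_sum A x t e 1 X - small_jump_limit A x t X\<bar> > \<delta> / 2}"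
    proof (rule finite_measure_mono)
      show "{X \<in> space M. \<bar>Y_trunc m A t x e X - (small_jump_limit A x t X - drift x t X)\<bar> > \<delta>} \<subseteq> {X \<in> space M. \<bar>band_sum A x t e 1 X - small_jump_limit A x t X\<bar> > \<delta> / 2}"
      proof (intro Collect_mono impI conjI)
        fix X assume X: "X \<in> space M \<and> \<bar>Y_trunc m A t x e X - (small_jump_limit A x t X - drift x t X)\<bar> > \<delta>"
        then show "X \<in> space M" by simp
        have "X \<in> D0" using X by (simp add: space_M)
        from Y_trunc_close[OF this e(1) less_imp_le[OF e(2)] t, of x] X elim(1)
        show "\<bar>band_sum A x t e 1 X - small_jump_limit A x t X\<bar> > \<delta> / 2" by linarith
      qed
    qed measurable
    also have "\<dots> \<le> e * tail_const t (\<delta> / 2)" using \<delta> by (intro small_jump_limit_tail e t) simp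
    finally show ?case by simp
  qed
  have "((\<lambda>e. e * tail_const t (\<delta> / 2)) \<longlongrightarrow> 0 * tail_const t (\<delta> / 2)) (at_right 0)" by (intro tendsto_intros)
  then show "((\<lambda>e. e * tail_const t (\<delta> / 2)) \<longlongrightarrow> 0) (at_right 0)" by simp
qed

end

text \<open>Makes the \<open>SOME\<close> in \<open>Y_small\<close> harmless: any two admissible
  choices agree almost everywhere.\<close>

lemma (in prob_space) limit_in_prob_unique:
  fixes f :: "real \<Rightarrow> 'a \<Rightarrow> real"
  assumes f: "\<And>e. 0 < e \<Longrightarrow> f e \<in> borel_measurable M" and Y: "Y \<in> borel_measurable M" and Z: "Z \<in> borel_measurable M"
    and lY: "\<And>\<delta>. \<delta> > 0 \<Longrightarrow> ((\<lambda>e. prob {X \<in> space M. \<bar>f e X - Y X\<bar> > \<delta>}) \<longlongrightarrow> 0) (at_right 0)"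
    and lZ: "\<And>\<delta>. \<delta> > 0 \<Longrightarrow> ((\<lambda>e. prob {X \<in> space M. \<bar>f e X - Z X\<bar> > \<delta>}) \<longlongrightarrow> 0) (at_right 0)"
  shows "AE X in M. Y X = Z X"
proof -
  note [measurable] = Y Z
  have null: "prob {X \<in> space M. \<bar>Y X - Z X\<bar> > 2 * \<delta>} = 0" if \<delta>: "\<delta> > 0" for \<delta>
  proof -
    let ?p = "\<lambda>e. prob {X \<in> space M. \<bar>f e X - Y X\<bar> > \<delta>} + prob {X \<in> space M. \<bar>f e X - Z X\<bar> > \<delta>}"
    have "(?p \<longlongrightarrow> 0 + 0) (at_right 0)" by (intro tendsto_add lY lZ \<delta>)
    moreover have "\<forall>\<^sub>F e in at_right 0. prob {X \<in> space M. \<bar>Y X - Z X\<bar> > 2 * \<delta>} \<le> ?p e"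
      using eventually_at_right_less[of "0::real"]
    proof eventually_elim
      case (elim e)
      note [measurable] = f[OF elim]
      have "prob {X \<in> space M. \<bar>Y X - Z X\<bar> > 2 * \<delta>} \<le> prob ({X \<in> space M. \<bar>f e X - Y X\<bar> > \<delta>} \<union> {X \<in> space M. \<bar>f e X - Z X\<bar> > \<delta>})"
        by (intro finite_measure_mono) auto
      also have "\<dots> \<le> ?p e" by (intro measure_Un_le) auto
      finally show ?case .
    qed
    ultimately have "prob {X \<in> space M. \<bar>Y X - Z X\<bar> > 2 * \<delta>} \<le> 0 + 0" by (rule tendsto_lowerbound) simp
    then show ?thesis using measure_nonneg[of M] by (simp add: order_antisym)
  qed
  have "AE X in M. \<not> \<bar>Y X - Z X\<bar> > 2 * (1 / real (Suc n))" for n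
    using prob_Collect_eq_0[of "\<lambda>X. \<bar>Y X - Z X\<bar> > 2 * (1 / real (Suc n))"] null[of "1 / real (Suc n)"] by simp
  then have "AE X in M. \<forall>n. \<not> \<bar>Y X - Z X\<bar> > 2 * (1 / real (Suc n))" unfolding AE_all_countable by blast
  then show ?thesis
  proof eventually_elim
    case (elim X)
    show ?case
    proof (rule ccontr)
      assume "Y X \<noteq> Z X"
      then obtain n where "inverse (real (Suc n)) < \<bar>Y X - Z X\<bar> / 2" using reals_Archimedean[of "\<bar>Y X - Z X\<bar> / 2"] by auto
      then have "\<bar>Y X - Z X\<bar> > 2 * (1 / real (Suc n))" by (simp add: inverse_eq_divide)
      with elim show False by blast
    qed
  qed
qed

text \<open>\<open>small_jump_limit\<close> minus the drift is an admissible value for the choice in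
  \<open>Y_small\<close>, and \<open>Ym\<close> adds the drift back. All dependence on the mass is
  thereby left in the exceptional null set.\<close>

lemma Ym_AE_eq:
  fixes A :: "'a::euclidean_space \<Rightarrow> 'a"
  assumes J: "jump_estimate m (lam m) A KA L" and t: "0 \<le> t"
  shows "Ym m A t x \<in> borel_measurable (lam m)" "AE X in lam m. Ym m A t x X = big_jump_sum A x t X + small_jump_limit A x t X"
proof -
  interpret jump_estimate m "lam m" A KA L by (rule J)
  let ?P = "\<lambda>Z. Z \<in> borel_measurable (lam m) \<and> (\<forall>\<delta>>0. ((\<lambda>\<epsilon>. measure (lam m) {X \<in> space (lam m). \<bar>Y_trunc m A t x \<epsilon> X - Z X\<bar> > \<delta>}) \<longlongrightarrow> 0) (at_right 0))"
  let ?Z = "\<lambda>X. small_jump_limit A x t X - drift x t X"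
  have Zm: "?Z \<in> borel_measurable (lam m)" by (intro borel_measurable_diff small_jump_limit_meas drift_measurable)
  have "?P ?Z" using Zm Y_trunc_tail[OF t] by simp
  then have P: "?P (Y_small m A t x)" unfolding Y_small_def by (rule someI[of ?P])
  have big: "Y_big A t x X = big_jump_sum A x t X" if "X \<in> D0" for X using big_jump_sum_eq[OF that] by (simp only: Y_big_def)
  have "Y_big A t x \<in> borel_measurable (lam m)"
    by (subst measurable_cong[OF big]) (auto simp: space_M intro!: measurable_cyl big_jump_sum_measurable contA)
  then show "Ym m A t x \<in> borel_measurable (lam m)"
    unfolding Ym_def[abs_def] Y_drift_eq by (intro borel_measurable_add conjunct1[OF P] drift_measurable)
  have "AE X in lam m. Y_small m A t x X = ?Z X"
    by (rule limit_in_prob_unique[OF Y_trunc_measurable conjunct1[OF P] Zm]) (use P Y_trunc_tail[OF t] in auto)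
  then show "AE X in lam m. Ym m A t x X = big_jump_sum A x t X + small_jump_limit A x t X"
    using AE_space by eventually_elim (simp add: Ym_def Y_drift_eq big space_M)
qed

lemma C0_cont_bounded:
  assumes "C0_cont V" shows "\<exists>K\<ge>0. \<forall>x. \<bar>V x\<bar> \<le> K"
proof -
  have c: "continuous_on UNIV V" and S: "compact (closure {x. V x \<noteq> 0})" using assms by (auto simp: C0_cont_def has_compact_support_def)
  have "V x = 0" if "x \<notin> closure {x. V x \<noteq> 0}" for x using that closure_subset[of "{x. V x \<noteq> 0}"] by auto
  from bounded_compact_support[OF c S this] show ?thesis by simp
qed

section \<open>Uniform convergence of the Feynman-Kac integrals\<close>

text \<open>The Feynman-Kac integrand with the mass-free phase. It is defined on every path, so the
  same function can be integrated under all \<open>lam m\<close>.\<close>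

definition fk_weight :: "('a::euclidean_space \<Rightarrow> 'a) \<Rightarrow> ('a \<Rightarrow> real) \<Rightarrow> ('a \<Rightarrow> complex) \<Rightarrow> 'a \<Rightarrow> real \<Rightarrow> (real \<Rightarrow> 'a) \<Rightarrow> complex" where
  "fk_weight A V g x t X = exp (- (\<i> * complex_of_real (big_jump_sum A x t X + small_jump_limit A x t X) + complex_of_real (LBINT s:{0<..t}. V (x + X s)))) * g (x + X t)"

lemma fk_weight_measurable:
  fixes A :: "'a::euclidean_space \<Rightarrow> 'a"
  assumes A: "continuous_on UNIV A" and V: "continuous_on UNIV V" and g: "continuous_on UNIV g" and t: "0 \<le> t"
  shows "fk_weight A V g x t \<in> borel_measurable (cyl_space :: (real \<Rightarrow> 'a) measure)"
proof -
  have gm: "(\<lambda>p. g (x + p)) \<in> borel_measurable borel"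
    by (intro borel_measurable_continuous_onI continuous_on_compose2[OF g] continuous_intros) auto
  have Vm: "(\<lambda>p. V (x + p)) \<in> borel_measurable borel"
    by (intro borel_measurable_continuous_onI continuous_on_compose2[OF V] continuous_intros) auto
  have c: "(\<lambda>X. X t) \<in> borel_measurable (cyl_space :: (real \<Rightarrow> 'a) measure)" by (rule measurable_coord)
  have 1: "(\<lambda>X. complex_of_real (big_jump_sum A x t X + small_jump_limit A x t X)) \<in> borel_measurable cyl_space"
    by (intro measurable_compose[OF _ borel_measurable_of_real] borel_measurable_add big_jump_sum_measurable small_jump_limit_measurable A)
  have 2: "(\<lambda>X. complex_of_real (LBINT s:{0<..t}. V (x + X s))) \<in> borel_measurable (cyl_space :: (real \<Rightarrow> 'a) measure)"
    by (intro measurable_compose[OF _ borel_measurable_of_real] time_integral_measurable[OF Vm])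
  show ?thesis unfolding fk_weight_def[abs_def]
    by (intro borel_measurable_times measurable_compose[OF c gm] measurable_compose[OF _ borel_measurable_cexp] borel_measurable_uminus borel_measurable_add borel_measurable_const 1 2)
qed

lemma fk_weight_bound:
  fixes A :: "'a::euclidean_space \<Rightarrow> 'a"
  assumes V: "continuous_on UNIV V" "\<And>x. \<bar>V x\<bar> \<le> KV" and g: "\<And>x. norm (g x) \<le> KG" and t: "0 \<le> t" "t \<le> T" and X: "X \<in> D0"
  shows "norm (fk_weight A V g x t X) \<le> exp (T * KV) * KG"
proof -
  have KV: "0 \<le> KV" using V(2)[of 0] by simp
  have Vm: "(\<lambda>p. V (x + p)) \<in> borel_measurable borel"
    by (intro borel_measurable_continuous_onI continuous_on_compose2[OF V(1)] continuous_intros) auto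
  have "\<bar>LBINT s:{0<..t}. V (x + X s)\<bar> \<le> t * KV" by (rule time_integral_bound[OF X Vm V(2) t(1)])
  also have "\<dots> \<le> T * KV" by (intro mult_right_mono t KV)
  finally have "exp (- (LBINT s:{0<..t}. V (x + X s))) \<le> exp (T * KV)" by simp
  then show ?thesis unfolding fk_weight_def norm_mult norm_exp_eq_Re
    by (intro mult_mono g) simp_all
qed

lemma fk_weight_stop:
  assumes t: "0 \<le> t" "t \<le> T"
  shows "fk_weight A V g x t (stop T X) = fk_weight A V g x t X"
proof -
  have "(LBINT s:{0<..t}. V (x + stop T X s)) = (LBINT s:{0<..t}. V (x + X s))"
    by (rule set_lebesgue_integral_cong) (use t in \<open>auto simp: stop_def min_def\<close>)
  moreover have "stop T X t = X t" using t by (simp add: stop_def min_def)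
  ultimately show ?thesis unfolding fk_weight_def by (simp only: big_jump_sum_stop[OF t(2)] small_jump_limit_stop[OF t(2)])
qed

lemma um_eq_fk_weight:
  fixes A :: "'a::euclidean_space \<Rightarrow> 'a"
  assumes J: "jump_estimate m (lam m) A KA L" and V: "continuous_on UNIV V" and g: "continuous_on UNIV g" and t: "0 \<le> t"
  shows "um m A V g x t = (\<integral>X. fk_weight A V g x t X \<partial>lam m)"
proof -
  interpret jump_estimate m "lam m" A KA L by (rule J)
  note Y = Ym_AE_eq[OF J t, of x]
  have gm: "(\<lambda>p. g (x + p)) \<in> borel_measurable borel"
    by (intro borel_measurable_continuous_onI continuous_on_compose2[OF g] continuous_intros) auto
  have Vm: "(\<lambda>p. V (x + p)) \<in> borel_measurable borel"
    by (intro borel_measurable_continuous_onI continuous_on_compose2[OF V] continuous_intros) auto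
  have c: "(\<lambda>X. g (x + X t)) \<in> borel_measurable (lam m)"
    by (rule measurable_cyl[OF measurable_compose[OF measurable_coord gm]])
  have v: "(\<lambda>X. complex_of_real (LBINT s:{0<..t}. V (x + X s))) \<in> borel_measurable (lam m)"
    by (intro measurable_compose[OF _ borel_measurable_of_real] measurable_cyl[OF time_integral_measurable[OF Vm]])
  show ?thesis unfolding um_def
  proof (rule integral_cong_AE)
    show "(\<lambda>X. exp (- Sm m A V t x X) * g (x + X t)) \<in> borel_measurable (lam m)"
      unfolding Sm_def
      by (intro borel_measurable_times measurable_compose[OF _ borel_measurable_cexp] borel_measurable_uminus borel_measurable_add borel_measurable_const measurable_compose[OF _ borel_measurable_of_real] Y(1) c v)
    show "fk_weight A V g x t \<in> borel_measurable (lam m)"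
      by (intro measurable_cyl fk_weight_measurable contA V g t)
    show "AE X in lam m. exp (- Sm m A V t x X) * g (x + X t) = fk_weight A V g x t X"
      using Y(2) by eventually_elim (simp only: Sm_def fk_weight_def)
  qed
qed

theorem theorem3:
  fixes g :: "'a::euclidean_space \<Rightarrow> complex" and A :: "'a \<Rightarrow> 'a" and V :: "'a \<Rightarrow> real"
    and T :: real
  assumes "C_infty g" and "C0_smooth A" and "C0_cont V" and "0 < T"
  shows "\<forall>\<epsilon>>0. \<forall>\<^sub>F m in at_right 0.
           \<forall>t\<in>{0..T}. \<forall>x. cmod (um m A V g x t - um 0 A V g x t) \<le> \<epsilon>"
proof (intro allI impI)
  fix \<epsilon> :: real assume \<epsilon>: "\<epsilon> > 0"
  have g: "continuous_on UNIV g" and V: "continuous_on UNIV V" using assms by (auto simp: C_infty_def C0_cont_def)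
  note A = C0_smooth_bounds[OF assms(2)]
  obtain KA where KA: "\<And>x. norm (A x) \<le> KA" using A(2) by blast
  obtain L where L: "L \<ge> 0" "\<And>x y. norm (A x - A y) \<le> L * norm (x - y)" using A(3) by blast
  obtain KG where KG: "\<And>x. norm (g x) \<le> KG" using C_infty_bounded[OF assms(1)] by blast
  obtain KV where KV: "\<And>x. \<bar>V x\<bar> \<le> KV" using C0_cont_bounded[OF assms(3)] by blast
  \<comment> \<open>Grid events need an integer horizon, so \<open>T\<close> is rounded up.\<close>
  obtain N :: nat where N: "T \<le> real N" using real_arch_simple by blast
  define K where "K = exp (real N * KV) * KG"
  have J: "jump_estimate m (lam m) A KA L" if "m \<ge> 0" for m
    using rel_levy_lam[OF that, where 'a='a] A(1) KA L by (intro jump_estimate.intro jump_estimate_axioms.intro)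
  have main: "cmod (um m A V g x t - um 0 A V g x t) \<le> 4 * K * (exp (real N * m) - 1)" if m: "m \<ge> 0" and t: "t \<in> {0..T}" for m t x
  proof -
    have t': "0 \<le> t" "t \<le> real N" using t N by auto
    \<comment> \<open>The bound involves neither \<open>x\<close> nor \<open>t\<close>, which is the
      source of the uniformity.\<close>
    have "cmod ((\<integral>X. fk_weight A V g x t X \<partial>lam m) - (\<integral>X. fk_weight A V g x t X \<partial>lam 0)) \<le> 4 * K * (exp (real N * m) - 1)"
      unfolding K_def
      by (intro lam_total_variation m fk_weight_measurable A(1) V g t' fk_weight_bound KV KG fk_weight_stop)
    then show ?thesis using um_eq_fk_weight[OF J V g t'(1)] m by simp
  qed
  have "((\<lambda>m. 4 * K * (exp (real N * m) - 1)) \<longlongrightarrow> 4 * K * (exp (real N * 0) - 1)) (at_right 0)"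
    by (intro tendsto_intros)
  then have "\<forall>\<^sub>F m in at_right 0. 4 * K * (exp (real N * m) - 1) < \<epsilon>"
    using \<epsilon> by (intro order_tendstoD(2)) auto
  moreover have "\<forall>\<^sub>F m in at_right (0::real). 0 < m" by (rule eventually_at_right_less)
  ultimately show "\<forall>\<^sub>F m in at_right 0. \<forall>t\<in>{0..T}. \<forall>x. cmod (um m A V g x t - um 0 A V g x t) \<le> \<epsilon>"
  proof eventually_elim
    case (elim m)
    have "cmod (um m A V g x t - um 0 A V g x t) \<le> \<epsilon>" if "t \<in> {0..T}" for t x
      using main[OF less_imp_le[OF elim(2)] that, of x] elim(1) by linarith
    then show ?case by blast
  qed
qed

end
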